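(* Let $t\ge 2$ be a fixed integer, and let $T$ be chosen uniformly at random among all canonical $t$-ary trees of size $n$. Then the number $d(T)$ of distinct depths of leaves is asymptotically (for $n\to\infty$) normally distributed, and a local limit theorem holds. Its mean is $\mu_d n+O(1)$ and its variance is $\sigma_d^2 n+O(1)$, where $\mu_d,\sigma_d^2$ depend only on $t$ and satisfy $$\mu_d=\frac12+\frac{t-4}{2^{t+3}}+\frac{2t^2-t-14}{2^{2t+5}}+\frac{9t^3+27t^2-76t-144}{2^{3t+8}}+\frac{0.06\,t^4}{2^{4t}}\,\varepsilon(t)$$ and $$\sigma_d^2=\frac14+\frac{-t^2+9t-14}{2^{t+4}}+\frac{-4t^3+20t^2+3t-54}{2^{2t+6}}+\frac{0.056\,t^4}{2^{3t}}\,\varepsilon'(t)$$ for all $t\ge2$, where $\varepsilon,\varepsilon'$ are real-valued functions with $|\varepsilon(t)|\le1$ and $|\varepsilon'(t)|\le1$.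
   Context: A canonical $t$-ary tree is a rooted plane tree (the children of every vertex are ordered from left to right) in which every vertex has either $0$ or $t$ children and such that for every $k\ge0$, if $v_1,\dots,v_K$ are the vertices at depth $k$ (distance $k$ from the root) from left to right, then the number of children of $v_i$ is at most that of $v_{i+1}$ for all $i$. Leaves are vertices without children, all other vertices are internal. The size $n(T)$ is the number of internal vertices. The quantity $d(T)$ is the cardinality of the set of depths of leaves of $T$. Asymptotic normality means that $(d(T)-\mathbb E(d(T)))/\sqrt{\mathbb V(d(T))}$ converges in distribution to a standard normal random variable. A local limit theorem (of Gaussian type) means that, with $\mu_n$ and $\sigma_n$ the mean and standard deviation of $d(T)$ for trees of size $n$, $\sup_{x\in\mathbb R}\bigl|\sigma_n\,\mathbb P(d(T)=\lfloor \mu_n+x\sigma_n\rfloor)-\frac1{\sqrt{2\pi}}e^{-x^2/2}\bigr|\to0$ as $n\to\infty$. *)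

theory Defs
  imports "HOL-Probability.Probability"
begin

datatype ptree = Node (children: "ptree list")

text \<open>
  The vertices at depth \<open>k\<close>, from left to right; each vertex is represented by the subtree
  rooted at it, so equal subtrees at different positions occur as separate list entries.
\<close>
primrec level :: "nat \<Rightarrow> ptree \<Rightarrow> ptree list" where
  "level 0 T = [T]"
| "level (Suc k) T = concat (map children (level k T))"

definition tary :: "nat \<Rightarrow> ptree \<Rightarrow> bool" where
  "tary t T \<longleftrightarrow> (\<forall>k. \<forall>v\<in>set (level k T). length (children v) = 0 \<or> length (children v) = t)"

definition canonical :: "nat \<Rightarrow> ptree \<Rightarrow> bool" where
  "canonical t T \<longleftrightarrow> tary t T \<and> (\<forall>k. sorted (map (\<lambda>v. length (children v)) (level k T)))"

primrec tree_size :: "ptree \<Rightarrow> nat" where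
  "tree_size (Node ts) = (if ts = [] then 0 else 1) + sum_list (map tree_size ts)"

definition leaf_depths :: "ptree \<Rightarrow> nat set" where
  "leaf_depths T = {k. \<exists>v\<in>set (level k T). children v = []}"

definition num_leaf_depths :: "ptree \<Rightarrow> nat" where
  "num_leaf_depths T = card (leaf_depths T)"

definition canonical_trees :: "nat \<Rightarrow> nat \<Rightarrow> ptree set" where
  "canonical_trees t n = {T. canonical t T \<and> tree_size T = n}"

text \<open>
  This is the uniform distribution because the underlying set is finite and nonempty for
  \<open>t \<ge> 1\<close>; see \<open>finite_canonical_trees\<close> and \<open>canonical_trees_nonempty\<close> below.
\<close>
definition random_tree :: "nat \<Rightarrow> nat \<Rightarrow> ptree pmf" where
  "random_tree t n = pmf_of_set (canonical_trees t n)"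

definition mean_d :: "nat \<Rightarrow> nat \<Rightarrow> real" where
  "mean_d t n = measure_pmf.expectation (random_tree t n) (\<lambda>T. real (num_leaf_depths T))"

definition var_d :: "nat \<Rightarrow> nat \<Rightarrow> real" where
  "var_d t n = measure_pmf.variance (random_tree t n) (\<lambda>T. real (num_leaf_depths T))"

lemma level_Node: "level (Suc k) (Node ts) = concat (map (level k) ts)"
proof (induction k)
  case 0
  show ?case by (induction ts) auto
next
  case (Suc k)
  have "level (Suc (Suc k)) (Node ts) = concat (map children (concat (map (level k) ts)))"
    using Suc by simp
  also have "\<dots> = concat (map (level (Suc k)) ts)"
    by (induction ts) auto
  finally show ?case .
qed

lemma tary_Node:
  assumes "tary t (Node ts)"
  shows "length ts = 0 \<or> length ts = t" and "\<And>s. s \<in> set ts \<Longrightarrow> tary t s"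
proof -
  have "Node ts \<in> set (level 0 (Node ts))" by simp
  with assms show "length ts = 0 \<or> length ts = t"
    unfolding tary_def by fastforce
next
  fix s assume "s \<in> set ts"
  hence "set (level k s) \<subseteq> set (level (Suc k) (Node ts))" for k
    unfolding level_Node by auto
  with assms show "tary t s" unfolding tary_def by blast
qed

lemma finite_tary_trees: "finite {T. tary t T \<and> tree_size T \<le> n}"
proof (induction n)
  case 0
  have "{T. tary t T \<and> tree_size T \<le> 0} \<subseteq> {Node []}"
  proof
    fix T assume "T \<in> {T. tary t T \<and> tree_size T \<le> 0}"
    thus "T \<in> {Node []}" by (cases T) (auto split: if_splits)
  qed
  thus ?case by (rule finite_subset) simp
next
  case (Suc n)
  let ?A = "{T. tary t T \<and> tree_size T \<le> n}"
  have "{T. tary t T \<and> tree_size T \<le> Suc n}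
      \<subseteq> Node ` ({ts. set ts \<subseteq> ?A \<and> length ts = t} \<union> {[]})"
  proof
    fix T assume T: "T \<in> {T. tary t T \<and> tree_size T \<le> Suc n}"
    obtain ts where ts: "T = Node ts" by (cases T)
    show "T \<in> Node ` ({ts. set ts \<subseteq> ?A \<and> length ts = t} \<union> {[]})"
    proof (cases "ts = []")
      case False
      have "s \<in> ?A" if "s \<in> set ts" for s
      proof -
        have "tree_size s \<le> sum_list (map tree_size ts)"
          using that by (intro member_le_sum_list) auto
        thus ?thesis using T ts False tary_Node(2)[of t ts s] that by auto
      qed
      moreover have "length ts = t" using T ts False tary_Node(1)[of t ts] by auto
      ultimately show ?thesis using ts by blast
    qed (use ts in auto)
  qed
  moreover have "finite (Node ` ({ts. set ts \<subseteq> ?A \<and> length ts = t} \<union> {[]}))"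
    using Suc by (intro finite_imageI finite_UnI finite_lists_length_eq) auto
  ultimately show ?case by (rule finite_subset)
qed

lemma finite_canonical_trees: "finite (canonical_trees t n)"
  by (rule finite_subset[OF _ finite_tary_trees[of t n]])
     (auto simp: canonical_trees_def canonical_def)

lemma level_leaf: "level k (Node []) = (if k = 0 then [Node []] else [])"
  by (cases k) (simp_all add: level_Node del: level.simps(2))

lemma canonical_trees_nonempty:
  assumes "t \<ge> 1"
  shows "canonical_trees t n \<noteq> {}"
proof (induction n)
  case 0
  have "canonical t (Node [])" by (auto simp: canonical_def tary_def level_leaf)
  thus ?case by (auto simp: canonical_trees_def)
next
  case (Suc n)
  then obtain T where T: "canonical t T" "tree_size T = n"
    by (auto simp: canonical_trees_def)
  define ts where "ts = replicate (t - 1) (Node []) @ [T]"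
  have len: "length ts = t" "ts \<noteq> []" using assms by (auto simp: ts_def)
  have lev: "level (Suc k) (Node ts) =
      (if k = 0 then replicate (t - 1) (Node []) else []) @ level k T" for k
    by (auto simp: level_Node ts_def level_leaf map_replicate_const concat_replicate_trivial
             simp del: level.simps(2) intro: replicate_eqI)
  have "canonical t (Node ts)"
    unfolding canonical_def tary_def
  proof (intro conjI allI)
    fix k
    show "\<forall>v\<in>set (level k (Node ts)). length (children v) = 0 \<or> length (children v) = t"
    proof (cases k)
      case (Suc j)
      thus ?thesis using T(1) unfolding canonical_def tary_def
        by (auto simp: lev simp del: level.simps(2) split: if_splits)
    qed (use len in auto)
    show "sorted (map (\<lambda>v. length (children v)) (level k (Node ts)))"
    proof (cases k)
      case (Suc j)
      thus ?thesis using T(1) unfolding canonical_def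
        by (auto simp: lev sorted_append simp del: level.simps(2))
    qed auto
  qed
  moreover have "tree_size (Node ts) = Suc n"
    using len T(2) by (auto simp: ts_def sum_list_replicate)
  ultimately show ?case by (auto simp: canonical_trees_def)
qed

end

theory Submission imports Defs "HOL-Complex_Analysis.Complex_Analysis" begin

text \<open>
A canonical tree is determined by the numbers of internal vertices on its levels, a sequence
\<open>1 = m\<^sub>0, m\<^sub>1, \<dots>, m\<^sub>h\<close> with \<open>1 \<le> m\<^sub>k\<^sub>+\<^sub>1 \<le> t m\<^sub>k\<close> and sum \<open>n\<close>. There is a leaf at depth \<open>k + 1\<close> exactly
if \<open>m\<^sub>k\<^sub>+\<^sub>1 < t m\<^sub>k\<close>, so the number of leaf depths is one plus the number of strict inequalities
(lemma \<open>tree_chain_bij\<close>). Whenever a level count equals 1 the sequence starts afresh. Cutting it at these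
levels (\<open>paths_decomp\<close>) turns the generating polynomials into a renewal sequence
\<open>p n = (\<Sum>k=1..n. c k * p (n - k))\<close>, hence \<open>(\<Sum>n. p n v * q ^ n) = 1 / (1 - C q v)\<close>, where \<open>C\<close> is the
generating function of the blocks between two regenerations.

The series \<open>C\<close> converges beyond its dominant root: removing one level of a block gives a functional
equation with a contracting factor (\<open>level_gf_Suc\<close>), so that \<open>C\<close> is holomorphic for \<open>\<bar>q\<bar> < 0.605\<close>, and
\<open>C \<rho> 1 = 1\<close> for some \<open>\<rho>\<close> between \<open>1 / 2\<close> and \<open>0.6\<close>. For \<open>v\<close> near 1 the denominator has a single simple zero
\<open>\<rho> v\<close> in a fixed disc, and for \<open>v\<close> on the unit circle away from 1 the coefficients are exponentially
smaller, because equality in the triangle inequality would align the phases of all blocks. With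
\<open>v = exp z\<close> this yields quasi-powers: \<open>p n (exp z) * exp (n * s z)\<close> converges uniformly near 0, where
\<open>s z = ln (\<rho> (exp z))\<close>. Differentiating gives mean and variance up to bounded errors, pointwise convergence of
the characteristic functions gives the central limit theorem, and Fourier inversion with the bound on
the rest of the circle gives the local one. The drift is \<open>- s' 0\<close> and the dispersion is \<open>- s'' 0\<close>.

It remains to locate these two constants. Iterating the functional equation \<open>J\<close> times expresses \<open>1 - C\<close>, up to
a nonvanishing factor, as \<open>1 - B\<close> with an explicit finite sum \<open>B\<close> in \<open>l\<^sub>j = x\<^sub>j / (1 - x\<^sub>j)\<close>,
\<open>x\<^sub>j = q ^ (1 + t + \<dots> + t ^ j)\<close>, and a remainder of size about \<open>0.6 ^ (t + \<dots> + t ^ J)\<close>. Along the curve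
\<open>q = \<rho> * exp (- \<mu> * w)\<close>, \<open>v = exp w\<close> the function \<open>1 - C\<close> vanishes at 0 together with its first derivative, and its
second derivative is proportional to the dispersion; Cauchy estimates control the derivatives of the
remainder (\<open>curve_equations\<close>). For \<open>t \<le> 10\<close> these equations are solved in interval arithmetic. For
\<open>t \<ge> 11\<close> two iterations suffice: with \<open>b = l\<^sub>1\<close> and \<open>m = t + 1\<close> the constants are rational in \<open>m\<close> and \<open>b\<close> up to
negligible errors, \<open>2 ^ (- t)\<close> is a polynomial \<open>\<zeta>\<close> in \<open>m\<close> and \<open>b\<close> up to order \<open>m ^ 3 * b ^ 4\<close>, and substituting
\<open>\<zeta>\<close> into the asserted expansions leaves polynomials whose monomials are all small compared with the
error term.\<close>

section \<open>Canonical trees as sequences of level counts\<close>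

definition forest_level :: "nat \<Rightarrow> ptree list \<Rightarrow> ptree list" where
  "forest_level k ts = concat (map (level k) ts)"

definition forest_ok :: "nat \<Rightarrow> ptree list \<Rightarrow> bool" where
  "forest_ok t ts \<longleftrightarrow> (\<forall>k. (\<forall>v\<in>set (forest_level k ts). length (children v) = 0 \<or> length (children v) = t)
     \<and> sorted (map (\<lambda>v. length (children v)) (forest_level k ts)))"

definition forest_depths :: "ptree list \<Rightarrow> nat set" where
  "forest_depths ts = {k. \<exists>v\<in>set (forest_level k ts). children v = []}"

abbreviation forest_size :: "ptree list \<Rightarrow> nat" where
  "forest_size ts \<equiv> sum_list (map tree_size ts)"

abbreviation offspring :: "ptree list \<Rightarrow> ptree list" where
  "offspring ts \<equiv> concat (map children ts)"

definition forests :: "nat \<Rightarrow> nat \<Rightarrow> nat \<Rightarrow> ptree list set" where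
  "forests t N n = {ts. length ts = N \<and> forest_ok t ts \<and> forest_size ts = n}"

lemma forest_level_0: "forest_level 0 ts = ts"
  by (induction ts) (auto simp: forest_level_def)

lemma forest_level_Suc: "forest_level (Suc k) ts = forest_level k (offspring ts)"
proof (induction ts)
  case (Cons a ts)
  obtain us where a: "a = Node us" by (cases a)
  show ?case using Cons
    by (simp add: forest_level_def a level_Node del: level.simps)
qed (auto simp: forest_level_def)

lemma forest_ok_iff:
  "forest_ok t ts \<longleftrightarrow> (\<forall>v\<in>set ts. length (children v) = 0 \<or> length (children v) = t)
     \<and> sorted (map (\<lambda>v. length (children v)) ts) \<and> forest_ok t (offspring ts)"
proof -
  have *: "(\<forall>k. P k) \<longleftrightarrow> P 0 \<and> (\<forall>k. P (Suc k))" for P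
    by (metis not0_implies_Suc)
  show ?thesis unfolding forest_ok_def
    by (subst *) (simp add: forest_level_0 forest_level_Suc)
qed

lemma forest_depths_rec:
  "forest_depths ts = (if \<exists>v\<in>set ts. children v = [] then {0} else {}) \<union> Suc ` forest_depths (offspring ts)"
proof -
  have "k \<in> forest_depths ts \<longleftrightarrow> k = 0 \<and> (\<exists>v\<in>set ts. children v = []) \<or>
      (\<exists>j. k = Suc j \<and> j \<in> forest_depths (offspring ts))" for k
    by (cases k) (auto simp: forest_depths_def forest_level_0 forest_level_Suc)
  thus ?thesis by auto
qed

fun chunks :: "nat \<Rightarrow> nat \<Rightarrow> 'a list \<Rightarrow> 'a list list" where
  "chunks t 0 us = []"
| "chunks t (Suc m) us = take t us # chunks t m (drop t us)"

lemma length_chunks [simp]: "length (chunks t m us) = m"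
  by (induction m arbitrary: us) auto

lemma concat_chunks: "length us = t * m \<Longrightarrow> concat (chunks t m us) = us"
proof (induction m arbitrary: us)
  case (Suc m)
  have "concat (chunks t m (drop t us)) = drop t us" by (rule Suc.IH) (use Suc.prems in auto)
  thus ?case by simp
qed auto

lemma length_in_chunks: "length us = t * m \<Longrightarrow> c \<in> set (chunks t m us) \<Longrightarrow> length c = t"
proof (induction m arbitrary: us)
  case (Suc m)
  have "length (drop t us) = t * m" using Suc.prems by simp
  thus ?case using Suc.IH[of "drop t us"] Suc.prems by auto
qed auto

lemma chunks_concat: "(\<And>c. c \<in> set cs \<Longrightarrow> length c = t) \<Longrightarrow> chunks t (length cs) (concat cs) = cs"
  by (induction cs) auto

text \<open>The inverse of taking offspring: the forest of \<open>N\<close> trees whose last \<open>m\<close> roots receive consecutive groups of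
\<open>t\<close> trees each. Canonicity pushes all internal vertices of a level to the right, so no other shape occurs.\<close>
definition graft :: "nat \<Rightarrow> nat \<Rightarrow> nat \<Rightarrow> ptree list \<Rightarrow> ptree list" where
  "graft t N m us = replicate (N - m) (Node []) @ map Node (chunks t m us)"

lemma offspring_graft: "length us = t * m \<Longrightarrow> offspring (graft t N m us) = us"
  by (simp add: graft_def concat_chunks o_def)

lemma forest_ok_graft:
  assumes "length us = t * m" "m \<le> N" 
  shows "forest_ok t (graft t N m us) \<longleftrightarrow> forest_ok t us"
proof -
  have 1: "\<forall>v\<in>set (graft t N m us). length (children v) = 0 \<or> length (children v) = t"
    using length_in_chunks[OF assms(1)] by (auto simp: graft_def)
  have "map (\<lambda>v. length (children v)) (map Node (chunks t m us)) = replicate m t"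
    using length_in_chunks[OF assms(1)] by (auto intro!: replicate_eqI)
  hence 2: "sorted (map (\<lambda>v. length (children v)) (graft t N m us))"
    by (auto simp: graft_def sorted_append)
  show ?thesis
    using 1 2 forest_ok_iff[of t "graft t N m us"] offspring_graft[OF assms(1), of N] by simp
qed

lemma forest_size_offspring:
  "forest_size ts = length (filter (\<lambda>v. children v \<noteq> []) ts) + forest_size (offspring ts)"
proof (induction ts)
  case (Cons a ts)
  show ?case by (cases a) (use Cons in auto)
qed auto

lemma forest_size_graft:
  assumes "t > 0" "length us = t * m"
  shows "forest_size (graft t N m us) = m + forest_size us"
proof -
  have "filter (\<lambda>v. children v \<noteq> []) (map Node (chunks t m us)) = map Node (chunks t m us)"
    using length_in_chunks[OF assms(2)] assms(1) by (intro filter_True) fastforce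
  hence "length (filter (\<lambda>v. children v \<noteq> []) (graft t N m us)) = m"
    by (simp add: graft_def)
  thus ?thesis by (subst forest_size_offspring) (simp add: offspring_graft[OF assms(2)])
qed

lemma forest_depths_graft:
  assumes "t > 0" "length us = t * m" "m \<le> N"
  shows "forest_depths (graft t N m us) = (if m < N then {0} else {}) \<union> Suc ` forest_depths us"
proof -
  have "(\<exists>v\<in>set (graft t N m us). children v = []) \<longleftrightarrow> m < N"
    using length_in_chunks[OF assms(2)] assms(1,3) by (fastforce simp: graft_def)
  thus ?thesis by (subst forest_depths_rec) (simp add: offspring_graft[OF assms(2)])
qed

lemma finite_forest_depths: "finite (forest_depths ts)"
proof (induction "forest_size ts" arbitrary: ts rule: less_induct)
  case less
  show ?case
  proof (cases "\<forall>v\<in>set ts. children v = []")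
    case True
    hence "offspring ts = []" by auto
    hence "forest_depths (offspring ts) = {}" by (simp add: forest_depths_def forest_level_def)
    thus ?thesis by (subst forest_depths_rec) auto
  next
    case False
    hence "length (filter (\<lambda>v. children v \<noteq> []) ts) > 0"
      by (auto simp: filter_empty_conv)
    hence "forest_size (offspring ts) < forest_size ts" 
      using forest_size_offspring[of ts] by linarith
    thus ?thesis using less by (subst forest_depths_rec) auto
  qed
qed

lemma sorted_two_valued:
  assumes "\<forall>v\<in>set ts. f v = 0 \<or> f v = (t::nat)" "sorted (map f ts)" "t > 0"
  shows "\<exists>as bs. ts = as @ bs \<and> (\<forall>v\<in>set as. f v = 0) \<and> (\<forall>v\<in>set bs. f v = t)"
  using assms
proof (induction ts)
  case (Cons a ts)
  show ?case
  proof (cases "f a = 0")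
    case True
    obtain as bs where "ts = as @ bs" "\<forall>v\<in>set as. f v = 0" "\<forall>v\<in>set bs. f v = t"
      using Cons by auto
    thus ?thesis using True by (intro exI[of _ "a # as"] exI[of _ bs]) auto
  next
    case False
    hence "f a = t" using Cons.prems by auto
    moreover have "f v = t" if "v \<in> set ts" for v
      using Cons.prems that False by fastforce
    ultimately show ?thesis by (intro exI[of _ "[]"] exI[of _ "a # ts"]) auto
  qed
qed auto

text \<open>By sortedness the childless roots come first, and all other roots have exactly \<open>t\<close> children.\<close>
lemma forest_is_graft:
  assumes "forest_ok t ts" "t > 0"
  shows "\<exists>m us. m \<le> length ts \<and> length us = t * m \<and> ts = graft t (length ts) m us"
proof -
  obtain as bs where ab: "ts = as @ bs" "\<forall>v\<in>set as. length (children v) = 0"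
     "\<forall>v\<in>set bs. length (children v) = t"
    using sorted_two_valued[of ts "\<lambda>v. length (children v)" t] assms forest_ok_iff by blast
  have as: "as = replicate (length as) (Node [])"
    using ab(2) by (intro replicate_eqI) (auto, metis ptree.collapse)
  have off: "offspring ts = concat (map children bs)" using ab by auto
  have "chunks t (length (map children bs)) (offspring ts) = map children bs"
    unfolding off using ab(3) by (intro chunks_concat) auto
  hence "map Node (chunks t (length bs) (offspring ts)) = bs"
    by (simp add: map_idI)
  hence "ts = graft t (length ts) (length bs) (offspring ts)"
    using as ab(1) by (simp add: graft_def)
  moreover have "length (offspring ts) = t * length bs"
  proof -
    have "map length (map children bs) = replicate (length bs) t"
      using ab(3) by (intro replicate_eqI) auto
    thus ?thesis by (simp add: off length_concat sum_list_replicate mult.commute)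
  qed
  moreover have "length bs \<le> length ts" using ab by simp
  ultimately show ?thesis by blast
qed

text \<open>Level counts of internal vertices; the parameter \<open>N\<close> is the number of places available on the next level.\<close>
fun chain :: "nat \<Rightarrow> nat \<Rightarrow> nat list \<Rightarrow> bool" where
  "chain t N [] \<longleftrightarrow> True"
| "chain t N (m # l) \<longleftrightarrow> 1 \<le> m \<and> m \<le> N \<and> chain t (t * m) l"

text \<open>A level contributes a leaf depth when its places are not all taken by internal vertices. The last clause is
the level below the last internal one, which consists of leaves only.\<close>
fun chain_depths :: "nat \<Rightarrow> nat \<Rightarrow> nat list \<Rightarrow> nat" where
  "chain_depths t N [] = (if N > 0 then 1 else 0)"
| "chain_depths t N (m # l) = (if m < N then 1 else 0) + chain_depths t (t * m) l"

lemma forest_chain_bij: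
  assumes "t > 0"
  shows "\<exists>h. bij_betw h (forests t N n) {l. chain t N l \<and> sum_list l = n} \<and>
     (\<forall>ts\<in>forests t N n. card (forest_depths ts) = chain_depths t N (h ts))"
proof (induction n arbitrary: N rule: less_induct)
  case (less n)
  show ?case
  proof (cases "n = 0")
    case True
    have f0: "forests t N 0 = {replicate N (Node [])}"
    proof -
      have "ts = replicate N (Node [])" if "ts \<in> forests t N 0" for ts
      proof -
        have "forest_ok t ts" and len: "length ts = N" and sz: "forest_size ts = 0"
          using that by (auto simp: forests_def)
        then obtain m us where m: "m \<le> N" "length us = t * m" "ts = graft t N m us"
          using forest_is_graft[OF _ assms] by blast
        have "m = 0" using forest_size_graft[OF assms m(2), of N] m(3) sz by simp
        thus ?thesis using m(3) by (simp add: graft_def)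
      qed
      moreover have "replicate N (Node []) \<in> forests t N 0"
      proof -
        have "forest_ok t []" by (simp add: forest_ok_def forest_level_def)
        hence "forest_ok t (graft t N 0 [])" by (subst forest_ok_graft) auto
        thus ?thesis by (simp add: forests_def graft_def sum_list_replicate)
      qed
      ultimately show ?thesis by blast
    qed
    have c0: "{l. chain t N l \<and> sum_list l = 0} = {[]}"
    proof -
      have "l = []" if "chain t N l" "sum_list l = 0" for l using that by (cases l) auto
      thus ?thesis by auto
    qed
    have "card (forest_depths (replicate N (Node []))) = chain_depths t N []"
      using forest_depths_graft[OF assms, of "[]" 0 N] 
      by (simp add: graft_def forest_depths_def[of "[]"] forest_level_def)
    thus ?thesis unfolding True f0 c0 by (intro exI[of _ "\<lambda>_. []"]) (auto simp: bij_betw_def)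
  next
    case False
    have "\<forall>m\<in>{1..min n N}. \<exists>h. bij_betw h (forests t (t*m) (n-m)) {l. chain t (t*m) l \<and> sum_list l = n-m} \<and>
     (\<forall>ts\<in>forests t (t*m) (n-m). card (forest_depths ts) = chain_depths t (t*m) (h ts))"
      using False by (intro ballI less.IH) auto
    then obtain h where h: "\<And>m. m \<in> {1..min n N} \<Longrightarrow> bij_betw (h m) (forests t (t*m) (n-m)) {l. chain t (t*m) l \<and> sum_list l = n-m}"
      "\<And>m ts. m \<in> {1..min n N} \<Longrightarrow> ts\<in>forests t (t*m) (n-m) \<Longrightarrow> card (forest_depths ts) = chain_depths t (t*m) (h m ts)"
      by (subst (asm) bchoice_iff) blast
    define S where "S = (SIGMA m:{1..min n N}. forests t (t*m) (n-m))"
    define g where "g = (\<lambda>(m,us). graft t N m us)"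
    define k where "k = (\<lambda>(m,us). m # h m us)"
    have inj_g: "inj_on g S"
    proof (rule inj_onI, clarsimp simp: S_def g_def)
      fix m us m' us' assume *: "us \<in> forests t (t*m) (n-m)" "us' \<in> forests t (t*m') (n-m')"
        "graft t N m us = graft t N m' us'" 
      hence l: "length us = t*m" "length us' = t*m'" by (auto simp: forests_def)
      from *(3) have "us = us'" using offspring_graft[OF l(1)] offspring_graft[OF l(2)] by metis
      thus "m = m' \<and> us = us'" using l assms by auto
    qed
    have img_g: "g ` S = forests t N n"
    proof (intro equalityI subsetI)
      fix ts assume "ts \<in> g ` S"
      thus "ts \<in> forests t N n"
        by (auto simp: S_def g_def forests_def forest_ok_graft forest_size_graft[OF assms])
           (simp add: graft_def)
    next
      fix ts assume ts: "ts \<in> forests t N n"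
      hence ok: "forest_ok t ts" and len: "length ts = N" and sz: "forest_size ts = n"
        by (auto simp: forests_def)
      obtain m us where m: "m \<le> N" "length us = t * m" "ts = graft t N m us"
        using forest_is_graft[OF ok assms] len by blast
      have s: "n = m + forest_size us"
        using forest_size_graft[OF assms m(2), of N] m(3) sz by simp
      have "m \<noteq> 0"
      proof
        assume "m = 0"
        hence "us = []" using m(2) by simp
        thus False using s False \<open>m = 0\<close> by simp
      qed
      moreover have "forest_ok t us" using ok forest_ok_graft[OF m(2,1)] by (simp only: m(3))
      ultimately have "(m, us) \<in> S" using m s by (auto simp: S_def forests_def)
      thus "ts \<in> g ` S" using m(3) by (force simp: g_def)
    qed
    have gS: "bij_betw g S (forests t N n)" using inj_g img_g by (simp add: bij_betw_def)
    have kS: "bij_betw k S {l. chain t N l \<and> sum_list l = n}"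
    proof (rule bij_betwI')
      fix x y assume "x \<in> S" "y \<in> S"
      thus "(k x = k y) = (x = y)"
        using h(1) by (auto simp: S_def k_def bij_betw_def inj_on_def)
    next
      fix x assume "x \<in> S"
      thus "k x \<in> {l. chain t N l \<and> sum_list l = n}"
        using h(1) by (force simp: S_def k_def bij_betw_def)
    next
      fix l assume l: "l \<in> {l. chain t N l \<and> sum_list l = n}"
      then obtain m l' where ml: "l = m # l'" using False by (cases l) auto
      have m: "m \<in> {1..min n N}" using l ml by auto
      have "l' \<in> h m ` forests t (t*m) (n-m)"
        unfolding bij_betw_imp_surj_on[OF h(1)[OF m]] using l ml by auto
      then obtain us where "us \<in> forests t (t*m) (n-m)" "l' = h m us" by blast
      thus "\<exists>x\<in>S. l = k x" using m ml by (intro bexI[of _ "(m,us)"]) (auto simp: S_def k_def)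
    qed
    have bij: "bij_betw (k \<circ> inv_into S g) (forests t N n) {l. chain t N l \<and> sum_list l = n}"
      by (rule bij_betw_trans[OF bij_betw_inv_into[OF gS] kS])
    have "card (forest_depths ts) = chain_depths t N ((k \<circ> inv_into S g) ts)" if ts: "ts \<in> forests t N n" for ts
    proof -
      obtain m us where x: "(m,us) \<in> S" "ts = g (m,us)"
      proof -
        have "ts \<in> g ` S" unfolding img_g by (rule ts)
        then obtain x where "x \<in> S" "ts = g x" by blast
        thus ?thesis using that by (cases x) auto
      qed
      have inv: "inv_into S g ts = (m,us)" unfolding x(2) by (rule inv_into_f_f[OF inj_g x(1)])
      have m: "m \<in> {1..min n N}" and us: "us \<in> forests t (t*m) (n-m)" using x by (auto simp: S_def)
      have len: "length us = t*m" using us by (simp add: forests_def)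
      have "card (forest_depths ts) = (if m < N then 1 else 0) + card (Suc ` forest_depths us)"
        unfolding x(2) using m
        by (simp add: g_def forest_depths_graft[OF assms len] finite_forest_depths card_insert_if image_iff)
      also have "card (Suc ` forest_depths us) = card (forest_depths us)" by (simp add: card_image)
      finally show ?thesis using inv h(2)[OF m us] by (simp add: k_def)
    qed
    with bij show ?thesis by (intro exI[of _ "k \<circ> inv_into S g"] conjI ballI)
  qed
qed

lemma canonical_trees_forests: "bij_betw (\<lambda>T. [T]) (canonical_trees t n) (forests t 1 n)"
proof -
  have "forest_level k [T] = level k T" for k T by (simp add: forest_level_def)
  hence "T \<in> canonical_trees t n \<longleftrightarrow> [T] \<in> forests t 1 n" for T
    by (auto simp: canonical_trees_def forests_def canonical_def tary_def forest_ok_def)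
  moreover have "ts \<in> forests t 1 n \<Longrightarrow> \<exists>T. ts = [T]" for ts
    by (auto simp: forests_def length_Suc_conv)
  ultimately have "(\<lambda>T. [T]) ` canonical_trees t n = forests t 1 n" by blast
  thus ?thesis unfolding bij_betw_def by (auto simp: inj_on_def) 
qed

lemma tree_chain_bij:
  assumes "t > 0"
  shows "\<exists>h. bij_betw h (canonical_trees t n) {l. chain t 1 l \<and> sum_list l = n} \<and>
     (\<forall>T\<in>canonical_trees t n. num_leaf_depths T = chain_depths t 1 (h T))"
proof -
  obtain h where h: "bij_betw h (forests t 1 n) {l. chain t 1 l \<and> sum_list l = n}"
     "\<forall>ts\<in>forests t 1 n. card (forest_depths ts) = chain_depths t 1 (h ts)"
    using forest_chain_bij[OF assms] by blast
  have "forest_depths [T] = leaf_depths T" for T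
    by (simp add: forest_depths_def leaf_depths_def forest_level_def)
  hence "\<forall>T\<in>canonical_trees t n. num_leaf_depths T = chain_depths t 1 ((h \<circ> (\<lambda>T. [T])) T)"
    using h(2) bij_betwE[OF canonical_trees_forests] by (simp only: num_leaf_depths_def o_def) metis
  moreover have "bij_betw (h \<circ> (\<lambda>T. [T])) (canonical_trees t n) {l. chain t 1 l \<and> sum_list l = n}"
    using canonical_trees_forests h(1) by (rule bij_betw_trans)
  ultimately show ?thesis by (intro exI[of _ "h \<circ> (\<lambda>T. [T])"] conjI)
qed

section \<open>Regeneration: paths and blocks\<close>

text \<open>Chains read backwards, from the deepest level to the root. In this order the recursion steps are local and
the root level is the final entry 1.\<close>
fun rpath :: "nat \<Rightarrow> nat list \<Rightarrow> bool" where
  "rpath t [] \<longleftrightarrow> False"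
| "rpath t [x] \<longleftrightarrow> x = 1"
| "rpath t (j # k # l) \<longleftrightarrow> 1 \<le> j \<and> j \<le> t * k \<and> rpath t (k # l)"

fun descents :: "nat \<Rightarrow> nat list \<Rightarrow> nat" where
  "descents t [] = 0"
| "descents t [x] = 1"
| "descents t (j # k # l) = (if j < t * k then 1 else 0) + descents t (k # l)"

lemma chain_snoc: "chain t N (l @ [j]) \<longleftrightarrow> chain t N l \<and> 1 \<le> j \<and> j \<le> (if l = [] then N else t * last l)"
  by (induction l arbitrary: N) auto

lemma chain_depths_snoc:
  assumes "t > 0" "chain t N (l @ [j])" "N > 0"
  shows "chain_depths t N (l @ [j]) = chain_depths t N l + (if j < (if l = [] then N else t * last l) then 1 else 0)"
  using assms(2,3)
proof (induction l arbitrary: N)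
  case Nil
  thus ?case using assms(1) by auto
next
  case (Cons m l)
  hence "t * m > 0" using assms(1) by auto
  hence "chain_depths t (t*m) (l @ [j]) = chain_depths t (t*m) l + (if j < (if l = [] then t*m else t * last l) then 1 else 0)"
    using Cons by auto
  thus ?case by auto
qed

lemma chain_rpath:
  assumes "t > 0"
  shows "l \<noteq> [] \<Longrightarrow> (chain t 1 l \<longleftrightarrow> rpath t (rev l)) \<and> (chain t 1 l \<longrightarrow> chain_depths t 1 l = descents t (rev l))"
proof (induction l rule: rev_induct)
  case (snoc j l)
  show ?case
  proof (cases "l = []")
    case True
    thus ?thesis using assms by auto
  next
    case False
    then obtain k l' where r: "rev l = k # l'" by (cases "rev l") auto
    hence k: "last l = k" by (metis hd_rev list.sel(1))
    have 1: "chain t 1 (l @ [j]) \<longleftrightarrow> rpath t (rev (l @ [j]))"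
      using snoc.IH[OF False] by (auto simp: chain_snoc k False r simp del: rev_eq_Cons_iff)
    moreover have "chain_depths t 1 (l @ [j]) = descents t (rev (l @ [j]))" if "chain t 1 (l @ [j])"
      using that snoc.IH[OF False] chain_depths_snoc[OF assms that] 
      by (simp add: chain_snoc k False r del: rev_eq_Cons_iff)
    ultimately show ?thesis by blast
  qed
qed simp

definition paths :: "nat \<Rightarrow> nat \<Rightarrow> nat list set" where
  "paths t n = {l. (l = [] \<or> rpath t l) \<and> sum_list l = n}"

definition blocks :: "nat \<Rightarrow> nat list set" where
  "blocks t = {l. rpath t l \<and> (\<forall>x\<in>set (butlast l). x \<noteq> 1)}"

definition sized_blocks :: "nat \<Rightarrow> nat \<Rightarrow> nat list set" where
  "sized_blocks t n = {l \<in> blocks t. sum_list l = n}"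

definition block_count :: "nat \<Rightarrow> nat \<Rightarrow> nat \<Rightarrow> real" where
  "block_count t n j = real (card {l \<in> sized_blocks t n. descents t l = j})"

lemma rpath_pos: "rpath t l \<Longrightarrow> x \<in> set l \<Longrightarrow> 1 \<le> x"
  by (induction t l rule: rpath.induct) auto

lemma length_le_sum_list: "(\<And>x. x \<in> set l \<Longrightarrow> 1 \<le> (x::nat)) \<Longrightarrow> length l \<le> sum_list l"
  by (induction l) force+

lemma finite_bounded_lists: "finite {l. (\<forall>x\<in>set l. 1 \<le> (x::nat)) \<and> sum_list l = n}"
proof (rule finite_subset)
  show "{l. (\<forall>x\<in>set l. 1 \<le> (x::nat)) \<and> sum_list l = n} \<subseteq> {l. set l \<subseteq> {..n} \<and> length l \<le> n}"
    using length_le_sum_list member_le_sum_list by fastforce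
  show "finite {l. set l \<subseteq> {..n} \<and> length l \<le> n}" by (rule finite_lists_length_le) auto
qed

lemma finite_paths: "finite (paths t n)"
  by (rule finite_subset[OF _ finite_bounded_lists[of n]]) (auto simp: paths_def dest: rpath_pos)

lemma finite_sized_blocks: "finite (sized_blocks t n)"
  by (rule finite_subset[OF _ finite_bounded_lists[of n]])
     (auto simp: sized_blocks_def blocks_def dest: rpath_pos)

lemma descents_le_length: "descents t l \<le> length l"
  by (induction t l rule: descents.induct) auto

lemma descents_le_sum: "rpath t l \<Longrightarrow> descents t l \<le> sum_list l"
  using descents_le_length length_le_sum_list[OF rpath_pos] by (rule order_trans)

lemma rpath_nonempty: "rpath t l \<Longrightarrow> l \<noteq> []" by auto

lemma rpath_last: "rpath t l \<Longrightarrow> last l = 1"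
  by (induction t l rule: rpath.induct) auto

lemma rpath_append:
  assumes "l \<noteq> []" "r = [] \<or> rpath t r" "t \<ge> 2" "last l = 1"
  shows "rpath t (l @ r) \<longleftrightarrow> rpath t l" "descents t (l @ r) = descents t l + descents t r"
proof -
  have "(rpath t (l @ r) \<longleftrightarrow> rpath t l) \<and> descents t (l @ r) = descents t l + descents t r"
    using assms(2,3,1,4)
  proof (induction t l rule: rpath.induct)
    case (2 t x)
    note x = this
    show ?case
    proof (cases r)
      case (Cons k l)
      hence k: "k \<ge> 1" using x(1) rpath_pos by force
      hence "t * k \<ge> 2 * 1" using x(2) by (intro mult_le_mono) auto
      thus ?thesis using x Cons k by auto
    qed (use x in auto)
  qed auto
  thus "rpath t (l @ r) \<longleftrightarrow> rpath t l" "descents t (l @ r) = descents t l + descents t r" by auto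
qed

text \<open>A path is cut at its last visit to 1.\<close>
lemma paths_decomp:
  assumes "t \<ge> 2" "n \<ge> 1"
  shows "bij_betw (\<lambda>(k,b,r). b @ r) (SIGMA k:{1..n}. sized_blocks t k \<times> paths t (n - k)) (paths t n)"
proof (rule bij_betwI')
  fix x y assume x: "x \<in> (SIGMA k:{1..n}. sized_blocks t k \<times> paths t (n - k))" 
             and y: "y \<in> (SIGMA k:{1..n}. sized_blocks t k \<times> paths t (n - k))"
  obtain k b r where x': "x = (k,b,r)" by (cases x)
  obtain k' b' r' where y': "y = (k',b',r')" by (cases y)
  have *: "butlast b = takeWhile (\<lambda>x. x \<noteq> 1) (b @ r) \<and> b = butlast b @ [1]" 
    if "b \<in> blocks t" for b r
  proof -
    have "b \<noteq> []" "last b = 1" using that by (auto simp: blocks_def dest: rpath_last)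
    hence b: "b = butlast b @ [1]" by (metis append_butlast_last_id)
    have "takeWhile (\<lambda>x. x \<noteq> 1) (b @ r) = takeWhile (\<lambda>x. x \<noteq> 1) (butlast b @ 1 # r)"
      by (subst b) simp
    also have "\<dots> = butlast b" using that by (subst takeWhile_append2) (auto simp: blocks_def)
    finally show ?thesis using b by simp
  qed
  have "b @ r = b' @ r' \<Longrightarrow> b = b' \<and> r = r'"
    using *[of b r] *[of b' r'] x y x' y' by (auto simp: sized_blocks_def)
  thus "((\<lambda>(k,b,r). b @ r) x = (\<lambda>(k,b,r). b @ r) y) = (x = y)"
    using x y x' y' by (auto simp: sized_blocks_def)
next
  fix x assume x: "x \<in> (SIGMA k:{1..n}. sized_blocks t k \<times> paths t (n - k))" 
  obtain k b r where x': "x = (k,b,r)" by (cases x)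
  have b: "rpath t b" "sum_list b = k" "k \<le> n" and r: "r = [] \<or> rpath t r" "sum_list r = n - k"
    using x x' by (auto simp: sized_blocks_def blocks_def paths_def)
  hence "rpath t (b @ r)" using rpath_append(1)[OF rpath_nonempty[OF b(1)] r(1) assms(1) rpath_last[OF b(1)]] by simp
  thus "(\<lambda>(k,b,r). b @ r) x \<in> paths t n" using x' b r by (simp add: paths_def)
next
  fix l assume l: "l \<in> paths t n"
  hence "rpath t l" using assms by (auto simp: paths_def)
  define b where "b = takeWhile (\<lambda>x. x \<noteq> 1) l @ [1]"
  define r where "r = tl (dropWhile (\<lambda>x. x \<noteq> 1) l)"
  have "1 \<in> set l" using rpath_last[OF \<open>rpath t l\<close>] rpath_nonempty[OF \<open>rpath t l\<close>] by (metis last_in_set)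
  hence ne: "dropWhile (\<lambda>x. x \<noteq> 1) l \<noteq> []" by (auto simp: dropWhile_eq_Nil_conv)
  hence "dropWhile (\<lambda>x. x \<noteq> 1) l = 1 # r" unfolding r_def using hd_dropWhile[OF ne] by (metis list.collapse)
  hence lbr: "l = b @ r" unfolding b_def by (metis append.assoc append_Cons append_Nil takeWhile_dropWhile_id)
  have suffix: "rpath t (xs @ ys) \<Longrightarrow> ys = [] \<or> rpath t ys" for xs ys
  proof (induction xs)
    case (Cons a xs)
    thus ?case by (cases "xs @ ys") auto
  qed auto
  have r: "r = [] \<or> rpath t r" using suffix[of b r] lbr \<open>rpath t l\<close> by auto
  have "b \<noteq> []" "last b = 1" by (simp_all add: b_def)
  hence "rpath t b" using rpath_append(1)[OF _ r assms(1)] \<open>rpath t l\<close>[unfolded lbr] by blast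
  moreover have "\<forall>x\<in>set (butlast b). x \<noteq> 1" by (auto simp: b_def dest: set_takeWhileD)
  moreover have "sum_list b \<ge> 1" by (simp add: b_def)
  moreover have "sum_list b + sum_list r = n"
  proof -
    have "sum_list (b @ r) = n" using l unfolding lbr[symmetric] by (simp add: paths_def)
    thus ?thesis by simp
  qed
  ultimately show "\<exists>x\<in>(SIGMA k:{1..n}. sized_blocks t k \<times> paths t (n - k)). l = (\<lambda>(k,b,r). b @ r) x"
    using r lbr by (intro bexI[of _ "(sum_list b, b, r)"]) (auto simp: sized_blocks_def blocks_def paths_def)
qed

definition block_poly :: "nat \<Rightarrow> nat \<Rightarrow> complex \<Rightarrow> complex" where
  "block_poly t n v = (\<Sum>b\<in>sized_blocks t n. v ^ descents t b)"

definition path_poly :: "nat \<Rightarrow> nat \<Rightarrow> complex \<Rightarrow> complex" where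
  "path_poly t n v = (\<Sum>l\<in>paths t n. v ^ descents t l)"

lemma path_poly_0: "path_poly t 0 v = 1"
proof -
  have "paths t 0 = {[]}"
  proof -
    have False if "rpath t l" "sum_list l = 0" for l
    proof -
      have "length l \<le> sum_list l" using rpath_pos[OF that(1)] by (rule length_le_sum_list)
      thus False using that(2) rpath_nonempty[OF that(1)] by simp
    qed
    thus ?thesis by (auto simp: paths_def)
  qed
  thus ?thesis by (simp add: path_poly_def)
qed

lemma path_poly_rec:
  assumes "t \<ge> 2" "n \<ge> 1"
  shows "path_poly t n v = (\<Sum>k=1..n. block_poly t k v * path_poly t (n - k) v)"
proof -
  have "path_poly t n v = (\<Sum>x\<in>(SIGMA k:{1..n}. sized_blocks t k \<times> paths t (n - k)). v ^ descents t ((\<lambda>(k,b,r). b @ r) x))"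
    unfolding path_poly_def by (rule sum.reindex_bij_betw[OF paths_decomp[OF assms], symmetric])
  also have "\<dots> = (\<Sum>k=1..n. \<Sum>(b,r)\<in>sized_blocks t k \<times> paths t (n - k). v ^ descents t (b @ r))"
    by (subst sum.Sigma) (auto simp: finite_paths finite_sized_blocks intro!: sum.cong)
  also have "\<dots> = (\<Sum>k=1..n. \<Sum>(b,r)\<in>sized_blocks t k \<times> paths t (n - k). v ^ descents t b * v ^ descents t r)"
  proof (intro sum.cong refl, clarify)
    fix k b r assume "b \<in> sized_blocks t k" "r \<in> paths t (n - k)"
    hence "rpath t b" "r = [] \<or> rpath t r" by (auto simp: sized_blocks_def blocks_def paths_def)
    thus "v ^ descents t (b @ r) = v ^ descents t b * v ^ descents t r"
      by (subst rpath_append(2)) (use assms rpath_last in \<open>auto simp: power_add\<close>)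
  qed
  finally show ?thesis 
    by (simp add: block_poly_def path_poly_def sum_product sum.cartesian_product)
qed

lemma block_poly_counts: "block_poly t n v = (\<Sum>j\<le>n. complex_of_real (block_count t n j) * v ^ j)"
proof -
  have "block_poly t n v = (\<Sum>j\<le>n. \<Sum>b\<in>{b\<in>sized_blocks t n. descents t b = j}. v ^ descents t b)"
    unfolding block_poly_def
  proof (rule sum.group[symmetric, OF finite_sized_blocks])
    show "descents t ` sized_blocks t n \<subseteq> {..n}"
      using descents_le_sum by (auto simp: sized_blocks_def blocks_def)
  qed auto
  also have "\<dots> = (\<Sum>j\<le>n. complex_of_real (block_count t n j) * v ^ j)"
    by (intro sum.cong refl) (simp add: block_count_def)
  finally show ?thesis .
qed

lemma tree_path_bij:
  assumes "t > 0" "n > 0"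
  shows "\<exists>h. bij_betw h (canonical_trees t n) (paths t n) \<and>
     (\<forall>T\<in>canonical_trees t n. num_leaf_depths T = descents t (h T))"
proof -
  obtain h where h: "bij_betw h (canonical_trees t n) {l. chain t 1 l \<and> sum_list l = n}"
     "\<forall>T\<in>canonical_trees t n. num_leaf_depths T = chain_depths t 1 (h T)"
    using tree_chain_bij[OF assms(1)] by blast
  have ne: "l \<noteq> []" if "sum_list l = n" for l using that assms(2) by auto
  have b: "bij_betw rev {l. chain t 1 l \<and> sum_list l = n} (paths t n)"
  proof (rule bij_betw_byWitness[where f' = rev])
    show "rev ` {l. chain t 1 l \<and> sum_list l = n} \<subseteq> paths t n"
      using chain_rpath[OF assms(1)] ne by (auto simp: paths_def)
    show "rev ` paths t n \<subseteq> {l. chain t 1 l \<and> sum_list l = n}"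
    proof clarify
      fix l assume l: "l \<in> paths t n"
      hence "rpath t l" "rev l \<noteq> []" "sum_list l = n" using ne by (auto simp: paths_def)
      thus "chain t 1 (rev l) \<and> sum_list (rev l) = n" using chain_rpath[OF assms(1), of "rev l"] by simp
    qed
  qed auto
  have "num_leaf_depths T = descents t ((rev \<circ> h) T)" if T: "T \<in> canonical_trees t n" for T
  proof -
    have "chain t 1 (h T)" "sum_list (h T) = n" using bij_betwE[OF h(1)] T by auto
    thus ?thesis using h(2) T chain_rpath[OF assms(1) ne, of "h T"] by simp
  qed
  thus ?thesis using bij_betw_trans[OF h(1) b] by (intro exI[of _ "rev \<circ> h"]) blast
qed

lemma tree_poly:
  assumes "t > 0" "n > 0"
  shows "(\<Sum>T\<in>canonical_trees t n. v ^ num_leaf_depths T) = path_poly t n v"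
proof -
  obtain h where h: "bij_betw h (canonical_trees t n) (paths t n)"
     "\<forall>T\<in>canonical_trees t n. num_leaf_depths T = descents t (h T)"
    using tree_path_bij[OF assms] by blast
  have "(\<Sum>T\<in>canonical_trees t n. v ^ num_leaf_depths T) = (\<Sum>T\<in>canonical_trees t n. v ^ descents t (h T))"
    using h(2) by (intro sum.cong) auto
  also have "\<dots> = path_poly t n v" unfolding path_poly_def by (rule sum.reindex_bij_betw[OF h(1)])
  finally show ?thesis .
qed

section \<open>The generating function of the blocks\<close>

text \<open>Regrouping an absolutely convergent family along a statistic with finite fibres.\<close>
lemma fibre_sums:
  fixes f :: "'a \<Rightarrow> 'b::{banach, second_countable_topology}"
  assumes f: "f summable_on A" and k: "\<And>n. finite {b\<in>A. k b = (n::nat)}"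
  shows "(\<lambda>n. \<Sum>b\<in>{b\<in>A. k b = n}. f b) sums infsum f A"
proof -
  have bij: "bij_betw snd (SIGMA n:UNIV. {b\<in>A. k b = n}) A"
    by (rule bij_betw_byWitness[where f' = "\<lambda>b. (k b, b)"]) auto
  have "((\<lambda>x. f (snd x)) has_sum infsum f A) (SIGMA n:UNIV. {b\<in>A. k b = n})"
    using has_sum_reindex_bij_betw[OF bij, of f] has_sum_infsum[OF f] by blast
  hence "((\<lambda>n. \<Sum>b\<in>{b\<in>A. k b = n}. f b) has_sum infsum f A) UNIV"
    by (rule has_sum_SigmaD) (use k in \<open>auto intro!: has_sum_finite\<close>)
  thus ?thesis by (rule has_sum_imp_sums)
qed

definition long_blocks :: "nat \<Rightarrow> nat \<Rightarrow> nat list set" where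
  "long_blocks t L = {b \<in> blocks t. length b = Suc L}"

lemma long_blocks_0: "long_blocks t 0 = {[1]}"
  by (auto simp: long_blocks_def blocks_def length_Suc_conv)

lemma block_hd: "b \<in> blocks t \<Longrightarrow> 1 \<le> hd b"
  by (cases b) (auto simp: blocks_def dest: rpath_pos)

lemma long_blocks_Suc:
  "bij_betw (\<lambda>(l, j). j # l) (SIGMA l:long_blocks t L. {2..t * hd l}) (long_blocks t (Suc L))"
proof (rule bij_betw_byWitness[where f' = "\<lambda>b. (tl b, hd b)"])
  show "(\<lambda>(l, j). j # l) ` (SIGMA l:long_blocks t L. {2..t * hd l}) \<subseteq> long_blocks t (Suc L)"
  proof (rule image_subsetI)
    fix x assume "x \<in> (SIGMA l:long_blocks t L. {2..t * hd l})"
    then obtain l j where x: "x = (l, j)" and lj: "l \<in> long_blocks t L" "j \<in> {2..t * hd l}" by auto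
    then obtain k m where "l = k # m" by (cases l) (auto simp: long_blocks_def)
    thus "(\<lambda>(l, j). j # l) x \<in> long_blocks t (Suc L)" using lj x by (auto simp: long_blocks_def blocks_def)
  qed
  show "(\<lambda>b. (tl b, hd b)) ` long_blocks t (Suc L) \<subseteq> (SIGMA l:long_blocks t L. {2..t * hd l})"
  proof (rule image_subsetI)
    fix b assume b: "b \<in> long_blocks t (Suc L)"
    then obtain j k m where "b = j # k # m" by (auto simp: long_blocks_def length_Suc_conv)
    thus "(tl b, hd b) \<in> (SIGMA l:long_blocks t L. {2..t * hd l})"
      using b by (auto simp: long_blocks_def blocks_def)
  qed
qed (auto simp: long_blocks_def length_Suc_conv)

lemma finite_long_blocks: "finite (long_blocks t L)"
proof (induction L)
  case (Suc L)
  thus ?case using bij_betw_finite[OF long_blocks_Suc, of t L] by auto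
qed (simp add: long_blocks_0)

text \<open>The variable \<open>u\<close> marks the first entry of a block, which belongs to its deepest level.\<close>
definition level_gf :: "nat \<Rightarrow> nat \<Rightarrow> 'a \<Rightarrow> 'a \<Rightarrow> 'a \<Rightarrow> 'a::real_normed_field" where
  "level_gf t L q v u = (\<Sum>b\<in>long_blocks t L. v ^ descents t b * q ^ sum_list b * u ^ hd b)"

lemma level_gf_0: "level_gf t 0 q v u = v * q * u" by (simp add: level_gf_def long_blocks_0)

lemma level_gf_Suc_sum: "level_gf t (Suc L) q v u = (\<Sum>l\<in>long_blocks t L. v ^ descents t l * q ^ sum_list l * 
   (\<Sum>j=2..t * hd l. (if j < t * hd l then v else 1) * (q * u) ^ j))"
proof -
  have "level_gf t (Suc L) q v u = (\<Sum>x\<in>(SIGMA l:long_blocks t L. {2..t * hd l}). (\<lambda>b. v ^ descents t b * q ^ sum_list b * u ^ hd b) ((\<lambda>(l, j). j # l) x))"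
    unfolding level_gf_def by (rule sum.reindex_bij_betw[OF long_blocks_Suc, symmetric])
  also have "\<dots> = (\<Sum>l\<in>long_blocks t L. \<Sum>j=2..t * hd l. v ^ descents t (j # l) * q ^ sum_list (j # l) * u ^ j)"
    by (subst sum.Sigma) (auto simp: finite_long_blocks intro!: sum.cong)
  also have "\<dots> = (\<Sum>l\<in>long_blocks t L. \<Sum>j=2..t * hd l. v ^ descents t l * q ^ sum_list l * ((if j < t * hd l then v else 1) * (q * u) ^ j))"
  proof (intro sum.cong refl)
    fix l j assume "l \<in> long_blocks t L"
    then obtain k m where "l = k # m" by (cases l) (auto simp: long_blocks_def)
    thus "v ^ descents t (j # l) * q ^ sum_list (j # l) * u ^ j = v ^ descents t l * q ^ sum_list l * ((if j < t * hd l then v else 1) * (q * u) ^ j)"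
      by (simp add: power_add power_mult_distrib mult_ac)
  qed
  finally show ?thesis by (simp add: sum_distrib_left)
qed

lemma geometric_with_top:
  fixes x w :: "'a::field"
  assumes "m \<ge> 2"
  shows "(\<Sum>j=2..m. (if j < m then w * (1 - x) else 1) * x ^ j) = w * x\<^sup>2 + (1 - w) * x ^ m"
proof -
  obtain k where k: "m = Suc k" "k \<ge> 1" using assms by (cases m) auto
  have "(\<Sum>j=2..k. w * (1 - x) * x ^ j) = w * x\<^sup>2 - w * x ^ Suc k"
    using k(2) by (induction k rule: dec_induct) (simp_all add: algebra_simps power2_eq_square)
  moreover have "(\<Sum>j=2..Suc k. (if j < Suc k then w * (1 - x) else 1) * x ^ j) = (\<Sum>j=2..k. w * (1 - x) * x ^ j) + x ^ Suc k"
    using k(2) by simp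
  ultimately show ?thesis unfolding k(1) by (simp add: algebra_simps)
qed

text \<open>The entry following an entry \<open>k\<close> on the deepest level ranges over \<open>2, \<dots>, t * k\<close>, and all choices but the top one are
descents. Summing this geometric progression expresses the next level through the values at \<open>1\<close> and at
\<open>(q * u) ^ t\<close>.\<close>
lemma level_gf_Suc:
  fixes q v u :: "'a::real_normed_field"
  assumes "q * u \<noteq> 1" "t \<ge> 2"
  shows "level_gf t (Suc L) q v u = v / (1 - q * u) * (q * u)\<^sup>2 * level_gf t L q v 1 + (1 - v / (1 - q * u)) * level_gf t L q v ((q * u) ^ t)"
proof -
  define x where "x = q * u"
  define w where "w = v / (1 - x)"
  have v: "v = w * (1 - x)" using assms by (simp add: w_def x_def)
  have "level_gf t (Suc L) q v u = (\<Sum>l\<in>long_blocks t L. v ^ descents t l * q ^ sum_list l * (w * x\<^sup>2 + (1 - w) * x ^ (t * hd l)))"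
    unfolding level_gf_Suc_sum x_def[symmetric]
  proof (intro sum.cong refl arg_cong2[of _ _ _ _ "(*)"])
    fix l assume "l \<in> long_blocks t L"
    hence "1 \<le> hd l" using block_hd by (auto simp: long_blocks_def)
    hence "2 * 1 \<le> t * hd l" using assms(2) by (intro mult_le_mono) auto
    thus "(\<Sum>j=2..t * hd l. (if j < t * hd l then v else 1) * x ^ j) = w * x\<^sup>2 + (1 - w) * x ^ (t * hd l)"
      unfolding v by (intro geometric_with_top) simp
  qed
  also have "\<dots> = w * x\<^sup>2 * level_gf t L q v 1 + (1 - w) * level_gf t L q v (x ^ t)"
    unfolding level_gf_def sum_distrib_left sum.distrib[symmetric]
    by (intro sum.cong refl) (simp add: power_mult algebra_simps)
  finally show ?thesis by (simp add: w_def x_def)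
qed

text \<open>The factor \<open>V * R\<^sup>2 / (1 - R)\<close> gained per level is below 1 for the radii used here, which is what
makes the blocks summable beyond the dominant root.\<close>
lemma level_gf_bound:
  fixes q v u :: "'a::real_normed_field"
  assumes "norm q \<le> R" "R < 1" "norm v \<le> V" "1 \<le> V" "norm u \<le> 1"
  shows "norm (level_gf t L q v u) \<le> norm u * (V * R * (V * R\<^sup>2 / (1 - R)) ^ L)"
proof -
  have R: "R \<ge> 0" using assms(1) norm_ge_zero order_trans by blast
  have "norm (level_gf t L q v u) \<le> norm u * level_gf t L (norm q) (norm v) 1" 
    if "norm u \<le> 1" for u :: 'a and L
  proof -
    have "norm (level_gf t L q v u) \<le> (\<Sum>b\<in>long_blocks t L. norm v ^ descents t b * norm q ^ sum_list b * norm u)"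
      unfolding level_gf_def
    proof (intro sum_norm_le)
      fix b assume "b \<in> long_blocks t L"
      hence "norm u ^ hd b \<le> norm u ^ 1" using block_hd that by (intro power_decreasing) (auto simp: long_blocks_def)
      thus "norm (v ^ descents t b * q ^ sum_list b * u ^ hd b) \<le> norm v ^ descents t b * norm q ^ sum_list b * norm u"
        by (simp add: norm_mult norm_power mult_left_mono)
    qed
    thus ?thesis by (simp add: level_gf_def sum_distrib_left sum_distrib_right mult_ac)
  qed
  moreover have "level_gf t L (norm q) (norm v) 1 \<le> V * R * (V * R\<^sup>2 / (1 - R)) ^ L"
  proof (induction L)
    case 0
    show ?case using assms R by (simp add: level_gf_0 mult_mono)
  next
    case (Suc L)
    have g: "(\<Sum>j=2..m. (if j < m then norm v else 1) * norm q ^ j) \<le> V * R\<^sup>2 / (1 - R)" for m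
    proof -
      have "(\<Sum>j=2..m. (if j < m then norm v else 1) * norm q ^ j) \<le> (\<Sum>j=2..m. V * R ^ j)"
        using assms by (intro sum_mono mult_mono power_mono) auto
      also have "\<dots> = V * (\<Sum>j=2..m. R ^ j)" by (simp add: sum_distrib_left)
      also have "(\<Sum>j=2..m. R ^ j) \<le> R\<^sup>2 / (1 - R)"
        using assms(2) R by (auto simp: sum_gp divide_right_mono)
      finally show ?thesis using assms by (simp add: mult_left_mono)
    qed
    have "level_gf t (Suc L) (norm q) (norm v) 1 \<le> (\<Sum>l\<in>long_blocks t L. norm v ^ descents t l * norm q ^ sum_list l * (V * R\<^sup>2 / (1 - R)))"
      unfolding level_gf_Suc_sum using g by (intro sum_mono mult_left_mono) auto
    also have "\<dots> = level_gf t L (norm q) (norm v) 1 * (V * R\<^sup>2 / (1 - R))" by (simp add: level_gf_def sum_distrib_right sum_divide_distrib)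
    also have "\<dots> \<le> V * R * (V * R\<^sup>2 / (1 - R)) ^ L * (V * R\<^sup>2 / (1 - R))"
      using Suc assms by (intro mult_right_mono) auto
    finally show ?case by (simp add: mult_ac)
  qed
  ultimately show ?thesis using assms(5) mult_left_mono[OF _ norm_ge_zero[of u]] order_trans by blast
qed

definition block_gf :: "nat \<Rightarrow> 'a \<Rightarrow> 'a \<Rightarrow> 'a \<Rightarrow> 'a::{real_normed_field,banach}" where
  "block_gf t q v u = (\<Sum>L. level_gf t L q v u)"

definition Rmax :: real where "Rmax = 121 / 200"
definition Vmax :: real where "Vmax = 101 / 100"

lemma kappa: "Vmax * Rmax\<^sup>2 / (1 - Rmax) < 0.936" "Vmax * Rmax\<^sup>2 / (1 - Rmax) \<ge> 0" "Vmax \<ge> 1" "Rmax < 1" "Rmax > 0"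
  by (simp_all add: Vmax_def Rmax_def power2_eq_square)

lemma level_gf_bound':
  fixes q v u :: "'a::real_normed_field"
  assumes "norm q \<le> Rmax" "norm v \<le> Vmax" "norm u \<le> 1"
  shows "norm (level_gf t L q v u) \<le> norm u * 0.62 * 0.936 ^ L"
proof -
  have "norm (level_gf t L q v u) \<le> norm u * (Vmax * Rmax * (Vmax * Rmax\<^sup>2 / (1 - Rmax)) ^ L)"
    by (rule level_gf_bound) (use assms kappa in auto)
  also have "\<dots> \<le> norm u * (0.62 * 0.936 ^ L)"
    using kappa by (intro mult_left_mono mult_mono power_mono) (auto simp: Vmax_def Rmax_def)
  finally show ?thesis by simp
qed

lemma summable_majorant: "summable (\<lambda>L. c * 0.62 * (0.936::real) ^ L)"
  by (intro summable_mult summable_geometric) simp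

lemma level_gf_summable:
  fixes q v u :: "'a::{real_normed_field,banach}"
  assumes "norm q \<le> Rmax" "norm v \<le> Vmax" "norm u \<le> 1"
  shows "summable (\<lambda>L. level_gf t L q v u)" "summable (\<lambda>L. norm (level_gf t L q v u))"
  by (rule summable_comparison_test'[OF summable_majorant]; use level_gf_bound'[OF assms] in auto)+

lemma block_gf_bound:
  fixes q v u :: "'a::{real_normed_field,banach}"
  assumes "norm q \<le> Rmax" "norm v \<le> Vmax" "norm u \<le> 1"
  shows "norm (block_gf t q v u) \<le> 10 * norm u"
proof -
  have "norm (block_gf t q v u) \<le> (\<Sum>L. norm u * 0.62 * 0.936 ^ L)"
    unfolding block_gf_def by (rule order_trans[OF summable_norm[OF level_gf_summable(2)[OF assms]] suminf_le[OF level_gf_bound'[OF assms] level_gf_summable(2)[OF assms] summable_majorant]])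
  also have "\<dots> = norm u * 0.62 * (1 / (1 - 0.936))" by (subst suminf_mult) (auto simp: suminf_geometric)
  also have "\<dots> \<le> 10 * norm u" by (simp add: mult.commute) 
  finally show ?thesis .
qed

text \<open>This equation, iterated, is the source of the kernel series from which the constants are computed.\<close>
lemma block_gf_functional:
  fixes q v u :: "'a::{real_normed_field,banach}"
  assumes "norm q \<le> Rmax" "norm v \<le> Vmax" "norm u \<le> 1" "t \<ge> 2"
  shows "block_gf t q v u = v * (q * u) + v / (1 - q * u) * (q * u)\<^sup>2 * block_gf t q v 1 + (1 - v / (1 - q * u)) * block_gf t q v ((q * u) ^ t)"
proof -
  have "norm (q * u) \<le> Rmax * 1" unfolding norm_mult using assms kappa by (intro mult_mono) auto
  hence x: "norm (q * u) < 1" using kappa by simp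
  hence x1: "q * u \<noteq> 1" by auto
  have xt: "norm ((q * u) ^ t) \<le> 1" using x by (simp add: norm_power power_le_one)
  have "(\<lambda>L. level_gf t (Suc L) q v u) sums (v / (1 - q * u) * (q * u)\<^sup>2 * block_gf t q v 1 + (1 - v / (1 - q * u)) * block_gf t q v ((q * u) ^ t))"
    unfolding level_gf_Suc[OF x1 assms(4)] block_gf_def
    by (intro sums_add sums_mult summable_sums level_gf_summable assms xt) auto
  hence "(\<lambda>L. level_gf t L q v u) sums (v / (1 - q * u) * (q * u)\<^sup>2 * block_gf t q v 1 + (1 - v / (1 - q * u)) * block_gf t q v ((q * u) ^ t) + level_gf t 0 q v u)"
    by (rule sums_Suc)
  thus ?thesis unfolding block_gf_def by (simp add: sums_iff level_gf_0 mult.assoc)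
qed

lemma blocks_summable:
  fixes q v :: "'a::{real_normed_field,banach,second_countable_topology}"
  assumes "norm q \<le> Rmax" "norm v \<le> Vmax"
  shows "(\<lambda>b. v ^ descents t b * q ^ sum_list b) summable_on blocks t"
proof (rule abs_summable_summable)
  let ?f = "\<lambda>b. norm v ^ descents t b * norm q ^ sum_list b"
  have "?f summable_on blocks t"
  proof (rule nonneg_bdd_above_summable_on)
    show "bdd_above (sum ?f ` {F. F \<subseteq> blocks t \<and> finite F})"
    proof (rule bdd_aboveI2)
      fix F assume "F \<in> {F. F \<subseteq> blocks t \<and> finite F}"
      hence F: "F \<subseteq> blocks t" "finite F" by auto
      define N where "N = Suc (Max (insert 0 (length ` F)))"
      have len: "length b < N" if "b \<in> F" for b using that F by (simp add: N_def less_Suc_eq_le)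
      have sub: "F \<subseteq> (\<Union>L<N. long_blocks t L)"
      proof
        fix b assume b: "b \<in> F"
        hence "b \<noteq> []" using F by (auto simp: blocks_def)
        hence "b \<in> long_blocks t (length b - 1)" using b F by (auto simp: long_blocks_def)
        moreover have "length b - 1 < N" using len[OF b] by simp
        ultimately show "b \<in> (\<Union>L<N. long_blocks t L)" by blast
      qed
      have "sum ?f F \<le> sum ?f (\<Union>L<N. long_blocks t L)"
        using sub by (intro sum_mono2) (auto simp: finite_long_blocks)
      also have "\<dots> = (\<Sum>L<N. level_gf t L (norm q) (norm v) 1)"
        by (subst sum.UNION_disjoint) (auto simp: finite_long_blocks level_gf_def, auto simp: long_blocks_def)
      also have "\<dots> \<le> (\<Sum>L. norm (level_gf t L (norm q) (norm v) 1))"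
      proof (rule order_trans[OF _ sum_le_suminf])
        show "summable (\<lambda>L. norm (level_gf t L (norm q) (norm v) 1))" by (rule level_gf_summable) (use assms in auto)
        show "(\<Sum>L<N. level_gf t L (norm q) (norm v) 1) \<le> (\<Sum>L<N. norm (level_gf t L (norm q) (norm v) 1))" by (intro sum_mono) simp
      qed auto
      finally show "sum ?f F \<le> (\<Sum>L. norm (level_gf t L (norm q) (norm v) 1))" .
    qed
  qed auto
  thus "(\<lambda>b. norm (v ^ descents t b * q ^ sum_list b)) summable_on blocks t"
    by (simp add: norm_mult norm_power)
qed

lemma block_gf_infsum:
  fixes q v :: "'a::{real_normed_field,banach,second_countable_topology}"
  assumes "norm q \<le> Rmax" "norm v \<le> Vmax"
  shows "block_gf t q v 1 = (\<Sum>\<^sub>\<infinity>b\<in>blocks t. v ^ descents t b * q ^ sum_list b)"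
    and "(\<lambda>n. (\<Sum>b\<in>sized_blocks t n. v ^ descents t b) * q ^ n) sums block_gf t q v 1"
proof -
  have k1: "{b \<in> blocks t. length b - 1 = n} = long_blocks t n" for n
  proof -
    have "length b - 1 = n \<longleftrightarrow> length b = Suc n" if "b \<in> blocks t" for b
      using that by (cases b) (auto simp: blocks_def)
    thus ?thesis by (auto simp: long_blocks_def)
  qed
  have "(\<lambda>n. \<Sum>b\<in>{b \<in> blocks t. length b - 1 = n}. v ^ descents t b * q ^ sum_list b) sums (\<Sum>\<^sub>\<infinity>b\<in>blocks t. v ^ descents t b * q ^ sum_list b)"
    by (rule fibre_sums[OF blocks_summable[OF assms]]) (simp only: k1 finite_long_blocks)
  thus 1: "block_gf t q v 1 = (\<Sum>\<^sub>\<infinity>b\<in>blocks t. v ^ descents t b * q ^ sum_list b)"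
    unfolding k1 by (simp add: block_gf_def level_gf_def sums_iff)
  have k2: "{b \<in> blocks t. sum_list b = n} = sized_blocks t n" for n by (simp add: sized_blocks_def)
  have "(\<lambda>n. \<Sum>b\<in>{b \<in> blocks t. sum_list b = n}. v ^ descents t b * q ^ sum_list b) sums (\<Sum>\<^sub>\<infinity>b\<in>blocks t. v ^ descents t b * q ^ sum_list b)"
    by (rule fibre_sums[OF blocks_summable[OF assms]]) (simp add: k2 finite_sized_blocks)
  moreover have "(\<Sum>b\<in>sized_blocks t n. v ^ descents t b * q ^ sum_list b) = (\<Sum>b\<in>sized_blocks t n. v ^ descents t b) * q ^ n" for n
    by (simp add: sum_distrib_right sized_blocks_def)
  ultimately show "(\<lambda>n. (\<Sum>b\<in>sized_blocks t n. v ^ descents t b) * q ^ n) sums block_gf t q v 1"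
    unfolding 1 k2 by simp
qed

lemma block_gf_continuous_real: "continuous_on {0..Rmax} (\<lambda>x::real. block_gf t x 1 1)"
proof -
  have "uniform_limit {0..Rmax} (\<lambda>N x. \<Sum>L<N. level_gf t L x 1 1) (\<lambda>x::real. \<Sum>L. level_gf t L x 1 1) sequentially"
    by (rule Weierstrass_m_test[OF _ summable_majorant[of 1]]) (use level_gf_bound'[of _ 1 "1::real"] kappa in auto)
  thus ?thesis unfolding block_gf_def
    by (rule uniform_limit_theorem[rotated]) (auto simp: level_gf_def intro!: always_eventually continuous_intros)
qed

text \<open>Intermediate value theorem. At \<open>1 / 2\<close> the bounds for the single levels add up to 1; at \<open>0.6\<close> eight short
blocks already exceed 1.\<close>
lemma dominant_root: 
  assumes "t \<ge> 2"
  shows "\<exists>\<rho>\<in>{1/2..0.6::real}. block_gf t \<rho> 1 1 = 1"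
proof -
  have "block_gf t (1/2) 1 1 \<le> (1::real)"
  proof -
    have b: "norm (level_gf t L (1/2::real) 1 1) \<le> 1/2 * (1/2::real) ^ L" for L
      using level_gf_bound[of "1/2::real" "1/2" "1" 1 1 t L] by (simp add: power2_eq_square)
    have "\<bar>block_gf t (1/2) 1 1\<bar> \<le> (\<Sum>L. 1/2 * (1/2::real) ^ L)"
      unfolding block_gf_def real_norm_def[symmetric] by (intro order_trans[OF summable_norm suminf_le] b level_gf_summable) (auto simp: Rmax_def Vmax_def)
    also have "\<dots> = 1" by (subst suminf_mult) (auto simp: suminf_geometric)
    finally show ?thesis by linarith
  qed
  moreover have "1 \<le> block_gf t (0.6::real) 1 1"
  proof -
    define B where "B = {[1], [2,1], [2,2,1], [3,2,1], [4,2,1], [2,2,2,1], [3,2,2,1], [2,3,2,1::nat]}"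
    have "B \<subseteq> blocks t" using assms by (auto simp: B_def blocks_def)
    moreover have "(\<lambda>b. 1 ^ descents t b * (0.6::real) ^ sum_list b) summable_on blocks t"
      by (rule blocks_summable) (auto simp: Rmax_def Vmax_def)
    ultimately have "(\<Sum>b\<in>B. 1 ^ descents t b * (0.6::real) ^ sum_list b) \<le> (\<Sum>\<^sub>\<infinity>b\<in>blocks t. 1 ^ descents t b * (0.6::real) ^ sum_list b)"
      by (intro finite_sum_le_infsum) (auto simp: B_def)
    also have "\<dots> = block_gf t 0.6 1 1" by (rule block_gf_infsum(1)[symmetric]) (auto simp: Rmax_def Vmax_def)
    finally show ?thesis by (simp add: B_def eval_nat_numeral)
  qed
  moreover have "continuous_on {1/2..0.6} (\<lambda>x::real. block_gf t x 1 1)"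
    by (rule continuous_on_subset[OF block_gf_continuous_real]) (auto simp: Rmax_def)
  ultimately show ?thesis using IVT'[of "\<lambda>x. block_gf t x 1 1" "1/2::real" 1 "0.6"] by auto
qed

section \<open>Renewal sequences with rewards\<close>

text \<open>M-test for holomorphic functions.\<close>
lemma holomorphic_suminf:
  fixes f :: "nat \<Rightarrow> complex \<Rightarrow> complex"
  assumes "open S" "\<And>n. f n holomorphic_on S" "summable a" "\<And>n z. z \<in> S \<Longrightarrow> norm (f n z) \<le> a n"
  shows "(\<lambda>z. \<Sum>n. f n z) holomorphic_on S"
    and "z \<in> S \<Longrightarrow> (\<lambda>n. (deriv ^^ k) (f n) z) sums (deriv ^^ k) (\<lambda>z. \<Sum>n. f n z) z"
proof -
  have ul: "uniform_limit S (\<lambda>n z. \<Sum>i<n. f i z) (\<lambda>z. \<Sum>n. f n z) sequentially"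
    using assms(4,3) by (rule Weierstrass_m_test)
  have hol: "(\<lambda>z. \<Sum>i<n. f i z) holomorphic_on S" for n using assms(2) by (intro holomorphic_intros)
  show "(\<lambda>z. \<Sum>n. f n z) holomorphic_on S"
  proof (rule holomorphic_uniform_sequence[OF assms(1) hol])
    fix x assume "x \<in> S"
    then obtain d where "d > 0" "cball x d \<subseteq> S" using assms(1) open_contains_cball by blast
    thus "\<exists>d>0. cball x d \<subseteq> S \<and> uniform_limit (cball x d) (\<lambda>n z. \<Sum>i<n. f i z) (\<lambda>z. \<Sum>n. f n z) sequentially"
      using uniform_limit_on_subset[OF ul] by blast
  qed
  assume z: "z \<in> S"
  have "((\<lambda>n. (deriv ^^ k) (\<lambda>z. \<Sum>i<n. f i z) z) \<longlongrightarrow> (deriv ^^ k) (\<lambda>z. \<Sum>n. f n z) z) sequentially"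
    by (rule higher_deriv_complex_uniform_limit[OF ul _ _ assms(1) z]) (auto intro!: always_eventually hol)
  moreover have "(deriv ^^ k) (\<lambda>z. \<Sum>i<n. f i z) z = (\<Sum>i<n. (deriv ^^ k) (f i) z)" for n
  proof (induction n)
    case (Suc n)
    thus ?case using higher_deriv_add[OF hol assms(2) assms(1) z, of k n n] by simp
  qed (use higher_deriv_const[of k 0] in auto)
  ultimately show "(\<lambda>n. (deriv ^^ k) (f n) z) sums (deriv ^^ k) (\<lambda>z. \<Sum>n. f n z) z"
    by (simp add: sums_def)
qed

text \<open>The hypotheses speak of nonnegative weights \<open>c n j\<close> of blocks of size \<open>n\<close> and reward \<open>j\<close>. Rewards are bounded by sizes,
the weighted series converges strictly beyond the root, and no rotation of \<open>q\<close> and \<open>v\<close> fixes all blocks.\<close>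
locale renewal =
  fixes c :: "nat \<Rightarrow> nat \<Rightarrow> real" and R V \<rho>0 :: real
  assumes c_nonneg: "c n j \<ge> 0" and c_0: "c 0 0 = 0"
    and V: "V > 1" and rho0: "0 < \<rho>0" "\<rho>0 < R"
    and summable_c: "summable (\<lambda>n. (\<Sum>j\<le>n. c n j * V ^ j) * R ^ n)"
    and total_mass: "(\<Sum>n. (\<Sum>j\<le>n. c n j) * \<rho>0 ^ n) = 1"
    and aperiodic: "\<lbrakk>norm v = 1; \<And>n j. j \<le> n \<Longrightarrow> c n j > 0 \<Longrightarrow> q ^ n * v ^ j = complex_of_real \<rho>0 ^ n\<rbrakk>
        \<Longrightarrow> q = of_real \<rho>0 \<and> v = 1"
begin

definition cn :: "nat \<Rightarrow> complex \<Rightarrow> complex" where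
  "cn n v = (\<Sum>j\<le>n. of_real (c n j) * v ^ j)"

definition C :: "complex \<Rightarrow> complex \<Rightarrow> complex" where
  "C q v = (\<Sum>n. cn n v * q ^ n)"

definition a :: "nat \<Rightarrow> real" where "a n = (\<Sum>j\<le>n. c n j * V ^ j) * R ^ n"

lemma R_pos: "R > 0" using rho0 by simp

lemma a_nonneg: "a n \<ge> 0" unfolding a_def using V R_pos c_nonneg by (intro mult_nonneg_nonneg sum_nonneg) auto

lemma summable_a: "summable a" using summable_c by (simp add: a_def[abs_def])

lemma norm_cn_le: "norm v \<le> W \<Longrightarrow> norm (cn n v) \<le> (\<Sum>j\<le>n. c n j * W ^ j)"
  unfolding cn_def using c_nonneg
  by (intro sum_norm_le) (auto simp: norm_mult norm_power intro!: mult_left_mono power_mono)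

lemma norm_term: 
  assumes "norm q \<le> R" "norm v \<le> V"
  shows "norm (cn n v * q ^ n) \<le> a n"
  unfolding a_def norm_mult norm_power using assms V c_nonneg
  by (intro mult_mono norm_cn_le power_mono sum_nonneg mult_nonneg_nonneg) auto

lemma summable_C: "norm q \<le> R \<Longrightarrow> norm v \<le> V \<Longrightarrow> summable (\<lambda>n. cn n v * q ^ n)"
  by (rule summable_comparison_test'[OF summable_a]) (use norm_term in auto)

lemma cn_holo: "v holomorphic_on S \<Longrightarrow> (\<lambda>z. cn n (v z)) holomorphic_on S"
  unfolding cn_def by (intro holomorphic_intros)

lemma C_continuous: "continuous_on (cball 0 R \<times> cball 0 V) (\<lambda>x. C (fst x) (snd x))"
proof -
  have "uniform_limit (cball 0 R \<times> cball 0 V) (\<lambda>N x. \<Sum>n<N. cn n (snd x) * fst x ^ n)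
     (\<lambda>x. \<Sum>n. cn n (snd x) * fst x ^ n) sequentially"
    by (rule Weierstrass_m_test[OF _ summable_a]) (auto intro!: norm_term)
  thus ?thesis unfolding C_def
    by (rule uniform_limit_theorem[rotated]) (auto simp: cn_def intro!: always_eventually continuous_intros)
qed

lemma C_holo:
  assumes "open S" "q holomorphic_on S" "v holomorphic_on S" 
    "\<And>z. z \<in> S \<Longrightarrow> norm (q z) \<le> R" "\<And>z. z \<in> S \<Longrightarrow> norm (v z) \<le> V"
  shows "(\<lambda>z. C (q z) (v z)) holomorphic_on S"
  unfolding C_def
  by (rule holomorphic_suminf(1)[OF assms(1) _ summable_a])
     (use assms cn_holo norm_term in \<open>auto intro!: holomorphic_intros\<close>)

definition DC :: "complex \<Rightarrow> complex \<Rightarrow> complex" where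
  "DC q v = (\<Sum>n. diffs (\<lambda>n. cn n v) n * q ^ n)"

lemma C_deriv:
  assumes "norm q < R" "norm v \<le> V"
  shows "((\<lambda>q. C q v) has_field_derivative DC q v) (at q)"
  unfolding C_def DC_def
  by (rule termdiffs_strong[of _ "of_real R"]) (use assms R_pos in \<open>auto intro!: summable_C\<close>)

lemma n_times_power_le: 
  fixes x :: real assumes "0 \<le> x" "x < 1" shows "(real n + 1) * x ^ n \<le> 1 / (1 - x)"
proof -
  have "(real n + 1) * x ^ n = (\<Sum>i\<le>n. x ^ n)" by simp
  also have "\<dots> \<le> (\<Sum>i\<le>n. x ^ i)" using assms by (intro sum_mono power_decreasing) auto
  also have "\<dots> \<le> 1 / (1 - x)"
    using assms by (simp add: sum_gp0 divide_right_mono)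
  finally show ?thesis .
qed

lemma norm_DC_term:
  assumes "norm q \<le> r" "r < R" "0 < r" "norm v \<le> V"
  shows "norm (diffs (\<lambda>n. cn n v) n * q ^ n) \<le> a (Suc n) / (R - r)"
proof -
  have "norm (diffs (\<lambda>n. cn n v) n * q ^ n) = (real n + 1) * norm (cn (Suc n) v) * norm q ^ n"
    unfolding diffs_def norm_mult norm_power by (metis Suc_eq_plus1 norm_of_nat of_nat_Suc add.commute)
  also have "\<dots> \<le> (real n + 1) * (\<Sum>j\<le>Suc n. c (Suc n) j * V ^ j) * r ^ n"
    using assms V c_nonneg by (intro mult_mono norm_cn_le power_mono sum_nonneg mult_nonneg_nonneg) auto
  also have "\<dots> = ((real n + 1) * (r / R) ^ n) * (a (Suc n) / R)"
    using R_pos by (simp add: a_def power_divide)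
  also have "\<dots> \<le> 1 / (1 - r / R) * (a (Suc n) / R)"
    using assms R_pos a_nonneg by (intro mult_right_mono n_times_power_le) auto
  also have "\<dots> = a (Suc n) / (R - r)" using R_pos assms by (simp add: field_simps)
  finally show ?thesis .
qed

lemma DC_continuous:
  assumes "r < R" "0 < r"
  shows "continuous_on (cball 0 r \<times> cball 0 V) (\<lambda>x. DC (fst x) (snd x))"
proof -
  have sm: "summable (\<lambda>n. a (Suc n) / (R - r))"
    using summable_a by (intro summable_divide) (simp add: summable_Suc_iff)
  have "uniform_limit (cball 0 r \<times> cball 0 V) (\<lambda>N x. \<Sum>n<N. diffs (\<lambda>n. cn n (snd x)) n * fst x ^ n)
     (\<lambda>x. \<Sum>n. diffs (\<lambda>n. cn n (snd x)) n * fst x ^ n) sequentially"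
    by (rule Weierstrass_m_test[OF _ sm]) (auto intro!: norm_DC_term simp: assms)
  thus ?thesis unfolding DC_def
    by (rule uniform_limit_theorem[rotated]) (auto simp: cn_def diffs_def intro!: always_eventually continuous_intros)
qed

lemma cn_1: "cn n 1 = of_real (\<Sum>j\<le>n. c n j)" by (simp add: cn_def)

lemma C_rho0: "C (of_real \<rho>0) 1 = 1"
proof -
  have "(\<lambda>n. (\<Sum>j\<le>n. c n j) * \<rho>0 ^ n) sums 1"
  proof -
    have "summable (\<lambda>n. (\<Sum>j\<le>n. c n j) * \<rho>0 ^ n)"
    proof (rule summable_comparison_test'[OF summable_a])
      fix n
      have "norm ((\<Sum>j\<le>n. c n j) * \<rho>0 ^ n) = norm (cn n 1 * of_real \<rho>0 ^ n)"
        by (simp add: cn_1 norm_mult norm_power abs_mult power_abs del: of_real_sum)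
      also have "\<dots> \<le> a n" using rho0 V by (intro norm_term) auto
      finally show "norm ((\<Sum>j\<le>n. c n j) * \<rho>0 ^ n) \<le> a n" .
    qed
    thus ?thesis using total_mass summable_sums by metis
  qed
  hence "(\<lambda>n. complex_of_real ((\<Sum>j\<le>n. c n j) * \<rho>0 ^ n)) sums of_real 1" by (rule sums_of_real)
  thus ?thesis unfolding C_def cn_1 by (simp add: sums_iff)
qed

text \<open>Equality in the triangle inequality aligns all the phases.\<close>
lemma C_eq_1_imp:
  assumes q: "norm q \<le> \<rho>0" and v: "norm v = 1" and eq: "C q v = 1"
  shows "q = of_real \<rho>0 \<and> v = 1"
proof -
  define d where "d n = (\<Sum>j\<le>n. c n j) * \<rho>0 ^ n - Re (cn n v * q ^ n)" for n
  have le: "c n j * Re (v ^ j * q ^ n) \<le> c n j * \<rho>0 ^ n" for n j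
  proof (rule mult_left_mono[OF _ c_nonneg])
    have "Re (v ^ j * q ^ n) \<le> norm (v ^ j * q ^ n)" by (rule complex_Re_le_cmod)
    also have "\<dots> \<le> \<rho>0 ^ n" using q v by (simp add: norm_mult norm_power power_mono)
    finally show "Re (v ^ j * q ^ n) \<le> \<rho>0 ^ n" .
  qed
  have d_eq: "d n = (\<Sum>j\<le>n. c n j * \<rho>0 ^ n - c n j * Re (v ^ j * q ^ n))" for n
    by (simp add: d_def cn_def sum_distrib_right sum_subtractf mult.assoc)
  have d_nonneg: "d n \<ge> 0" for n unfolding d_eq using le by (intro sum_nonneg) auto
  have s1: "(\<lambda>n. cn n v * q ^ n) sums 1"
    using summable_C[of q v] eq q v rho0 V by (simp add: C_def sums_iff)
  have s2: "(\<lambda>n. cn n 1 * of_real \<rho>0 ^ n) sums 1"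
    using summable_C[of "of_real \<rho>0" 1] C_rho0 rho0 V by (simp add: C_def sums_iff)
  have "(\<lambda>n. Re (cn n 1 * of_real \<rho>0 ^ n) - Re (cn n v * q ^ n)) sums (Re 1 - Re 1)"
    by (intro sums_diff sums_Re s1 s2)
  hence "d sums 0" unfolding d_def cn_1 of_real_power[symmetric] of_real_mult[symmetric] by simp
  hence "\<forall>n. d n = 0" using suminf_eq_zero_iff[of d] d_nonneg by (auto simp: sums_iff)
  hence "c n j * \<rho>0 ^ n - c n j * Re (v ^ j * q ^ n) = 0" if "j \<le> n" for n j
    using that le unfolding d_eq by (subst (asm) sum_nonneg_eq_0_iff) auto
  hence re: "Re (v ^ j * q ^ n) = \<rho>0 ^ n" if "j \<le> n" "c n j > 0" for n j using that by fastforce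
  have "q ^ n * v ^ j = of_real \<rho>0 ^ n" if "j \<le> n" "c n j > 0" for n j
  proof -
    have nm: "norm (v ^ j * q ^ n) \<le> \<rho>0 ^ n" using q v by (simp add: norm_mult norm_power power_mono)
    have "Im w = 0" if "norm w \<le> \<rho>0 ^ n" "Re w = \<rho>0 ^ n" for w
    proof -
      have "(Re w)\<^sup>2 + (Im w)\<^sup>2 \<le> (\<rho>0 ^ n)\<^sup>2"
        using that(1) by (simp add: cmod_power2[symmetric] power_mono)
      thus ?thesis using that(2) by simp
    qed
    hence "Im (v ^ j * q ^ n) = 0" using nm re[OF that] by blast
    thus ?thesis using re[OF that] by (simp add: complex_eq_iff mult.commute flip: of_real_power)
  qed
  thus ?thesis using aperiodic v by blast
qed

lemma DC_rho0_pos: "\<exists>\<kappa>>0. DC (of_real \<rho>0) 1 = of_real \<kappa>"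
proof -
  define b where "b n = (real n + 1) * (\<Sum>j\<le>Suc n. c (Suc n) j) * \<rho>0 ^ n" for n
  have b: "diffs (\<lambda>n. cn n 1) n * of_real \<rho>0 ^ n = complex_of_real (b n)" for n
    by (simp add: diffs_def cn_1 b_def del: sum.atMost_Suc)
  have b0: "b n \<ge> 0" for n unfolding b_def using rho0 c_nonneg by (intro mult_nonneg_nonneg sum_nonneg) auto
  have sb: "summable (\<lambda>n. complex_of_real (b n))"
  proof -
    have sm: "summable (\<lambda>n. a (Suc n) / (R - \<rho>0))"
      using summable_a by (intro summable_divide) (simp add: summable_Suc_iff)
    show ?thesis unfolding b[symmetric]
      by (rule summable_comparison_test'[OF sm]) (use rho0 V in \<open>auto intro!: norm_DC_term\<close>)
  qed
  hence sb': "summable b" by (simp add: summable_of_real_iff)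
  have "\<exists>n. b n > 0"
  proof (rule ccontr)
    assume "\<not> ?thesis"
    hence "b n = 0" for n using b0[of n] by (meson leI order_antisym)
    hence "(\<Sum>j\<le>Suc n. c (Suc n) j) = 0" for n using rho0 by (auto simp: b_def simp del: sum.atMost_Suc)
    hence "(\<Sum>j\<le>n. c n j) = 0" for n using c_0 by (cases n) auto
    thus False using total_mass by simp
  qed
  hence "suminf b > 0" using suminf_pos_iff[OF sb'] b0 by blast
  moreover have "DC (of_real \<rho>0) 1 = of_real (suminf b)"
    unfolding DC_def b by (rule suminf_of_real[OF sb', symmetric])
  ultimately show ?thesis by blast
qed

definition p :: "nat \<Rightarrow> complex \<Rightarrow> complex" where "p n v = fps_nth (inverse (1 - Abs_fps (\<lambda>n. cn n v))) n"

lemma p_rec: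
  assumes "P 0 = 1" "\<And>n. n \<ge> 1 \<Longrightarrow> P n = (\<Sum>k=1..n. cn k v * P (n - k))"
  shows "P n = p n v"
proof -
  have c0: "cn 0 v = 0" using c_0 by (simp add: cn_def)
  have "Abs_fps P * (1 - Abs_fps (\<lambda>n. cn n v)) = 1"
  proof (rule fps_ext)
    fix n
    have "fps_nth (Abs_fps (\<lambda>n. cn n v) * Abs_fps P) n = (\<Sum>k=0..n. cn k v * P (n - k))"
      by (simp add: fps_mult_nth)
    also have "\<dots> = (\<Sum>k=1..n. cn k v * P (n - k))"
      by (subst sum.atLeast_Suc_atMost) (auto simp: c0)
    also have "\<dots> = (if n = 0 then 0 else P n)" using assms(2)[of n] by auto
    finally show "fps_nth (Abs_fps P * (1 - Abs_fps (\<lambda>n. cn n v))) n = fps_nth 1 n"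
      using assms(1) by (simp add: algebra_simps)
  qed
  hence "inverse (1 - Abs_fps (\<lambda>n. cn n v)) = Abs_fps P"
    by (metis fps_inverse_unique mult.commute)
  thus ?thesis by (simp add: p_def)
qed

lemma p_0: "p 0 v = 1" using c_0 by (simp add: p_def cn_def)

lemma p_recurrence: "n \<ge> 1 \<Longrightarrow> p n v = (\<Sum>k=1..n. cn k v * p (n - k) v)"
proof -
  assume n: "n \<ge> 1"
  let ?F = "Abs_fps (\<lambda>n. cn n v)"
  have c0: "cn 0 v = 0" using c_0 by (simp add: cn_def)
  have "(1 - ?F) * inverse (1 - ?F) = 1" by (rule inverse_mult_eq_1') (simp add: c0)
  hence "inverse (1 - ?F) = 1 + ?F * inverse (1 - ?F)" by (simp add: algebra_simps)
  hence "p n v = fps_nth (1 + ?F * inverse (1 - ?F)) n" unfolding p_def by (rule arg_cong)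
  also have "\<dots> = (\<Sum>k=0..n. cn k v * p (n - k) v)" using n by (simp add: fps_mult_nth p_def)
  also have "\<dots> = (\<Sum>k=1..n. cn k v * p (n - k) v)"
    by (subst sum.atLeast_Suc_atMost) (auto simp: c0)
  finally show ?thesis .
qed

lemma p_holo: "p n holomorphic_on S"
proof (induction n rule: less_induct)
  case (less n)
  show ?case
  proof (cases "n = 0")
    case True
    thus ?thesis by (simp add: p_0[abs_def])
  next
    case False
    hence "p n = (\<lambda>v. \<Sum>k=1..n. cn k v * p (n - k) v)" using p_recurrence[of n] by auto
    thus ?thesis using less by (auto intro!: holomorphic_intros cn_holo)
  qed
qed

lemma C_fps: "norm v \<le> V \<Longrightarrow> (\<lambda>q. C q v) has_fps_expansion Abs_fps (\<lambda>n. cn n v)"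
proof (rule has_fps_expansionI)
  assume v: "norm v \<le> V"
  have "eventually (\<lambda>u. u \<in> ball 0 R) (nhds (0::complex))" using R_pos by (intro eventually_nhds_in_open) auto
  thus "\<forall>\<^sub>F u in nhds 0. (\<lambda>n. fps_nth (Abs_fps (\<lambda>n. cn n v)) n * u ^ n) sums C u v"
    by eventually_elim (use summable_C v in \<open>auto simp: C_def sums_iff\<close>)
qed

text \<open>The coefficients of the cofactor of a possible pole.\<close>
lemma cofactor_coeffs:
  assumes h: "h holomorphic_on ball 0 r" "0 < r" and v: "norm v \<le> V"
    and eq: "\<And>z. z \<in> ball 0 r \<Longrightarrow> h z * (1 - C z v) = 1 - \<beta> * z"
  shows "(deriv ^^ n) h 0 / fact n = (if n = 0 then 1 else p n v - \<beta> * p (n - 1) v)"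
proof -
  have c0: "cn 0 v = 0" using c_0 by (simp add: cn_def)
  let ?F = "1 - Abs_fps (\<lambda>n. cn n v)"
  have hf: "h has_fps_expansion fps_expansion h 0"
    using h by (intro has_fps_expansion_fps_expansion[of "ball 0 r"]) auto
  have A: "(\<lambda>z. h z * (1 - C z v)) has_fps_expansion fps_expansion h 0 * ?F"
    by (intro fps_expansion_intros hf C_fps v)
  have B: "(\<lambda>z. 1 - \<beta> * z) has_fps_expansion 1 - fps_const \<beta> * fps_X"
    by (intro fps_expansion_intros)
  have E: "eventually (\<lambda>z. h z * (1 - C z v) = 1 - \<beta> * z) (nhds 0)"
  proof -
    have "eventually (\<lambda>u. u \<in> ball 0 r) (nhds (0::complex))" using h by (intro eventually_nhds_in_open) auto
    thus ?thesis by eventually_elim (use eq in auto)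
  qed
  have "fps_expansion h 0 * ?F = 1 - fps_const \<beta> * fps_X"
    using fps_expansion_unique_complex[OF _ B] has_fps_expansion_cong[OF E refl] A by blast
  hence 1: "fps_expansion h 0 * (?F * inverse ?F) = (1 - fps_const \<beta> * fps_X) * inverse ?F"
    by (simp only: mult.assoc[symmetric])
  have "?F * inverse ?F = 1" by (rule inverse_mult_eq_1') (simp add: c0)
  with 1 have "fps_expansion h 0 = inverse ?F - fps_const \<beta> * (fps_X * inverse ?F)"
    by (simp only: mult_1_right left_diff_distrib mult_1_left mult.assoc)
  hence "fps_nth (fps_expansion h 0) n = p n v - \<beta> * (if n = 0 then 0 else p (n - 1) v)"
    unfolding p_def by simp
  moreover have "p 0 v = 1" using c0 by (simp add: p_def)
  ultimately show ?thesis by (simp add: fps_expansion_def)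
qed


text \<open>On a small disc the derivative is nearly constant and the value at the centre is small compared with the
radius, so Newton's map with frozen derivative contracts the disc into itself.\<close>
lemma newton_contraction:
  "\<exists>\<kappa> \<epsilon> \<delta>. \<kappa> > 0 \<and> 0 < \<epsilon> \<and> \<epsilon> < R - \<rho>0 \<and> \<epsilon> < \<rho>0 \<and> 0 < \<delta> \<and> 1 + \<delta> < V \<and>
     (\<forall>v\<in>ball 1 \<delta>. norm (C (of_real \<rho>0) v - 1) \<le> \<kappa> * \<epsilon> / 2 \<and>
       (\<forall>z\<in>cball (of_real \<rho>0) \<epsilon>. norm (DC z v - of_real \<kappa>) \<le> \<kappa> / 2))"
proof -
  obtain \<kappa> where k: "\<kappa> > 0" "DC (of_real \<rho>0) 1 = of_real \<kappa>" using DC_rho0_pos by blast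
  define r where "r = (\<rho>0 + R) / 2"
  have r: "\<rho>0 < r" "r < R" "0 < r" using rho0 by (auto simp: r_def field_simps)
  let ?X = "cball 0 r \<times> cball 0 V :: (complex \<times> complex) set"
  have cts1: "continuous_on ?X (\<lambda>x. DC (fst x) (snd x))" using DC_continuous r(2,3) .
  have cts2: "continuous_on ?X (\<lambda>x. C (fst x) (snd x))"
    by (rule continuous_on_subset[OF C_continuous]) (use r in auto)
  have x0: "(of_real \<rho>0, 1) \<in> ?X" using r rho0 V by auto
  obtain d1 where d1: "d1 > 0" "\<And>x. x \<in> ?X \<Longrightarrow> dist x (of_real \<rho>0, 1) < d1 \<Longrightarrow> dist (DC (fst x) (snd x)) (of_real \<kappa>) < \<kappa> / 2"
    using cts1[unfolded continuous_on_iff, rule_format, OF x0, of "\<kappa> / 2"] k by auto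
  define \<epsilon> where "\<epsilon> = Min {d1 / 3, (r - \<rho>0) / 2, \<rho>0 / 2}"
  have e: "\<epsilon> > 0" "\<epsilon> < r - \<rho>0" "\<epsilon> < \<rho>0" "\<epsilon> < d1 / 2" using d1 r rho0 by (auto simp: \<epsilon>_def min_less_iff_disj)
  obtain d2 where d2: "d2 > 0" "\<And>x. x \<in> ?X \<Longrightarrow> dist x (of_real \<rho>0, 1) < d2 \<Longrightarrow> dist (C (fst x) (snd x)) 1 < \<kappa> * \<epsilon> / 2"
    using cts2[unfolded continuous_on_iff, rule_format, OF x0, of "\<kappa> * \<epsilon> / 2"] k e C_rho0 by auto
  define \<delta> where "\<delta> = Min {d1 / 3, d2 / 2, (V - 1) / 2}"
  have d: "\<delta> > 0" "\<delta> < d2" "\<delta> < d1 / 2" "\<delta> < V - 1" using d1 d2 V by (auto simp: \<delta>_def min_less_iff_disj)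
  have "norm (C (of_real \<rho>0) v - 1) \<le> \<kappa> * \<epsilon> / 2 \<and>
       (\<forall>z\<in>cball (of_real \<rho>0) \<epsilon>. norm (DC z v - of_real \<kappa>) \<le> \<kappa> / 2)" if v: "v \<in> ball 1 \<delta>" for v
  proof (intro conjI ballI)
    have nv: "norm v \<le> V" using v norm_triangle_ineq2[of v 1] d by (simp add: dist_norm norm_minus_commute)
    show "norm (C (of_real \<rho>0) v - 1) \<le> \<kappa> * \<epsilon> / 2"
      using d2(2)[of "(of_real \<rho>0, v)"] x0 nv v d by (simp add: dist_Pair_Pair dist_commute less_imp_le dist_norm norm_minus_commute)
    fix z assume z: "z \<in> cball (complex_of_real \<rho>0) \<epsilon>"
    have nz: "norm z \<le> r" using z norm_triangle_ineq2[of z "of_real \<rho>0"] e rho0 by (simp add: dist_norm norm_minus_commute)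
    have "dist (z, v) (of_real \<rho>0, 1) \<le> dist z (of_real \<rho>0) + dist v 1"
      unfolding dist_Pair_Pair by (rule sqrt_sum_squares_le_sum) auto
    also have "\<dots> < d1" using z v e d by (simp add: dist_commute)
    finally show "norm (DC z v - of_real \<kappa>) \<le> \<kappa> / 2"
      using d1(2)[of "(z, v)"] nz nv by (simp add: less_imp_le dist_norm)
  qed
  thus ?thesis using k e d r by (intro exI[of _ \<kappa>] exI[of _ \<epsilon>] exI[of _ \<delta>]) auto
qed

text \<open>The zero is the uniform limit of the Newton iterates started at \<open>\<rho>0\<close>, which are holomorphic in \<open>v\<close>.\<close>
lemma branch:
  "\<exists>\<rho> \<epsilon> \<delta>. 0 < \<epsilon> \<and> \<epsilon> < R - \<rho>0 \<and> \<epsilon> < \<rho>0 \<and> 0 < \<delta> \<and> 1 + \<delta> < V \<and> \<rho> holomorphic_on ball 1 \<delta> \<and> \<rho> 1 = of_real \<rho>0 \<and>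
     (\<forall>v\<in>ball 1 \<delta>. \<rho> v \<in> cball (of_real \<rho>0) \<epsilon> \<and> C (\<rho> v) v = 1 \<and> DC (\<rho> v) v \<noteq> 0 \<and>
        (\<forall>z\<in>cball (of_real \<rho>0) \<epsilon>. C z v = 1 \<longrightarrow> z = \<rho> v))"
proof -
  obtain \<kappa> \<epsilon> \<delta> where k: "\<kappa> > 0" "0 < \<epsilon>" "\<epsilon> < R - \<rho>0" "\<epsilon> < \<rho>0" "0 < \<delta>" "1 + \<delta> < V"
    and C0: "\<And>v. v \<in> ball 1 \<delta> \<Longrightarrow> norm (C (of_real \<rho>0) v - 1) \<le> \<kappa> * \<epsilon> / 2"
    and D0: "\<And>v z. v \<in> ball 1 \<delta> \<Longrightarrow> z\<in>cball (of_real \<rho>0) \<epsilon> \<Longrightarrow> norm (DC z v - of_real \<kappa>) \<le> \<kappa> / 2"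
    using newton_contraction by auto
  let ?B = "cball (complex_of_real \<rho>0) \<epsilon>"
  have nv: "norm v \<le> V" if "v \<in> ball 1 \<delta>" for v :: complex
    using that norm_triangle_ineq2[of v 1] k by (simp add: dist_norm norm_minus_commute)
  have nz: "norm z < R" if "z \<in> ?B" for z
    using that norm_triangle_ineq2[of z "of_real \<rho>0"] k rho0 by (simp add: dist_norm norm_minus_commute)
  define g where "g v z = z - (C z v - 1) / of_real \<kappa>" for v z
  have contr: "norm (g v z - g v w) \<le> 1/2 * norm (z - w)" if "v \<in> ball 1 \<delta>" "z \<in> ?B" "w \<in> ?B" for v z w
  proof (rule field_differentiable_bound[of ?B _ "\<lambda>z. 1 - DC z v / of_real \<kappa>"])
    fix z assume z: "z \<in> ?B"
    show "(g v has_field_derivative 1 - DC z v / of_real \<kappa>) (at z within ?B)"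
      unfolding g_def using k
      by (auto intro!: derivative_eq_intros DERIV_subset[OF C_deriv[OF nz[OF z] nv[OF that(1)]]])
    have "1 - DC z v / of_real \<kappa> = - (DC z v - of_real \<kappa>) / of_real \<kappa>" using k by (simp add: field_simps)
    thus "norm (1 - DC z v / of_real \<kappa>) \<le> 1/2"
      using D0[OF that(1) z] k by (simp add: norm_divide divide_simps norm_minus_commute)
  qed (use that in auto)
  have g0: "norm (g v (of_real \<rho>0) - of_real \<rho>0) \<le> \<epsilon> / 2" if "v \<in> ball 1 \<delta>" for v
    using C0[OF that] k by (simp add: g_def norm_divide divide_simps mult.commute norm_minus_commute)
  have maps: "g v z \<in> ?B" if "v \<in> ball 1 \<delta>" "z \<in> ?B" for v z
  proof -
    have "norm (g v z - of_real \<rho>0) \<le> norm (g v z - g v (of_real \<rho>0)) + norm (g v (of_real \<rho>0) - of_real \<rho>0)"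
      by (metis norm_triangle_ineq diff_add_cancel add_diff_eq)
    also have "\<dots> \<le> 1/2 * norm (z - of_real \<rho>0) + \<epsilon> / 2"
      using contr[OF that(1,2), of "of_real \<rho>0"] g0[OF that(1)] k by simp
    also have "\<dots> \<le> \<epsilon>" using that(2) by (simp add: dist_norm norm_minus_commute)
    finally show ?thesis by (simp add: dist_norm norm_minus_commute)
  qed
  define w where "w = (\<lambda>k v. (g v ^^ k) (of_real \<rho>0))"
  have w_Suc: "w (Suc k) v = g v (w k v)" for k v by (simp add: w_def)
  have w_in: "w k v \<in> ?B" if "v \<in> ball 1 \<delta>" for k v
    by (induction k) (use that maps k in \<open>auto simp: w_Suc simp del: mem_cball\<close>, simp add: w_def)
  have w_diff: "norm (w (Suc k) v - w k v) \<le> \<epsilon> / 2 * (1/2) ^ k" if "v \<in> ball 1 \<delta>" for k v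
  proof (induction k)
    case 0
    show ?case using g0[OF that] by (simp add: w_def)
  next
    case (Suc k)
    have "norm (w (Suc (Suc k)) v - w (Suc k) v) \<le> 1/2 * norm (w (Suc k) v - w k v)"
      using contr[OF that w_in[OF that] w_in[OF that], of "Suc k" k] by (simp add: w_Suc)
    thus ?case using Suc by simp
  qed
  have w_hol: "w k holomorphic_on ball 1 \<delta>" for k
  proof (induction k)
    case (Suc k)
    have "(\<lambda>v. C (w k v) v) holomorphic_on ball 1 \<delta>"
      by (rule C_holo) (use Suc nv nz[OF w_in] in \<open>auto intro: less_imp_le\<close>)
    thus ?case unfolding w_Suc[abs_def] g_def using Suc k by (auto intro!: holomorphic_intros)
  qed (simp add: w_def)
  define \<rho> where "\<rho> v = of_real \<rho>0 + (\<Sum>k. w (Suc k) v - w k v)" for v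
  have sm: "summable (\<lambda>k. \<epsilon> / 2 * (1/2) ^ k :: real)" by (intro summable_mult) simp
  have hol: "\<rho> holomorphic_on ball 1 \<delta>" unfolding \<rho>_def
  proof (intro holomorphic_intros holomorphic_suminf(1)[OF _ _ sm])
    fix k v assume "v \<in> ball (1::complex) \<delta>"
    thus "norm (w (Suc k) v - w k v) \<le> \<epsilon> / 2 * (1/2) ^ k" by (rule w_diff)
  qed (auto intro!: holomorphic_intros w_hol)
  have lim: "(\<lambda>k. w k v) \<longlonglongrightarrow> \<rho> v" if "v \<in> ball 1 \<delta>" for v
  proof -
    have "(\<lambda>k. w (Suc k) v - w k v) sums (\<Sum>k. w (Suc k) v - w k v)"
      by (intro summable_sums summable_comparison_test'[OF sm]) (use w_diff[OF that] in auto)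
    hence "(\<lambda>n. w n v - w 0 v) \<longlonglongrightarrow> (\<Sum>k. w (Suc k) v - w k v)"
      unfolding sums_def sum_lessThan_telescope[of "\<lambda>k. w k v"] .
    from tendsto_add[OF this tendsto_const[of "w 0 v"]] show ?thesis by (simp add: \<rho>_def w_def add.commute)
  qed
  have rho_in: "\<rho> v \<in> ?B" if "v \<in> ball 1 \<delta>" for v
    using closed_sequentially[OF closed_cball _ lim[OF that]] w_in[OF that] by blast
  have fixp: "g v (\<rho> v) = \<rho> v" if "v \<in> ball 1 \<delta>" for v
  proof -
    have "(\<lambda>k. norm (w (Suc k) v - g v (\<rho> v))) \<longlonglongrightarrow> 0"
    proof (rule Lim_null_comparison)
      show "\<forall>\<^sub>F k in sequentially. norm (norm (w (Suc k) v - g v (\<rho> v))) \<le> 1/2 * norm (w k v - \<rho> v)"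
        using contr[OF that w_in[OF that] rho_in[OF that]] by (simp add: w_Suc)
      show "(\<lambda>k. 1/2 * norm (w k v - \<rho> v)) \<longlonglongrightarrow> 0"
        using lim[OF that] by (auto intro!: tendsto_eq_intros simp: LIM_zero tendsto_norm_zero_iff)
    qed
    hence "(\<lambda>k. w (Suc k) v) \<longlonglongrightarrow> g v (\<rho> v)" by (simp add: tendsto_norm_zero_iff LIM_zero_iff)
    thus ?thesis using LIMSEQ_Suc[OF lim[OF that]] LIMSEQ_unique by blast
  qed
  have zero: "C (\<rho> v) v = 1" if "v \<in> ball 1 \<delta>" for v using fixp[OF that] k by (simp add: g_def)
  have uniq: "z = \<rho> v" if "v \<in> ball 1 \<delta>" "z \<in> ?B" "C z v = 1" for v z
  proof -
    have "norm (z - \<rho> v) \<le> 1/2 * norm (z - \<rho> v)"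
      using contr[OF that(1,2) rho_in[OF that(1)]] zero[OF that(1)] that(3) by (simp add: g_def)
    thus ?thesis by simp
  qed
  have "DC (\<rho> v) v \<noteq> 0" if "v \<in> ball 1 \<delta>" for v
    using D0[OF that rho_in[OF that]] k by auto
  moreover have "\<rho> 1 = of_real \<rho>0" using uniq[of 1 "of_real \<rho>0"] C_rho0 k by simp
  ultimately show ?thesis using k hol rho_in zero uniq
    by (intro exI[of _ \<rho>] exI[of _ \<epsilon>] exI[of _ \<delta>]) blast
qed

end

context renewal begin

text \<open>Zero-freeness spreads to a neighbourhood, by compactness.\<close>
lemma zero_free_nbhd:
  assumes A: "compact A" "A \<subseteq> cball 0 V" and E: "open E"
    and free: "\<And>v q. v \<in> A \<Longrightarrow> norm q \<le> \<rho>0 \<Longrightarrow> q \<notin> E \<Longrightarrow> C q v \<noteq> 1"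
  shows "\<exists>\<eta>>0. \<rho>0 + \<eta> < R \<and> (\<forall>v' v q. v' \<in> A \<longrightarrow> dist v' v \<le> \<eta> \<longrightarrow> norm v \<le> V \<longrightarrow> norm q \<le> \<rho>0 + \<eta> \<longrightarrow> q \<notin> E \<longrightarrow> C q v \<noteq> 1)"
proof -
  let ?X = "cball 0 R \<times> cball 0 V :: (complex \<times> complex) set"
  define Z where "Z = {x \<in> ?X. C (fst x) (snd x) = 1} \<inter> (- E) \<times> UNIV"
  have "closed Z" unfolding Z_def
    by (intro closed_Int closed_Times continuous_closed_preimage_constant[OF C_continuous] closed_Times) (use E in auto)
  moreover have "compact (cball (0::complex) \<rho>0 \<times> A)" using A by (intro compact_Times) auto
  moreover have "(cball (0::complex) \<rho>0 \<times> A) \<inter> Z = {}" using free by (auto simp: Z_def)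
  ultimately obtain d where d: "d > 0" "\<And>x y. x \<in> cball 0 \<rho>0 \<times> A \<Longrightarrow> y \<in> Z \<Longrightarrow> d \<le> dist x y"
    using separate_compact_closed by metis
  define \<eta> where "\<eta> = min (d / 3) ((R - \<rho>0) / 2)"
  have e: "\<eta> > 0" "\<eta> \<le> d / 3" "\<rho>0 + \<eta> < R" using d rho0 by (auto simp: \<eta>_def min_def field_simps)
  have "C q v \<noteq> 1" if *: "v' \<in> A" "dist v' v \<le> \<eta>" "norm v \<le> V" "norm q \<le> \<rho>0 + \<eta>" "q \<notin> E" for v' v q
  proof
    assume "C q v = 1"
    hence z: "(q, v) \<in> Z" using * e by (auto simp: Z_def)
    define q' where "q' = (if norm q \<le> \<rho>0 then q else of_real (\<rho>0 / norm q) * q)"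
    have "norm q' \<le> \<rho>0" using rho0 by (auto simp: q'_def norm_mult norm_divide)
    moreover have "dist q' q \<le> \<eta>"
    proof (cases "norm q \<le> \<rho>0")
      case False
      have "q' - q = of_real (\<rho>0 / norm q - 1) * q" using False by (simp add: q'_def algebra_simps)
      hence "norm (q' - q) = \<bar>\<rho>0 / norm q - 1\<bar> * norm q" by (simp only: norm_mult norm_of_real)
      also have "\<dots> = norm q - \<rho>0"
      proof -
        have "norm q > 0" using False rho0 by linarith
        thus ?thesis using False by (auto simp: abs_if field_simps)
      qed
      finally show ?thesis using * by (simp add: dist_norm)
    qed (use e in \<open>auto simp: q'_def\<close>)
    ultimately have "d \<le> dist (q', v') (q, v)" using d(2)[OF _ z] *(1) by simp
    also have "\<dots> \<le> dist q' q + dist v' v"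
      unfolding dist_Pair_Pair by (rule sqrt_sum_squares_le_sum) auto
    finally show False using \<open>dist q' q \<le> \<eta>\<close> *(2) e d by linarith
  qed
  thus ?thesis using e by blast
qed

text \<open>The coefficients are exponentially small away from 1.\<close>
text \<open>Away from \<open>v = 1\<close> there is no zero in a closed disc of radius larger than \<open>\<rho>0\<close>, uniformly by compactness, so Cauchy's
inequality applies to the reciprocal.\<close>
lemma p_arc_bound:
  assumes A: "compact A" "A \<subseteq> cball 0 V" 
    and free: "\<And>v q. v \<in> A \<Longrightarrow> norm q \<le> \<rho>0 \<Longrightarrow> C q v \<noteq> 1"
  shows "\<exists>M r. r > \<rho>0 \<and> (\<forall>v\<in>A. \<forall>n. norm (p n v) \<le> M / r ^ n)"
proof (cases "A = {}")
  case True
  thus ?thesis by (intro exI[of _ 0] exI[of _ "\<rho>0 + 1"]) auto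
next
  case False
  obtain \<eta> where e: "\<eta> > 0" "\<rho>0 + \<eta> < R" 
    "\<And>v q. v \<in> A \<Longrightarrow> norm v \<le> V \<Longrightarrow> norm q \<le> \<rho>0 + \<eta> \<Longrightarrow> C q v \<noteq> 1"
  proof -
    obtain \<eta> where "\<eta> > 0" "\<rho>0 + \<eta> < R"
      and *: "\<And>v' v q. v' \<in> A \<Longrightarrow> dist v' v \<le> \<eta> \<Longrightarrow> norm v \<le> V \<Longrightarrow> norm q \<le> \<rho>0 + \<eta> \<Longrightarrow> C q v \<noteq> 1"
      using zero_free_nbhd[of A "{}"] A free by auto
    thus ?thesis using that[of \<eta>] *[of v v for v] by auto
  qed
  define r where "r = \<rho>0 + \<eta>"
  let ?Y = "cball (0::complex) r \<times> A"
  have r: "r > \<rho>0" "r < R" "0 < r" using e rho0 by (auto simp: r_def)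
  have Y: "?Y \<subseteq> cball 0 R \<times> cball 0 V" using r A by auto
  have cts: "continuous_on ?Y (\<lambda>x. norm (1 - C (fst x) (snd x)))"
    by (intro continuous_intros continuous_on_subset[OF C_continuous Y])
  have cpt: "compact ?Y" by (intro compact_Times) (use A in auto)
  have ne: "?Y \<noteq> {}" using False r by auto
  obtain x where x: "x \<in> ?Y" "\<And>y. y \<in> ?Y \<Longrightarrow> norm (1 - C (fst x) (snd x)) \<le> norm (1 - C (fst y) (snd y))"
    using continuous_attains_inf[OF cpt _ cts] ne by blast
  define m where "m = norm (1 - C (fst x) (snd x))"
  have m: "m > 0" using x(1) e(3)[of "snd x" "fst x"] A by (auto simp: m_def r_def)
  have "norm (p n v) \<le> (1/m) / r ^ n" if v: "v \<in> A" for v n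
  proof -
    have nv: "norm v \<le> V" using v A by auto
    have nz: "1 - C z v \<noteq> 0" if "norm z \<le> r" for z using e(3)[OF v nv, of z] that by (simp add: r_def)
    define h where "h z = 1 / (1 - C z v)" for z
    have hol: "h holomorphic_on ball 0 R \<inter> - {z. C z v = 1}"
    proof -
      have hC: "(\<lambda>z. C z v) holomorphic_on ball 0 R" by (rule C_holo) (use nv in auto)
      show ?thesis unfolding h_def by (intro holomorphic_intros holomorphic_on_subset[OF hC]) auto
    qed
    have sub: "cball 0 r \<subseteq> ball 0 R \<inter> - {z. C z v = 1}" using nz r by auto
    have "(deriv ^^ n) h 0 / fact n = (if n = 0 then 1 else p n v - 0 * p (n - 1) v)"
    proof (rule cofactor_coeffs[where r = r])
      show "h holomorphic_on ball 0 r" using holomorphic_on_subset[OF hol] sub ball_subset_cball by blast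
    qed (use r nv nz in \<open>auto simp: h_def\<close>)
    moreover have "p 0 v = 1" using c_0 by (simp add: p_def cn_def)
    ultimately have pn: "p n v = (deriv ^^ n) h 0 / fact n" by (cases n) auto
    have "norm ((deriv ^^ n) h 0) \<le> fact n * (1/m) / r ^ n"
    proof (rule Cauchy_inequality)
      show "h holomorphic_on ball 0 r" using holomorphic_on_subset[OF hol] sub ball_subset_cball by blast
      show "continuous_on (cball 0 r) h" using holomorphic_on_imp_continuous_on[OF hol] sub continuous_on_subset by blast
      fix z :: complex assume "norm (0 - z) = r"
      hence "m \<le> norm (1 - C z v)" using x(2)[of "(z, v)"] v r by (simp add: m_def)
      thus "norm (h z) \<le> 1/m" using m by (simp add: h_def norm_divide frac_le)
    qed (use r in auto)
    thus ?thesis unfolding pn using m r by (simp add: norm_divide divide_simps)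
  qed
  thus ?thesis using r by blast
qed

lemma p_unit_circle_bound:
  assumes "\<delta> > 0"
  shows "\<exists>M r. r > \<rho>0 \<and> (\<forall>v n. norm v = 1 \<longrightarrow> norm (v - 1) \<ge> \<delta> \<longrightarrow> norm (p n v) \<le> M / r ^ n)"
proof -
  define A where "A = sphere 0 1 - ball (1::complex) \<delta>"
  have "\<exists>M r. r > \<rho>0 \<and> (\<forall>v\<in>A. \<forall>n. norm (p n v) \<le> M / r ^ n)"
  proof (rule p_arc_bound)
    show "compact A" unfolding A_def by (intro compact_diff) auto
    show "A \<subseteq> cball 0 V" using V by (auto simp: A_def)
    fix v q :: complex assume "v \<in> A" "norm q \<le> \<rho>0"
    thus "C q v \<noteq> 1" using C_eq_1_imp[of q v] assms by (auto simp: A_def)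
  qed
  then obtain M r where Mr: "r > \<rho>0" "\<And>v n. v \<in> A \<Longrightarrow> norm (p n v) \<le> M / r ^ n" by blast
  have "v \<in> A" if "norm v = 1" "norm (v - 1) \<ge> \<delta>" for v
    using that by (simp add: A_def dist_norm norm_minus_commute)
  thus ?thesis using Mr by blast
qed

text \<open>Multiplying by \<open>1 - q / \<rho> v\<close> removes the only pole, so the coefficients of the product are summable with a geometric
rate that is uniform in \<open>v\<close>.\<close>
lemma uniform_pole:
  "\<exists>\<rho> f \<delta>. 0 < \<delta> \<and> 1 + \<delta> < V \<and> \<rho> holomorphic_on ball 1 \<delta> \<and> \<rho> 1 = of_real \<rho>0 \<and>
     (\<forall>v\<in>ball 1 \<delta>. norm (\<rho> v - of_real \<rho>0) < \<rho>0 \<and> norm (\<rho> v) < R \<and> C (\<rho> v) v = 1) \<and>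
     f holomorphic_on ball 1 \<delta> \<and> f 1 \<noteq> 0 \<and>
     uniform_limit (ball 1 \<delta>) (\<lambda>n v. p n v * \<rho> v ^ n) f sequentially"
proof -
  from branch obtain \<rho> \<epsilon> \<delta>1 where b0: "0 < \<epsilon>" "\<epsilon> < R - \<rho>0" "\<epsilon> < \<rho>0" "0 < \<delta>1" "1 + \<delta>1 < V" "\<rho> holomorphic_on ball 1 \<delta>1" "\<rho> 1 = of_real \<rho>0"
     "\<forall>v\<in>ball 1 \<delta>1. \<rho> v \<in> cball (of_real \<rho>0) \<epsilon> \<and> C (\<rho> v) v = 1 \<and> DC (\<rho> v) v \<noteq> 0 \<and>
        (\<forall>z\<in>cball (of_real \<rho>0) \<epsilon>. C z v = 1 \<longrightarrow> z = \<rho> v)" by blast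
  have b: "\<And>v. v\<in>ball 1 \<delta>1 \<Longrightarrow> \<rho> v \<in> cball (of_real \<rho>0) \<epsilon>" "\<And>v. v\<in>ball 1 \<delta>1 \<Longrightarrow> C (\<rho> v) v = 1" "\<And>v. v\<in>ball 1 \<delta>1 \<Longrightarrow> DC (\<rho> v) v \<noteq> 0"
     "\<And>v z. v\<in>ball 1 \<delta>1 \<Longrightarrow> z\<in>cball (of_real \<rho>0) \<epsilon> \<Longrightarrow> C z v = 1 \<Longrightarrow> z = \<rho> v"
    using b0(8) by blast+
  note b = b0(1-7) b
  have "\<exists>\<eta>>0. \<rho>0 + \<eta> < R \<and> (\<forall>v' v q. v' \<in> {1} \<longrightarrow> dist v' v \<le> \<eta> \<longrightarrow> norm v \<le> V \<longrightarrow> norm q \<le> \<rho>0 + \<eta> \<longrightarrow> q \<notin> ball (of_real \<rho>0) \<epsilon> \<longrightarrow> C q v \<noteq> 1)"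
  proof (rule zero_free_nbhd)
    fix v q :: complex assume "v \<in> {1}" "norm q \<le> \<rho>0" "q \<notin> ball (of_real \<rho>0) \<epsilon>"
    thus "C q v \<noteq> 1" using C_eq_1_imp[of q v] b(1) by auto
  qed (use V in auto)
  then obtain \<eta> where e: "\<eta> > 0" "\<rho>0 + \<eta> < R" 
    "\<And>v q :: complex. dist 1 v \<le> \<eta> \<Longrightarrow> norm v \<le> V \<Longrightarrow> norm q \<le> \<rho>0 + \<eta> \<Longrightarrow> q \<notin> ball (of_real \<rho>0) \<epsilon> \<Longrightarrow> C q v \<noteq> 1"
    by auto
  have "continuous_on (ball 1 \<delta>1) \<rho>" using b(6) by (rule holomorphic_on_imp_continuous_on)
  moreover have "1 \<in> ball (1::complex) \<delta>1" "0 < min (\<eta> / 2) (\<rho>0 / 2)" using b(4) e rho0 by auto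
  ultimately have "\<exists>d>0. \<forall>v\<in>ball 1 \<delta>1. dist v 1 < d \<longrightarrow> dist (\<rho> v) (\<rho> 1) < min (\<eta> / 2) (\<rho>0 / 2)"
    unfolding continuous_on_iff by blast
  then obtain d where d: "d > 0" "\<And>v. v \<in> ball 1 \<delta>1 \<Longrightarrow> dist v 1 < d \<Longrightarrow> dist (\<rho> v) (\<rho> 1) < min (\<eta> / 2) (\<rho>0 / 2)"
    by blast
  define \<delta> where "\<delta> = Min {d / 2, \<delta>1 / 2, \<eta> / 2}"
  have de: "\<delta> > 0" "\<delta> < d" "\<delta> < \<delta>1" "\<delta> < \<eta>" using d b e by (auto simp: \<delta>_def min_less_iff_disj)
  define r where "r = \<rho>0 + \<eta>"
  define r1 where "r1 = \<rho>0 + \<eta> / 2"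
  have r: "r < R" "r1 < r" "0 < r1" "0 < r" using e rho0 by (auto simp: r_def r1_def)
  have V1: "norm v \<le> V" if "dist 1 v \<le> \<delta>" for v :: complex
    using that norm_triangle_ineq2[of v 1] de b by (simp add: dist_norm norm_minus_commute)
  have B1: "v \<in> ball 1 \<delta>1" if "dist 1 v \<le> \<delta>" for v :: complex using that de by auto
  have near: "dist (\<rho> v) (of_real \<rho>0) < min (\<eta> / 2) (\<rho>0 / 2)" if "dist 1 v \<le> \<delta>" for v :: complex
    using d(2)[OF B1[OF that]] that de b(7) by (simp add: dist_commute)
  have rho_r1: "norm (\<rho> v) < r1" if "dist 1 v \<le> \<delta>" for v :: complex
    using near[OF that] norm_triangle_ineq2[of "\<rho> v" "of_real \<rho>0"] rho0 by (simp add: dist_norm r1_def)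
  have zeros: "z = \<rho> v" if "dist 1 v \<le> \<delta>" "norm z \<le> r" "C z v = 1" for v z
  proof (cases "z \<in> ball (of_real \<rho>0) \<epsilon>")
    case True
    thus ?thesis using b(11)[OF B1[OF that(1)]] that by (simp add: less_imp_le)
  next
    case False
    thus ?thesis using e(3)[of v z] that V1[OF that(1)] de by (simp add: r_def)
  qed
  let ?Y = "sphere 0 r \<times> cball 1 \<delta> :: (complex \<times> complex) set"
  have Y: "?Y \<subseteq> cball 0 R \<times> cball 0 V" using r V1 by auto
  have cts: "continuous_on ?Y (\<lambda>x. norm (1 - C (fst x) (snd x)))"
    by (intro continuous_intros continuous_on_subset[OF C_continuous Y])
  have cpt: "compact ?Y" by (intro compact_Times) auto
  have ne: "(of_real r, 1) \<in> ?Y" using r de by auto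
  obtain x where x: "x \<in> ?Y" "\<And>y. y \<in> ?Y \<Longrightarrow> norm (1 - C (fst x) (snd x)) \<le> norm (1 - C (fst y) (snd y))"
    using continuous_attains_inf[OF cpt _ cts] ne by blast
  define m where "m = norm (1 - C (fst x) (snd x))"
  have m: "m > 0"
    using x(1) zeros[of "snd x" "fst x"] rho_r1[of "snd x"] r by (force simp: m_def)
  define K where "K v z = 1 - C z v" for v z
  define G where "G v z = (if z = \<rho> v then deriv (K v) (\<rho> v) else (K v z - K v (\<rho> v)) / (z - \<rho> v))" for v z
  define h where "h v z = - 1 / (\<rho> v * G v z)" for v z
  have rho_nz: "\<rho> v \<noteq> 0" if "dist 1 v \<le> \<delta>" for v :: complex
    using near[OF that] rho0 by (auto simp: dist_norm)
  have Gnz: "G v z \<noteq> 0" if "dist 1 v \<le> \<delta>" "norm z \<le> r" for v z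
  proof (cases "z = \<rho> v")
    case True
    have "(K v has_field_derivative - DC (\<rho> v) v) (at (\<rho> v))"
      unfolding K_def using rho_r1[OF that(1)] r V1[OF that(1)]
      by (auto intro!: derivative_eq_intros C_deriv)
    hence "deriv (K v) (\<rho> v) = - DC (\<rho> v) v" by (rule DERIV_imp_deriv)
    thus ?thesis using b(10)[OF B1[OF that(1)]] True by (simp add: G_def)
  next
    case False
    hence "C z v \<noteq> 1" using zeros that by blast
    thus ?thesis using False b(9)[OF B1[OF that(1)]] by (simp add: G_def K_def)
  qed
  have hK: "h v z * K v z = 1 - (1 / \<rho> v) * z" if "dist 1 v \<le> \<delta>" "norm z \<le> r" for v z
  proof -
    have "K v z = (z - \<rho> v) * G v z" using b(9)[OF B1[OF that(1)]] by (simp add: G_def K_def)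
    thus ?thesis using Gnz[OF that] rho_nz[OF that(1)] by (simp add: h_def divide_simps)
  qed
  have hol_h: "h v holomorphic_on {z \<in> ball 0 R. G v z \<noteq> 0}" if "dist 1 v \<le> \<delta>" for v
  proof -
    have "K v holomorphic_on ball 0 R" unfolding K_def 
      by (intro holomorphic_intros C_holo) (use V1[OF that] in auto)
    hence "G v holomorphic_on ball 0 R" unfolding G_def by (rule pole_lemma_open) auto
    thus ?thesis unfolding h_def using rho_nz[OF that]
      by (intro holomorphic_intros) (auto elim: holomorphic_on_subset)
  qed
  have sub: "cball 0 r \<subseteq> {z \<in> ball 0 R. G v z \<noteq> 0}" if "dist 1 v \<le> \<delta>" for v
    using Gnz[OF that] r by auto
  have hol_r: "h v holomorphic_on ball 0 r" if "dist 1 v \<le> \<delta>" for v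
    using holomorphic_on_subset[OF hol_h[OF that]] sub[OF that] ball_subset_cball by blast
  define M where "M = (1 + 2 * r / \<rho>0) / m"
  have M: "M \<ge> 0" using m r rho0 by (simp add: M_def)
  define e where "e k v = (deriv ^^ k) (h v) 0 / fact k" for k v
  have e_bound: "norm (e k v) \<le> M / r ^ k" if "dist 1 v \<le> \<delta>" for k v
  proof -
    have "norm ((deriv ^^ k) (h v) 0) \<le> fact k * M / r ^ k"
    proof (rule Cauchy_inequality[OF hol_r[OF that]])
      show "continuous_on (cball 0 r) (h v)"
        using holomorphic_on_imp_continuous_on[OF hol_h[OF that]] sub[OF that] continuous_on_subset by blast
      fix z :: complex assume z: "norm (0 - z) = r"
      have K: "m \<le> norm (K v z)" using x(2)[of "(z, v)"] that z by (simp add: m_def K_def)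
      have "\<rho>0 / 2 \<le> norm (\<rho> v)"
        using near[OF that] norm_triangle_ineq2[of "of_real \<rho>0" "\<rho> v"] rho0 by (simp add: dist_norm norm_minus_commute)
      hence "norm (1 / \<rho> v * z) \<le> 2 * r / \<rho>0" using z rho0 r rho_nz[OF that]
        by (simp add: norm_mult norm_divide divide_simps mult_left_mono)
      hence "norm (1 - 1 / \<rho> v * z) \<le> 1 + 2 * r / \<rho>0"
        using norm_triangle_ineq4[of 1 "1 / \<rho> v * z"] by simp
      hence "norm (h v z) * norm (K v z) \<le> 1 + 2 * r / \<rho>0"
        using hK[OF that, of z] z by (simp flip: norm_mult)
      moreover have "norm (h v z) * m \<le> norm (h v z) * norm (K v z)" using K by (intro mult_left_mono) auto
      ultimately show "norm (h v z) \<le> M" using m by (simp add: M_def pos_le_divide_eq)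
    qed (use r in auto)
    thus ?thesis using r by (simp add: e_def norm_divide divide_simps mult.commute)
  qed
  have e_eq: "e k v = (if k = 0 then 1 else p k v - 1 / \<rho> v * p (k - 1) v)" if "dist 1 v \<le> \<delta>" for k v
    unfolding e_def by (rule cofactor_coeffs[where r = r]) (use hol_r hK V1 that r in \<open>auto simp: K_def\<close>)
  have term_eq: "e k v * \<rho> v ^ k = (if k = 0 then 1 else p k v * \<rho> v ^ k - p (k-1) v * \<rho> v ^ (k-1))" if "dist 1 v \<le> \<delta>" for k v
    using rho_nz[OF that] by (cases k) (auto simp: e_eq[OF that] algebra_simps)
  have partial: "(\<Sum>k<Suc n. e k v * \<rho> v ^ k) = p n v * \<rho> v ^ n" if "dist 1 v \<le> \<delta>" for n v
    by (induction n) (simp_all add: term_eq[OF that] e_eq[OF that, of 0] p_0)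
  have bound: "norm (e k v * \<rho> v ^ k) \<le> M * (r1 / r) ^ k" if "dist 1 v \<le> \<delta>" for k v
  proof -
    have "norm (e k v) * norm (\<rho> v) ^ k \<le> (M / r ^ k) * r1 ^ k"
      using e_bound[OF that] rho_r1[OF that] M r by (intro mult_mono power_mono) auto
    thus ?thesis by (simp add: norm_mult norm_power power_divide)
  qed
  have sm: "summable (\<lambda>k. M * (r1 / r) ^ k)" using r by (intro summable_mult summable_geometric) auto
  define f where "f v = (\<Sum>k. e k v * \<rho> v ^ k)" for v
  have "uniform_limit (ball 1 \<delta>) (\<lambda>n v. \<Sum>k<n. e k v * \<rho> v ^ k) f sequentially"
    unfolding f_def by (rule Weierstrass_m_test[OF _ sm]) (use bound in auto)
  hence "uniform_limit (ball 1 \<delta>) (\<lambda>n v. \<Sum>k<Suc n. e k v * \<rho> v ^ k) f sequentially"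
    by (rule filterlim_compose[OF _ filterlim_Suc])
  hence ul: "uniform_limit (ball 1 \<delta>) (\<lambda>n v. p n v * \<rho> v ^ n) f sequentially"
    by (rule uniform_limit_cong'[THEN iffD1, rotated -1]) (auto simp: partial simp del: sum.lessThan_Suc)
  have rho_hol: "\<rho> holomorphic_on ball 1 \<delta>" using b(6) by (rule holomorphic_on_subset) (use de in auto)
  have "f holomorphic_on ball 1 \<delta>" unfolding f_def
  proof (rule holomorphic_suminf(1)[OF _ _ sm])
    fix k
    have "(\<lambda>v. if k = 0 then 1 else p k v * \<rho> v ^ k - p (k-1) v * \<rho> v ^ (k-1)) holomorphic_on ball 1 \<delta>"
      by (cases "k = 0") (auto intro!: holomorphic_intros p_holo rho_hol)
    thus "(\<lambda>v. e k v * \<rho> v ^ k) holomorphic_on ball 1 \<delta>"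
      by (rule holomorphic_transform) (simp add: term_eq)
  qed (use bound in auto)
  moreover have "f 1 \<noteq> 0"
  proof -
    have "\<rho> 1 \<in> ball 0 r" using rho_r1[of 1] r de by auto
    hence "(\<lambda>k. e k 1 * (\<rho> 1 - 0) ^ k) sums h 1 (\<rho> 1)"
      unfolding e_def by (intro holomorphic_power_series[OF hol_r]) (use de in auto)
    hence "f 1 = h 1 (\<rho> 1)" by (simp add: f_def sums_iff)
    thus ?thesis using Gnz[of 1 "\<rho> 1"] rho_nz[of 1] rho_r1[of 1] r de by (simp add: h_def)
  qed
  moreover have "norm (\<rho> v - of_real \<rho>0) < \<rho>0 \<and> norm (\<rho> v) < R \<and> C (\<rho> v) v = 1" if "v \<in> ball 1 \<delta>" for v
    using near[of v] rho_r1[of v] b(9)[OF B1[of v]] that r rho0 by (auto simp: dist_norm)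
  ultimately show ?thesis using ul rho_hol b(5,7) de
    by (intro exI[of _ \<rho>] exI[of _ f] exI[of _ \<delta>]) auto
qed
end

context renewal begin

text \<open>Derivatives of \<open>C\<close> along a curve through \<open>(\<rho>0, 1)\<close>, computed termwise.\<close>
lemma path_derivs:
  fixes s :: "complex \<Rightarrow> complex" and b :: complex
  assumes e: "e > 0" and s: "s holomorphic_on ball 0 e" "exp (s 0) = of_real \<rho>0"
    and R: "\<And>z. z \<in> ball 0 e \<Longrightarrow> norm (exp (s z)) \<le> R"
    and V: "\<And>z. z \<in> ball 0 e \<Longrightarrow> norm (exp (b * z)) \<le> V"
  defines "\<Phi> \<equiv> (\<lambda>z. C (exp (s z)) (exp (b * z)))"
  shows "(\<lambda>n. \<Sum>j\<le>n. of_real (c n j * \<rho>0 ^ n) * (of_nat n * deriv s 0 + b * of_nat j)) sums deriv \<Phi> 0"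
    and "(\<lambda>n. \<Sum>j\<le>n. of_real (c n j * \<rho>0 ^ n) * ((of_nat n * deriv s 0 + b * of_nat j)\<^sup>2 + of_nat n * (deriv ^^ 2) s 0)) sums (deriv ^^ 2) \<Phi> 0"
    and "\<Phi> holomorphic_on ball 0 e"
proof -
  define f where "f n z = cn n (exp (b * z)) * exp (s z) ^ n" for n z
  have \<Phi>: "\<Phi> = (\<lambda>z. \<Sum>n. f n z)" by (simp add: \<Phi>_def C_def f_def)
  define E where "E n j z = exp (of_nat n * s z + b * of_nat j * z)" for n j z
  have f_eq: "f n = (\<lambda>z. \<Sum>j\<le>n. of_real (c n j) * E n j z)" for n
    by (rule ext) (simp add: f_def cn_def E_def sum_distrib_left exp_add exp_of_nat_mult[symmetric] mult_ac)
  have f_holo: "f n holomorphic_on ball 0 e" for n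
    unfolding f_eq E_def by (intro holomorphic_intros s)
  have f_le: "norm (f n z) \<le> a n" if "z \<in> ball 0 e" for n z
    unfolding f_def by (intro norm_term R V that)
  note M = holomorphic_suminf[OF open_ball f_holo summable_a f_le, folded \<Phi>]
  show "\<Phi> holomorphic_on ball 0 e" by (rule M(1))
  have s': "(s has_field_derivative deriv s z) (at z)" if "z \<in> ball 0 e" for z
    by (rule holomorphic_derivI[OF s(1) _ that]) auto
  have s'': "(deriv s has_field_derivative (deriv ^^ 2) s z) (at z)" if "z \<in> ball 0 e" for z
    using holomorphic_derivI[OF holomorphic_deriv[OF s(1)] _ that] by (simp add: numeral_2_eq_2)
  have E': "(E n j has_field_derivative (of_nat n * deriv s z + b * of_nat j) * E n j z) (at z)" if "z \<in> ball 0 e" for n j z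
    unfolding E_def by (auto intro!: derivative_eq_intros s'[OF that])
  have f': "(f n has_field_derivative (\<Sum>j\<le>n. of_real (c n j) * ((of_nat n * deriv s z + b * of_nat j) * E n j z))) (at z)" 
    if "z \<in> ball 0 e" for n z
    unfolding f_eq by (intro DERIV_sum DERIV_cmult E' that)
  have df: "deriv (f n) z = (\<Sum>j\<le>n. of_real (c n j) * ((of_nat n * deriv s z + b * of_nat j) * E n j z))" if "z \<in> ball 0 e" for n z
    using f'[OF that] by (rule DERIV_imp_deriv)
  have f'': "((\<lambda>z. \<Sum>j\<le>n. of_real (c n j) * ((of_nat n * deriv s z + b * of_nat j) * E n j z)) has_field_derivative
      (\<Sum>j\<le>n. of_real (c n j) * (((of_nat n * deriv s z + b * of_nat j)\<^sup>2 + of_nat n * (deriv ^^ 2) s z) * E n j z))) (at z)" 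
    if "z \<in> ball 0 e" for n z
  proof (intro DERIV_sum DERIV_cmult)
    fix j
    show "((\<lambda>z. (of_nat n * deriv s z + b * of_nat j) * E n j z) has_field_derivative
      ((of_nat n * deriv s z + b * of_nat j)\<^sup>2 + of_nat n * (deriv ^^ 2) s z) * E n j z) (at z)"
      by (rule derivative_eq_intros E'[OF that] s''[OF that] refl)+ (simp add: algebra_simps power2_eq_square)
  qed
  have ddf: "(deriv ^^ 2) (f n) 0 = (\<Sum>j\<le>n. of_real (c n j) * (((of_nat n * deriv s 0 + b * of_nat j)\<^sup>2 + of_nat n * (deriv ^^ 2) s 0) * E n j 0))" for n
  proof -
    have "eventually (\<lambda>z. z \<in> ball 0 e) (nhds (0::complex))" using e by (intro eventually_nhds_in_open) auto
    hence "eventually (\<lambda>z. deriv (f n) z = (\<Sum>j\<le>n. of_real (c n j) * ((of_nat n * deriv s z + b * of_nat j) * E n j z))) (nhds 0)"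
      by eventually_elim (rule df)
    hence "deriv (deriv (f n)) 0 = deriv (\<lambda>z. \<Sum>j\<le>n. of_real (c n j) * ((of_nat n * deriv s z + b * of_nat j) * E n j z)) 0"
      by (rule deriv_cong_ev) auto
    thus ?thesis using DERIV_imp_deriv[OF f''[of 0 n]] e by (simp add: numeral_2_eq_2)
  qed
  have E0: "E n j 0 = of_real \<rho>0 ^ n" for n j by (simp add: E_def s(2) exp_of_nat_mult)
  show "(\<lambda>n. \<Sum>j\<le>n. of_real (c n j * \<rho>0 ^ n) * (of_nat n * deriv s 0 + b * of_nat j)) sums deriv \<Phi> 0"
    using M(2)[of 0 1] e by (simp add: df E0 mult_ac)
  show "(\<lambda>n. \<Sum>j\<le>n. of_real (c n j * \<rho>0 ^ n) * ((of_nat n * deriv s 0 + b * of_nat j)\<^sup>2 + of_nat n * (deriv ^^ 2) s 0)) sums (deriv ^^ 2) \<Phi> 0"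
    using M(2)[of 0 2] e unfolding ddf E0 by (simp add: mult_ac)
qed

text \<open>Mean size and mean reward of a block, and the drift and the dispersion they determine.\<close>
definition EN :: real where "EN = (\<Sum>n. \<Sum>j\<le>n. c n j * \<rho>0 ^ n * real n)"
definition ER :: real where "ER = (\<Sum>n. \<Sum>j\<le>n. c n j * \<rho>0 ^ n * real j)"
definition mu :: real where "mu = ER / EN"
definition EV :: real where "EV = (\<Sum>n. \<Sum>j\<le>n. c n j * \<rho>0 ^ n * (real j - mu * real n)\<^sup>2)"
definition sigma2 :: real where "sigma2 = EV / EN"

lemma small_disc: 
  "\<exists>e>0. \<forall>z\<in>ball (0::complex) e. \<forall>m. \<bar>m\<bar> \<le> 1 \<longrightarrow> norm (of_real \<rho>0 * exp (of_real m * z)) \<le> R \<and> norm (exp (of_real m * z)) \<le> V"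
proof -
  define e where "e = min (ln (R / \<rho>0)) (ln V)"
  have e: "e > 0" using rho0 V by (simp add: e_def)
  have *: "norm (of_real \<rho>0 * exp (of_real m * z)) \<le> R \<and> norm (exp (of_real m * z)) \<le> V" if "z \<in> ball 0 e" "\<bar>m\<bar> \<le> 1" for z :: complex and m
  proof -
    have "Re (of_real m * z) \<le> norm (of_real m * z)" by (rule complex_Re_le_cmod)
    also have "\<dots> \<le> 1 * norm z" using that(2) unfolding norm_mult norm_of_real by (intro mult_right_mono) auto
    also have "\<dots> \<le> e" using that by simp
    finally have "m * Re z \<le> e" by simp
    hence "exp (m * Re z) \<le> exp e" by simp
    moreover have "exp e \<le> R / \<rho>0" "exp e \<le> V" using rho0 V by (auto simp: e_def simp flip: ln_ge_iff)
    ultimately have "exp (m * Re z) \<le> R / \<rho>0" "exp (m * Re z) \<le> V" by linarith+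
    thus ?thesis using rho0 by (simp add: norm_mult field_simps)
  qed
  show ?thesis by (rule exI[of _ e], rule conjI[OF e], intro ballI allI impI) (rule *)
qed

lemma linear_path_derivs:
  fixes m b :: real
  assumes "\<bar>m\<bar> \<le> 1" "\<bar>b\<bar> \<le> 1"
  defines "\<Phi> \<equiv> (\<lambda>z. C (of_real \<rho>0 * exp (of_real m * z)) (exp (of_real b * z)))"
  shows "(\<lambda>n. \<Sum>j\<le>n. c n j * \<rho>0 ^ n * (m * real n + b * real j)) sums Re (deriv \<Phi> 0)" "Im (deriv \<Phi> 0) = 0"
    and "(\<lambda>n. \<Sum>j\<le>n. c n j * \<rho>0 ^ n * (m * real n + b * real j)\<^sup>2) sums Re ((deriv ^^ 2) \<Phi> 0)" "Im ((deriv ^^ 2) \<Phi> 0) = 0"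
proof -
  obtain e where e: "e > 0" "\<And>(z::complex) m. z\<in>ball 0 e \<Longrightarrow> \<bar>m\<bar> \<le> 1 \<Longrightarrow> norm (of_real \<rho>0 * exp (of_real m * z)) \<le> R \<and> norm (exp (of_real m * z)) \<le> V"
    using small_disc by blast
  define s where "s z = of_real (ln \<rho>0) + of_real m * z" for z :: complex
  have es: "exp (s z) = of_real \<rho>0 * exp (of_real m * z)" for z
    unfolding s_def exp_add exp_of_real using rho0 by simp
  have s': "deriv s = (\<lambda>z. of_real m)"
    unfolding s_def by (rule ext, rule DERIV_imp_deriv) (auto intro!: derivative_eq_intros)
  have s'': "(deriv ^^ 2) s 0 = 0" by (simp add: numeral_2_eq_2 s')
  have P1: "s holomorphic_on ball 0 e" unfolding s_def by (intro holomorphic_intros)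
  have P2: "exp (s 0) = of_real \<rho>0" unfolding es by simp
  have P3: "norm (exp (s z)) \<le> R" if "z \<in> ball 0 e" for z unfolding es using e(2)[OF that assms(1)] by blast
  have P4: "norm (exp (of_real b * z)) \<le> V" if "z \<in> ball 0 e" for z :: complex using e(2)[OF that assms(2)] by blast
  note D = path_derivs[OF e(1) P1 P2 P3 P4, unfolded es, folded \<Phi>_def]
  have 1: "(\<lambda>n. complex_of_real (\<Sum>j\<le>n. c n j * \<rho>0 ^ n * (m * real n + b * real j))) sums deriv \<Phi> 0"
    using D(1) by (simp add: s' mult_ac)
  have 2: "(\<lambda>n. complex_of_real (\<Sum>j\<le>n. c n j * \<rho>0 ^ n * (m * real n + b * real j)\<^sup>2)) sums (deriv ^^ 2) \<Phi> 0"
    using D(2) unfolding s' s'' by (simp add: mult_ac)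
  show "(\<lambda>n. \<Sum>j\<le>n. c n j * \<rho>0 ^ n * (m * real n + b * real j)) sums Re (deriv \<Phi> 0)" using sums_Re[OF 1] by (simp only: Re_complex_of_real)
  show "(\<lambda>n. \<Sum>j\<le>n. c n j * \<rho>0 ^ n * (m * real n + b * real j)\<^sup>2) sums Re ((deriv ^^ 2) \<Phi> 0)" using sums_Re[OF 2] by (simp only: Re_complex_of_real)
  show "Im (deriv \<Phi> 0) = 0" using sums_Im[OF 1] by (simp only: Im_complex_of_real) (simp add: sums_iff)
  show "Im ((deriv ^^ 2) \<Phi> 0) = 0" using sums_Im[OF 2] by (simp only: Im_complex_of_real) (simp add: sums_iff)
qed

lemma EN_sums: "(\<lambda>n. \<Sum>j\<le>n. c n j * \<rho>0 ^ n * real n) sums EN"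
  using linear_path_derivs(1)[of 1 0] by (simp add: EN_def sums_iff)

lemma ER_sums: "(\<lambda>n. \<Sum>j\<le>n. c n j * \<rho>0 ^ n * real j) sums ER"
  using linear_path_derivs(1)[of 0 1] by (simp add: ER_def sums_iff)

lemma size_deriv: "deriv (\<lambda>z. C (of_real \<rho>0 * exp z) 1) 0 = of_real EN"
proof -
  have "Re (deriv (\<lambda>z. C (of_real \<rho>0 * exp z) 1) 0) = EN"
    using linear_path_derivs(1)[of 1 0] EN_sums sums_unique2 by fastforce
  thus ?thesis using linear_path_derivs(2)[of 1 0] by (simp add: complex_eq_iff)
qed

lemma some_block: "\<exists>n j. j \<le> n \<and> n > 0 \<and> c n j > 0"
proof (rule ccontr)
  assume *: "\<not> ?thesis"
  have "c n j = 0" if "j \<le> n" for n j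
  proof (cases "n = 0")
    case False
    hence "\<not> c n j > 0" using * that by blast
    thus ?thesis using c_nonneg[of n j] by linarith
  qed (use that c_0 in simp)
  hence "(\<Sum>j\<le>n. c n j) = 0" for n by simp
  thus False using total_mass by simp
qed

lemma EN_pos: "EN > 0"
proof -
  obtain n j where nj: "j \<le> n" "n > 0" "c n j > 0" using some_block by blast
  have nn: "0 \<le> (\<Sum>j\<le>n. c n j * \<rho>0 ^ n * real n)" for n using c_nonneg rho0 by (intro sum_nonneg) auto
  have "0 < c n j * \<rho>0 ^ n * real n" using nj rho0 by simp
  also have "\<dots> \<le> (\<Sum>j\<le>n. c n j * \<rho>0 ^ n * real n)"
    using nj c_nonneg rho0 by (intro member_le_sum) auto
  finally show ?thesis unfolding EN_def using EN_sums nn by (subst suminf_pos_iff) (auto simp: sums_iff)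
qed

lemma mu_bounds: "0 \<le> mu" "mu \<le> 1"
proof -
  have "0 \<le> ER" unfolding ER_def using c_nonneg rho0 ER_sums by (intro suminf_nonneg sum_nonneg) (auto simp: sums_iff)
  thus "0 \<le> mu" using EN_pos by (simp add: mu_def)
  have "ER \<le> EN" unfolding ER_def EN_def using c_nonneg rho0 ER_sums EN_sums
    by (intro suminf_le sum_mono mult_left_mono) (auto simp: sums_iff)
  thus "mu \<le> 1" using EN_pos by (simp add: mu_def)
qed

lemma centred_derivs:
  defines "\<Phi> \<equiv> (\<lambda>z. C (of_real \<rho>0 * exp (- of_real mu * z)) (exp z))"
  shows "deriv \<Phi> 0 = 0" "(deriv ^^ 2) \<Phi> 0 = of_real (sigma2 * EN)"
    "(\<lambda>n. \<Sum>j\<le>n. c n j * \<rho>0 ^ n * (real j - mu * real n)\<^sup>2) sums (sigma2 * EN)"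
proof -
  have "\<bar>- mu\<bar> \<le> 1" "\<bar>1::real\<bar> \<le> 1" using mu_bounds by auto
  note D = linear_path_derivs[OF this]
  have \<Phi>: "(\<lambda>z. C (of_real \<rho>0 * exp (of_real (- mu) * z)) (exp (of_real 1 * z))) = \<Phi>" by (simp add: \<Phi>_def)
  note D = D[unfolded \<Phi>]
  have "(\<lambda>n. (\<Sum>j\<le>n. c n j * \<rho>0 ^ n * real j) - mu * (\<Sum>j\<le>n. c n j * \<rho>0 ^ n * real n)) sums (ER - mu * EN)"
    by (intro sums_diff ER_sums sums_mult EN_sums)
  moreover have "(\<Sum>j\<le>n. c n j * \<rho>0 ^ n * real j) - mu * (\<Sum>j\<le>n. c n j * \<rho>0 ^ n * real n)
     = (\<Sum>j\<le>n. c n j * \<rho>0 ^ n * (- mu * real n + 1 * real j))" for n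
    by (simp add: sum_distrib_left sum_subtractf[symmetric] algebra_simps)
  ultimately have "Re (deriv \<Phi> 0) = ER - mu * EN" using D(1) sums_unique2 by force
  thus "deriv \<Phi> 0 = 0" using D(2) EN_pos by (simp add: complex_eq_iff mu_def)
  have *: "(- mu * real n + 1 * real j)\<^sup>2 = (real j - mu * real n)\<^sup>2" for n j by (simp add: algebra_simps)
  have S: "(\<lambda>n. \<Sum>j\<le>n. c n j * \<rho>0 ^ n * (real j - mu * real n)\<^sup>2) sums Re ((deriv ^^ 2) \<Phi> 0)"
    using D(3) unfolding * .
  hence EV: "EV = Re ((deriv ^^ 2) \<Phi> 0)" unfolding EV_def by (simp add: sums_iff)
  moreover have "sigma2 * EN = EV" using EN_pos by (simp add: sigma2_def)
  ultimately show "(\<lambda>n. \<Sum>j\<le>n. c n j * \<rho>0 ^ n * (real j - mu * real n)\<^sup>2) sums (sigma2 * EN)" 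
    "(deriv ^^ 2) \<Phi> 0 = of_real (sigma2 * EN)" 
    using S D(4) by (auto simp: complex_eq_iff)
qed

text \<open>If all blocks had the same reward rate, a common rotation would violate aperiodicity.\<close>
lemma sigma2_pos: "sigma2 > 0"
proof -
  let ?g = "\<lambda>n. \<Sum>j\<le>n. c n j * \<rho>0 ^ n * (real j - mu * real n)\<^sup>2"
  have nn: "?g n \<ge> 0" for n using c_nonneg rho0 by (intro sum_nonneg) auto
  have "sigma2 * EN \<noteq> 0"
  proof
    assume "sigma2 * EN = 0"
    hence "?g n = 0" for n using centred_derivs(3) suminf_eq_zero_iff[of ?g] nn by (auto simp: sums_iff)
    hence z: "real j = mu * real n" if "j \<le> n" "c n j > 0" for n j
      using that c_nonneg rho0 by (subst (asm) sum_nonneg_eq_0_iff) force+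
    have "of_real \<rho>0 * exp (- \<i> * of_real mu) = complex_of_real \<rho>0 \<and> exp \<i> = 1"
    proof (rule aperiodic)
      fix n j assume nj: "j \<le> n" "c n j > 0"
      have "exp (- \<i> * of_real mu) ^ n * exp \<i> ^ j = exp (\<i> * of_real (real j - mu * real n))"
        by (simp add: exp_of_nat_mult[symmetric] exp_add[symmetric] algebra_simps)
      thus "(of_real \<rho>0 * exp (- \<i> * of_real mu)) ^ n * exp \<i> ^ j = of_real \<rho>0 ^ n"
        using z[OF nj] by (simp add: power_mult_distrib mult.assoc)
    qed simp
    hence "Re (exp \<i>) = 1" by simp
    hence "cos (1::real) = 1" by (simp only: Re_exp) simp
    moreover have "cos (1::real) < cos 0" by (rule cos_monotone_0_pi) (use pi_gt3 in auto)
    ultimately show False by (simp only: cos_zero)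
  qed
  moreover have "sigma2 * EN \<ge> 0" using sums_le[OF nn sums_zero centred_derivs(3)] by simp
  ultimately have "sigma2 * EN > 0" by linarith
  thus ?thesis using EN_pos by (simp add: zero_less_mult_iff)
qed

text \<open>The implicit equation \<open>C (exp (s z)) (exp z) = 1\<close> is differentiated twice at 0 to obtain the drift and the dispersion.\<close>
theorem quasi_power:
  "\<exists>e s F. e > 0 \<and> s holomorphic_on ball 0 e \<and> s 0 = of_real (ln \<rho>0) \<and> deriv s 0 = - of_real mu \<and>
      (deriv ^^ 2) s 0 = - of_real sigma2 \<and> F holomorphic_on ball 0 e \<and> F 0 \<noteq> 0 \<and>
      uniform_limit (ball 0 e) (\<lambda>n z. p n (exp z) * exp (of_nat n * s z)) F sequentially"
proof -
  from uniform_pole obtain \<rho> f \<delta> where b: "0 < \<delta>" "1 + \<delta> < V" "\<rho> holomorphic_on ball 1 \<delta>" "\<rho> 1 = of_real \<rho>0"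
     "\<forall>v\<in>ball 1 \<delta>. norm (\<rho> v - of_real \<rho>0) < \<rho>0 \<and> norm (\<rho> v) < R \<and> C (\<rho> v) v = 1"
     "f holomorphic_on ball 1 \<delta>" "f 1 \<noteq> 0"
     and ul: "uniform_limit (ball 1 \<delta>) (\<lambda>n v. p n v * \<rho> v ^ n) f sequentially" by blast
  have "open (exp -` ball 1 \<delta> :: complex set)" by (intro open_vimage continuous_intros) auto
  moreover have "(0::complex) \<in> exp -` ball 1 \<delta>" using b by auto
  ultimately obtain e where e: "e > 0" "ball 0 e \<subseteq> (exp -` ball 1 \<delta> :: complex set)"
    using open_contains_ball by blast
  define s where "s z = Ln (\<rho> (exp z))" for z
  have re: "Re (\<rho> v) > 0" if "v \<in> ball 1 \<delta>" for v
  proof -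
    have "\<bar>Re (\<rho> v - of_real \<rho>0)\<bar> < \<rho>0" using b(5) that abs_Re_le_cmod[of "\<rho> v - of_real \<rho>0"] by fastforce
    thus ?thesis by simp
  qed
  have rexp: "(\<lambda>z. \<rho> (exp z)) holomorphic_on ball 0 e"
    using holomorphic_on_compose_gen[OF holomorphic_on_exp b(3), of "ball 0 e"] e(2) by (auto simp: o_def)
  have fexp: "(\<lambda>z. f (exp z)) holomorphic_on ball 0 e"
    using holomorphic_on_compose_gen[OF holomorphic_on_exp b(6), of "ball 0 e"] e(2) by (auto simp: o_def)
  have shol: "s holomorphic_on ball 0 e"
    unfolding s_def using re e(2) by (intro holomorphic_intros rexp) (force simp: complex_nonpos_Reals_iff)
  have es: "exp (s z) = \<rho> (exp z)" if "z \<in> ball 0 e" for z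
    using re[of "exp z"] e(2) that unfolding s_def by (intro exp_Ln) auto
  have s0: "s 0 = of_real (ln \<rho>0)" using rho0 by (simp add: s_def b Ln_of_real)
  have nv: "norm (exp (1 * z)) \<le> V" if "z \<in> ball 0 e" for z :: complex
  proof -
    have "exp z \<in> ball 1 \<delta>" using e(2) that by auto
    hence "norm (exp z) \<le> 1 + \<delta>" using norm_triangle_ineq2[of "exp z" 1] by (simp add: dist_norm norm_minus_commute)
    thus ?thesis using b(2) by simp
  qed
  have inb: "exp z \<in> ball 1 \<delta>" if "z \<in> ball 0 e" for z :: complex using e(2) that by auto
  have nR: "norm (exp (s z)) \<le> R" if "z \<in> ball 0 e" for z
    using es[OF that] bspec[OF b(5) inb[OF that]] by simp
  have e0: "exp (s 0) = of_real \<rho>0" using es[of 0] e b by simp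
  define \<Phi> where "\<Phi> = (\<lambda>z. C (exp (s z)) (exp (1 * z)))"
  have \<Phi>1: "\<Phi> z = 1" if "z \<in> ball 0 e" for z
    using es[OF that] bspec[OF b(5) inb[OF that]] by (simp add: \<Phi>_def)
  have ev: "eventually (\<lambda>z. \<Phi> z = 1) (nhds 0)"
    using eventually_nhds_in_open[of "ball 0 e" 0] e \<Phi>1 by (auto elim: eventually_mono)
  have d0: "(deriv ^^ k) \<Phi> 0 = (deriv ^^ k) (\<lambda>z. 1) 0" for k
    by (rule higher_deriv_cong_ev[OF ev refl])
  note D = path_derivs[OF e(1) shol e0 nR nv, folded \<Phi>_def]
  have 1: "(\<lambda>n. \<Sum>j\<le>n. of_real (c n j * \<rho>0 ^ n) * (of_nat n * deriv s 0 + 1 * of_nat j)) sums 0"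
    using D(1) d0[of 1] by simp
  have "(\<lambda>n. deriv s 0 * of_real (\<Sum>j\<le>n. c n j * \<rho>0 ^ n * real n) + of_real (\<Sum>j\<le>n. c n j * \<rho>0 ^ n * real j)) 
      sums (deriv s 0 * of_real EN + of_real ER)"
    by (intro sums_add sums_mult sums_of_real EN_sums ER_sums)
  moreover have "deriv s 0 * of_real (\<Sum>j\<le>n. c n j * \<rho>0 ^ n * real n) + of_real (\<Sum>j\<le>n. c n j * \<rho>0 ^ n * real j)
     = (\<Sum>j\<le>n. of_real (c n j * \<rho>0 ^ n) * (of_nat n * deriv s 0 + 1 * of_nat j))" for n
    by (simp add: sum_distrib_left sum.distrib[symmetric] algebra_simps)
  ultimately have "deriv s 0 * of_real EN + of_real ER = 0" using 1 sums_unique2 by force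
  hence s1: "deriv s 0 = - of_real mu" using EN_pos by (simp add: mu_def field_simps eq_neg_iff_add_eq_0)
  have 2: "(\<lambda>n. \<Sum>j\<le>n. of_real (c n j * \<rho>0 ^ n) * ((of_nat n * deriv s 0 + 1 * of_nat j)\<^sup>2 + of_nat n * (deriv ^^ 2) s 0)) sums 0"
    using D(2) d0[of 2] by (simp add: numeral_2_eq_2)
  have "(\<lambda>n. of_real (\<Sum>j\<le>n. c n j * \<rho>0 ^ n * (real j - mu * real n)\<^sup>2) + (deriv ^^ 2) s 0 * of_real (\<Sum>j\<le>n. c n j * \<rho>0 ^ n * real n)) 
      sums (of_real (sigma2 * EN) + (deriv ^^ 2) s 0 * of_real EN)"
    by (intro sums_add sums_mult sums_of_real EN_sums centred_derivs)
  moreover have "of_real (\<Sum>j\<le>n. c n j * \<rho>0 ^ n * (real j - mu * real n)\<^sup>2) + (deriv ^^ 2) s 0 * of_real (\<Sum>j\<le>n. c n j * \<rho>0 ^ n * real n)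
     = (\<Sum>j\<le>n. of_real (c n j * \<rho>0 ^ n) * ((of_nat n * deriv s 0 + 1 * of_nat j)\<^sup>2 + of_nat n * (deriv ^^ 2) s 0))" for n
    by (simp add: sum_distrib_left sum.distrib[symmetric] algebra_simps s1)
  ultimately have "of_real (sigma2 * EN) + (deriv ^^ 2) s 0 * of_real EN = 0" using 2 sums_unique2 by force
  hence "(of_real sigma2 + (deriv ^^ 2) s 0) * of_real EN = 0" by (simp add: algebra_simps)
  hence s2: "(deriv ^^ 2) s 0 = - of_real sigma2" using EN_pos by (simp add: eq_neg_iff_add_eq_0 add.commute)
  have "uniform_limit (ball 0 e) (\<lambda>n z. p n (exp z) * \<rho> (exp z) ^ n) (\<lambda>z. f (exp z)) sequentially"
    by (rule uniform_limit_compose'[OF ul]) (use e(2) in auto)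
  hence "uniform_limit (ball 0 e) (\<lambda>n z. p n (exp z) * exp (of_nat n * s z)) (\<lambda>z. f (exp z)) sequentially"
    by (rule uniform_limit_cong'[THEN iffD1, rotated -1]) (auto simp: exp_of_nat_mult es)
  thus ?thesis using e(1) shol s0 s1 s2 fexp b(7)
    by (intro exI[of _ e] exI[of _ s] exI[of _ "\<lambda>z. f (exp z)"]) auto
qed

end

section \<open>From quasi-powers to limit laws\<close>

text \<open>The moment generating functions \<open>Mg\<close>, scaled by \<open>N n\<close>, behave like \<open>exp (- n * s z) * F z\<close> near 0 and are exponentially
smaller on the rest of the imaginary period.\<close>
locale quasi_powers =
  fixes D :: "nat \<Rightarrow> 'a pmf" and X :: "'a \<Rightarrow> nat" and N :: "nat \<Rightarrow> real" and s F :: "complex \<Rightarrow> complex"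
    and e \<rho>0 \<mu> \<sigma>2 :: real and Mg :: "nat \<Rightarrow> complex \<Rightarrow> complex"
  defines "Mg \<equiv> (\<lambda>n z. \<Sum>T\<in>set_pmf (D n). of_real (pmf (D n) T) * exp (z * of_nat (X T)))"
  assumes fin: "finite (set_pmf (D n))" and N_pos: "N n > 0"
    and e: "e > 0" and rho0: "\<rho>0 > 0" and sigma2: "\<sigma>2 > 0"
    and s_holo: "s holomorphic_on ball 0 e" and s0: "s 0 = of_real (ln \<rho>0)"
    and s1: "deriv s 0 = - of_real \<mu>" and s2: "(deriv ^^ 2) s 0 = - of_real \<sigma>2"
    and F_holo: "F holomorphic_on ball 0 e" and F0: "F 0 \<noteq> 0"
    and ul: "uniform_limit (ball 0 e) (\<lambda>n z. of_real (N n) * Mg n z * exp (of_nat n * s z)) F sequentially"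
    and arcs: "\<And>\<delta>. \<delta> > 0 \<Longrightarrow> \<exists>M r. r > \<rho>0 \<and> (\<forall>\<theta>. \<forall>n\<ge>1. norm (exp (\<i> * of_real \<theta>) - 1) \<ge> \<delta> \<longrightarrow>
         norm (of_real (N n) * Mg n (\<i> * of_real \<theta>)) \<le> M / r ^ n)"
begin

definition Fn :: "nat \<Rightarrow> complex \<Rightarrow> complex" where "Fn n z = of_real (N n) * Mg n z * exp (of_nat n * s z)"

definition mean :: "nat \<Rightarrow> real" where "mean n = measure_pmf.expectation (D n) (\<lambda>T. real (X T))"
definition var :: "nat \<Rightarrow> real" where "var n = measure_pmf.variance (D n) (\<lambda>T. real (X T))"

lemma ul': "uniform_limit (ball 0 e) Fn F sequentially" using ul by (simp add: Fn_def[abs_def])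

lemma Mg_holo: "Mg n holomorphic_on S" unfolding Mg_def by (intro holomorphic_intros)

lemma Fn_holo: "Fn n holomorphic_on ball 0 e"
  unfolding Fn_def by (intro holomorphic_intros Mg_holo s_holo)

lemma expect: "measure_pmf.expectation (D n) f = (\<Sum>T\<in>set_pmf (D n). pmf (D n) T *\<^sub>R f T)"
  for f :: "'a \<Rightarrow> 'b::{banach, second_countable_topology}"
  using fin by (intro integral_measure_pmf) auto

lemma Mg_0: "Mg n 0 = 1"
  unfolding Mg_def using sum_pmf_eq_1[OF fin subset_refl, of n] by (simp flip: of_real_sum)

lemma Fn_0: "Fn n 0 = of_real (N n * \<rho>0 ^ n)"
  using rho0 by (simp add: Fn_def Mg_0 s0 exp_of_nat_mult exp_of_real)

lemma Fn_0_pos: "N n * \<rho>0 ^ n > 0" using N_pos rho0 by simp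

lemma Fn_0_nz: "Fn n 0 \<noteq> 0"
  unfolding Fn_0 of_real_eq_0_iff using Fn_0_pos[of n] by linarith

lemma moments:
  "deriv (Fn n) 0 = Fn n 0 * of_real (mean n - real n * \<mu>)"
  "(deriv ^^ 2) (Fn n) 0 = Fn n 0 * of_real (var n - real n * \<sigma>2 + (mean n - real n * \<mu>)\<^sup>2)"
proof -
  define E where "E = (\<lambda>T z. exp (z * of_nat (X T) + of_nat n * s z))"
  define w where "w = (\<lambda>T. complex_of_real (N n * pmf (D n) T))"
  have Fn_eq: "Fn n = (\<lambda>z. \<Sum>T\<in>set_pmf (D n). w T * E T z)"
    by (rule ext) (simp add: Fn_def Mg_def E_def w_def sum_distrib_left sum_distrib_right exp_add mult_ac)
  have s': "(s has_field_derivative deriv s z) (at z)" if "z \<in> ball 0 e" for z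
    by (rule holomorphic_derivI[OF s_holo _ that]) auto
  have s'': "(deriv s has_field_derivative (deriv ^^ 2) s z) (at z)" if "z \<in> ball 0 e" for z
    using holomorphic_derivI[OF holomorphic_deriv[OF s_holo] _ that] by (simp add: numeral_2_eq_2)
  have E': "(E T has_field_derivative (of_nat (X T) + of_nat n * deriv s z) * E T z) (at z)" if "z \<in> ball 0 e" for T z
    unfolding E_def by (auto intro!: derivative_eq_intros s'[OF that])
  have d1: "deriv (Fn n) z = (\<Sum>T\<in>set_pmf (D n). w T * ((of_nat (X T) + of_nat n * deriv s z) * E T z))" if "z \<in> ball 0 e" for z
    unfolding Fn_eq by (intro DERIV_imp_deriv DERIV_sum DERIV_cmult E' that)
  have f'': "((\<lambda>z. \<Sum>T\<in>set_pmf (D n). w T * ((of_nat (X T) + of_nat n * deriv s z) * E T z)) has_field_derivative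
     (\<Sum>T\<in>set_pmf (D n). w T * (((of_nat (X T) + of_nat n * deriv s z)\<^sup>2 + of_nat n * (deriv ^^ 2) s z) * E T z))) (at z)" if "z \<in> ball 0 e" for z
  proof (intro DERIV_sum DERIV_cmult)
    fix T
    show "((\<lambda>z. (of_nat (X T) + of_nat n * deriv s z) * E T z) has_field_derivative
      ((of_nat (X T) + of_nat n * deriv s z)\<^sup>2 + of_nat n * (deriv ^^ 2) s z) * E T z) (at z)"
      by (rule derivative_eq_intros E'[OF that] s''[OF that] refl)+ (simp add: algebra_simps power2_eq_square)
  qed
  have ev: "eventually (\<lambda>z. z \<in> ball 0 e) (nhds (0::complex))" using e by (intro eventually_nhds_in_open) auto
  have "deriv (deriv (Fn n)) 0 = deriv (\<lambda>z. \<Sum>T\<in>set_pmf (D n). w T * ((of_nat (X T) + of_nat n * deriv s z) * E T z)) 0"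
    by (rule deriv_cong_ev) (use ev in \<open>auto elim!: eventually_mono intro!: d1\<close>)
  hence d2: "(deriv ^^ 2) (Fn n) 0 = (\<Sum>T\<in>set_pmf (D n). w T * (((of_nat (X T) + of_nat n * deriv s 0)\<^sup>2 + of_nat n * (deriv ^^ 2) s 0) * E T 0))"
    using DERIV_imp_deriv[OF f''[of 0]] e by (simp add: numeral_2_eq_2)
  have E0: "E T 0 = of_real (\<rho>0 ^ n)" for T using rho0 by (simp add: E_def s0 exp_of_nat_mult exp_of_real)
  have one: "(\<Sum>T\<in>set_pmf (D n). pmf (D n) T) = 1" using sum_pmf_eq_1[OF fin subset_refl] .
  have m: "mean n = (\<Sum>T\<in>set_pmf (D n). pmf (D n) T * real (X T))" by (simp add: mean_def expect)
  have v: "var n = (\<Sum>T\<in>set_pmf (D n). pmf (D n) T * (real (X T) - mean n)\<^sup>2)" unfolding var_def mean_def[symmetric] expect by simp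
  have "deriv (Fn n) 0 = of_real (N n * \<rho>0 ^ n * (\<Sum>T\<in>set_pmf (D n). pmf (D n) T * (real (X T) - real n * \<mu>)))"
    using d1[of 0] e by (simp add: E0 w_def s1 sum_distrib_left mult_ac)
  also have "(\<Sum>T\<in>set_pmf (D n). pmf (D n) T * (real (X T) - real n * \<mu>)) = mean n - real n * \<mu>"
    using one by (simp add: m right_diff_distrib sum_subtractf flip: sum_distrib_right)
  finally show "deriv (Fn n) 0 = Fn n 0 * of_real (mean n - real n * \<mu>)" by (simp add: Fn_0)
  have "(deriv ^^ 2) (Fn n) 0 = of_real (N n * \<rho>0 ^ n * (\<Sum>T\<in>set_pmf (D n). pmf (D n) T * ((real (X T) - real n * \<mu>)\<^sup>2 - real n * \<sigma>2)))"
    using d2 by (simp add: E0 w_def s1 s2 sum_distrib_left mult_ac)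
  also have "(\<Sum>T\<in>set_pmf (D n). pmf (D n) T * ((real (X T) - real n * \<mu>)\<^sup>2 - real n * \<sigma>2))
     = (\<Sum>T\<in>set_pmf (D n). pmf (D n) T * (real (X T) - mean n)\<^sup>2 + 2 * (mean n - real n * \<mu>) * (pmf (D n) T * real (X T)) 
         - 2 * (mean n - real n * \<mu>) * mean n * pmf (D n) T + ((mean n - real n * \<mu>)\<^sup>2 - real n * \<sigma>2) * pmf (D n) T)"
    by (intro sum.cong refl) (simp add: algebra_simps power2_eq_square)
  also have "\<dots> = var n + 2 * (mean n - real n * \<mu>) * mean n - 2 * (mean n - real n * \<mu>) * mean n + ((mean n - real n * \<mu>)\<^sup>2 - real n * \<sigma>2)"
    unfolding sum.distrib sum_subtractf sum_distrib_left[symmetric] one v[symmetric] m[symmetric] by simp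
  finally show "(deriv ^^ 2) (Fn n) 0 = Fn n 0 * of_real (var n - real n * \<sigma>2 + (mean n - real n * \<mu>)\<^sup>2)"
    by (simp add: Fn_0 algebra_simps)
qed

lemma Fn_deriv_lim: "(\<lambda>n. (deriv ^^ k) (Fn n) 0) \<longlonglongrightarrow> (deriv ^^ k) F 0"
  by (rule higher_deriv_complex_uniform_limit[OF ul']) (use e Fn_holo in auto)

lemma mean_lim: "\<exists>a. (\<lambda>n. mean n - real n * \<mu>) \<longlonglongrightarrow> a"
proof -
  have "(\<lambda>n. deriv (Fn n) 0 / Fn n 0) \<longlonglongrightarrow> deriv F 0 / F 0"
    using Fn_deriv_lim[of 1] Fn_deriv_lim[of 0] F0 by (intro tendsto_divide) auto
  moreover have "deriv (Fn n) 0 / Fn n 0 = of_real (mean n - real n * \<mu>)" for n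
    by (simp add: moments Fn_0_nz)
  ultimately have "(\<lambda>n. Re (of_real (mean n - real n * \<mu>))) \<longlonglongrightarrow> Re (deriv F 0 / F 0)" by (intro tendsto_Re) simp
  thus ?thesis by auto
qed

lemma var_lim: "\<exists>a. (\<lambda>n. var n - real n * \<sigma>2) \<longlonglongrightarrow> a"
proof -
  obtain a where a: "(\<lambda>n. mean n - real n * \<mu>) \<longlonglongrightarrow> a" using mean_lim by blast
  have "(\<lambda>n. (deriv ^^ 2) (Fn n) 0 / Fn n 0) \<longlonglongrightarrow> (deriv ^^ 2) F 0 / F 0"
    using Fn_deriv_lim[of 2] Fn_deriv_lim[of 0] F0 by (intro tendsto_divide) auto
  moreover have "(deriv ^^ 2) (Fn n) 0 / Fn n 0 = of_real (var n - real n * \<sigma>2 + (mean n - real n * \<mu>)\<^sup>2)" for n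
    by (simp add: moments Fn_0_nz)
  ultimately have "(\<lambda>n. Re (of_real (var n - real n * \<sigma>2 + (mean n - real n * \<mu>)\<^sup>2))) \<longlonglongrightarrow> Re ((deriv ^^ 2) F 0 / F 0)" by (intro tendsto_Re) simp
  hence "(\<lambda>n. (var n - real n * \<sigma>2 + (mean n - real n * \<mu>)\<^sup>2) - (mean n - real n * \<mu>)\<^sup>2) \<longlonglongrightarrow> Re ((deriv ^^ 2) F 0 / F 0) - a\<^sup>2"
    by (intro tendsto_diff tendsto_power a) simp
  thus ?thesis by auto
qed

lemma mean_bigo: "(\<lambda>n. mean n - \<mu> * real n) \<in> O(\<lambda>n. 1)"
  using mean_lim by (auto intro: bigoI_tendsto simp: mult.commute)

lemma var_bigo: "(\<lambda>n. var n - \<sigma>2 * real n) \<in> O(\<lambda>n. 1)"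
  using var_lim by (auto intro: bigoI_tendsto simp: mult.commute)

lemma var_ratio: "(\<lambda>n. var n / real n) \<longlonglongrightarrow> \<sigma>2"
proof -
  obtain a where a: "(\<lambda>n. var n - real n * \<sigma>2) \<longlonglongrightarrow> a" using var_lim by blast
  have "(\<lambda>n. (var n - real n * \<sigma>2) * (1 / real n) + \<sigma>2) \<longlonglongrightarrow> a * 0 + \<sigma>2"
    by (intro tendsto_intros a lim_1_over_n)
  moreover have "eventually (\<lambda>n. (var n - real n * \<sigma>2) * (1 / real n) + \<sigma>2 = var n / real n) sequentially"
    using eventually_gt_at_top[of 0] by eventually_elim (simp add: field_simps)
  ultimately show ?thesis by (simp add: tendsto_cong)
qed

lemma var_at_top: "filterlim var at_top sequentially"
proof -
  have "filterlim (\<lambda>n. (var n / real n) * real n) at_top sequentially"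
    by (rule filterlim_tendsto_pos_mult_at_top[OF var_ratio sigma2 filterlim_real_sequentially])
  moreover have "eventually (\<lambda>n. (var n / real n) * real n = var n) sequentially"
    using eventually_gt_at_top[of 0] by eventually_elim simp
  ultimately show ?thesis using filterlim_cong[OF refl refl] by fast
qed

definition rem :: "complex \<Rightarrow> complex" where
  "rem z = s z - (of_real (ln \<rho>0) - of_real \<mu> * z - of_real \<sigma>2 / 2 * z\<^sup>2)"

lemma rem_bound: "\<exists>K>0. \<forall>z. norm z \<le> e / 2 \<longrightarrow> norm (rem z) \<le> K * norm z ^ 3"
proof -
  let ?S = "cball (0::complex) (e/2)"
  have sub: "?S \<subseteq> ball 0 e" using e by auto
  have hk: "(deriv ^^ k) s holomorphic_on ball 0 e" for k by (rule holomorphic_higher_deriv[OF s_holo]) auto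
  have "compact ((deriv ^^ 3) s ` ?S)"
    by (intro compact_continuous_image continuous_on_subset[OF holomorphic_on_imp_continuous_on[OF hk] sub]) auto
  then obtain B where B: "B > 0" "\<And>z. z \<in> ?S \<Longrightarrow> norm ((deriv ^^ 3) s z) \<le> B"
    using compact_imp_bounded bounded_pos by (metis (no_types, lifting) imageI)
  have "norm (rem z) \<le> B / 2 * norm z ^ 3" if "norm z \<le> e / 2" for z
  proof -
    have "norm ((deriv ^^ 0) s z - (\<Sum>i\<le>2. (deriv ^^ i) s 0 * (z - 0) ^ i / fact i)) \<le> B * norm (z - 0) ^ (Suc 2) / fact 2"
    proof (rule complex_Taylor[of ?S 2 "\<lambda>i. (deriv ^^ i) s"])
      fix i x assume x: "x \<in> ?S"
      have "((deriv ^^ i) s has_field_derivative deriv ((deriv ^^ i) s) x) (at x)"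
        by (rule holomorphic_derivI[OF hk]) (use x sub in auto)
      thus "((deriv ^^ i) s has_field_derivative (deriv ^^ Suc i) s x) (at x within ?S)"
        by (simp add: has_field_derivative_at_within)
    qed (use B that e in \<open>auto simp: numeral_3_eq_3 numeral_2_eq_2\<close>)
    moreover have "(\<Sum>i\<le>2. (deriv ^^ i) s 0 * (z - 0) ^ i / fact i) = of_real (ln \<rho>0) - of_real \<mu> * z - of_real \<sigma>2 / 2 * z\<^sup>2"
      using s0 s1 s2 by (simp add: numeral_2_eq_2 algebra_simps)
    ultimately show ?thesis by (simp add: rem_def numeral_3_eq_3)
  qed
  thus ?thesis using B by (intro exI[of _ "B/2"]) auto
qed

lemma Mg_expand: "norm z < e \<Longrightarrow> Mg n z = Fn n z / Fn n 0 * exp (of_nat n * (of_real \<mu> * z + of_real \<sigma>2 / 2 * z\<^sup>2 - rem z))"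
proof -
  have "exp (of_nat n * s z) * exp (of_nat n * (of_real \<mu> * z + of_real \<sigma>2 / 2 * z\<^sup>2 - rem z)) = of_real (\<rho>0 ^ n)"
  proof -
    have "exp (of_nat n * s z) * exp (of_nat n * (of_real \<mu> * z + of_real \<sigma>2 / 2 * z\<^sup>2 - rem z)) 
       = exp (of_nat n * of_real (ln \<rho>0))"
      unfolding exp_add[symmetric] by (rule arg_cong[of _ _ exp]) (simp add: rem_def algebra_simps)
    thus ?thesis using rho0 by (simp add: exp_of_nat_mult exp_of_real)
  qed
  thus ?thesis using N_pos[of n] rho0 unfolding Fn_0 by (simp add: Fn_def mult.assoc)
qed

text \<open>A Gaussian majorant for the normalized characteristic function on the central range: the quadratic part of
the exponent dominates the cubic remainder when \<open>\<theta>\<close> is small compared with \<open>sqrt (var n)\<close>.\<close>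
lemma charf_bound: 
  "\<exists>K c. c > 0 \<and> (\<forall>\<^sub>F n in sequentially. \<forall>\<theta>. \<bar>\<theta>\<bar> \<le> pi \<longrightarrow> norm (Mg n (\<i> * of_real \<theta>)) \<le> K * exp (- c * real n * \<theta>\<^sup>2))"
proof -
  obtain K3 where K3: "K3 > 0" "\<And>z. norm z \<le> e / 2 \<Longrightarrow> norm (rem z) \<le> K3 * norm z ^ 3" using rem_bound by blast
  define t1 where "t1 = min (min (e/2) (\<sigma>2 / (4 * K3))) 1"
  have t1: "t1 > 0" "t1 \<le> e / 2" "t1 \<le> \<sigma>2 / (4 * K3)" "t1 \<le> 1" using e sigma2 K3 by (auto simp: t1_def min_le_iff_disj)
  have "compact (F ` cball 0 (e/2))"
    by (intro compact_continuous_image continuous_on_subset[OF holomorphic_on_imp_continuous_on[OF F_holo]]) (use e in auto)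
  then obtain B where B: "B > 0" "\<And>z. norm z \<le> e/2 \<Longrightarrow> norm (F z) \<le> B"
    using compact_imp_bounded bounded_pos by (metis (no_types, lifting) imageI mem_cball_0)
  define \<delta> where "\<delta> = sqrt (2 - 2 * cos t1)"
  have cos1: "cos t1 < 1" using cos_monotone_0_pi[of 0 t1] t1 pi_gt3 by simp
  have d: "\<delta> > 0" using cos1 by (simp add: \<delta>_def)
  obtain M r where Mr: "r > \<rho>0" "\<And>\<theta> n. n \<ge> 1 \<Longrightarrow> norm (exp (\<i> * of_real \<theta>) - 1) \<ge> \<delta> \<Longrightarrow> norm (of_real (N n) * Mg n (\<i> * of_real \<theta>)) \<le> M / r ^ n"
    using arcs[OF d] by blast
  define c where "c = min (\<sigma>2 / 4) (ln (r / \<rho>0) / pi\<^sup>2)"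
  have c: "c > 0" "c \<le> \<sigma>2 / 4" "c * pi\<^sup>2 \<le> ln (r / \<rho>0)" using sigma2 Mr rho0 by (auto simp: c_def min_def field_simps)
  define K where "K = max (2 * (B + 1) / norm (F 0)) (2 * \<bar>M\<bar> / norm (F 0))"
  have ev1: "\<forall>\<^sub>F n in sequentially. \<forall>z\<in>ball 0 e. dist (Fn n z) (F z) < min 1 (norm (F 0) / 2)"
    by (rule uniform_limitD[OF ul']) (use F0 in auto)
  have "\<forall>\<^sub>F n in sequentially. \<forall>\<theta>. \<bar>\<theta>\<bar> \<le> pi \<longrightarrow> norm (Mg n (\<i> * of_real \<theta>)) \<le> K * exp (- c * real n * \<theta>\<^sup>2)"
    using ev1 eventually_ge_at_top[of 1]
  proof eventually_elim
    case (elim n)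
    have lower: "norm (Fn n 0) \<ge> norm (F 0) / 2"
      using bspec[OF elim(1), of 0] e norm_triangle_ineq2[of "F 0" "Fn n 0"] by (simp add: dist_norm norm_minus_commute)
    show ?case
    proof (intro allI impI)
      fix \<theta> :: real assume th: "\<bar>\<theta>\<bar> \<le> pi"
      show "norm (Mg n (\<i> * of_real \<theta>)) \<le> K * exp (- c * real n * \<theta>\<^sup>2)"
      proof (cases "\<bar>\<theta>\<bar> \<le> t1")
        case True
        let ?z = "\<i> * of_real \<theta> :: complex"
        have nz: "norm ?z = \<bar>\<theta>\<bar>" by (simp add: norm_mult)
        have "norm (Fn n ?z) \<le> B + 1"
        proof -
          have "dist (Fn n ?z) (F ?z) < 1" using elim(1) True t1 nz e by (auto simp: norm_mult)
          moreover have "norm (F ?z) \<le> B" using B True t1 nz by auto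
          ultimately show ?thesis using norm_triangle_ineq2[of "Fn n ?z" "F ?z"] by (simp add: dist_norm)
        qed
        hence "norm (Fn n ?z) / norm (Fn n 0) \<le> (B + 1) / (norm (F 0) / 2)"
          using lower F0 B by (intro frac_le) auto
        hence 1: "norm (Fn n ?z) / norm (Fn n 0) \<le> K" by (simp add: K_def mult.commute)
        have rz: "norm (rem ?z) \<le> \<sigma>2 / 4 * \<theta>\<^sup>2"
        proof -
          have "norm (rem ?z) \<le> K3 * \<bar>\<theta>\<bar> * \<theta>\<^sup>2"
            using K3(2)[of ?z] True t1 nz by (simp add: power3_eq_cube power2_eq_square mult.assoc)
          also have "\<dots> \<le> (K3 * (\<sigma>2 / (4 * K3))) * \<theta>\<^sup>2"
            using True t1 K3 by (intro mult_right_mono mult_left_mono) auto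
          finally show ?thesis using K3 by simp
        qed
        have "Re (of_real \<mu> * ?z + of_real \<sigma>2 / 2 * ?z\<^sup>2 - rem ?z) = - (\<sigma>2 / 2 * \<theta>\<^sup>2) - Re (rem ?z)"
          by (simp add: power_mult_distrib)
        also have "\<dots> \<le> - (\<sigma>2 / 4 * \<theta>\<^sup>2)" using rz abs_Re_le_cmod[of "rem ?z"] by linarith
        also have "\<dots> \<le> - (c * \<theta>\<^sup>2)" using mult_right_mono[OF c(2), of "\<theta>\<^sup>2"] by simp
        finally have "real n * Re (of_real \<mu> * ?z + of_real \<sigma>2 / 2 * ?z\<^sup>2 - rem ?z) \<le> real n * (- (c * \<theta>\<^sup>2))"
          by (rule mult_left_mono) simp
        hence 2: "norm (exp (of_nat n * (of_real \<mu> * ?z + of_real \<sigma>2 / 2 * ?z\<^sup>2 - rem ?z))) \<le> exp (- c * real n * \<theta>\<^sup>2)"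
          unfolding norm_exp_eq_Re by (simp add: algebra_simps)
        have "norm ?z < e" using True t1 e nz by linarith
        hence M: "Mg n ?z = Fn n ?z / Fn n 0 * exp (of_nat n * (of_real \<mu> * ?z + of_real \<sigma>2 / 2 * ?z\<^sup>2 - rem ?z))"
          by (rule Mg_expand)
        show ?thesis unfolding M norm_mult[of "_ / _"] norm_divide
          by (rule mult_mono[OF 1 2]) (auto intro: order_trans[OF _ 1])
      next
        case False
        have "cos \<theta> \<le> cos t1"
        proof -
          have "cos \<bar>\<theta>\<bar> \<le> cos t1" using False th t1 by (intro cos_monotone_0_pi_le) auto
          thus ?thesis by simp
        qed
        moreover have "norm (exp (\<i> * of_real \<theta>) - 1) = sqrt (2 - 2 * cos \<theta>)"
        proof -
          have "(norm (exp (\<i> * of_real \<theta>) - 1))\<^sup>2 = (cos \<theta> - 1)\<^sup>2 + (sin \<theta>)\<^sup>2"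
            by (simp add: cmod_power2 Re_exp Im_exp)
          also have "\<dots> = 2 - 2 * cos \<theta>" using sin_cos_squared_add[of \<theta>] by (simp add: power2_eq_square algebra_simps)
          finally show ?thesis by (metis norm_ge_zero real_sqrt_unique)
        qed
        ultimately have "norm (exp (\<i> * of_real \<theta>) - 1) \<ge> \<delta>" by (simp add: \<delta>_def)
        hence "norm (of_real (N n) * Mg n (\<i> * of_real \<theta>)) \<le> M / r ^ n" using Mr elim by blast
        hence a: "N n * norm (Mg n (\<i> * of_real \<theta>)) \<le> \<bar>M\<bar> / r ^ n"
          using N_pos[of n] Mr rho0 by (simp add: norm_mult) (smt (verit) divide_right_mono zero_le_power)
        have "norm (F 0) / 2 \<le> N n * \<rho>0 ^ n" using lower N_pos[of n] rho0 unfolding Fn_0 by (simp add: norm_mult norm_power)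
        hence "norm (F 0) / 2 * norm (Mg n (\<i> * of_real \<theta>)) \<le> (N n * \<rho>0 ^ n) * norm (Mg n (\<i> * of_real \<theta>))"
          by (rule mult_right_mono) simp
        also have "\<dots> \<le> \<rho>0 ^ n * (\<bar>M\<bar> / r ^ n)" using mult_left_mono[OF a, of "\<rho>0 ^ n"] rho0 by (simp add: mult_ac)
        finally have "norm (Mg n (\<i> * of_real \<theta>)) \<le> 2 * (\<rho>0 ^ n * (\<bar>M\<bar> / r ^ n)) / norm (F 0)"
        proof -
          have gen: "x \<le> 2 * y / f" if "f / 2 * x \<le> y" "f > 0" for f x y :: real
            using that by (simp add: pos_le_divide_eq mult.commute)
          show ?thesis if "norm (F 0) / 2 * norm (Mg n (\<i> * of_real \<theta>)) \<le> \<rho>0 ^ n * (\<bar>M\<bar> / r ^ n)"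
            by (rule gen[OF that]) (use F0 in simp)
        qed
        also have "\<dots> = 2 * \<bar>M\<bar> / norm (F 0) * (\<rho>0 / r) ^ n" by (simp add: power_divide mult_ac)
        finally have "norm (Mg n (\<i> * of_real \<theta>)) \<le> 2 * \<bar>M\<bar> / norm (F 0) * (\<rho>0 / r) ^ n" .
        also have "\<dots> \<le> K * exp (- c * real n * \<theta>\<^sup>2)"
        proof (rule mult_mono)
          have "c * \<theta>\<^sup>2 \<le> c * pi\<^sup>2" using th c abs_le_square_iff[of \<theta> pi] pi_ge_zero by (intro mult_left_mono) auto
          hence "c * \<theta>\<^sup>2 \<le> ln (r / \<rho>0)" using c by linarith
          hence "real n * (c * \<theta>\<^sup>2) \<le> real n * ln (r / \<rho>0)" by (rule mult_left_mono) simp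
          hence "exp (- (real n * ln (r / \<rho>0))) \<le> exp (- c * real n * \<theta>\<^sup>2)" by (simp add: algebra_simps)
          moreover have "exp (- (real n * ln (r / \<rho>0))) = (\<rho>0 / r) ^ n"
            using Mr rho0 by (simp add: exp_minus exp_of_nat_mult power_divide)
          ultimately show "(\<rho>0 / r) ^ n \<le> exp (- c * real n * \<theta>\<^sup>2)" by simp
        qed (use Mr rho0 B in \<open>auto simp: K_def le_max_iff_disj\<close>)
        finally show ?thesis .
      qed
    qed
  qed
  thus ?thesis using c by blast
qed

definition charf :: "nat \<Rightarrow> real \<Rightarrow> complex" where
  "charf n \<theta> = exp (- \<i> * of_real (\<theta> * mean n / sqrt (var n))) * Mg n (\<i> * of_real (\<theta> / sqrt (var n)))"

lemma Fn_tendsto_moving: 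
  assumes "z \<longlonglongrightarrow> 0" shows "(\<lambda>n. Fn n (z n)) \<longlonglongrightarrow> F 0"
proof -
  have ev: "\<forall>\<^sub>F n in sequentially. z n \<in> ball 0 e" using assms e
    by (intro topological_tendstoD) auto
  have "isCont F 0" using holomorphic_on_imp_continuous_on[OF F_holo] e
    by (meson centre_in_ball continuous_on_eq_continuous_at open_ball)
  hence F: "(\<lambda>n. F (z n)) \<longlonglongrightarrow> F 0" using assms by (rule isCont_tendsto_compose)
  have "(\<lambda>n. Fn n (z n) - F (z n)) \<longlonglongrightarrow> 0"
  proof (rule tendstoI)
    fix d :: real assume "d > 0"
    from uniform_limitD[OF ul' this] ev show "\<forall>\<^sub>F n in sequentially. dist (Fn n (z n) - F (z n)) 0 < d"
      by eventually_elim (auto simp: dist_norm)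
  qed
  from tendsto_add[OF this F] show ?thesis by simp
qed

lemma charf_lim: "(\<lambda>n. charf n \<theta>) \<longlonglongrightarrow> of_real (exp (- \<theta>\<^sup>2 / 2))"
proof -
  obtain K3 where K3: "K3 > 0" "\<And>z. norm z \<le> e / 2 \<Longrightarrow> norm (rem z) \<le> K3 * norm z ^ 3" using rem_bound by blast
  define w where "w n = sqrt (var n)" for n
  have w_top: "filterlim w at_top sequentially"
    unfolding w_def by (rule filterlim_compose[OF sqrt_at_top var_at_top])
  define z where "z n = \<i> * of_real (\<theta> / w n)" for n
  have tw: "(\<lambda>n. \<theta> / w n) \<longlonglongrightarrow> 0" by (intro tendsto_divide_0[OF tendsto_const] filterlim_at_top_imp_at_infinity w_top)
  have z0: "z \<longlonglongrightarrow> 0" unfolding z_def using tendsto_mult[OF tendsto_const[of \<i>] tendsto_of_real[OF tw, where 'a=complex]] by simp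
  have ev: "\<forall>\<^sub>F n in sequentially. w n > 0 \<and> n > 0 \<and> norm (z n) \<le> e / 2 \<and> var n > 0"
  proof -
    have "\<forall>\<^sub>F n in sequentially. norm (z n) < e / 2" using tendstoD[OF z0, of "e/2"] e by simp
    moreover have "\<forall>\<^sub>F n in sequentially. w n > 0" using w_top by (auto simp: filterlim_at_top_dense)
    moreover have "\<forall>\<^sub>F n in sequentially. var n > 0" using var_at_top by (auto simp: filterlim_at_top_dense)
    ultimately show ?thesis using eventually_gt_at_top[of 0] by eventually_elim auto
  qed
  have nw: "(\<lambda>n. real n / var n) \<longlonglongrightarrow> 1 / \<sigma>2"
    using tendsto_divide[OF tendsto_const[of 1] var_ratio] sigma2 by simp
  obtain a where a: "(\<lambda>n. mean n - real n * \<mu>) \<longlonglongrightarrow> a" using mean_lim by blast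
  have r0: "(\<lambda>n. of_nat n * rem (z n)) \<longlonglongrightarrow> 0"
  proof (rule Lim_null_comparison)
    show "\<forall>\<^sub>F n in sequentially. norm (of_nat n * rem (z n)) \<le> K3 * \<theta>\<^sup>2 * (real n / var n) * \<bar>\<theta> / w n\<bar>"
      using ev
    proof eventually_elim
      case (elim n)
      have "norm (z n) = \<bar>\<theta> / w n\<bar>" unfolding z_def by (simp add: norm_mult norm_divide)
      hence "norm (rem (z n)) \<le> K3 * \<bar>\<theta> / w n\<bar> ^ 3" using K3(2)[of "z n"] elim by simp
      also have "\<bar>\<theta> / w n\<bar> ^ 3 = \<theta>\<^sup>2 / (w n)\<^sup>2 * \<bar>\<theta> / w n\<bar>" using elim by (simp add: power3_eq_cube power2_eq_square abs_mult)
      also have "(w n)\<^sup>2 = var n" using elim by (simp add: w_def)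
      finally have "real n * norm (rem (z n)) \<le> real n * (K3 * (\<theta>\<^sup>2 / var n * \<bar>\<theta> / w n\<bar>))" by (intro mult_left_mono) auto
      thus ?case by (simp add: norm_mult mult_ac)
    qed
    show "(\<lambda>n. K3 * \<theta>\<^sup>2 * (real n / var n) * \<bar>\<theta> / w n\<bar>) \<longlonglongrightarrow> 0"
      using tendsto_mult[OF tendsto_mult[OF tendsto_const[of "K3 * \<theta>\<^sup>2"] nw] tendsto_rabs[OF tw]] by simp
  qed
  define x where "x n = - \<i> * of_real (\<theta> / w n * (mean n - real n * \<mu>)) - of_real (\<theta>\<^sup>2 / 2 * \<sigma>2 * (real n / var n)) - of_nat n * rem (z n)" for n
  have "x \<longlonglongrightarrow> - \<i> * of_real (0 * a) - of_real (\<theta>\<^sup>2 / 2 * \<sigma>2 * (1 / \<sigma>2)) - 0"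
    unfolding x_def by (intro tendsto_intros tw a nw r0)
  hence x: "x \<longlonglongrightarrow> of_real (- \<theta>\<^sup>2 / 2)" using sigma2 by simp
  have "(\<lambda>n. Fn n (z n) / Fn n 0 * exp (x n)) \<longlonglongrightarrow> F 0 / F 0 * exp (of_real (- \<theta>\<^sup>2 / 2))"
    by (intro tendsto_intros Fn_tendsto_moving z0 x F0)
  moreover have "\<forall>\<^sub>F n in sequentially. charf n \<theta> = Fn n (z n) / Fn n 0 * exp (x n)"
    using ev
  proof eventually_elim
    case (elim n)
    have "norm (z n) < e" using elim e by linarith
    hence "charf n \<theta> = Fn n (z n) / Fn n 0 * (exp (- \<i> * of_real (\<theta> * mean n / w n)) * exp (of_nat n * (of_real \<mu> * z n + of_real \<sigma>2 / 2 * (z n)\<^sup>2 - rem (z n))))"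
      unfolding charf_def w_def[symmetric] z_def[symmetric] by (simp add: Mg_expand)
    also have "exp (- \<i> * of_real (\<theta> * mean n / w n)) * exp (of_nat n * (of_real \<mu> * z n + of_real \<sigma>2 / 2 * (z n)\<^sup>2 - rem (z n))) = exp (x n)"
    proof -
      have wv: "w n * w n = var n" using elim by (simp add: w_def)
      have z2: "(z n)\<^sup>2 = - of_real (\<theta>\<^sup>2 / var n)"
      proof -
        have "(\<theta> / w n)\<^sup>2 = \<theta>\<^sup>2 / var n" by (simp add: power_divide wv[symmetric] power2_eq_square)
        thus ?thesis unfolding z_def power_mult_distrib of_real_power[symmetric] by simp
      qed
      have "- \<i> * of_real (\<theta> * mean n / w n) + of_nat n * (of_real \<mu> * z n + of_real \<sigma>2 / 2 * (z n)\<^sup>2 - rem (z n)) = x n"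
        unfolding z2 x_def using elim by (simp add: z_def field_simps)
      thus ?thesis by (simp add: exp_add[symmetric])
    qed
    finally show ?case .
  qed
  ultimately show ?thesis using F0 by (simp add: tendsto_cong flip: exp_of_real)
qed

end

text \<open>Orthogonality of characters on the circle.\<close>
lemma integral_exp_int:
  fixes j :: int
  shows "(\<integral>\<theta>. indicator {-pi..pi} \<theta> *\<^sub>R exp (\<i> * of_real (of_int j * \<theta>)) \<partial>lborel) = (if j = 0 then 2 * pi else 0)"
proof (cases "j = 0")
  case True
  thus ?thesis by (simp add: measure_def scaleR_conv_of_real)
next
  case False
  have "(LINT \<theta>:{-pi..pi}|lborel. exp (\<i> * of_real (of_int j * \<theta>))) = 
      exp (\<i> * of_real (of_int j * pi)) / (\<i> * of_int j) - exp (\<i> * of_real (of_int j * (-pi))) / (\<i> * of_int j)"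
    unfolding set_lebesgue_integral_def
  proof (rule integral_FTC_Icc)
    fix x :: real
    show "((\<lambda>\<theta>. exp (\<i> * of_real (of_int j * \<theta>)) / (\<i> * of_int j)) has_vector_derivative exp (\<i> * of_real (of_int j * x))) (at x within {-pi..pi})"
    proof -
      have "((\<lambda>z. exp (\<i> * (of_int j * z)) / (\<i> * of_int j)) has_field_derivative exp (\<i> * (of_int j * of_real x))) (at (of_real x))"
        using False by (auto intro!: derivative_eq_intros simp: field_simps)
      from has_vector_derivative_real_field[OF this, of "{-pi..pi}"] show ?thesis by simp
    qed
  qed (auto intro!: continuous_intros)
  also have "\<dots> = 0"
  proof -
    have "exp (\<i> * of_real (of_int j * pi)) = exp (\<i> * of_real (of_int j * (-pi)))"
      by (auto simp: exp_eq intro!: exI[of _ j])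
    thus ?thesis by simp
  qed
  finally show ?thesis using False by (simp add: set_lebesgue_integral_def)
qed

lemma gaussian_integrable: "c > 0 \<Longrightarrow> integrable lborel (\<lambda>x::real. exp (- c * x\<^sup>2))"
proof -
  assume c: "c > 0"
  have "integrable lborel (\<lambda>x. sqrt (2 * pi * (1 / (2 * c))) * normal_density 0 (sqrt (1 / (2 * c))) x)"
    by (intro integrable_mult_right integrable_normal_density) (use c in auto)
  also have "(\<lambda>x. sqrt (2 * pi * (1 / (2 * c))) * normal_density 0 (sqrt (1 / (2 * c))) x) = (\<lambda>x. exp (- c * x\<^sup>2))"
    using c by (simp add: normal_density_def real_sqrt_divide[symmetric] field_simps fun_eq_iff)
  finally show ?thesis .
qed

lemma gaussian_fourier:
  fixes x :: real
  shows "(\<integral>\<theta>. of_real (exp (- \<theta>\<^sup>2 / 2)) * exp (- \<i> * of_real (x * \<theta>)) \<partial>lborel) = complex_of_real (sqrt (2 * pi) * exp (- x\<^sup>2 / 2))"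
proof -
  have "complex_of_real (exp (- (- x)\<^sup>2 / 2)) = char std_normal_distribution (- x)" by (simp add: char_std_normal_distribution)
  also have "\<dots> = (\<integral>\<theta>. std_normal_density \<theta> *\<^sub>R iexp (- x * \<theta>) \<partial>lborel)"
    unfolding char_def by (subst integral_density) (auto simp: normal_density_nonneg)
  also have "\<dots> = (\<integral>\<theta>. of_real (1 / sqrt (2 * pi)) * (of_real (exp (- \<theta>\<^sup>2 / 2)) * exp (- \<i> * of_real (x * \<theta>))) \<partial>lborel)"
    by (intro Bochner_Integration.integral_cong refl) (simp add: normal_density_def scaleR_conv_of_real)
  also have "\<dots> = of_real (1 / sqrt (2 * pi)) * (\<integral>\<theta>. of_real (exp (- \<theta>\<^sup>2 / 2)) * exp (- \<i> * of_real (x * \<theta>)) \<partial>lborel)"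
    by (rule integral_mult_right_zero)
  finally show ?thesis by (simp add: field_simps)
qed

lemma std_gauss_lipschitz: "\<bar>exp (- x\<^sup>2 / 2) - exp (- y\<^sup>2 / 2)\<bar> \<le> \<bar>x - y\<bar>" for x y :: real
proof -
  have "norm (exp (- x\<^sup>2 / 2) - exp (- y\<^sup>2 / 2)) \<le> 1 * norm (x - y)"
  proof (rule field_differentiable_bound[of UNIV])
    fix z :: real
    show "((\<lambda>x. exp (- x\<^sup>2 / 2)) has_field_derivative - z * exp (- z\<^sup>2 / 2)) (at z within UNIV)"
      by (auto intro!: derivative_eq_intros)
    have "\<bar>z\<bar> \<le> 1 + z\<^sup>2 / 2" using zero_le_power2[of "\<bar>z\<bar> - 1"] by (simp add: power2_eq_square algebra_simps)
    also have "\<dots> \<le> exp (z\<^sup>2 / 2)" by (rule exp_ge_add_one_self)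
    finally show "norm (- z * exp (- z\<^sup>2 / 2)) \<le> 1" by (simp add: abs_mult exp_minus field_simps)
  qed auto
  thus ?thesis by simp
qed

context quasi_powers begin

lemma charf_char: "char (distr (measure_pmf (D n)) borel (\<lambda>T. (real (X T) - mean n) / sqrt (var n))) \<theta> = charf n \<theta>"
proof -
  have "char (distr (measure_pmf (D n)) borel (\<lambda>T. (real (X T) - mean n) / sqrt (var n))) \<theta>
     = measure_pmf.expectation (D n) (\<lambda>T. iexp (\<theta> * ((real (X T) - mean n) / sqrt (var n))))"
    unfolding char_def by (subst integral_distr) auto
  also have "\<dots> = (\<Sum>T\<in>set_pmf (D n). pmf (D n) T *\<^sub>R iexp (\<theta> * ((real (X T) - mean n) / sqrt (var n))))"
    by (rule expect)
  also have "\<dots> = (\<Sum>T\<in>set_pmf (D n). exp (- \<i> * of_real (\<theta> * mean n / sqrt (var n))) * (of_real (pmf (D n) T) * exp (\<i> * of_real (\<theta> / sqrt (var n)) * of_nat (X T))))"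
  proof (intro sum.cong refl)
    fix T
    have "\<i> * of_real (\<theta> * ((real (X T) - mean n) / sqrt (var n))) = - \<i> * of_real (\<theta> * mean n / sqrt (var n)) + \<i> * of_real (\<theta> / sqrt (var n)) * of_nat (X T)"
      by (simp add: diff_divide_distrib algebra_simps)
    thus "pmf (D n) T *\<^sub>R iexp (\<theta> * ((real (X T) - mean n) / sqrt (var n))) = exp (- \<i> * of_real (\<theta> * mean n / sqrt (var n))) * (of_real (pmf (D n) T) * exp (\<i> * of_real (\<theta> / sqrt (var n)) * of_nat (X T)))"
      by (simp only: exp_add scaleR_conv_of_real mult_ac)
  qed
  finally show ?thesis by (simp add: charf_def Mg_def sum_distrib_left)
qed

theorem central_limit:
  "weak_conv_m (\<lambda>n. distr (measure_pmf (D n)) borel (\<lambda>T. (real (X T) - mean n) / sqrt (var n))) std_normal_distribution"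
proof (rule levy_continuity)
  show "real_distribution (distr (measure_pmf (D n)) borel (\<lambda>T. (real (X T) - mean n) / sqrt (var n)))" for n
    by (rule prob_space.real_distribution_distr[OF measure_pmf.prob_space_axioms]) auto
  show "real_distribution std_normal_distribution" by (rule real_dist_normal_dist)
  show "(\<lambda>n. char (distr (measure_pmf (D n)) borel (\<lambda>T. (real (X T) - mean n) / sqrt (var n))) t) \<longlonglongrightarrow> char std_normal_distribution t" for t
    using charf_lim[of t] by (simp add: charf_char char_std_normal_distribution)
qed

lemma Mg_continuous: "continuous_on S (Mg n)"
  using holomorphic_on_imp_continuous_on[OF Mg_holo] .

lemma Mg_measurable [measurable]: "(\<lambda>\<theta>. Mg n (\<i> * of_real (\<theta> * y))) \<in> borel_measurable borel"
  by (intro borel_measurable_continuous_onI continuous_intros continuous_on_compose2[OF Mg_continuous[of UNIV]]) auto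

text \<open>Point probabilities of an integer variable are Fourier coefficients of its characteristic function.\<close>
lemma fourier_inversion:
  "of_real (2 * pi * measure_pmf.prob (D n) {T. int (X T) = k}) = 
     (\<integral>\<theta>. indicator {-pi..pi} \<theta> *\<^sub>R (Mg n (\<i> * of_real \<theta>) * exp (- \<i> * of_real (of_int k * \<theta>))) \<partial>lborel)"
proof -
  have int: "integrable lborel (\<lambda>\<theta>. indicator {-pi..pi} \<theta> *\<^sub>R exp (\<i> * of_real (of_int j * \<theta>)))" for j :: int
    by (rule borel_integrable_atLeastAtMost'[unfolded set_integrable_def]) (intro continuous_intros)
  have "(\<integral>\<theta>. indicator {-pi..pi} \<theta> *\<^sub>R (Mg n (\<i> * of_real \<theta>) * exp (- \<i> * of_real (of_int k * \<theta>))) \<partial>lborel)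
     = (\<integral>\<theta>. (\<Sum>T\<in>set_pmf (D n). of_real (pmf (D n) T) * (indicator {-pi..pi} \<theta> *\<^sub>R exp (\<i> * of_real (of_int (int (X T) - k) * \<theta>)))) \<partial>lborel)"
  proof (intro Bochner_Integration.integral_cong refl)
    fix \<theta> :: real
    have "exp (\<i> * of_real \<theta> * of_nat m) * exp (- \<i> * of_real (of_int k * \<theta>)) = exp (\<i> * of_real (of_int (int m - k) * \<theta>))" for m
      unfolding exp_add[symmetric] by (rule arg_cong[of _ _ exp]) (simp add: algebra_simps)
    thus "indicator {-pi..pi} \<theta> *\<^sub>R (Mg n (\<i> * of_real \<theta>) * exp (- \<i> * of_real (of_int k * \<theta>))) = 
        (\<Sum>T\<in>set_pmf (D n). of_real (pmf (D n) T) * (indicator {-pi..pi} \<theta> *\<^sub>R exp (\<i> * of_real (of_int (int (X T) - k) * \<theta>))))"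
      by (simp add: Mg_def sum_distrib_right scaleR_sum_right mult.assoc)
  qed
  also have "\<dots> = (\<Sum>T\<in>set_pmf (D n). of_real (pmf (D n) T) * complex_of_real (if int (X T) - k = 0 then 2 * pi else 0))"
  proof (subst Bochner_Integration.integral_sum)
    show "(\<Sum>T\<in>set_pmf (D n). \<integral>\<theta>. of_real (pmf (D n) T) * (indicator {-pi..pi} \<theta> *\<^sub>R exp (\<i> * of_real (of_int (int (X T) - k) * \<theta>))) \<partial>lborel)
      = (\<Sum>T\<in>set_pmf (D n). of_real (pmf (D n) T) * complex_of_real (if int (X T) - k = 0 then 2 * pi else 0))"
      unfolding integral_mult_right_zero integral_exp_int ..
  qed (intro integrable_mult_right int)
  also have "\<dots> = of_real (\<Sum>T\<in>set_pmf (D n). pmf (D n) T * (2 * pi * indicator {T. int (X T) = k} T))"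
    unfolding of_real_sum by (intro sum.cong) (auto simp: indicator_def)
  also have "(\<Sum>T\<in>set_pmf (D n). pmf (D n) T * (2 * pi * indicator {T. int (X T) = k} T)) = measure_pmf.expectation (D n) (\<lambda>T. 2 * pi * indicator {T. int (X T) = k} T)"
    by (simp only: expect real_scaleR_def)
  also have "\<dots> = 2 * pi * measure_pmf.prob (D n) {T. int (X T) = k}" by simp
  finally show ?thesis by simp
qed

lemma scaled_inversion:
  assumes w: "w = sqrt (var n)" "w > 0" 
  shows "of_real (2 * pi * (w * measure_pmf.prob (D n) {T. int (X T) = k})) = 
     (\<integral>\<theta>. (indicator {- (pi * w)..pi * w} \<theta> *\<^sub>R charf n \<theta>) * exp (- \<i> * of_real ((of_int k - mean n) / w * \<theta>)) \<partial>lborel)"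
proof -
  have "of_real (2 * pi * measure_pmf.prob (D n) {T. int (X T) = k}) = 
      \<bar>1 / w\<bar> *\<^sub>R (\<integral>\<theta>. indicator {-pi..pi} (0 + 1 / w * \<theta>) *\<^sub>R (Mg n (\<i> * of_real (0 + 1 / w * \<theta>)) * exp (- \<i> * of_real (of_int k * (0 + 1 / w * \<theta>)))) \<partial>lborel)"
    unfolding fourier_inversion by (rule lborel_integral_real_affine) (use w in auto)
  also have "(\<integral>\<theta>. indicator {-pi..pi} (0 + 1 / w * \<theta>) *\<^sub>R (Mg n (\<i> * of_real (0 + 1 / w * \<theta>)) * exp (- \<i> * of_real (of_int k * (0 + 1 / w * \<theta>)))) \<partial>lborel)
     = (\<integral>\<theta>. (indicator {- (pi * w)..pi * w} \<theta> *\<^sub>R charf n \<theta>) * exp (- \<i> * of_real ((of_int k - mean n) / w * \<theta>)) \<partial>lborel)"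
  proof (intro Bochner_Integration.integral_cong refl)
    fix \<theta> :: real
    have "indicator {-pi..pi} (0 + 1 / w * \<theta>) = (indicator {- (pi * w)..pi * w} \<theta> :: real)"
      using w(2) by (auto simp: indicator_def field_simps)
    moreover have "exp (- \<i> * of_real (of_int k * (0 + 1 / w * \<theta>))) = exp (- \<i> * of_real (\<theta> * mean n / w)) * exp (- \<i> * of_real ((of_int k - mean n) / w * \<theta>))"
      unfolding exp_add[symmetric] using w(2) by (intro arg_cong[of _ _ exp]) (simp add: field_simps)
    ultimately show "indicator {-pi..pi} (0 + 1 / w * \<theta>) *\<^sub>R (Mg n (\<i> * of_real (0 + 1 / w * \<theta>)) * exp (- \<i> * of_real (of_int k * (0 + 1 / w * \<theta>)))) = 
       (indicator {- (pi * w)..pi * w} \<theta> *\<^sub>R charf n \<theta>) * exp (- \<i> * of_real ((of_int k - mean n) / w * \<theta>))"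
      by (simp add: charf_def w(1)[symmetric] mult_ac)
  qed
  finally have "of_real w * of_real (2 * pi * measure_pmf.prob (D n) {T. int (X T) = k}) = of_real w * (of_real (1 / w) *
     (\<integral>\<theta>. (indicator {- (pi * w)..pi * w} \<theta> *\<^sub>R charf n \<theta>) * exp (- \<i> * of_real ((of_int k - mean n) / w * \<theta>)) \<partial>lborel))"
    using w(2) by (simp only: scaleR_conv_of_real abs_of_pos divide_pos_pos zero_less_one)
  also have "\<dots> = (of_real (w * (1 / w)) *
     (\<integral>\<theta>. (indicator {- (pi * w)..pi * w} \<theta> *\<^sub>R charf n \<theta>) * exp (- \<i> * of_real ((of_int k - mean n) / w * \<theta>)) \<partial>lborel))"
    by (simp only: of_real_mult mult.assoc)
  also have "w * (1 / w) = 1" using w(2) by simp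
  finally show ?thesis by (simp only: of_real_mult of_real_1 mult_1_left mult_ac)
qed

definition L1 :: "nat \<Rightarrow> real" where
  "L1 n = (\<integral>\<theta>. norm (indicator {- (pi * sqrt (var n))..pi * sqrt (var n)} \<theta> *\<^sub>R charf n \<theta> - of_real (exp (- \<theta>\<^sup>2 / 2))) \<partial>lborel)"

lemma charf_measurable [measurable]: "charf n \<in> borel_measurable borel"
proof -
  have "(\<lambda>\<theta>. exp (- \<i> * of_real (\<theta> * x)) * Mg n (\<i> * of_real (\<theta> * y))) \<in> borel_measurable borel" for x y
    by (intro borel_measurable_times Mg_measurable borel_measurable_continuous_onI) (auto intro!: continuous_intros)
  from this[of "mean n / sqrt (var n)" "1 / sqrt (var n)"] show ?thesis by (simp add: charf_def[abs_def])
qed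

text \<open>Dominated convergence on the central range, exponential smallness beyond it.\<close>
lemma L1_lim: "L1 \<longlonglongrightarrow> 0"
  and L1_integrable: "\<forall>\<^sub>F n in sequentially. integrable lborel (\<lambda>\<theta>. indicator {- (pi * sqrt (var n))..pi * sqrt (var n)} \<theta> *\<^sub>R charf n \<theta>)"
proof -
  obtain K c where c: "c > 0" and Kc: "\<forall>\<^sub>F n in sequentially. \<forall>\<theta>. \<bar>\<theta>\<bar> \<le> pi \<longrightarrow> norm (Mg n (\<i> * of_real \<theta>)) \<le> K * exp (- c * real n * \<theta>\<^sup>2)"
    using charf_bound by blast
  define c' where "c' = c / (2 * \<sigma>2)"
  have c': "c' > 0" using c sigma2 by (simp add: c'_def)
  define G where "G = (\<lambda>n \<theta>. indicator {- (pi * sqrt (var n))..pi * sqrt (var n)} \<theta> *\<^sub>R charf n \<theta>)"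
  have Gm[measurable]: "G n \<in> borel_measurable borel" for n unfolding G_def by measurable
  have "\<forall>\<^sub>F n in sequentially. var n / real n < 2 * \<sigma>2" by (rule order_tendstoD[OF var_ratio]) (use sigma2 in auto)
  moreover have "\<forall>\<^sub>F n in sequentially. var n > 0" using var_at_top by (auto simp: filterlim_at_top_dense)
  ultimately have dom: "\<forall>\<^sub>F n in sequentially. \<forall>\<theta>. norm (G n \<theta>) \<le> \<bar>K\<bar> * exp (- c' * \<theta>\<^sup>2)"
    using Kc eventually_gt_at_top[of 0]
  proof eventually_elim
    case (elim n)
    show ?case
    proof
      fix \<theta>
      show "norm (G n \<theta>) \<le> \<bar>K\<bar> * exp (- c' * \<theta>\<^sup>2)"
      proof (cases "\<theta> \<in> {- (pi * sqrt (var n))..pi * sqrt (var n)}")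
        case True
        hence "\<bar>\<theta> / sqrt (var n)\<bar> \<le> pi" using elim by (auto simp: abs_le_iff field_simps)
        hence "norm (Mg n (\<i> * of_real (\<theta> / sqrt (var n)))) \<le> K * exp (- c * real n * (\<theta> / sqrt (var n))\<^sup>2)"
          using elim by blast
        also have "\<dots> \<le> \<bar>K\<bar> * exp (- c' * \<theta>\<^sup>2)"
        proof (rule mult_mono)
          have "c' \<le> c * real n / var n" using elim c sigma2 by (simp add: c'_def field_simps)
          hence "c' * \<theta>\<^sup>2 \<le> c * real n / var n * \<theta>\<^sup>2" by (rule mult_right_mono) simp
          thus "exp (- c * real n * (\<theta> / sqrt (var n))\<^sup>2) \<le> exp (- c' * \<theta>\<^sup>2)"
            using elim by (simp add: power_divide)
        qed auto
        finally have "norm (charf n \<theta>) \<le> \<bar>K\<bar> * exp (- c' * \<theta>\<^sup>2)" by (simp add: charf_def norm_mult)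
        thus ?thesis using True by (simp add: G_def)
      qed (simp add: G_def)
    qed
  qed
  have int_dom: "integrable lborel (\<lambda>\<theta>. \<bar>K\<bar> * exp (- c' * \<theta>\<^sup>2))" by (intro integrable_mult_right gaussian_integrable c')
  show "\<forall>\<^sub>F n in sequentially. integrable lborel (\<lambda>\<theta>. indicator {- (pi * sqrt (var n))..pi * sqrt (var n)} \<theta> *\<^sub>R charf n \<theta>)"
    using dom
  proof eventually_elim
    case (elim n)
    have "integrable lborel (G n)"
      by (rule Bochner_Integration.integrable_bound[OF int_dom]) (use elim in \<open>auto intro!: AE_I2 order_trans[OF _ abs_ge_self]\<close>)
    thus ?case by (simp add: G_def)
  qed
  obtain n0 where n0: "\<And>n \<theta>. n \<ge> n0 \<Longrightarrow> norm (G n \<theta>) \<le> \<bar>K\<bar> * exp (- c' * \<theta>\<^sup>2)"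
    using dom unfolding eventually_sequentially by blast
  have Glim: "(\<lambda>n. G n \<theta>) \<longlonglongrightarrow> of_real (exp (- \<theta>\<^sup>2 / 2))" for \<theta>
  proof -
    have "filterlim (\<lambda>n. pi * sqrt (var n)) at_top sequentially"
      by (rule filterlim_tendsto_pos_mult_at_top[OF tendsto_const pi_gt_zero filterlim_compose[OF sqrt_at_top var_at_top]])
    hence "\<forall>\<^sub>F n in sequentially. pi * sqrt (var n) > \<bar>\<theta>\<bar>" by (auto simp: filterlim_at_top_dense)
    hence "\<forall>\<^sub>F n in sequentially. G n \<theta> = charf n \<theta>" by eventually_elim (auto simp: G_def indicator_def abs_less_iff)
    thus ?thesis using charf_lim[of \<theta>] by (simp add: tendsto_cong)
  qed
  have "(\<lambda>n. \<integral>\<theta>. norm (G (n + n0) \<theta> - of_real (exp (- \<theta>\<^sup>2 / 2))) \<partial>lborel) \<longlonglongrightarrow> (\<integral>\<theta>. 0 \<partial>(lborel :: real measure))"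
  proof (rule integral_dominated_convergence[where w = "\<lambda>\<theta>. \<bar>K\<bar> * exp (- c' * \<theta>\<^sup>2) + exp (- (1/2) * \<theta>\<^sup>2)"])
    show "integrable lborel (\<lambda>\<theta>. \<bar>K\<bar> * exp (- c' * \<theta>\<^sup>2) + exp (- (1/2) * \<theta>\<^sup>2))"
      by (intro Bochner_Integration.integrable_add int_dom gaussian_integrable) simp
    show "AE \<theta> in lborel. (\<lambda>n. norm (G (n + n0) \<theta> - of_real (exp (- \<theta>\<^sup>2 / 2)))) \<longlonglongrightarrow> 0"
    proof (rule AE_I2)
      fix \<theta>
      have "(\<lambda>n. norm (G n \<theta> - of_real (exp (- \<theta>\<^sup>2 / 2)))) \<longlonglongrightarrow> 0" using Glim[of \<theta>] by (simp add: tendsto_norm_zero_iff LIM_zero_iff)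
      thus "(\<lambda>n. norm (G (n + n0) \<theta> - of_real (exp (- \<theta>\<^sup>2 / 2)))) \<longlonglongrightarrow> 0" by (rule LIMSEQ_ignore_initial_segment)
    qed
    fix n
    show "AE \<theta> in lborel. norm (norm (G (n + n0) \<theta> - of_real (exp (- \<theta>\<^sup>2 / 2)))) \<le> \<bar>K\<bar> * exp (- c' * \<theta>\<^sup>2) + exp (- (1/2) * \<theta>\<^sup>2)"
    proof (rule AE_I2)
      fix \<theta>
      have "norm (G (n + n0) \<theta> - of_real (exp (- \<theta>\<^sup>2 / 2))) \<le> norm (G (n + n0) \<theta>) + norm (complex_of_real (exp (- \<theta>\<^sup>2 / 2)))"
        by (rule norm_triangle_ineq4)
      also have "\<dots> \<le> \<bar>K\<bar> * exp (- c' * \<theta>\<^sup>2) + exp (- (1/2) * \<theta>\<^sup>2)" using n0[of "n + n0" \<theta>] by simp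
      finally show "norm (norm (G (n + n0) \<theta> - of_real (exp (- \<theta>\<^sup>2 / 2)))) \<le> \<bar>K\<bar> * exp (- c' * \<theta>\<^sup>2) + exp (- (1/2) * \<theta>\<^sup>2)" by simp
    qed
  qed auto
  hence "(\<lambda>n. L1 (n + n0)) \<longlonglongrightarrow> 0" by (simp add: L1_def[abs_def] G_def)
  thus "L1 \<longlonglongrightarrow> 0" by (rule LIMSEQ_offset)
qed

text \<open>Both the point probabilities and the Gaussian density are Fourier integrals, so their difference is
at most the \<open>L1\<close> distance of the transforms. Rounding the argument to an integer costs at most \<open>1 / sqrt (var n)\<close> by
the Lipschitz property of the density.\<close>
theorem local_limit:
  "(\<lambda>n. SUP x::real. \<bar>sqrt (var n) * measure_pmf.prob (D n) {T. int (X T) = \<lfloor>mean n + x * sqrt (var n)\<rfloor>}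
       - 1 / sqrt (2 * pi) * exp (- x\<^sup>2 / 2)\<bar>) \<longlonglongrightarrow> 0"
proof -
  define err where "err n x = \<bar>sqrt (var n) * measure_pmf.prob (D n) {T. int (X T) = \<lfloor>mean n + x * sqrt (var n)\<rfloor>}
       - 1 / sqrt (2 * pi) * exp (- x\<^sup>2 / 2)\<bar>" for n and x :: real
  have "\<forall>\<^sub>F n in sequentially. var n > 0" using var_at_top by (auto simp: filterlim_at_top_dense)
  hence bnd: "\<forall>\<^sub>F n in sequentially. \<forall>x. err n x \<le> L1 n / (2 * pi) + 1 / sqrt (var n)"
    using L1_integrable
  proof eventually_elim
    case (elim n)
    show ?case
    proof
      fix x :: real
      define w where "w = sqrt (var n)"
      have w: "w > 0" using elim by (simp add: w_def)
      define k where "k = \<lfloor>mean n + x * w\<rfloor>"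
      define y where "y = (of_int k - mean n) / w"
      have y: "\<bar>y - x\<bar> \<le> 1 / w"
      proof -
        have "of_int k \<le> mean n + x * w" "mean n + x * w < of_int k + 1" unfolding k_def by linarith+
        hence "\<bar>of_int k - mean n - x * w\<bar> \<le> 1" by linarith
        moreover have "y - x = (of_int k - mean n - x * w) / w" using w by (simp add: y_def field_simps)
        ultimately show ?thesis using w by (simp add: abs_divide divide_right_mono)
      qed
      let ?g = "\<lambda>\<theta>. indicator {- (pi * w)..pi * w} \<theta> *\<^sub>R charf n \<theta>"
      let ?h = "\<lambda>\<theta>. complex_of_real (exp (- \<theta>\<^sup>2 / 2))"
      let ?e = "\<lambda>\<theta>. exp (- \<i> * of_real (y * \<theta>))"
      have ne: "norm (?e \<theta>) = 1" for \<theta> by simp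
      have em: "?e \<in> borel_measurable borel" by (intro borel_measurable_continuous_onI continuous_intros)
      have ig: "integrable lborel ?g" using elim by (simp add: w_def)
      have ih: "integrable lborel ?h" using gaussian_integrable[of "1/2"] by simp
      have ige: "integrable lborel (\<lambda>\<theta>. ?g \<theta> * ?e \<theta>)"
        by (rule Bochner_Integration.integrable_bound[OF ig]) (use em in \<open>auto simp: norm_mult intro!: AE_I2\<close>)
      have ihe: "integrable lborel (\<lambda>\<theta>. ?h \<theta> * ?e \<theta>)"
        by (rule Bochner_Integration.integrable_bound[OF ih]) (use em in \<open>auto simp: norm_mult intro!: AE_I2\<close>)
      have "of_real (2 * pi * (w * measure_pmf.prob (D n) {T. int (X T) = k}) - sqrt (2 * pi) * exp (- y\<^sup>2 / 2)) 
         = (\<integral>\<theta>. ?g \<theta> * ?e \<theta> \<partial>lborel) - (\<integral>\<theta>. ?h \<theta> * ?e \<theta> \<partial>lborel)"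
        unfolding of_real_diff scaled_inversion[OF w_def w] gaussian_fourier y_def ..
      also have "\<dots> = (\<integral>\<theta>. ?g \<theta> * ?e \<theta> - ?h \<theta> * ?e \<theta> \<partial>lborel)"
        by (rule Bochner_Integration.integral_diff[OF ige ihe, symmetric])
      finally have "norm (complex_of_real (2 * pi * (w * measure_pmf.prob (D n) {T. int (X T) = k}) - sqrt (2 * pi) * exp (- y\<^sup>2 / 2)))
         \<le> (\<integral>\<theta>. norm (?g \<theta> * ?e \<theta> - ?h \<theta> * ?e \<theta>) \<partial>lborel)" by (simp only: integral_norm_bound)
      also have "\<dots> = L1 n"
        unfolding L1_def w_def[symmetric] 
        by (intro Bochner_Integration.integral_cong refl) (simp only: left_diff_distrib[symmetric] norm_mult ne mult_1_right)
      finally have *: "\<bar>2 * pi * (w * measure_pmf.prob (D n) {T. int (X T) = k}) - sqrt (2 * pi) * exp (- y\<^sup>2 / 2)\<bar> \<le> L1 n"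
        by (simp only: norm_of_real)
      have "w * measure_pmf.prob (D n) {T. int (X T) = k} - 1 / sqrt (2 * pi) * exp (- y\<^sup>2 / 2)
         = (2 * pi * (w * measure_pmf.prob (D n) {T. int (X T) = k}) - sqrt (2 * pi) * exp (- y\<^sup>2 / 2)) / (2 * pi)"
      proof -
        have "sqrt (2 * pi) / (2 * pi) = 1 / sqrt (2 * pi)" 
          by (simp add: field_simps)
        hence "sqrt (2 * pi) * E / (2 * pi) = 1 / sqrt (2 * pi) * E" for E
          by (simp only: times_divide_eq_left[symmetric])
        thus ?thesis unfolding diff_divide_distrib by simp
      qed
      hence 1: "\<bar>w * measure_pmf.prob (D n) {T. int (X T) = k} - 1 / sqrt (2 * pi) * exp (- y\<^sup>2 / 2)\<bar> \<le> L1 n / (2 * pi)"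
        using * by (simp add: abs_divide divide_right_mono)
      have 2: "\<bar>1 / sqrt (2 * pi) * exp (- y\<^sup>2 / 2) - 1 / sqrt (2 * pi) * exp (- x\<^sup>2 / 2)\<bar> \<le> 1 / w"
      proof -
        have "1 / sqrt (2 * pi) \<le> 1" using pi_gt3 by (simp add: real_le_rsqrt)
        hence "1 / sqrt (2 * pi) * \<bar>exp (- y\<^sup>2 / 2) - exp (- x\<^sup>2 / 2)\<bar> \<le> 1 * \<bar>y - x\<bar>"
          by (intro mult_mono std_gauss_lipschitz) auto
        hence A: "1 / sqrt (2 * pi) * \<bar>exp (- y\<^sup>2 / 2) - exp (- x\<^sup>2 / 2)\<bar> \<le> \<bar>y - x\<bar>" by (simp only: mult_1_left)
        have B: "\<bar>1 / sqrt (2 * pi) * exp (- y\<^sup>2 / 2) - 1 / sqrt (2 * pi) * exp (- x\<^sup>2 / 2)\<bar> = 1 / sqrt (2 * pi) * \<bar>exp (- y\<^sup>2 / 2) - exp (- x\<^sup>2 / 2)\<bar>"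
          unfolding right_diff_distrib[symmetric] abs_mult by simp
        show ?thesis unfolding B using A y by (rule order_trans)
      qed
      show "err n x \<le> L1 n / (2 * pi) + 1 / sqrt (var n)"
        using 1 2 unfolding err_def w_def[symmetric] k_def[symmetric] by linarith
    qed
  qed
  have "(\<lambda>n. SUP x. err n x) \<longlonglongrightarrow> 0"
  proof (rule tendsto_sandwich[of "\<lambda>_. 0" _ _ "\<lambda>n. L1 n / (2 * pi) + 1 / sqrt (var n)"])
    show "\<forall>\<^sub>F n in sequentially. (SUP x. err n x) \<le> L1 n / (2 * pi) + 1 / sqrt (var n)"
      using bnd by eventually_elim (auto intro!: cSUP_least)
    show "\<forall>\<^sub>F n in sequentially. 0 \<le> (SUP x. err n x)"
      using bnd
    proof eventually_elim
      case (elim n)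
      have "0 \<le> err n 0" by (simp add: err_def)
      also have "\<dots> \<le> (SUP x. err n x)" by (rule cSUP_upper) (use elim in \<open>auto intro!: bdd_aboveI2\<close>)
      finally show ?case .
    qed
    have "(\<lambda>n. 1 / sqrt (var n)) \<longlonglongrightarrow> 0"
      by (intro tendsto_divide_0[OF tendsto_const] filterlim_at_top_imp_at_infinity filterlim_compose[OF sqrt_at_top var_at_top])
    from tendsto_add[OF tendsto_divide[OF L1_lim tendsto_const, of "2 * pi"] this]
    show "(\<lambda>n. L1 n / (2 * pi) + 1 / sqrt (var n)) \<longlonglongrightarrow> 0" by simp
  qed auto
  thus ?thesis unfolding err_def .
qed

end

section \<open>The dominant root and its derivatives\<close>

lemma block_count_poly: "(\<Sum>b\<in>sized_blocks t n. (v::real) ^ descents t b) = (\<Sum>j\<le>n. block_count t n j * v ^ j)"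
proof -
  have "complex_of_real (\<Sum>b\<in>sized_blocks t n. v ^ descents t b) = block_poly t n (of_real v)"
    by (simp add: block_poly_def)
  also have "\<dots> = complex_of_real (\<Sum>j\<le>n. block_count t n j * v ^ j)" by (simp add: block_poly_counts)
  finally show ?thesis by (simp only: of_real_eq_iff)
qed

lemma block_count_pos: "b \<in> blocks t \<Longrightarrow> block_count t (sum_list b) (descents t b) > 0"
proof -
  assume b: "b \<in> blocks t"
  have "finite {l \<in> sized_blocks t (sum_list b). descents t l = descents t b}"
    by (rule finite_subset[OF _ finite_sized_blocks[of t "sum_list b"]]) auto
  thus ?thesis using b unfolding block_count_def by (auto simp: card_gt_0_iff sized_blocks_def)
qed

text \<open>The blocks [1] and [2,1], together with [2,2,1] when t = 2, already exclude a common rotation.\<close>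
lemma blocks_aperiodic:
  assumes t: "t \<ge> 2" and \<rho>: "\<rho> > 0" and v: "norm v = 1"
    and *: "\<And>n j. j \<le> n \<Longrightarrow> block_count t n j > 0 \<Longrightarrow> q ^ n * v ^ j = complex_of_real \<rho> ^ n"
  shows "q = of_real \<rho> \<and> v = 1"
proof -
  have B: "q ^ sum_list b * v ^ descents t b = of_real \<rho> ^ sum_list b" if "b \<in> blocks t" for b
    using that descents_le_sum by (intro * block_count_pos) (auto simp: blocks_def)
  have 1: "q * v = of_real \<rho>" using B[of "[1]"] by (simp add: blocks_def)
  have 2: "q ^ 3 * v ^ descents t [2,1] = of_real \<rho> ^ 3" using B[of "[2,1]"] t by (simp add: blocks_def eval_nat_numeral)
  define r where "r = complex_of_real \<rho>"
  have r: "r = q * v" using 1 by (simp add: r_def)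
  have cancel: "a = b" if "a * r ^ k = b * r ^ k" for a b k
    using that \<rho> by (simp add: r_def)
  have "q = of_real \<rho>"
  proof (cases "t = 2")
    case True
    have 3: "q ^ 5 * v ^ 2 = of_real \<rho> ^ 5" using B[of "[2,2,1]"] True by (simp add: blocks_def eval_nat_numeral)
    have h2: "q ^ 3 * v = of_real \<rho> ^ 3" using 2 True by simp
    have "q ^ 3 * r\<^sup>2 = q ^ 5 * v ^ 2" unfolding r by (simp add: eval_nat_numeral mult_ac)
    also have "\<dots> = r ^ 3 * r\<^sup>2" using 3 by (simp add: r_def flip: power_add)
    finally have "q ^ 3 * r\<^sup>2 = r ^ 3 * r\<^sup>2" .
    hence q3: "q ^ 3 = r ^ 3" using cancel by blast
    have "q\<^sup>2 * r ^ 1 = q ^ 3 * v" unfolding r by (simp add: eval_nat_numeral mult_ac)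
    also have "\<dots> = r\<^sup>2 * r ^ 1" using h2 by (simp add: r_def eval_nat_numeral mult_ac)
    finally have "q\<^sup>2 * r ^ 1 = r\<^sup>2 * r ^ 1" .
    hence q2: "q\<^sup>2 = r\<^sup>2" using cancel by blast
    have "q * q\<^sup>2 = r * r\<^sup>2" using q3 by (simp add: eval_nat_numeral)
    hence "q * r\<^sup>2 = r * r\<^sup>2" unfolding q2 .
    thus ?thesis using cancel unfolding r_def by blast
  next
    case False
    hence h: "descents t [2,1] = 2" using t by simp
    have "q ^ 3 * v ^ 2 = r ^ 3" using 2 unfolding h r_def .
    moreover have "q * r\<^sup>2 = q ^ 3 * v ^ 2" unfolding r by (simp add: eval_nat_numeral mult_ac)
    ultimately have "q * r\<^sup>2 = r * r\<^sup>2" by (simp add: eval_nat_numeral)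
    thus ?thesis using cancel unfolding r_def by blast
  qed
  thus ?thesis using 1 \<rho> by simp
qed

lemma blocks_renewal:
  assumes t: "t \<ge> 2" and \<rho>: "\<rho> \<in> {1/2..0.6}" and root: "block_gf t \<rho> 1 (1::real) = 1"
  shows "renewal (block_count t) Rmax Vmax \<rho>"
proof
  show "block_count t n j \<ge> 0" for n j by (simp add: block_count_def)
  have "sum_list b \<ge> 1" if "b \<in> blocks t" for b
    using that rpath_last[of t b] rpath_nonempty[of t b] member_le_sum_list[of 1 b] last_in_set[of b] by (auto simp: blocks_def)
  hence "sum_list b \<noteq> 0" if "b \<in> blocks t" for b using that by (metis not_one_le_zero)
  hence "sized_blocks t 0 = {}" unfolding sized_blocks_def by blast
  thus "block_count t 0 0 = 0" by (simp add: block_count_def)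
  show "1 < Vmax" "0 < \<rho>" "\<rho> < Rmax" using \<rho> by (auto simp: Vmax_def Rmax_def)
  show "summable (\<lambda>n. (\<Sum>j\<le>n. block_count t n j * Vmax ^ j) * Rmax ^ n)"
    using block_gf_infsum(2)[of Rmax Vmax t] kappa by (simp add: block_count_poly sums_iff)
  show "(\<Sum>n. (\<Sum>j\<le>n. block_count t n j) * \<rho> ^ n) = 1"
    using block_gf_infsum(2)[of \<rho> 1 t] \<rho> root kappa block_count_poly[of 1 t] by (simp add: Rmax_def sums_iff)
  show "q = of_real \<rho> \<and> v = 1" if "norm v = 1" "\<And>n j. j \<le> n \<Longrightarrow> block_count t n j > 0 \<Longrightarrow> q ^ n * v ^ j = complex_of_real \<rho> ^ n" for v q
    using blocks_aperiodic[OF t _ that] \<rho> by simp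
qed

lemma renewal_C_block_gf:
  assumes "renewal (block_count t) Rmax Vmax \<rho>" "norm q \<le> Rmax" "norm v \<le> Vmax"
  shows "renewal.C (block_count t) q v = block_gf t q v 1"
proof -
  interpret renewal "block_count t" Rmax Vmax \<rho> by fact
  have "(\<lambda>n. cn n v * q ^ n) sums block_gf t q v 1"
    using block_gf_infsum(2)[OF assms(2,3), of t] unfolding cn_def block_poly_def[symmetric] block_poly_counts .
  thus ?thesis by (simp add: C_def sums_iff)
qed

text \<open>Value and first two derivatives at 0.\<close>
definition jet :: "(complex \<Rightarrow> complex) \<Rightarrow> real \<times> real \<times> real \<Rightarrow> bool" where
  "jet f = (\<lambda>(x, y, z). \<exists>f'. (\<forall>w\<in>ball 0 (1/124). (f has_field_derivative f' w) (at w)) \<and>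
      (f' has_field_derivative of_real z) (at 0) \<and> f 0 = of_real x \<and> f' 0 = of_real y)"

fun jadd :: "real \<times> real \<times> real \<Rightarrow> real \<times> real \<times> real \<Rightarrow> real \<times> real \<times> real" where
  "jadd (x,y,z) (x',y',z') = (x + x', y + y', z + z')"
fun jsub :: "real \<times> real \<times> real \<Rightarrow> real \<times> real \<times> real \<Rightarrow> real \<times> real \<times> real" where
  "jsub (x,y,z) (x',y',z') = (x - x', y - y', z - z')"
text \<open>Leibniz rule for a value with its first two derivatives (not Taylor coefficients, hence the factor 2).\<close>
fun jmul :: "real \<times> real \<times> real \<Rightarrow> real \<times> real \<times> real \<Rightarrow> real \<times> real \<times> real" where
  "jmul (x,y,z) (x',y',z') = (x * x', y * x' + x * y', z * x' + 2 * (y * y') + x * z')"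
definition jexp :: "real \<Rightarrow> real \<times> real \<times> real" where "jexp \<beta> = (1, \<beta>, \<beta> * \<beta>)"
text \<open>The jet of \<open>x / (1 - x)\<close> when \<open>x\<close> is proportional to \<open>exp (a * w)\<close>; as a function of \<open>ln x\<close> it satisfies \<open>l' = l * (1 + l)\<close>.\<close>
definition jodds :: "real \<Rightarrow> real \<Rightarrow> real \<times> real \<times> real" where
  "jodds l a = (l, a * (l * (1 + l)), a * a * (l * (1 + l) * (1 + 2 * l)))"

lemma jetI: "(\<And>w. w \<in> ball 0 (1/124) \<Longrightarrow> (f has_field_derivative f' w) (at w)) \<Longrightarrow> (f' has_field_derivative of_real z) (at 0) \<Longrightarrow>
   f 0 = of_real x \<Longrightarrow> f' 0 = of_real y \<Longrightarrow> jet f (x, y, z)"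
  unfolding jet_def prod.case by (intro exI[of _ f']) blast

lemma jet_const: "jet (\<lambda>w. of_real x) (x, 0, 0)"
  by (rule jetI[of _ "\<lambda>w. 0"]) auto

lemma jet_add: "jet f j \<Longrightarrow> jet g k \<Longrightarrow> jet (\<lambda>w. f w + g w) (jadd j k)"
proof -
  obtain x y z where j: "j = (x,y,z)" by (cases j)
  obtain x' y' z' where k: "k = (x',y',z')" by (cases k)
  assume "jet f j" "jet g k"
  then obtain f' g' where "\<forall>w\<in>ball 0 (1/124). (f has_field_derivative f' w) (at w)" "(f' has_field_derivative of_real z) (at 0)" "f 0 = of_real x" "f' 0 = of_real y"
    "\<forall>w\<in>ball 0 (1/124). (g has_field_derivative g' w) (at w)" "(g' has_field_derivative of_real z') (at 0)" "g 0 = of_real x'" "g' 0 = of_real y'"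
    unfolding jet_def j k by auto
  thus ?thesis unfolding j k jadd.simps by (intro jetI[of _ "\<lambda>w. f' w + g' w"]) (auto intro!: derivative_eq_intros)
qed

lemma jet_diff: "jet f j \<Longrightarrow> jet g k \<Longrightarrow> jet (\<lambda>w. f w - g w) (jsub j k)"
proof -
  obtain x y z where j: "j = (x,y,z)" by (cases j)
  obtain x' y' z' where k: "k = (x',y',z')" by (cases k)
  assume "jet f j" "jet g k"
  then obtain f' g' where "\<forall>w\<in>ball 0 (1/124). (f has_field_derivative f' w) (at w)" "(f' has_field_derivative of_real z) (at 0)" "f 0 = of_real x" "f' 0 = of_real y"
    "\<forall>w\<in>ball 0 (1/124). (g has_field_derivative g' w) (at w)" "(g' has_field_derivative of_real z') (at 0)" "g 0 = of_real x'" "g' 0 = of_real y'"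
    unfolding jet_def j k by auto
  thus ?thesis unfolding j k jsub.simps by (intro jetI[of _ "\<lambda>w. f' w - g' w"]) (auto intro!: derivative_eq_intros)
qed

lemma jet_mult: "jet f j \<Longrightarrow> jet g k \<Longrightarrow> jet (\<lambda>w. f w * g w) (jmul j k)"
proof -
  obtain x y z where j: "j = (x,y,z)" by (cases j)
  obtain x' y' z' where k: "k = (x',y',z')" by (cases k)
  assume "jet f j" "jet g k"
  then obtain f' g' where *: "\<forall>w\<in>ball 0 (1/124). (f has_field_derivative f' w) (at w)" "(f' has_field_derivative of_real z) (at 0)" "f 0 = of_real x" "f' 0 = of_real y"
    "\<forall>w\<in>ball 0 (1/124). (g has_field_derivative g' w) (at w)" "(g' has_field_derivative of_real z') (at 0)" "g 0 = of_real x'" "g' 0 = of_real y'"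
    unfolding jet_def j k by auto
  have f0: "(f has_field_derivative of_real y) (at 0)" "(g has_field_derivative of_real y') (at 0)"
    using bspec[OF *(1), of 0] bspec[OF *(5), of 0] * by auto
  have d: "((\<lambda>w. f' w * g w + f w * g' w) has_field_derivative of_real (z * x' + 2 * (y * y') + x * z')) (at 0)"
    by (rule derivative_eq_intros *(2,6) f0 refl)+ (use * in \<open>simp add: algebra_simps\<close>)
  show ?thesis unfolding j k jmul.simps
    by (rule jetI[of _ "\<lambda>w. f' w * g w + f w * g' w", OF _ d]) (use * in \<open>auto intro!: derivative_eq_intros\<close>)
qed

lemma jet_exp: "jet (\<lambda>w. exp (of_real \<beta> * w)) (jexp \<beta>)"
  unfolding jexp_def by (rule jetI[of _ "\<lambda>w. of_real \<beta> * exp (of_real \<beta> * w)"]) (auto intro!: derivative_eq_intros)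

lemma jet_odds:
  assumes "\<And>w::complex. w \<in> ball 0 (1/124) \<Longrightarrow> of_real \<xi> * exp (of_real a * w) \<noteq> 1"
  shows "jet (\<lambda>w. of_real \<xi> * exp (of_real a * w) / (1 - of_real \<xi> * exp (of_real a * w))) (jodds (\<xi> / (1 - \<xi>)) a)"
proof -
  define L where "L w = of_real \<xi> * exp (of_real a * w) / (1 - of_real \<xi> * exp (of_real a * w))" for w :: complex
  have L': "(L has_field_derivative of_real a * (L w * (1 + L w))) (at w)" if "w \<in> ball 0 (1/124)" for w
  proof -
    have nz: "1 - of_real \<xi> * exp (of_real a * w) \<noteq> 0" using assms[OF that] by auto
    show ?thesis unfolding L_def using nz
      by (auto intro!: derivative_eq_intros simp: divide_simps) (simp add: algebra_simps)
  qed
  define l where "l = \<xi> / (1 - \<xi>)"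
  have L0: "L 0 = of_real l" by (simp add: L_def l_def)
  have L'0: "(L has_field_derivative of_real a * (of_real l * (1 + of_real l))) (at 0)" using L'[of 0] L0 by simp
  have "((\<lambda>w. of_real a * (L w * (1 + L w))) has_field_derivative of_real (a * a * (l * (1 + l) * (1 + 2 * l)))) (at 0)"
    by (rule derivative_eq_intros L'0 refl)+ (simp add: L0 algebra_simps)
  thus ?thesis unfolding jodds_def L_def[symmetric] l_def[symmetric] by (intro jetI[OF L']) (auto simp: L0)
qed

lemma jet_holo: "jet f j \<Longrightarrow> f holomorphic_on ball 0 (1/124)"
  unfolding jet_def by (auto simp: holomorphic_on_open field_differentiable_def split: prod.splits)

lemma jet_derivs: "jet f (x, y, z) \<Longrightarrow> f 0 = of_real x \<and> deriv f 0 = of_real y \<and> (deriv ^^ 2) f 0 = of_real z"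
proof -
  assume "jet f (x, y, z)"
  then obtain f' where f: "\<forall>w\<in>ball 0 (1/124). (f has_field_derivative f' w) (at w)" "(f' has_field_derivative of_real z) (at 0)" "f 0 = of_real x" "f' 0 = of_real y"
    unfolding jet_def by auto
  have "eventually (\<lambda>w. deriv f w = f' w) (nhds 0)"
  proof (rule eventually_mono)
    show "eventually (\<lambda>w. w \<in> ball (0::complex) (1/124)) (nhds 0)" by (rule eventually_nhds_in_open) auto
    show "deriv f w = f' w" if "w \<in> ball 0 (1/124)" for w using f(1) that DERIV_imp_deriv by blast
  qed
  hence "deriv (deriv f) 0 = deriv f' 0" by (rule deriv_cong_ev) simp
  moreover have "deriv f 0 = f' 0" using f(1) by (intro DERIV_imp_deriv) auto
  ultimately show ?thesis using f DERIV_imp_deriv[OF f(2)] by (simp add: numeral_2_eq_2)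
qed

text \<open>The exponents 1, 1 + t, 1 + t + t^2, ...\<close>
primrec ge :: "nat \<Rightarrow> nat \<Rightarrow> nat" where
  "ge t 0 = 1" | "ge t (Suc j) = 1 + t * ge t j"

lemma ge_pos: "ge t j \<ge> 1" by (cases j) auto

definition lo :: "nat \<Rightarrow> real \<Rightarrow> nat \<Rightarrow> real" where "lo t \<rho> j = \<rho> ^ ge t j / (1 - \<rho> ^ ge t j)"

text \<open>Partial sums and running products of the kernel series, as jets along \<open>q = \<rho> * exp (\<alpha> * w)\<close>, \<open>v = exp (\<beta> * w)\<close>.\<close>
primrec kjet :: "nat \<Rightarrow> real \<Rightarrow> real \<Rightarrow> real \<Rightarrow> nat \<Rightarrow> (real \<times> real \<times> real) \<times> (real \<times> real \<times> real)" where
  "kjet t \<rho> \<alpha> \<beta> 0 = ((0,0,0), (1,0,0))"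
| "kjet t \<rho> \<alpha> \<beta> (Suc J) = (let vl = jmul (jexp \<beta>) (jodds (lo t \<rho> J) (\<alpha> * real (ge t J))) in
     (jadd (fst (kjet t \<rho> \<alpha> \<beta> J)) (jmul (snd (kjet t \<rho> \<alpha> \<beta> J)) vl),
      jmul (snd (kjet t \<rho> \<alpha> \<beta> J)) (jsub (jsub (1,0,0) (jexp \<beta>)) vl)))"

definition cbar :: "nat \<Rightarrow> nat \<Rightarrow> real" where "cbar t j = (0.0082 + 0.605 ^ ge t j) / (1 - 0.605 ^ ge t j)"
text \<open>Bounds the remainder on \<open>\<bar>w\<bar> \<le> 1 / 124\<close>, where \<open>\<bar>q\<bar> \<le> 0.605\<close> and \<open>\<bar>v\<bar> \<le> 1.0082\<close>.\<close>
definition tail_bound :: "nat \<Rightarrow> nat \<Rightarrow> real" where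
  "tail_bound t J = 10 * 0.605 ^ (ge t J - 1) * (\<Prod>j<J. cbar t j)"

primrec kern :: "nat \<Rightarrow> complex \<Rightarrow> complex \<Rightarrow> nat \<Rightarrow> complex \<times> complex \<times> complex" where
  "kern t q v 0 = (0, 0, 1)"
| "kern t q v (Suc J) = (case kern t q v J of (a, b, p) \<Rightarrow> let x = q ^ ge t J; l = x / (1 - x) in
     (a + p * (v * x), b + p * (v * l), p * (1 - v - v * l)))"

text \<open>The functional equation applied \<open>J\<close> times. The second component is the kernel sum; the first one only
enters the cofactor of \<open>1 - C\<close>.\<close>
lemma kern_identity:
  assumes "norm q \<le> Rmax" "norm v \<le> Vmax" "t \<ge> 2"
  shows "case kern t q v J of (a, b, p) \<Rightarrow> block_gf t q v 1 = (1 - block_gf t q v 1) * a + block_gf t q v 1 * b + p * block_gf t q v (q ^ (ge t J - 1))"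
proof (induction J)
  case (Suc J)
  obtain a b p where k: "kern t q v J = (a, b, p)" by (cases "kern t q v J")
  have q1: "norm q < 1" using assms kappa by simp
  define x where "x = q ^ ge t J"
  have nx: "norm x < 1" using q1 ge_pos[of t J] unfolding x_def norm_power by (simp add: power_Suc_less_one power_less_one_iff)
  hence x1: "x \<noteq> 1" by auto
  have u: "norm (q ^ (ge t J - 1)) \<le> 1" using q1 by (simp add: norm_power power_le_one)
  have qu: "q * q ^ (ge t J - 1) = x" unfolding x_def using ge_pos[of t J] by (simp flip: power_Suc)
  have xt: "x ^ t = q ^ (ge t (Suc J) - 1)" by (simp add: x_def power_mult[symmetric] mult.commute)
  define l where "l = x / (1 - x)"
  define G where "G = block_gf t q v 1"
  define R where "R = block_gf t q v (q ^ (ge t (Suc J) - 1))"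
  have e1: "block_gf t q v (q ^ (ge t J - 1)) = v * x + v / (1 - x) * x\<^sup>2 * G + (1 - v / (1 - x)) * R"
    using block_gf_functional[OF assms(1,2) u assms(3)] unfolding qu xt G_def R_def .
  have e2: "v / (1 - x) * x\<^sup>2 = v * l - v * x" using x1 unfolding l_def by (simp add: divide_simps power2_eq_square) (simp add: algebra_simps)
  have e3: "1 - v / (1 - x) = 1 - v - v * l" using x1 unfolding l_def by (simp add: divide_simps) (simp add: algebra_simps)
  have "G = (1 - G) * a + G * b + p * (v * x + (v * l - v * x) * G + (1 - v - v * l) * R)"
    using Suc unfolding k prod.case e1 unfolding G_def[symmetric] e2 e3 .
  hence "G = (1 - G) * (a + p * (v * x)) + G * (b + p * (v * l)) + p * (1 - v - v * l) * R" by algebra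
  thus ?case unfolding kern.simps k prod.case Let_def x_def[symmetric] l_def[symmetric] G_def[symmetric] R_def[symmetric] .
qed simp

lemma kern_p_bound:
  assumes "norm q \<le> 0.605" "norm (v - 1) \<le> 0.0082"
  shows "norm (snd (snd (kern t q v J))) \<le> (\<Prod>j<J. cbar t j)"
proof (induction J)
  case (Suc J)
  obtain a b p where k: "kern t q v J = (a, b, p)" by (cases "kern t q v J")
  define x where "x = q ^ ge t J"
  have x: "norm x \<le> 0.605 ^ ge t J" unfolding x_def norm_power using assms by (intro power_mono) auto
  have y: "(0.605::real) ^ ge t J < 1" using ge_pos[of t J] by (intro power_less_one_iff[THEN iffD2]) auto
  hence x1: "x \<noteq> 1" using x by auto
  have "1 - v - v * (x / (1 - x)) = - (x + (v - 1)) / (1 - x)" using x1 by (simp add: divide_simps) (simp add: algebra_simps)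
  hence "norm (1 - v - v * (x / (1 - x))) = norm (x + (v - 1)) / norm (1 - x)" by (simp only: norm_divide norm_minus_cancel)
  also have "\<dots> \<le> cbar t J" unfolding cbar_def
  proof (rule frac_le)
    show "norm (x + (v - 1)) \<le> 0.0082 + 0.605 ^ ge t J" using norm_triangle_ineq[of x "v - 1"] x assms by linarith
    show "1 - 0.605 ^ ge t J \<le> norm (1 - x)" using norm_triangle_ineq2[of 1 x] x by simp
  qed (use y in auto)
  finally have "norm (1 - v - v * (x / (1 - x))) \<le> cbar t J" .
  with Suc show ?case unfolding k kern.simps prod.case Let_def x_def[symmetric]
    by (simp add: norm_mult k) (intro mult_mono, auto intro: order_trans[OF norm_ge_zero])
qed simp

lemma kern_jets:
  assumes "0 < \<rho>" "\<rho> \<le> 0.6" "\<bar>\<alpha>\<bar> \<le> 1" 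
    and q: "\<And>w::complex. w \<in> ball 0 (1/124) \<Longrightarrow> norm (of_real \<rho> * exp (of_real \<alpha> * w)) \<le> 0.605"
  shows "jet (\<lambda>w. fst (snd (kern t (of_real \<rho> * exp (of_real \<alpha> * w)) (exp (of_real \<beta> * w)) J))) (fst (kjet t \<rho> \<alpha> \<beta> J)) \<and>
         jet (\<lambda>w. snd (snd (kern t (of_real \<rho> * exp (of_real \<alpha> * w)) (exp (of_real \<beta> * w)) J))) (snd (kjet t \<rho> \<alpha> \<beta> J)) \<and>
         (\<lambda>w. fst (kern t (of_real \<rho> * exp (of_real \<alpha> * w)) (exp (of_real \<beta> * w)) J)) holomorphic_on ball 0 (1/124)"
proof (induction J)
  case 0
  show ?case using jet_const[of 0] jet_const[of 1] by auto
next
  case (Suc J)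
  let ?q = "\<lambda>w. of_real \<rho> * exp (of_real \<alpha> * w) :: complex"
  let ?v = "\<lambda>w. exp (of_real \<beta> * w) :: complex"
  define x where "x w = ?q w ^ ge t J" for w
  have x_eq: "x w = of_real (\<rho> ^ ge t J) * exp (of_real (\<alpha> * real (ge t J)) * w)" for w
    by (simp add: x_def power_mult_distrib exp_of_nat_mult[symmetric] mult_ac)
  have xn1: "x w \<noteq> 1" if "w \<in> ball 0 (1/124)" for w
  proof -
    have "norm (x w) \<le> 0.605 ^ ge t J" unfolding x_def norm_power using q[OF that] by (intro power_mono) auto
    also have "\<dots> < 1" using ge_pos[of t J] by (intro power_less_one_iff[THEN iffD2]) auto
    finally show ?thesis by auto
  qed
  have vl: "jet (\<lambda>w. ?v w * (x w / (1 - x w))) (jmul (jexp \<beta>) (jodds (lo t \<rho> J) (\<alpha> * real (ge t J))))"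
    unfolding lo_def x_eq by (intro jet_mult jet_exp jet_odds) (rule xn1[unfolded x_eq])
  have xh: "x holomorphic_on ball 0 (1/124)" unfolding x_def by (intro holomorphic_intros)
  have one: "jet (\<lambda>w. 1) (1, 0, 0)" using jet_const[of 1] by simp
  have S: "kern t (?q w) (?v w) (Suc J) = 
     (fst (kern t (?q w) (?v w) J) + snd (snd (kern t (?q w) (?v w) J)) * (?v w * x w),
      fst (snd (kern t (?q w) (?v w) J)) + snd (snd (kern t (?q w) (?v w) J)) * (?v w * (x w / (1 - x w))),
      snd (snd (kern t (?q w) (?v w) J)) * (1 - ?v w - ?v w * (x w / (1 - x w))))" for w
    by (simp add: x_def Let_def split: prod.splits)
  have IH: "jet (\<lambda>w. fst (snd (kern t (?q w) (?v w) J))) (fst (kjet t \<rho> \<alpha> \<beta> J))" "jet (\<lambda>w. snd (snd (kern t (?q w) (?v w) J))) (snd (kjet t \<rho> \<alpha> \<beta> J))"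
     "(\<lambda>w. fst (kern t (?q w) (?v w) J)) holomorphic_on ball 0 (1/124)" using Suc by auto
  show ?case unfolding S fst_conv snd_conv kjet.simps Let_def
    by (intro conjI jet_add jet_mult jet_diff vl one jet_exp IH holomorphic_intros xh jet_holo[OF IH(2)])
qed

lemma exp_small_disc: "norm w \<le> 1/124 \<Longrightarrow> \<bar>\<beta>\<bar> \<le> 1 \<Longrightarrow> norm (exp (of_real \<beta> * w)) \<le> 1.0082 \<and> norm (exp (of_real \<beta> * w) - 1) \<le> 0.0082"
  for w :: complex
proof -
  have e1: "exp (1/124::real) \<le> 1.00814" using exp_bound[of "1/124::real"] by (simp add: power2_eq_square)
  have n: "norm (exp z) \<le> 1.00814" if "norm z \<le> 1/124" for z :: complex
  proof -
    have "Re z \<le> 1/124" using complex_Re_le_cmod[of z] that by linarith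
    hence "exp (Re z) \<le> exp (1/124)" by (simp only: exp_le_cancel_iff)
    hence "exp (Re z) \<le> 1.00814" using e1 by (rule order_trans)
    thus ?thesis by (simp only: norm_exp_eq_Re)
  qed
  assume "norm w \<le> 1/124" "\<bar>\<beta>\<bar> \<le> 1"
  hence z: "norm (of_real \<beta> * w) \<le> 1/124" unfolding norm_mult norm_of_real using mult_mono[of "\<bar>\<beta>\<bar>" 1 "norm w" "1/124"] by simp
  have "norm (exp (of_real \<beta> * w) - exp 0) \<le> 1.00814 * norm (of_real \<beta> * w - 0)"
    by (rule field_differentiable_bound[of "cball 0 (1/124)" exp exp]) (use n z in \<open>auto intro!: derivative_eq_intros\<close>)
  also have "\<dots> \<le> 1.00814 * (1/124)" using z by (intro mult_left_mono) auto
  finally show ?thesis using n[OF z] by simp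
qed

text \<open>The constants 125 and \<open>31250 = 2 * 125\<^sup>2\<close> are the Cauchy estimates for the first two derivatives on discs of
radius \<open>1 / 125\<close>.\<close>
theorem curve_equations:
  fixes t J :: nat and \<rho> :: real
  assumes t: "t \<ge> 2" and \<rho>: "\<rho> \<in> {1/2..0.6}" and ren: "renewal (block_count t) Rmax Vmax \<rho>"
  defines "\<mu> \<equiv> renewal.mu (block_count t) \<rho>" and "\<sigma>2 \<equiv> renewal.sigma2 (block_count t) \<rho>" and "\<epsilon> \<equiv> tail_bound t J"
  assumes B: "fst (kjet t \<rho> (-\<mu>) 1 J) = (B0, B1, B2)" and C: "fst (kjet t \<rho> 1 0 J) = (C0, C1, C2)"
  shows "0 \<le> \<mu>" "\<mu> \<le> 1" "\<bar>B0 - 1\<bar> \<le> \<epsilon>" "\<bar>B1\<bar> \<le> 125 * \<epsilon>" "\<exists>e. \<bar>e\<bar> \<le> 125 * \<epsilon> \<and> \<bar>B2 - \<sigma>2 * (C1 + e)\<bar> \<le> 31250 * \<epsilon>"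
proof -
  interpret renewal "block_count t" Rmax Vmax \<rho> by fact
  show mu: "0 \<le> \<mu>" "\<mu> \<le> 1" unfolding \<mu>_def using mu_bounds by auto
  have \<rho>0: "0 < \<rho>" "\<rho> \<le> 0.6" using \<rho> by auto
  have curve: "\<exists>W N. (\<forall>w\<in>ball 0 (1/124). (1 - C (of_real \<rho> * exp (of_real \<alpha> * w)) (exp (of_real \<beta> * w))) * N w = 1 - W w) \<and>
      W holomorphic_on ball 0 (1/124) \<and> N holomorphic_on ball 0 (1/124) \<and> (\<lambda>w. C (of_real \<rho> * exp (of_real \<alpha> * w)) (exp (of_real \<beta> * w))) holomorphic_on ball 0 (1/124) \<and>
      \<bar>x - Re (W 0)\<bar> \<le> \<epsilon> \<and> norm (deriv W 0 - of_real y) \<le> 125 * \<epsilon> \<and> norm ((deriv ^^ 2) W 0 - of_real z) \<le> 31250 * \<epsilon> \<and>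
      N 0 = fst (kern t (of_real \<rho>) 1 J) + 1 - fst (snd (kern t (of_real \<rho>) 1 J))"
    if ab: "\<bar>\<alpha>\<bar> \<le> 1" "\<bar>\<beta>\<bar> \<le> 1" and K: "fst (kjet t \<rho> \<alpha> \<beta> J) = (x, y, z)" for \<alpha> \<beta> x y z
  proof -
    let ?q = "\<lambda>w. of_real \<rho> * exp (of_real \<alpha> * w) :: complex"
    let ?v = "\<lambda>w. exp (of_real \<beta> * w) :: complex"
    have q: "norm (?q w) \<le> 0.605" if "w \<in> ball 0 (1/124)" for w
    proof -
      have "norm (?q w) = \<rho> * norm (exp (of_real \<alpha> * w))" using \<rho>0 by (simp add: norm_mult)
      also have "\<dots> \<le> 0.6 * 1.0082" using exp_small_disc[of w \<alpha>] that ab \<rho>0 by (intro mult_mono) auto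
      finally show ?thesis by simp
    qed
    have q': "norm (?q w) \<le> Rmax" if "w \<in> ball 0 (1/124)" for w using q[OF that] by (simp add: Rmax_def)
    have v': "norm (?v w) \<le> Vmax" "norm (?v w - 1) \<le> 0.0082" if "w \<in> ball 0 (1/124)" for w
      using exp_small_disc[of w \<beta>] that ab by (auto simp: Vmax_def)
    define \<Phi> where "\<Phi> w = C (?q w) (?v w)" for w
    define a where "a w = fst (kern t (?q w) (?v w) J)" for w
    define b where "b w = fst (snd (kern t (?q w) (?v w) J))" for w
    define p where "p w = snd (snd (kern t (?q w) (?v w) J))" for w
    define \<tau> where "\<tau> w = \<Phi> w - (1 - \<Phi> w) * a w - \<Phi> w * b w" for w
    note J = kern_jets[OF \<rho>0 ab(1) q, where J = J and t = t and \<beta> = \<beta>, folded a_def b_def p_def, unfolded K]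
    have bj: "jet b (x, y, z)" and ah: "a holomorphic_on ball 0 (1/124)" using J by auto
    have bh: "b holomorphic_on ball 0 (1/124)" using bj by (rule jet_holo)
    have \<Phi>h: "\<Phi> holomorphic_on ball 0 (1/124)" unfolding \<Phi>_def
      by (intro C_holo holomorphic_intros q' v') auto
    have \<tau>h: "\<tau> holomorphic_on ball 0 (1/124)" unfolding \<tau>_def by (intro holomorphic_intros ah bh \<Phi>h)
    have \<tau>b: "norm (\<tau> w) \<le> \<epsilon>" if w: "w \<in> ball 0 (1/124)" for w
    proof -
      have "\<Phi> w = block_gf t (?q w) (?v w) 1" unfolding \<Phi>_def by (rule renewal_C_block_gf[OF ren q'[OF w] v'(1)[OF w]])
      moreover obtain a' b' p' where K': "kern t (?q w) (?v w) J = (a', b', p')" by (cases "kern t (?q w) (?v w) J")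
      ultimately have "\<Phi> w = (1 - \<Phi> w) * a w + \<Phi> w * b w + p w * block_gf t (?q w) (?v w) (?q w ^ (ge t J - 1))"
        using kern_identity[OF q'[OF w] v'(1)[OF w] t, of J] by (simp only: a_def b_def p_def K' prod.case fst_conv snd_conv)
      hence "\<tau> w = p w * block_gf t (?q w) (?v w) (?q w ^ (ge t J - 1))" unfolding \<tau>_def by algebra
      hence "norm (\<tau> w) = norm (p w) * norm (block_gf t (?q w) (?v w) (?q w ^ (ge t J - 1)))" by (simp only: norm_mult)
      also have "\<dots> \<le> (\<Prod>j<J. cbar t j) * (10 * 0.605 ^ (ge t J - 1))"
      proof (rule mult_mono)
        show pb: "norm (p w) \<le> (\<Prod>j<J. cbar t j)" unfolding p_def by (rule kern_p_bound[OF q[OF w] v'(2)[OF w]])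
        have "norm (?q w ^ (ge t J - 1)) \<le> 0.605 ^ (ge t J - 1)" unfolding norm_power[of "_ * _"] using q[OF w] by (intro power_mono) auto
        moreover have "(0.605::real) ^ (ge t J - 1) \<le> 1" by (intro power_le_one) auto
        ultimately show "norm (block_gf t (?q w) (?v w) (?q w ^ (ge t J - 1))) \<le> 10 * 0.605 ^ (ge t J - 1)"
          using block_gf_bound[OF q'[OF w] v'(1)[OF w], of "?q w ^ (ge t J - 1)" t] by linarith
        show "0 \<le> (\<Prod>j<J. cbar t j)" using pb norm_ge_zero order_trans by blast
      qed auto
      finally show ?thesis by (simp add: \<epsilon>_def tail_bound_def mult_ac)
    qed
    have cauchy: "norm ((deriv ^^ k) \<tau> 0) \<le> fact k * \<epsilon> / (1/125) ^ k" for k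
    proof (rule Cauchy_inequality)
      show "\<tau> holomorphic_on ball 0 (1/125)" by (rule holomorphic_on_subset[OF \<tau>h]) auto
      show "continuous_on (cball 0 (1/125)) \<tau>"
        by (rule continuous_on_subset[OF holomorphic_on_imp_continuous_on[OF \<tau>h]]) auto
    qed (use \<tau>b in auto)
    define W where "W w = b w + \<tau> w" for w
    define N where "N w = a w + 1 - b w" for w
    have Wh: "W holomorphic_on ball 0 (1/124)" "N holomorphic_on ball 0 (1/124)"
      unfolding W_def N_def by (intro holomorphic_intros ah bh \<tau>h)+
    have dW: "(deriv ^^ k) W 0 = (deriv ^^ k) b 0 + (deriv ^^ k) \<tau> 0" for k
      unfolding W_def by (rule higher_deriv_add[OF bh \<tau>h]) auto
    note bd = jet_derivs[OF bj]
    show ?thesis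
    proof (rule exI[of _ W], rule exI[of _ N], intro conjI ballI)
      show "(1 - C (?q w) (?v w)) * N w = 1 - W w" for w
        unfolding \<Phi>_def[symmetric] W_def N_def \<tau>_def by (simp add: algebra_simps)
      have "norm (\<tau> 0) \<le> \<epsilon>" using \<tau>b[of 0] by simp
      thus "\<bar>x - Re (W 0)\<bar> \<le> \<epsilon>" using bd abs_Re_le_cmod[of "\<tau> 0"] by (simp add: W_def)
      show "norm (deriv W 0 - of_real y) \<le> 125 * \<epsilon>" using dW[of 1] bd cauchy[of 1] by simp
      show "norm ((deriv ^^ 2) W 0 - of_real z) \<le> 31250 * \<epsilon>" using dW[of 2] bd cauchy[of 2] by (simp add: fact_2 power2_eq_square)
      show "N 0 = fst (kern t (of_real \<rho>) 1 J) + 1 - fst (snd (kern t (of_real \<rho>) 1 J))" by (simp add: N_def a_def b_def)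
    qed (use Wh \<Phi>h in \<open>auto simp: \<Phi>_def[abs_def]\<close>)
  qed
  have ab: "\<bar>- \<mu>\<bar> \<le> 1" "\<bar>1::real\<bar> \<le> 1" "\<bar>0::real\<bar> \<le> 1" using mu by auto
  define \<Phi>1 where "\<Phi>1 = (\<lambda>w. C (of_real \<rho> * exp (of_real (- \<mu>) * w)) (exp (of_real 1 * w)))"
  define \<Phi>2 where "\<Phi>2 = (\<lambda>w. C (of_real \<rho> * exp (of_real 1 * w)) (exp (of_real 0 * w)))"
  obtain W1 N1 where 1: "\<forall>w\<in>ball 0 (1/124). (1 - \<Phi>1 w) * N1 w = 1 - W1 w" "W1 holomorphic_on ball 0 (1/124)" "N1 holomorphic_on ball 0 (1/124)" "\<Phi>1 holomorphic_on ball 0 (1/124)"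
      "\<bar>B0 - Re (W1 0)\<bar> \<le> \<epsilon>" "norm (deriv W1 0 - of_real B1) \<le> 125 * \<epsilon>" "norm ((deriv ^^ 2) W1 0 - of_real B2) \<le> 31250 * \<epsilon>"
      "N1 0 = fst (kern t (of_real \<rho>) 1 J) + 1 - fst (snd (kern t (of_real \<rho>) 1 J))"
    using curve[OF ab(1,2) B] unfolding \<Phi>1_def by blast
  obtain W2 N2 where 2: "\<forall>w\<in>ball 0 (1/124). (1 - \<Phi>2 w) * N2 w = 1 - W2 w" "W2 holomorphic_on ball 0 (1/124)" "N2 holomorphic_on ball 0 (1/124)" "\<Phi>2 holomorphic_on ball 0 (1/124)"
      "norm (deriv W2 0 - of_real C1) \<le> 125 * \<epsilon>"
      "N2 0 = fst (kern t (of_real \<rho>) 1 J) + 1 - fst (snd (kern t (of_real \<rho>) 1 J))"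
    using curve[OF ab(2,3) C] unfolding \<Phi>2_def by blast
  have \<Phi>10: "\<Phi>1 0 = 1" "\<Phi>2 0 = 1" using C_rho0 by (auto simp: \<Phi>1_def \<Phi>2_def)
  have \<Phi>1d: "deriv \<Phi>1 0 = 0" "(deriv ^^ 2) \<Phi>1 0 = of_real (\<sigma>2 * EN)"
    using centred_derivs(1,2) by (simp_all add: \<Phi>1_def \<mu>_def \<sigma>2_def)
  have \<Phi>2d: "deriv \<Phi>2 0 = of_real EN" using size_deriv by (simp add: \<Phi>2_def)
  have expand: "deriv W 0 = deriv \<Phi> 0 * N 0 \<and> (deriv \<Phi> 0 = 0 \<longrightarrow> (deriv ^^ 2) W 0 = (deriv ^^ 2) \<Phi> 0 * N 0)"
    if h: "\<forall>w\<in>ball 0 (1/124). (1 - \<Phi> w) * N w = 1 - W w" "N holomorphic_on ball 0 (1/124)" "\<Phi> holomorphic_on ball 0 (1/124)" "\<Phi> 0 = 1" for \<Phi> N W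
  proof -
    define f' where "f' w = deriv \<Phi> w * N w - (1 - \<Phi> w) * deriv N w" for w
    have D: "(\<Phi> has_field_derivative deriv \<Phi> w) (at w)" "(N has_field_derivative deriv N w) (at w)"
       "(deriv \<Phi> has_field_derivative deriv (deriv \<Phi>) w) (at w)" "(deriv N has_field_derivative deriv (deriv N) w) (at w)" if "w \<in> ball 0 (1/124)" for w
      using that h(2,3) by (auto intro!: holomorphic_derivI[of _ "ball 0 (1/124)"] holomorphic_deriv)
    have z0: "(0::complex) \<in> ball 0 (1/124)" by simp
    have Wd0: "((\<lambda>w. 1 - (1 - \<Phi> w) * N w) has_field_derivative f' w) (at w)" if "w \<in> ball 0 (1/124)" for w
      unfolding f'_def by (rule derivative_eq_intros D[OF that] refl)+ (simp add: algebra_simps)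
    have Wd: "(W has_field_derivative f' w) (at w)" if "w \<in> ball 0 (1/124)" for w
      by (rule has_field_derivative_transform_within_open[OF Wd0[OF that] open_ball that]) (simp add: bspec[OF h(1)])
    have "eventually (\<lambda>w. deriv W w = f' w) (nhds 0)"
    proof (rule eventually_mono)
      show "eventually (\<lambda>w. w \<in> ball (0::complex) (1/124)) (nhds 0)" by (rule eventually_nhds_in_open) auto
      show "deriv W w = f' w" if "w \<in> ball 0 (1/124)" for w using Wd[OF that] DERIV_imp_deriv by blast
    qed
    hence "deriv (deriv W) 0 = deriv f' 0" by (rule deriv_cong_ev) simp
    moreover have "(f' has_field_derivative (deriv (deriv \<Phi>) 0 * N 0 + 2 * deriv \<Phi> 0 * deriv N 0)) (at 0)"
      unfolding f'_def by (rule derivative_eq_intros D[OF z0] refl)+ (use h(4) in \<open>simp add: algebra_simps\<close>)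
    ultimately show ?thesis using DERIV_imp_deriv DERIV_imp_deriv[OF Wd[of 0]] h(4) by (auto simp: f'_def numeral_2_eq_2)
  qed
  note X1 = expand[OF 1(1,3,4) \<Phi>10(1)] and X2 = expand[OF 2(1,3,4) \<Phi>10(2)]
  have "W1 0 = 1" using bspec[OF 1(1), of 0] \<Phi>10 by simp
  thus "\<bar>B0 - 1\<bar> \<le> \<epsilon>" using 1(5) by simp
  have "norm (of_real B1 :: complex) \<le> 125 * \<epsilon>" using X1 \<Phi>1d(1) 1(6) by (simp add: norm_minus_commute)
  thus "\<bar>B1\<bar> \<le> 125 * \<epsilon>" by simp
  define d where "d = deriv W2 0"
  have "(deriv ^^ 2) W1 0 = of_real \<sigma>2 * d" using X1 X2 \<Phi>1d \<Phi>2d 1(8) 2(6) by (simp add: d_def mult_ac)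
  hence b2: "norm (of_real \<sigma>2 * d - of_real B2) \<le> 31250 * \<epsilon>" using 1(7) by simp
  have "Re (of_real \<sigma>2 * d - of_real B2) = \<sigma>2 * Re d - B2" by simp
  hence "\<bar>B2 - \<sigma>2 * Re d\<bar> \<le> 31250 * \<epsilon>" using b2 abs_Re_le_cmod[of "of_real \<sigma>2 * d - of_real B2"] by linarith
  moreover have "\<bar>Re d - C1\<bar> \<le> 125 * \<epsilon>" using 2(5) abs_Re_le_cmod[of "d - of_real C1"] by (simp add: d_def)
  ultimately show "\<exists>e. \<bar>e\<bar> \<le> 125 * \<epsilon> \<and> \<bar>B2 - \<sigma>2 * (C1 + e)\<bar> \<le> 31250 * \<epsilon>"
    by (intro exI[of _ "Re d - C1"]) simp
qed

section \<open>Interval arithmetic for small arity\<close>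

text \<open>Fixed-point interval arithmetic with 44 fractional bits.\<close>
type_synonym iv = "int \<times> int"

definition ulp :: int where "ulp = 17592186044416"

definition mem :: "real \<Rightarrow> iv \<Rightarrow> bool" where
  "mem x i \<longleftrightarrow> of_int (fst i) \<le> x * of_int ulp \<and> x * of_int ulp \<le> of_int (snd i)"

definition iadd :: "iv \<Rightarrow> iv \<Rightarrow> iv" where "iadd i j = (fst i + fst j, snd i + snd j)"
definition isub :: "iv \<Rightarrow> iv \<Rightarrow> iv" where "isub i j = (fst i - snd j, snd i - fst j)"
definition imul :: "iv \<Rightarrow> iv \<Rightarrow> iv" where
  "imul i j = (let a = fst i * fst j; b = fst i * snd j; c = snd i * fst j; d = snd i * snd j in
     (min (min a b) (min c d) div ulp, - ((- max (max a b) (max c d)) div ulp)))"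
definition idiv :: "iv \<Rightarrow> iv \<Rightarrow> iv" where
  "idiv i j = (min (fst i * ulp div fst j) (fst i * ulp div snd j), 
     max (- ((- (snd i * ulp)) div fst j)) (- ((- (snd i * ulp)) div snd j)))"
definition irat :: "int \<Rightarrow> int \<Rightarrow> iv" where "irat a b = (a * ulp div b, - ((- (a * ulp)) div b))"
primrec ipow :: "iv \<Rightarrow> nat \<Rightarrow> iv" where "ipow i 0 = irat 1 1" | "ipow i (Suc n) = imul i (ipow i n)"

lemma ulp_pos: "(of_int ulp :: real) > 0" by (simp add: ulp_def)

lemma floor_div: "y > 0 \<Longrightarrow> real_of_int (x div y) \<le> real_of_int x / real_of_int y"
  by (metis floor_divide_of_int_eq of_int_floor_le)

lemma ceil_div: "y > 0 \<Longrightarrow> real_of_int x / real_of_int y \<le> real_of_int (- ((- x) div y))"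
  using floor_div[of y "- x"] by simp

lemma mem_add: "mem x i \<Longrightarrow> mem y j \<Longrightarrow> mem (x + y) (iadd i j)"
  by (auto simp: mem_def iadd_def algebra_simps)
lemma mem_sub: "mem x i \<Longrightarrow> mem y j \<Longrightarrow> mem (x - y) (isub i j)"
  by (auto simp: mem_def isub_def algebra_simps)

lemma mult_interval_bounds:
  fixes x y :: real
  assumes "a \<le> x" "x \<le> b" "c \<le> y" "y \<le> d"
  shows "min (min (a * c) (a * d)) (min (b * c) (b * d)) \<le> x * y \<and> x * y \<le> max (max (a * c) (a * d)) (max (b * c) (b * d))"
proof -
  have 1: "min (a * y) (b * y) \<le> x * y \<and> x * y \<le> max (a * y) (b * y)"
    using assms mult_right_mono[of a x y] mult_right_mono[of x b y] mult_right_mono_neg[of a x y] mult_right_mono_neg[of x b y]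
    by (cases "y \<ge> 0") (auto simp: min_le_iff_disj le_max_iff_disj)
  have 2: "min (e * c) (e * d) \<le> e * y \<and> e * y \<le> max (e * c) (e * d)" for e
    using assms mult_left_mono[of c y e] mult_left_mono[of y d e] mult_left_mono_neg[of c y e] mult_left_mono_neg[of y d e]
    by (cases "e \<ge> 0") (auto simp: min_le_iff_disj le_max_iff_disj)
  show ?thesis using 1 2[of a] 2[of b] by (auto simp: min_le_iff_disj le_max_iff_disj intro: order_trans) 
qed

lemma mem_mul: "mem x i \<Longrightarrow> mem y j \<Longrightarrow> mem (x * y) (imul i j)"
proof -
  assume "mem x i" "mem y j"
  define m where "m = min (min (fst i * fst j) (fst i * snd j)) (min (snd i * fst j) (snd i * snd j))"
  define M where "M = max (max (fst i * fst j) (fst i * snd j)) (max (snd i * fst j) (snd i * snd j))"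
  have b: "of_int m \<le> (x * of_int ulp) * (y * of_int ulp) \<and> (x * of_int ulp) * (y * of_int ulp) \<le> of_int M"
    using mult_interval_bounds[of "of_int (fst i)" "x * of_int ulp" "of_int (snd i)" "of_int (fst j)" "y * of_int ulp" "of_int (snd j)"] 
      \<open>mem x i\<close> \<open>mem y j\<close> unfolding mem_def m_def M_def of_int_min of_int_max of_int_mult by blast
  have "real_of_int (m div ulp) \<le> of_int m / of_int ulp" by (rule floor_div) (simp add: ulp_def)
  also have "\<dots> \<le> x * y * of_int ulp" using b ulp_pos by (simp add: pos_divide_le_eq mult_ac)
  finally have 1: "real_of_int (m div ulp) \<le> x * y * of_int ulp" .
  have "x * y * of_int ulp \<le> of_int M / of_int ulp" using b ulp_pos by (simp add: pos_le_divide_eq mult_ac)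
  also have "\<dots> \<le> real_of_int (- ((- M) div ulp))" by (rule ceil_div) (simp add: ulp_def)
  finally show ?thesis using 1 by (simp add: mem_def imul_def Let_def m_def M_def)
qed

lemma mem_div:
  assumes "mem x i" "mem y j" "fst j > 0"
  shows "mem (x / y) (idiv i j)"
proof -
  define u where "u = real_of_int ulp"
  have u: "u > 0" using ulp_pos by (simp add: u_def)
  have j: "0 < real_of_int (fst j)" "of_int (fst j) \<le> y * u" "y * u \<le> of_int (snd j)" "of_int (fst i) \<le> x * u" "x * u \<le> of_int (snd i)"
    using assms by (auto simp: mem_def u_def)
  hence yu: "y * u > 0" and j2: "snd j > 0" by linarith+
  have e: "x / y * u = (x * u) * u * (1 / (y * u))" using yu u by (simp add: field_simps)
  have inv: "1 / of_int (snd j) \<le> 1 / (y * u)" "1 / (y * u) \<le> 1 / of_int (fst j)"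
    using j yu by (auto intro!: divide_left_mono simp: j2)
  have B: "min (min (of_int (fst i) * u * (1 / of_int (snd j))) (of_int (fst i) * u * (1 / of_int (fst j)))) (min (of_int (snd i) * u * (1 / of_int (snd j))) (of_int (snd i) * u * (1 / of_int (fst j)))) \<le> x / y * u"
    "x / y * u \<le> max (max (of_int (fst i) * u * (1 / of_int (snd j))) (of_int (fst i) * u * (1 / of_int (fst j)))) (max (of_int (snd i) * u * (1 / of_int (snd j))) (of_int (snd i) * u * (1 / of_int (fst j))))"
    unfolding e using mult_interval_bounds[of "of_int (fst i) * u" "x * u * u" "of_int (snd i) * u" "1 / of_int (snd j)" "1 / (y * u)" "1 / of_int (fst j)"] j u inv
    by (auto intro: mult_right_mono)
  have p: "0 < 1 / real_of_int (fst j)" "0 < 1 / real_of_int (snd j)" using j j2 by auto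
  have ile: "of_int (fst i) * u \<le> of_int (snd i) * u" using j(4,5) u by (intro mult_right_mono) auto
  have "of_int (fst i) * u * (1 / of_int (snd j)) \<le> of_int (snd i) * u * (1 / of_int (snd j))"
       "of_int (fst i) * u * (1 / of_int (fst j)) \<le> of_int (snd i) * u * (1 / of_int (fst j))"
    by (rule mult_right_mono[OF ile]; use p in simp)+
  with B have C: "min (of_int (fst i) * u / of_int (fst j)) (of_int (fst i) * u / of_int (snd j)) \<le> x / y * u"
     "x / y * u \<le> max (of_int (snd i) * u / of_int (fst j)) (of_int (snd i) * u / of_int (snd j))"
    by (auto simp: min_le_iff_disj le_max_iff_disj)
  have "real_of_int (min (fst i * ulp div fst j) (fst i * ulp div snd j)) \<le> min (of_int (fst i) * u / of_int (fst j)) (of_int (fst i) * u / of_int (snd j))"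
    using floor_div[of "fst j" "fst i * ulp"] floor_div[of "snd j" "fst i * ulp"] assms(3) j2 by (auto simp: u_def of_int_min intro!: min.mono)
  moreover have "max (of_int (snd i) * u / of_int (fst j)) (of_int (snd i) * u / of_int (snd j)) \<le> real_of_int (max (- ((- (snd i * ulp)) div fst j)) (- ((- (snd i * ulp)) div snd j)))"
    using ceil_div[of "fst j" "snd i * ulp"] ceil_div[of "snd j" "snd i * ulp"] assms(3) j2 unfolding of_int_max by (auto simp: u_def intro!: max.mono)
  ultimately show ?thesis using C unfolding mem_def idiv_def u_def[symmetric] fst_conv snd_conv by linarith
qed

lemma mem_rat: "b > 0 \<Longrightarrow> mem (of_int a / of_int b) (irat a b)"
  using floor_div[of b "a * ulp"] ceil_div[of b "a * ulp"] by (auto simp: mem_def irat_def)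

lemma mem_one: "mem 1 (irat 1 1)" using mem_rat[of 1 1] by simp
lemma mem_zero: "mem 0 (irat 0 1)" using mem_rat[of 1 0] by simp

lemma mem_pow: "mem x i \<Longrightarrow> mem (x ^ n) (ipow i n)"
  by (induction n) (auto intro: mem_mul mem_one)

lemma mem_int: "mem (of_int a) (irat a 1)" using mem_rat[of 1 a] by simp

primrec xs_iv :: "nat \<Rightarrow> iv \<Rightarrow> nat \<Rightarrow> iv" where
  "xs_iv t q 0 = q" | "xs_iv t q (Suc j) = imul q (ipow (xs_iv t q j) t)"

definition odds_iv :: "iv \<Rightarrow> iv" where "odds_iv x = idiv x (isub (irat 1 1) x)"

lemma mem_xs: "mem \<rho> q \<Longrightarrow> mem (\<rho> ^ ge t j) (xs_iv t q j)"
proof (induction j)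
  case (Suc j)
  have "\<rho> ^ ge t (Suc j) = \<rho> * (\<rho> ^ ge t j) ^ t" by (simp add: power_mult[symmetric] mult.commute)
  thus ?case using Suc by (simp only: xs_iv.simps) (intro mem_mul mem_pow, auto)
qed simp

lemma mem_odds: "mem x i \<Longrightarrow> fst (isub (irat 1 1) i) > 0 \<Longrightarrow> mem (x / (1 - x)) (odds_iv i)"
  unfolding odds_iv_def by (intro mem_div mem_sub mem_one)

primrec prod_iv :: "(nat \<Rightarrow> iv) \<Rightarrow> nat \<Rightarrow> iv" where
  "prod_iv c 0 = irat 1 1" | "prod_iv c (Suc n) = imul (prod_iv c n) (c n)"

definition cbar_iv :: "nat \<Rightarrow> nat \<Rightarrow> iv" where
  "cbar_iv t j = idiv (iadd (irat 82 10000) (xs_iv t (irat 605 1000) j)) (isub (irat 1 1) (xs_iv t (irat 605 1000) j))"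

definition tail_iv :: "nat \<Rightarrow> nat \<Rightarrow> iv" where
  "tail_iv t K = imul (imul (irat 10 1) (ipow (xs_iv t (irat 605 1000) K) t)) (prod_iv (cbar_iv t) (Suc K))"

lemma mem_tail:
  assumes "list_all (\<lambda>j. fst (isub (irat 1 1) (xs_iv t (irat 605 1000) j)) > 0) [0..<Suc K]"
  shows "mem (tail_bound t (Suc K)) (tail_iv t K)"
proof -
  have r: "mem 0.605 (irat 605 1000)" using mem_rat[of 1000 605] by simp
  have r2: "mem 0.0082 (irat 82 10000)" using mem_rat[of 10000 82] by simp
  have pos: "fst (isub (irat 1 1) (xs_iv t (irat 605 1000) j)) > 0" if "j < Suc K" for j
    using assms that by (simp only: list_all_iff set_upt atLeastLessThan_iff zero_le)
  have c: "mem (cbar t j) (cbar_iv t j)" if "j < Suc K" for j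
    unfolding cbar_def cbar_iv_def by (intro mem_div mem_add mem_sub mem_one mem_xs r r2 pos that)
  have "n \<le> Suc K \<Longrightarrow> mem (\<Prod>j<n. cbar t j) (prod_iv (cbar_iv t) n)" for n
    by (induction n) (auto intro!: mem_mul mem_one c)
  hence "mem (\<Prod>j<Suc K. cbar t j) (prod_iv (cbar_iv t) (Suc K))" by blast
  moreover have "0.605 ^ (ge t (Suc K) - 1) = (0.605 ^ ge t K :: real) ^ t" by (simp add: power_mult[symmetric] mult.commute)
  ultimately show ?thesis unfolding tail_bound_def tail_iv_def using mem_int[of 10]
    by (simp only:) (intro mem_mul mem_pow mem_xs r, auto)
qed

type_synonym jiv = "iv \<times> iv \<times> iv"
definition memj :: "real \<times> real \<times> real \<Rightarrow> jiv \<Rightarrow> bool" where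
  "memj x i \<longleftrightarrow> mem (fst x) (fst i) \<and> mem (fst (snd x)) (fst (snd i)) \<and> mem (snd (snd x)) (snd (snd i))"

fun ijadd :: "jiv \<Rightarrow> jiv \<Rightarrow> jiv" where "ijadd (x,y,z) (x',y',z') = (iadd x x', iadd y y', iadd z z')"
fun ijsub :: "jiv \<Rightarrow> jiv \<Rightarrow> jiv" where "ijsub (x,y,z) (x',y',z') = (isub x x', isub y y', isub z z')"
fun ijmul :: "jiv \<Rightarrow> jiv \<Rightarrow> jiv" where
  "ijmul (x,y,z) (x',y',z') = (imul x x', iadd (imul y x') (imul x y'), iadd (iadd (imul z x') (imul (irat 2 1) (imul y y'))) (imul x z'))"
definition ijexp :: "iv \<Rightarrow> jiv" where "ijexp b = (irat 1 1, b, imul b b)"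
definition ijodds :: "iv \<Rightarrow> iv \<Rightarrow> jiv" where
  "ijodds l a = (l, imul a (imul l (iadd (irat 1 1) l)), imul (imul a a) (imul (imul l (iadd (irat 1 1) l)) (iadd (irat 1 1) (imul (irat 2 1) l))))"

lemma memj_ops: "memj x i \<Longrightarrow> memj y j \<Longrightarrow> memj (jadd x y) (ijadd i j)" "memj x i \<Longrightarrow> memj y j \<Longrightarrow> memj (jsub x y) (ijsub i j)"
   "memj x i \<Longrightarrow> memj y j \<Longrightarrow> memj (jmul x y) (ijmul i j)"
  using mem_int[of 2] by (cases x; cases y; cases i; cases j; force simp: memj_def intro!: mem_add mem_sub mem_mul)+

lemma memj_exp: "mem b i \<Longrightarrow> memj (jexp b) (ijexp i)"
  by (auto simp: memj_def jexp_def ijexp_def intro!: mem_one mem_mul)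

lemma memj_odds: "mem l i \<Longrightarrow> mem a j \<Longrightarrow> memj (jodds l a) (ijodds i j)"
  using mem_int[of 2] by (auto simp: memj_def jodds_def ijodds_def intro!: mem_one mem_mul mem_add)

primrec ikjet :: "nat \<Rightarrow> iv \<Rightarrow> iv \<Rightarrow> iv \<Rightarrow> nat \<Rightarrow> jiv \<times> jiv" where
  "ikjet t q a b 0 = ((irat 0 1, irat 0 1, irat 0 1), (irat 1 1, irat 0 1, irat 0 1))"
| "ikjet t q a b (Suc J) = (case ikjet t q a b J of (B, P) \<Rightarrow> 
     (case ijmul (ijexp b) (ijodds (odds_iv (xs_iv t q J)) (imul a (irat (int (ge t J)) 1))) of vl \<Rightarrow>
       (ijadd B (ijmul P vl), ijmul P (ijsub (ijsub (irat 1 1, irat 0 1, irat 0 1) (ijexp b)) vl))))"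

definition small_xs :: "nat \<Rightarrow> iv \<Rightarrow> nat \<Rightarrow> bool" where
  "small_xs t q J = list_all (\<lambda>j. fst (isub (irat 1 1) (xs_iv t q j)) > 0) [0..<J]"

lemma mem_lo: "mem \<rho> q \<Longrightarrow> small_xs t q J \<Longrightarrow> j < J \<Longrightarrow> mem (lo t \<rho> j) (odds_iv (xs_iv t q j))"
  unfolding lo_def by (intro mem_odds mem_xs) (auto simp: small_xs_def list_all_iff)

lemma memj_kjet:
  assumes "mem \<rho> q" "mem \<alpha> a" "mem \<beta> b" "small_xs t q J"
  shows "n \<le> J \<Longrightarrow> memj (fst (kjet t \<rho> \<alpha> \<beta> n)) (fst (ikjet t q a b n)) \<and> memj (snd (kjet t \<rho> \<alpha> \<beta> n)) (snd (ikjet t q a b n))"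
proof (induction n)
  case 0
  show ?case by (auto simp: memj_def intro: mem_zero mem_one)
next
  case (Suc n)
  have l: "memj (jmul (jexp \<beta>) (jodds (lo t \<rho> n) (\<alpha> * real (ge t n)))) (ijmul (ijexp b) (ijodds (odds_iv (xs_iv t q n)) (imul a (irat (int (ge t n)) 1))))"
    using Suc assms mem_int[of "int (ge t n)"] by (intro memj_ops memj_exp memj_odds mem_lo[where J = J] mem_mul) auto
  have one: "memj (1,0,0) (irat 1 1, irat 0 1, irat 0 1)" by (auto simp: memj_def intro: mem_zero mem_one)
  show ?case using Suc l one assms(3) by (auto simp: Let_def split: prod.splits intro!: memj_ops memj_exp)
qed

text \<open>Linearity in the direction turns the first order equation along the curve into a linear equation for the
drift.\<close>
lemma kjet_linear:
  "fst (fst (kjet t \<rho> \<alpha> \<beta> J)) = fst (fst (kjet t \<rho> 1 0 J)) \<and> fst (snd (kjet t \<rho> \<alpha> \<beta> J)) = fst (snd (kjet t \<rho> 1 0 J)) \<and>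
   fst (snd (fst (kjet t \<rho> \<alpha> \<beta> J))) = \<alpha> * fst (snd (fst (kjet t \<rho> 1 0 J))) + \<beta> * fst (snd (fst (kjet t \<rho> 0 1 J))) \<and>
   fst (snd (snd (kjet t \<rho> \<alpha> \<beta> J))) = \<alpha> * fst (snd (snd (kjet t \<rho> 1 0 J))) + \<beta> * fst (snd (snd (kjet t \<rho> 0 1 J)))"
proof (induction J arbitrary: \<alpha> \<beta>)
  case (Suc J)
  have m: "jmul j k = (fst j * fst k, fst (snd j) * fst k + fst j * fst (snd k), snd (snd j) * fst k + 2 * (fst (snd j) * fst (snd k)) + fst j * snd (snd k))"
    "jadd j k = (fst j + fst k, fst (snd j) + fst (snd k), snd (snd j) + snd (snd k))"
    "jsub j k = (fst j - fst k, fst (snd j) - fst (snd k), snd (snd j) - snd (snd k))" for j k by (cases j; cases k; simp)+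
  note I = Suc[of \<alpha> \<beta>] Suc[of 0 1]
  show ?case using I by (simp add: m jexp_def jodds_def Let_def algebra_simps)
qed simp

text \<open>The alternating sum l0 - l0 l1 + l0 l1 l2 - ... in Horner form.\<close>
primrec horner :: "nat \<Rightarrow> real \<Rightarrow> nat \<Rightarrow> nat \<Rightarrow> real" where
  "horner t \<rho> j 0 = 1" | "horner t \<rho> j (Suc n) = 1 - lo t \<rho> j * horner t \<rho> (Suc j) n"

primrec horner_iv :: "nat \<Rightarrow> iv \<Rightarrow> nat \<Rightarrow> nat \<Rightarrow> iv" where
  "horner_iv t q j 0 = irat 1 1" | "horner_iv t q j (Suc n) = isub (irat 1 1) (imul (odds_iv (xs_iv t q j)) (horner_iv t q (Suc j) n))"

lemma kjet_horner: "fst (fst (kjet t \<rho> \<alpha> \<beta> (Suc K))) = lo t \<rho> 0 * horner t \<rho> 1 K"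
proof -
  have S: "fst (fst (kjet t \<rho> \<alpha> \<beta> (Suc J))) = fst (fst (kjet t \<rho> \<alpha> \<beta> J)) + fst (snd (kjet t \<rho> \<alpha> \<beta> J)) * lo t \<rho> J \<and>
     fst (snd (kjet t \<rho> \<alpha> \<beta> (Suc J))) = - fst (snd (kjet t \<rho> \<alpha> \<beta> J)) * lo t \<rho> J" for J
  proof -
    have m: "fst (jmul j k) = fst j * fst k" "fst (jadd j k) = fst j + fst k" "fst (jsub j k) = fst j - fst k" for j k by (cases j; cases k; simp)+
    show ?thesis by (simp add: m jexp_def jodds_def Let_def)
  qed
  have "fst (fst (kjet t \<rho> \<alpha> \<beta> (J + Suc n))) = fst (fst (kjet t \<rho> \<alpha> \<beta> J)) + fst (snd (kjet t \<rho> \<alpha> \<beta> J)) * lo t \<rho> J * horner t \<rho> (Suc J) n" for J n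
  proof (induction n arbitrary: J)
    case 0
    show ?case using S[of J] by simp
  next
    case (Suc n)
    have "fst (fst (kjet t \<rho> \<alpha> \<beta> (Suc J + Suc n))) = fst (fst (kjet t \<rho> \<alpha> \<beta> (Suc J))) + fst (snd (kjet t \<rho> \<alpha> \<beta> (Suc J))) * lo t \<rho> (Suc J) * horner t \<rho> (Suc (Suc J)) n" by (rule Suc)
    thus ?case unfolding S[THEN conjunct1, of J] S[THEN conjunct2, of J] by (simp del: kjet.simps add: algebra_simps)
  qed
  from this[of 0 K] show ?thesis by simp
qed

lemma mem_horner: "mem \<rho> q \<Longrightarrow> small_xs t q J \<Longrightarrow> j + n \<le> J \<Longrightarrow> mem (horner t \<rho> j n) (horner_iv t q j n)"
  by (induction n arbitrary: j) (auto intro!: mem_one mem_sub mem_mul mem_lo[where J = J])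

definition ball_iv :: "iv \<Rightarrow> iv" where "ball_iv e = (- snd e, snd e)"

lemma mem_ball: "\<bar>x\<bar> \<le> y \<Longrightarrow> mem y e \<Longrightarrow> mem x (ball_iv e)"
proof -
  assume "\<bar>x\<bar> \<le> y" and e: "mem y e"
  hence "\<bar>x\<bar> * of_int ulp \<le> y * of_int ulp" using ulp_pos by (intro mult_right_mono) auto
  hence "\<bar>x\<bar> * of_int ulp \<le> of_int (snd e)" using e unfolding mem_def by linarith
  hence "\<bar>x * of_int ulp\<bar> \<le> of_int (snd e)" using ulp_pos by (simp add: abs_mult)
  thus ?thesis by (auto simp: mem_def ball_iv_def)
qed

text \<open>Solves the kernel equation \<open>l\<^sub>0 * h = 1 + \<delta>\<close>, \<open>\<bar>\<delta>\<bar> \<le> \<epsilon>\<close>, for \<open>q = l\<^sub>0 / (1 + l\<^sub>0)\<close> with the old enclosure inserted in \<open>h\<close>. The map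
contracts because \<open>h\<close> depends only weakly on \<open>q\<close>.\<close>
definition refine :: "nat \<Rightarrow> nat \<Rightarrow> iv \<Rightarrow> iv \<Rightarrow> iv" where
  "refine t K e q = idiv (iadd (irat 1 1) (ball_iv e)) (iadd (irat 1 1) (horner_iv t q 1 K))"
definition refine_ok :: "nat \<Rightarrow> nat \<Rightarrow> iv \<Rightarrow> bool" where
  "refine_ok t K q \<longleftrightarrow> small_xs t q (Suc K) \<and> fst (iadd (irat 1 1) (horner_iv t q 1 K)) > 0"

lemma mem_refine:
  assumes "0 < \<rho>" "\<rho> < 1" "\<bar>lo t \<rho> 0 * horner t \<rho> 1 K - 1\<bar> \<le> \<epsilon>" "mem \<epsilon> e" "mem \<rho> q" "refine_ok t K q"
  shows "mem \<rho> (refine t K e q)"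
proof -
  define D where "D = horner t \<rho> 1 K"
  define d where "d = lo t \<rho> 0 * D - 1"
  have D: "mem (1 + D) (iadd (irat 1 1) (horner_iv t q 1 K))"
    unfolding D_def using assms by (intro mem_add mem_one mem_horner[where J = "Suc K"]) (auto simp: refine_ok_def)
  hence Dpos: "1 + D > 0"
  proof -
    have "0 < (1 + D) * of_int ulp" using D assms(6) unfolding mem_def refine_ok_def by linarith
    thus ?thesis using ulp_pos by (simp add: zero_less_mult_iff)
  qed
  have "\<rho> * D = (1 + d) * (1 - \<rho>)" using assms(1,2) by (simp add: d_def lo_def field_simps)
  hence "\<rho> * (1 + D) = 1 + d * (1 - \<rho>)" by (simp add: algebra_simps)
  hence \<rho>: "\<rho> = (1 + d * (1 - \<rho>)) / (1 + D)" using Dpos by (simp add: field_simps)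
  have "\<bar>d * (1 - \<rho>)\<bar> \<le> \<epsilon>"
  proof -
    have "\<bar>d\<bar> * \<bar>1 - \<rho>\<bar> \<le> \<epsilon> * 1" using assms(1-3) by (intro mult_mono) (auto simp: d_def D_def)
    thus ?thesis by (simp add: abs_mult)
  qed
  hence "mem (1 + d * (1 - \<rho>)) (iadd (irat 1 1) (ball_iv e))" using assms(4) by (intro mem_add mem_one mem_ball)
  hence "mem ((1 + d * (1 - \<rho>)) / (1 + D)) (refine t K e q)"
    unfolding refine_def using D assms(6) by (intro mem_div) (auto simp: refine_ok_def)
  thus ?thesis using \<rho> by simp
qed

primrec enclose :: "nat \<Rightarrow> nat \<Rightarrow> iv \<Rightarrow> nat \<Rightarrow> iv \<Rightarrow> iv option" where
  "enclose t K e 0 q = Some q"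
| "enclose t K e (Suc n) q = (if refine_ok t K q then enclose t K e n (refine t K e q) else None)"

lemma mem_enclose:
  assumes "0 < \<rho>" "\<rho> < 1" "\<bar>lo t \<rho> 0 * horner t \<rho> 1 K - 1\<bar> \<le> \<epsilon>" "mem \<epsilon> e"
  shows "mem \<rho> q \<Longrightarrow> enclose t K e n q = Some q' \<Longrightarrow> mem \<rho> q'"
proof (induction n arbitrary: q)
  case (Suc n)
  hence "refine_ok t K q" "enclose t K e n (refine t K e q) = Some q'" by (auto split: if_splits)
  thus ?case using Suc mem_refine[OF assms] by blast
qed simp

definition mu_iv :: "nat \<Rightarrow> nat \<Rightarrow> iv \<Rightarrow> iv \<Rightarrow> iv" where
  "mu_iv t J e q = idiv (iadd (fst (snd (fst (ikjet t q (irat 0 1) (irat 1 1) J)))) (ball_iv (imul (irat 125 1) e)))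
      (fst (snd (fst (ikjet t q (irat 1 1) (irat 0 1) J))))"
definition sigma_iv :: "nat \<Rightarrow> nat \<Rightarrow> iv \<Rightarrow> iv \<Rightarrow> iv \<Rightarrow> iv" where
  "sigma_iv t J e q m = idiv (iadd (snd (snd (fst (ikjet t q (isub (irat 0 1) m) (irat 1 1) J)))) (ball_iv (imul (irat 31250 1) e)))
      (iadd (fst (snd (fst (ikjet t q (irat 1 1) (irat 0 1) J)))) (ball_iv (imul (irat 125 1) e)))"
definition denom_ok :: "nat \<Rightarrow> nat \<Rightarrow> iv \<Rightarrow> iv \<Rightarrow> bool" where
  "denom_ok t J e q \<longleftrightarrow> fst (fst (snd (fst (ikjet t q (irat 1 1) (irat 0 1) J)))) > 0 \<and>
     fst (iadd (fst (snd (fst (ikjet t q (irat 1 1) (irat 0 1) J)))) (ball_iv (imul (irat 125 1) e))) > 0"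

definition constants_iv :: "nat \<Rightarrow> nat \<Rightarrow> nat \<Rightarrow> (iv \<times> iv) option" where
  "constants_iv t K n = (if list_all (\<lambda>j. fst (isub (irat 1 1) (xs_iv t (irat 605 1000) j)) > 0) [0..<Suc K]
     then (case tail_iv t K of e \<Rightarrow> (case enclose t K e n (fst (irat 1 2), snd (irat 6 10)) of None \<Rightarrow> None
       | Some q \<Rightarrow> (if small_xs t q (Suc K) \<and> denom_ok t (Suc K) e q
            then (case mu_iv t (Suc K) e q of m \<Rightarrow> Some (m, sigma_iv t (Suc K) e q m)) else None)))
     else None)"

text \<open>The enclosure of the drift is inserted as the direction of the curve when the dispersion is computed.\<close>
theorem constants_enclosed:
  assumes t: "t \<ge> 2" and \<rho>: "\<rho> \<in> {1/2..0.6}" and ren: "renewal (block_count t) Rmax Vmax \<rho>"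
    and run: "constants_iv t K n = Some (m, s)"
  shows "mem (renewal.mu (block_count t) \<rho>) m" "mem (renewal.sigma2 (block_count t) \<rho>) s"
proof -
  define \<mu> where "\<mu> = renewal.mu (block_count t) \<rho>"
  define \<sigma>2 where "\<sigma>2 = renewal.sigma2 (block_count t) \<rho>"
  define \<epsilon> where "\<epsilon> = tail_bound t (Suc K)"
  define e where "e = tail_iv t K"
  define J where "J = Suc K"
  obtain q where small: "list_all (\<lambda>j. fst (isub (irat 1 1) (xs_iv t (irat 605 1000) j)) > 0) [0..<Suc K]"
    and enc: "enclose t K e n (fst (irat 1 2), snd (irat 6 10)) = Some q" and ok: "small_xs t q J" "denom_ok t J e q"
    and m: "m = mu_iv t J e q" and s: "s = sigma_iv t J e q m"
    using run by (auto simp: constants_iv_def e_def[symmetric] J_def[symmetric] split: if_splits option.splits)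
  have e: "mem \<epsilon> e" unfolding \<epsilon>_def e_def by (rule mem_tail[OF small])
  obtain B0 B1 B2 where B: "fst (kjet t \<rho> (-\<mu>) 1 J) = (B0, B1, B2)" by (cases "fst (kjet t \<rho> (-\<mu>) 1 J)")
  obtain C0 C1 C2 where C: "fst (kjet t \<rho> 1 0 J) = (C0, C1, C2)" by (cases "fst (kjet t \<rho> 1 0 J)")
  obtain A0 A1 A2 where A: "fst (kjet t \<rho> 0 1 J) = (A0, A1, A2)" by (cases "fst (kjet t \<rho> 0 1 J)")
  note E = curve_equations[OF t \<rho> ren B[unfolded \<mu>_def] C, folded \<mu>_def \<sigma>2_def J_def \<epsilon>_def, unfolded J_def, folded \<epsilon>_def]
  have lin: "B1 = A1 - \<mu> * C1" using kjet_linear[of t \<rho> "-\<mu>" 1 J] A B C by simp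
  have "B0 = lo t \<rho> 0 * horner t \<rho> 1 K" using kjet_horner[of t \<rho> "-\<mu>" 1 K] B by (simp only: J_def[symmetric] fst_conv)
  hence eq: "\<bar>lo t \<rho> 0 * horner t \<rho> 1 K - 1\<bar> \<le> \<epsilon>" using E(3) by simp
  have q0: "mem \<rho> (fst (irat 1 2), snd (irat 6 10))"
  proof -
    have "mem (of_int 1 / of_int 2) (irat 1 2)" "mem (of_int 6 / of_int 10) (irat 6 10)" by (rule mem_rat; simp)+
    moreover have "1/2 * of_int ulp \<le> \<rho> * of_int ulp" "\<rho> * of_int ulp \<le> 0.6 * of_int ulp"
      using \<rho> ulp_pos by (auto intro!: mult_right_mono)
    ultimately show ?thesis by (simp add: mem_def)
  qed
  have q: "mem \<rho> q" by (rule mem_enclose[OF _ _ eq e q0 enc]) (use \<rho> in auto)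
  have jA: "mem A1 (fst (snd (fst (ikjet t q (irat 0 1) (irat 1 1) J))))"
    using memj_kjet[OF q mem_zero mem_one ok(1), of J] A by (simp add: memj_def)
  have jC: "mem C1 (fst (snd (fst (ikjet t q (irat 1 1) (irat 0 1) J))))"
    using memj_kjet[OF q mem_one mem_zero ok(1), of J] C by (simp add: memj_def)
  have pos: "0 < x" if "mem x i" "fst i > 0" for x i
  proof -
    have "0 < x * of_int ulp" using that unfolding mem_def by linarith
    thus ?thesis using ulp_pos by (simp add: zero_less_mult_iff)
  qed
  have C1: "C1 > 0" using pos[OF jC] ok(2) by (simp add: denom_ok_def)
  have e125: "mem (125 * \<epsilon>) (imul (irat 125 1) e)" "mem (31250 * \<epsilon>) (imul (irat 31250 1) e)"
    using mem_int[of 125] mem_int[of 31250] e by (auto intro!: mem_mul)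
  have "\<mu> = (A1 + (- B1)) / C1" using lin C1 by (simp add: field_simps)
  moreover have "mem (- B1) (ball_iv (imul (irat 125 1) e))" by (rule mem_ball[OF _ e125(1)]) (use E(4) in simp)
  ultimately have \<mu>: "mem \<mu> m" unfolding m mu_iv_def
    by (simp only:) (intro mem_div mem_add jA jC, use ok(2) in \<open>auto simp: denom_ok_def\<close>)
  thus "mem (renewal.mu (block_count t) \<rho>) m" by (simp add: \<mu>_def)
  have jB: "mem B2 (snd (snd (fst (ikjet t q (isub (irat 0 1) m) (irat 1 1) J))))"
    using memj_kjet[OF q mem_sub[OF mem_zero \<mu>] mem_one ok(1), of J] B by (simp add: memj_def)
  obtain d where d: "\<bar>d\<bar> \<le> 125 * \<epsilon>" "\<bar>B2 - \<sigma>2 * (C1 + d)\<bar> \<le> 31250 * \<epsilon>" using E(5) by blast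
  define r where "r = \<sigma>2 * (C1 + d) - B2"
  have den: "mem (C1 + d) (iadd (fst (snd (fst (ikjet t q (irat 1 1) (irat 0 1) J)))) (ball_iv (imul (irat 125 1) e)))"
    by (intro mem_add jC mem_ball[OF d(1) e125(1)])
  have "C1 + d > 0" using pos[OF den] ok(2) by (simp add: denom_ok_def)
  hence "\<sigma>2 = (B2 + r) / (C1 + d)" by (simp add: r_def)
  moreover have "mem r (ball_iv (imul (irat 31250 1) e))" by (rule mem_ball[OF _ e125(2)]) (use d(2) in \<open>simp add: r_def abs_minus_commute\<close>)
  ultimately show "mem (renewal.sigma2 (block_count t) \<rho>) s"
    unfolding s sigma_iv_def \<sigma>2_def[symmetric]
    by (simp only:) (intro mem_div mem_add[OF jB] den, use ok(2) in \<open>auto simp: denom_ok_def\<close>)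
qed

text \<open>The numbers of kernel terms and of refinement steps are chosen such that the resulting
enclosures lie within the asserted error terms; they decrease with \<open>t\<close> since the remainder does.\<close>
lemma constants_iv_2: "constants_iv 2 3 10 = Some ((7300111906222, 7308253335224), (4219841756606, 4398178247603))"
  by code_simp

lemma constants_iv_3: "constants_iv 3 2 7 = Some ((8565724024426, 8565867507368), (5089565107575, 5091420342446))"
  by code_simp

lemma constants_iv_4: "constants_iv 4 2 5 = Some ((8839267835347, 8839415040201), (4821596697285, 4823138365086))"
  by code_simp

lemma constants_iv_5: "constants_iv 5 2 4 = Some ((8884560546732, 8884696761684), (4585784052550, 4587080870801))"
  by code_simp

lemma constants_iv_6: "constants_iv 6 1 4 = Some ((8872449502002, 8872463722121), (4452066309802, 4452424282437))"
  by code_simp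

lemma constants_iv_7: "constants_iv 7 1 4 = Some ((8850344132011, 8850345476844), (4390261427471, 4390273265382))"
  by code_simp

lemma constants_iv_8: "constants_iv 8 1 4 = Some ((8831365367401, 8831365505075), (4368777670562, 4368778871395))"
  by code_simp

lemma constants_iv_9: "constants_iv 9 1 4 = Some ((8817863468800, 8817863482911), (4366562067757, 4366562217057))"
  by code_simp

lemma constants_iv_10: "constants_iv 10 1 4 = Some ((8809070894232, 8809070895792), (4371739637700, 4371739681689))"
  by code_simp

section \<open>Expansion of the constants for large arity\<close>

text \<open>Trades powers for smallness: the exponents \<open>d\<close>, \<open>p\<close> and \<open>r\<close> say how many factors \<open>1 / m\<close>, \<open>m * b\<close> and \<open>b\<close> separate the monomial
from the reference monomial \<open>m ^ 4 * b ^ k\<close>.\<close>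
lemma monomial_le:
  fixes m b :: real
  assumes "12 \<le> m" "0 < b" "b \<le> (26/100000)" "m * b \<le> (31/10000)" "i + d = 4 + p" "j = k + p + r"
    "(1/12) ^ d * (31/10000) ^ p * (26/100000) ^ r \<le> K"
  shows "0 \<le> m ^ i * b ^ j \<and> m ^ i * b ^ j \<le> K * (m ^ 4 * b ^ k)"
proof -
  have "m ^ i * b ^ j * m ^ d = m ^ (i + d) * b ^ j" by (simp add: power_add)
  also have "\<dots> = m ^ 4 * b ^ k * ((m * b) ^ p * b ^ r)" unfolding assms(5,6) by (simp add: power_add power_mult_distrib)
  finally have "m ^ i * b ^ j * m ^ d = m ^ 4 * b ^ k * ((m * b) ^ p * b ^ r)" .
  hence "m ^ i * b ^ j = (1 / m ^ d) * (m * b) ^ p * b ^ r * (m ^ 4 * b ^ k)" using assms(1) by (simp add: field_simps)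
  also have "\<dots> \<le> (1/12) ^ d * (31/10000) ^ p * (26/100000) ^ r * (m ^ 4 * b ^ k)"
  proof (intro mult_right_mono mult_mono power_mono)
    have "(1 / m) ^ d \<le> (1 / 12) ^ d" using assms(1) by (intro power_mono) auto
    thus "1 / m ^ d \<le> (1 / 12) ^ d" by (simp add: power_divide)
  qed (use assms in auto)
  also have "\<dots> \<le> K * (m ^ 4 * b ^ k)" using assms by (intro mult_right_mono) auto
  finally show ?thesis using assms by simp
qed

text \<open>In this polynomial identity all terms of order below \<open>b ^ 4\<close> cancel: this is the assertion that the
expansion of the mean is correct.\<close>
lemma mean_poly_expand:
  fixes m b :: real
  shows "16384 * (1 - 3 * b + b\<^sup>2) - (8192 + 512 * (m - 5) * (b * (8 - b * (8 + 4 * m) + b\<^sup>2 * (8 + 4 * m + m * (m - 1)))) + 32 * (2 * (m - 1)\<^sup>2 - (m - 1) - 14) * (b * (8 - b * (8 + 4 * m) + b\<^sup>2 * (8 + 4 * m + m * (m - 1))))\<^sup>2 + (9 * (m - 1) ^ 3 + 27 * (m - 1)\<^sup>2 - 76 * (m - 1) - 144) * (b * (8 - b * (8 + 4 * m) + b\<^sup>2 * (8 + 4 * m + m * (m - 1)))) ^ 3) * (2 - b - m * b - m * b\<^sup>2) = - (19456 * (m ^ 0 * b ^ 4)) - 269312 * (m ^ 1 * b ^ 4) - 140800 * (m ^ 2 * b ^ 4) + 27648 * (m ^ 3 * b ^ 4) + 10752 * (m ^ 4 * b ^ 4) + 226304 * (m ^ 0 * b ^ 5) + 858880 * (m ^ 1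 * b ^ 5) + 620416 * (m ^ 2 * b ^ 5) + 110720 * (m ^ 3 * b ^ 5) - 51072 * (m ^ 4 * b ^ 5) - 14208 * (m ^ 5 * b ^ 5) - 421888 * (m ^ 0 * b ^ 6) - 1491072 * (m ^ 1 * b ^ 6) - 1279744 * (m ^ 2 * b ^ 6) - 421824 * (m ^ 3 * b ^ 6) - 14784 * (m ^ 4 * b ^ 6) + 41280 * (m ^ 5 * b ^ 6) + 9152 * (m ^ 6 * b ^ 6) + 463872 * (m ^ 0 * b ^ 7) + 1522176 * (m ^ 1 * b ^ 7) + 1411072 * (m ^ 2 * b ^ 7) + 657808 * (m ^ 3 * b ^ 7) + 129184 * (m ^ 4 * b ^ 7) - 15296 * (m ^ 5 * b ^ 7) - 18080 * (m ^ 6 * b ^ 7) - 3536 * (m ^ 7 * b ^ 7) - 307200 * (m ^ 0 * b ^ 8) - 984960 * (m ^ 1 * b ^ 8) - 901712 * (m ^ 2 * b ^ 8) - 448824 * (m ^ 3 * b ^ 8) - 151040 * (m ^ 4 * b ^ 8) - 19568 * (m ^ 5 * b ^ 8) + 6320 * (m ^ 6 * b ^ 8) + 4456 * (m ^ 7 * b ^ 8) + 864 * (m ^ 8 * b ^ 8) + 128000 * (m ^ 0 * b ^ 9) + 340480 * (m ^ 1 * b ^ 9) + 190608 * (m ^ 2 * b ^ 9) + 54204 * (m ^ 3 * b ^ 9) + 15906 * (m ^ 4 * b ^ 9) + 13554 * (m ^ 5 * b ^ 9) + 4372 * (m ^ 6 * b ^ 9) - 16 * (m ^ 7 * b ^ 9)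 - 486 * (m ^ 8 * b ^ 9) - 126 * (m ^ 9 * b ^ 9) - 25600 * (m ^ 0 * b ^ 10) - 30336 * (m ^ 1 * b ^ 10) + 92944 * (m ^ 2 * b ^ 10) + 130866 * (m ^ 3 * b ^ 10) + 68559 * (m ^ 4 * b ^ 10) + 16242 * (m ^ 5 * b ^ 10) - 1565 * (m ^ 6 * b ^ 10) - 1842 * (m ^ 7 * b ^ 10) - 427 * (m ^ 8 * b ^ 10) - 18 * (m ^ 9 * b ^ 10) + 9 * (m ^ 10 * b ^ 10) - 25600 * (m ^ 1 * b ^ 11) - 81536 * (m ^ 2 * b ^ 11) - 79728 * (m ^ 3 * b ^ 11) - 45966 * (m ^ 4 * b ^ 11) - 14979 * (m ^ 5 * b ^ 11) - 2031 * (m ^ 6 * b ^ 11) + 562 * (m ^ 7 * b ^ 11) + 356 * (m ^ 8 * b ^ 11) + 81 * (m ^ 9 * b ^ 11) + 9 * (m ^ 10 * b ^ 11)"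
  by algebra

lemma mean_poly_bound:
  fixes m b :: real
  assumes "12 \<le> m" "0 < b" "b \<le> (26/100000)" "m * b \<le> (31/10000)"
  shows "\<bar>16384 * (1 - 3 * b + b\<^sup>2) - (8192 + 512 * (m - 5) * (b * (8 - b * (8 + 4 * m) + b\<^sup>2 * (8 + 4 * m + m * (m - 1)))) + 32 * (2 * (m - 1)\<^sup>2 - (m - 1) - 14) * (b * (8 - b * (8 + 4 * m) + b\<^sup>2 * (8 + 4 * m + m * (m - 1))))\<^sup>2 + (9 * (m - 1) ^ 3 + 27 * (m - 1)\<^sup>2 - 76 * (m - 1) - 144) * (b * (8 - b * (8 + 4 * m) + b\<^sup>2 * (8 + 4 * m + m * (m - 1)))) ^ 3) * (2 - b - m * b - m * b\<^sup>2)\<bar> \<le> 77824/5 * (m ^ 4 * b ^ 4)"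
proof -
  define M where "M = m ^ 4 * b ^ 4"
  note F = monomial_le[OF assms, where k = 4, folded M_def]
  have f0: "0 \<le> m ^ 0 * b ^ 4 \<and> m ^ 0 * b ^ 4 \<le> 483/10000000 * M" by (rule F[of _ 4 0 _ 0]) (simp_all add: power_divide)
  have f1: "0 \<le> m ^ 1 * b ^ 4 \<and> m ^ 1 * b ^ 4 \<le> 579/1000000 * M" by (rule F[of _ 3 0 _ 0]) (simp_all add: power_divide)
  have f2: "0 \<le> m ^ 2 * b ^ 4 \<and> m ^ 2 * b ^ 4 \<le> 139/20000 * M" by (rule F[of _ 2 0 _ 0]) (simp_all add: power_divide)
  have f3: "0 \<le> m ^ 3 * b ^ 4 \<and> m ^ 3 * b ^ 4 \<le> 417/5000 * M" by (rule F[of _ 1 0 _ 0]) (simp_all add: power_divide)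
  have f4: "0 \<le> m ^ 4 * b ^ 4 \<and> m ^ 4 * b ^ 4 \<le> 1 * M" by (rule F[of _ 0 0 _ 0]) (simp_all add: power_divide)
  have f5: "0 \<le> m ^ 0 * b ^ 5 \<and> m ^ 0 * b ^ 5 \<le> 63/5000000000 * M" by (rule F[of _ 4 0 _ 1]) (simp_all add: power_divide)
  have f6: "0 \<le> m ^ 1 * b ^ 5 \<and> m ^ 1 * b ^ 5 \<le> 151/1000000000 * M" by (rule F[of _ 3 0 _ 1]) (simp_all add: power_divide)
  have f7: "0 \<le> m ^ 2 * b ^ 5 \<and> m ^ 2 * b ^ 5 \<le> 181/100000000 * M" by (rule F[of _ 2 0 _ 1]) (simp_all add: power_divide)
  have f8: "0 \<le> m ^ 3 * b ^ 5 \<and> m ^ 3 * b ^ 5 \<le> 217/10000000 * M" by (rule F[of _ 1 0 _ 1]) (simp_all add: power_divide)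
  have f9: "0 \<le> m ^ 4 * b ^ 5 \<and> m ^ 4 * b ^ 5 \<le> 13/50000 * M" by (rule F[of _ 0 0 _ 1]) (simp_all add: power_divide)
  have f10: "0 \<le> m ^ 5 * b ^ 5 \<and> m ^ 5 * b ^ 5 \<le> 31/10000 * M" by (rule F[of _ 0 1 _ 0]) (simp_all add: power_divide)
  have f11: "0 \<le> m ^ 0 * b ^ 6 \<and> m ^ 0 * b ^ 6 \<le> 327/100000000000000 * M" by (rule F[of _ 4 0 _ 2]) (simp_all add: power_divide)
  have f12: "0 \<le> m ^ 1 * b ^ 6 \<and> m ^ 1 * b ^ 6 \<le> 49/1250000000000 * M" by (rule F[of _ 3 0 _ 2]) (simp_all add: power_divide)
  have f13: "0 \<le> m ^ 2 * b ^ 6 \<and> m ^ 2 * b ^ 6 \<le> 47/100000000000 * M" by (rule F[of _ 2 0 _ 2]) (simp_all add: power_divide)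
  have f14: "0 \<le> m ^ 3 * b ^ 6 \<and> m ^ 3 * b ^ 6 \<le> 141/25000000000 * M" by (rule F[of _ 1 0 _ 2]) (simp_all add: power_divide)
  have f15: "0 \<le> m ^ 4 * b ^ 6 \<and> m ^ 4 * b ^ 6 \<le> 169/2500000000 * M" by (rule F[of _ 0 0 _ 2]) (simp_all add: power_divide)
  have f16: "0 \<le> m ^ 5 * b ^ 6 \<and> m ^ 5 * b ^ 6 \<le> 403/500000000 * M" by (rule F[of _ 0 1 _ 1]) (simp_all add: power_divide)
  have f17: "0 \<le> m ^ 6 * b ^ 6 \<and> m ^ 6 * b ^ 6 \<le> 961/100000000 * M" by (rule F[of _ 0 2 _ 0]) (simp_all add: power_divide)
  have f18: "0 \<le> m ^ 0 * b ^ 7 \<and> m ^ 0 * b ^ 7 \<le> 53/62500000000000000 * M" by (rule F[of _ 4 0 _ 3]) (simp_all add: power_divide)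
  have f19: "0 \<le> m ^ 1 * b ^ 7 \<and> m ^ 1 * b ^ 7 \<le> 51/5000000000000000 * M" by (rule F[of _ 3 0 _ 3]) (simp_all add: power_divide)
  have f20: "0 \<le> m ^ 2 * b ^ 7 \<and> m ^ 2 * b ^ 7 \<le> 123/1000000000000000 * M" by (rule F[of _ 2 0 _ 3]) (simp_all add: power_divide)
  have f21: "0 \<le> m ^ 3 * b ^ 7 \<and> m ^ 3 * b ^ 7 \<le> 147/100000000000000 * M" by (rule F[of _ 1 0 _ 3]) (simp_all add: power_divide)
  have f22: "0 \<le> m ^ 4 * b ^ 7 \<and> m ^ 4 * b ^ 7 \<le> 11/625000000000 * M" by (rule F[of _ 0 0 _ 3]) (simp_all add: power_divide)
  have f23: "0 \<le> m ^ 5 * b ^ 7 \<and> m ^ 5 * b ^ 7 \<le> 21/100000000000 * M" by (rule F[of _ 0 1 _ 2]) (simp_all add: power_divide)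
  have f24: "0 \<le> m ^ 6 * b ^ 7 \<and> m ^ 6 * b ^ 7 \<le> 1/400000000 * M" by (rule F[of _ 0 2 _ 1]) (simp_all add: power_divide)
  have f25: "0 \<le> m ^ 7 * b ^ 7 \<and> m ^ 7 * b ^ 7 \<le> 149/5000000000 * M" by (rule F[of _ 0 3 _ 0]) (simp_all add: power_divide)
  have f26: "0 \<le> m ^ 0 * b ^ 8 \<and> m ^ 0 * b ^ 8 \<le> 221/1000000000000000000000 * M" by (rule F[of _ 4 0 _ 4]) (simp_all add: power_divide)
  have f27: "0 \<le> m ^ 1 * b ^ 8 \<and> m ^ 1 * b ^ 8 \<le> 53/20000000000000000000 * M" by (rule F[of _ 3 0 _ 4]) (simp_all add: power_divide)
  have f28: "0 \<le> m ^ 2 * b ^ 8 \<and> m ^ 2 * b ^ 8 \<le> 159/5000000000000000000 * M" by (rule F[of _ 2 0 _ 4]) (simp_all add: power_divide)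
  have f29: "0 \<le> m ^ 3 * b ^ 8 \<and> m ^ 3 * b ^ 8 \<le> 381/1000000000000000000 * M" by (rule F[of _ 1 0 _ 4]) (simp_all add: power_divide)
  have f30: "0 \<le> m ^ 4 * b ^ 8 \<and> m ^ 4 * b ^ 8 \<le> 457/100000000000000000 * M" by (rule F[of _ 0 0 _ 4]) (simp_all add: power_divide)
  have f31: "0 \<le> m ^ 5 * b ^ 8 \<and> m ^ 5 * b ^ 8 \<le> 109/2000000000000000 * M" by (rule F[of _ 0 1 _ 3]) (simp_all add: power_divide)
  have f32: "0 \<le> m ^ 6 * b ^ 8 \<and> m ^ 6 * b ^ 8 \<le> 13/20000000000000 * M" by (rule F[of _ 0 2 _ 2]) (simp_all add: power_divide)
  have f33: "0 \<le> m ^ 7 * b ^ 8 \<and> m ^ 7 * b ^ 8 \<le> 31/4000000000000 * M" by (rule F[of _ 0 3 _ 1]) (simp_all add: power_divide)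
  have f34: "0 \<le> m ^ 8 * b ^ 8 \<and> m ^ 8 * b ^ 8 \<le> 231/2500000000000 * M" by (rule F[of _ 0 4 _ 0]) (simp_all add: power_divide)
  have f35: "0 \<le> m ^ 0 * b ^ 9 \<and> m ^ 0 * b ^ 9 \<le> 573/10000000000000000000000000 * M" by (rule F[of _ 4 0 _ 5]) (simp_all add: power_divide)
  have f36: "0 \<le> m ^ 1 * b ^ 9 \<and> m ^ 1 * b ^ 9 \<le> 43/62500000000000000000000 * M" by (rule F[of _ 3 0 _ 5]) (simp_all add: power_divide)
  have f37: "0 \<le> m ^ 2 * b ^ 9 \<and> m ^ 2 * b ^ 9 \<le> 413/50000000000000000000000 * M" by (rule F[of _ 2 0 _ 5]) (simp_all add: power_divide)
  have f38: "0 \<le> m ^ 3 * b ^ 9 \<and> m ^ 3 * b ^ 9 \<le> 991/10000000000000000000000 * M" by (rule F[of _ 1 0 _ 5]) (simp_all add: power_divide)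
  have f39: "0 \<le> m ^ 4 * b ^ 9 \<and> m ^ 4 * b ^ 9 \<le> 119/100000000000000000000 * M" by (rule F[of _ 0 0 _ 5]) (simp_all add: power_divide)
  have f40: "0 \<le> m ^ 5 * b ^ 9 \<and> m ^ 5 * b ^ 9 \<le> 71/5000000000000000000 * M" by (rule F[of _ 0 1 _ 4]) (simp_all add: power_divide)
  have f41: "0 \<le> m ^ 6 * b ^ 9 \<and> m ^ 6 * b ^ 9 \<le> 169/1000000000000000000 * M" by (rule F[of _ 0 2 _ 3]) (simp_all add: power_divide)
  have f42: "0 \<le> m ^ 7 * b ^ 9 \<and> m ^ 7 * b ^ 9 \<le> 101/50000000000000000 * M" by (rule F[of _ 0 3 _ 2]) (simp_all add: power_divide)
  have f43: "0 \<le> m ^ 8 * b ^ 9 \<and> m ^ 8 * b ^ 9 \<le> 241/10000000000000000 * M" by (rule F[of _ 0 4 _ 1]) (simp_all add: power_divide)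
  have f44: "0 \<le> m ^ 9 * b ^ 9 \<and> m ^ 9 * b ^ 9 \<le> 287/1000000000000000 * M" by (rule F[of _ 0 5 _ 0]) (simp_all add: power_divide)
  have f45: "0 \<le> m ^ 0 * b ^ 10 \<and> m ^ 0 * b ^ 10 \<le> 149/10000000000000000000000000000 * M" by (rule F[of _ 4 0 _ 6]) (simp_all add: power_divide)
  have f46: "0 \<le> m ^ 1 * b ^ 10 \<and> m ^ 1 * b ^ 10 \<le> 179/1000000000000000000000000000 * M" by (rule F[of _ 3 0 _ 6]) (simp_all add: power_divide)
  have f47: "0 \<le> m ^ 2 * b ^ 10 \<and> m ^ 2 * b ^ 10 \<le> 43/20000000000000000000000000 * M" by (rule F[of _ 2 0 _ 6]) (simp_all add: power_divide)
  have f48: "0 \<le> m ^ 3 * b ^ 10 \<and> m ^ 3 * b ^ 10 \<le> 129/5000000000000000000000000 * M" by (rule F[of _ 1 0 _ 6]) (simp_all add: power_divide)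
  have f49: "0 \<le> m ^ 4 * b ^ 10 \<and> m ^ 4 * b ^ 10 \<le> 309/1000000000000000000000000 * M" by (rule F[of _ 0 0 _ 6]) (simp_all add: power_divide)
  have f50: "0 \<le> m ^ 5 * b ^ 10 \<and> m ^ 5 * b ^ 10 \<le> 369/100000000000000000000000 * M" by (rule F[of _ 0 1 _ 5]) (simp_all add: power_divide)
  have f51: "0 \<le> m ^ 6 * b ^ 10 \<and> m ^ 6 * b ^ 10 \<le> 11/250000000000000000000 * M" by (rule F[of _ 0 2 _ 4]) (simp_all add: power_divide)
  have f52: "0 \<le> m ^ 7 * b ^ 10 \<and> m ^ 7 * b ^ 10 \<le> 131/250000000000000000000 * M" by (rule F[of _ 0 3 _ 3]) (simp_all add: power_divide)
  have f53: "0 \<le> m ^ 8 * b ^ 10 \<and> m ^ 8 * b ^ 10 \<le> 1/160000000000000000 * M" by (rule F[of _ 0 4 _ 2]) (simp_all add: power_divide)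
  have f54: "0 \<le> m ^ 9 * b ^ 10 \<and> m ^ 9 * b ^ 10 \<le> 149/2000000000000000000 * M" by (rule F[of _ 0 5 _ 1]) (simp_all add: power_divide)
  have f55: "0 \<le> m ^ 10 * b ^ 10 \<and> m ^ 10 * b ^ 10 \<le> 111/125000000000000000 * M" by (rule F[of _ 0 6 _ 0]) (simp_all add: power_divide)
  have f56: "0 \<le> m ^ 1 * b ^ 11 \<and> m ^ 1 * b ^ 11 \<le> 93/2000000000000000000000000000000 * M" by (rule F[of _ 3 0 _ 7]) (simp_all add: power_divide)
  have f57: "0 \<le> m ^ 2 * b ^ 11 \<and> m ^ 2 * b ^ 11 \<le> 279/500000000000000000000000000000 * M" by (rule F[of _ 2 0 _ 7]) (simp_all add: power_divide)
  have f58: "0 \<le> m ^ 3 * b ^ 11 \<and> m ^ 3 * b ^ 11 \<le> 67/10000000000000000000000000000 * M" by (rule F[of _ 1 0 _ 7]) (simp_all add: power_divide)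
  have f59: "0 \<le> m ^ 4 * b ^ 11 \<and> m ^ 4 * b ^ 11 \<le> 201/2500000000000000000000000000 * M" by (rule F[of _ 0 0 _ 7]) (simp_all add: power_divide)
  have f60: "0 \<le> m ^ 5 * b ^ 11 \<and> m ^ 5 * b ^ 11 \<le> 479/500000000000000000000000000 * M" by (rule F[of _ 0 1 _ 6]) (simp_all add: power_divide)
  have f61: "0 \<le> m ^ 6 * b ^ 11 \<and> m ^ 6 * b ^ 11 \<le> 23/2000000000000000000000000 * M" by (rule F[of _ 0 2 _ 5]) (simp_all add: power_divide)
  have f62: "0 \<le> m ^ 7 * b ^ 11 \<and> m ^ 7 * b ^ 11 \<le> 137/1000000000000000000000000 * M" by (rule F[of _ 0 3 _ 4]) (simp_all add: power_divide)
  have f63: "0 \<le> m ^ 8 * b ^ 11 \<and> m ^ 8 * b ^ 11 \<le> 163/100000000000000000000000 * M" by (rule F[of _ 0 4 _ 3]) (simp_all add: power_divide)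
  have f64: "0 \<le> m ^ 9 * b ^ 11 \<and> m ^ 9 * b ^ 11 \<le> 97/5000000000000000000000 * M" by (rule F[of _ 0 5 _ 2]) (simp_all add: power_divide)
  have f65: "0 \<le> m ^ 10 * b ^ 11 \<and> m ^ 10 * b ^ 11 \<le> 231/1000000000000000000000 * M" by (rule F[of _ 0 6 _ 1]) (simp_all add: power_divide)
  show ?thesis unfolding mean_poly_expand abs_le_iff M_def[symmetric]
    using f0 f1 f2 f3 f4 f5 f6 f7 f8 f9 f10 f11 f12 f13 f14 f15 f16 f17 f18 f19 f20 f21 f22 f23 f24 f25 f26 f27 f28 f29 f30 f31 f32 f33 f34 f35 f36 f37 f38 f39 f40 f41 f42 f43 f44 f45 f46 f47 f48 f49 f50 f51 f52 f53 f54 f55 f56 f57 f58 f59 f60 f61 f62 f63 f64 f65 by linarith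
qed

text \<open>Here the expansion is correct up to order \<open>b\<^sup>2\<close>; the terms of order \<open>b ^ 3\<close> remain and determine the error
constant.\<close>
lemma var_poly_expand:
  fixes m b :: real
  shows "1024 * ((1 - 7 * b + 3 * b\<^sup>2) * (1 - b) * (2 - b - m * b - m * b\<^sup>2)\<^sup>2 - 2 * (1 - 3 * b + b\<^sup>2) * (2 - b - m * b - m * b\<^sup>2) * ((2 - b) * (1 - 2 * b) - m * b * (1 + b) * (3 - b) * (1 - b)) + (1 - 3 * b + b\<^sup>2)\<^sup>2 * ((2 - b) * (3 - b) - 2 * m * b * (1 + b) * (2 - b) - m\<^sup>2 * b * (1 + b) * (1 + 2 * b) * (1 - b))) - (256 + 16 * (- (m - 1)\<^sup>2 + 9 * (m - 1) - 14) * (b * (8 - b * (8 + 4 * m) + b\<^sup>2 * (8 + 4 * m + m * (m - 1)))) + (- 4 * (m - 1) ^ 3 + 20 * (m - 1)\<^sup>2 + 3 * (m - 1) - 54) * (b * (8 - b * (8 + 4 * m) + b\<^sup>2 * (8 + 4 * m + m * (m - 1))))\<^sup>2) * (1 - b) * (2 - b - m * b - m * b\<^sup>2) ^ 3 = - (9728 * (m ^ 0 * b ^ 3)) - 112640 * (m ^ 1 * b ^ 3) + 14208 * (m ^ 2 * b ^ 3) + 18432 * (m ^ 3 * b ^ 3) - 3456 * (m ^ 4 * b ^ 3) + 74624 * (m ^ 0 * b ^ 4) + 386944 * (m ^ 1 * b ^ 4) + 78528 * (m ^ 2 * b ^ 4) - 51264 * (m ^ 3 * b ^ 4) - 21440 *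 (m ^ 4 * b ^ 4) + 4928 * (m ^ 5 * b ^ 4) - 181696 * (m ^ 0 * b ^ 5) - 660032 * (m ^ 1 * b ^ 5) - 261024 * (m ^ 2 * b ^ 5) + 12160 * (m ^ 3 * b ^ 5) + 44224 * (m ^ 4 * b ^ 5) + 12480 * (m ^ 5 * b ^ 5) - 3424 * (m ^ 6 * b ^ 5) + 223552 * (m ^ 0 * b ^ 6) + 673568 * (m ^ 1 * b ^ 6) + 266680 * (m ^ 2 * b ^ 6) + 48360 * (m ^ 3 * b ^ 6) - 13800 * (m ^ 4 * b ^ 6) - 17304 * (m ^ 5 * b ^ 6) - 5008 * (m ^ 6 * b ^ 6) + 1424 * (m ^ 7 * b ^ 6) - 163776 * (m ^ 0 * b ^ 7) - 382256 * (m ^ 1 * b ^ 7) - 6836 * (m ^ 2 * b ^ 7) + 10184 * (m ^ 3 * b ^ 7) - 19168 * (m ^ 4 * b ^ 7) - 5896 * (m ^ 5 * b ^ 7) + 3908 * (m ^ 6 * b ^ 7) + 1648 * (m ^ 7 * b ^ 7) - 368 * (m ^ 8 * b ^ 7) + 73920 * (m ^ 0 * b ^ 8) + 75680 * (m ^ 1 * b ^ 8) - 232982 * (m ^ 2 * b ^ 8) - 109310 * (m ^ 3 * b ^ 8) - 4008 * (m ^ 4 * b ^ 8) + 15544 * (m ^ 5 * b ^ 8) + 6462 * (m ^ 6 * b ^ 8) - 722 * (m ^ 7 * b ^ 8) - 448 * (m ^ 8 * b ^ 8) + 56 * (m ^ 9 * b ^ 8) - 19008 * (m ^ 0 * b ^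 9) + 45696 * (m ^ 1 * b ^ 9) + 212681 * (m ^ 2 * b ^ 9) + 85464 * (m ^ 3 * b ^ 9) + 20145 * (m ^ 4 * b ^ 9) - 3664 * (m ^ 5 * b ^ 9) - 3757 * (m ^ 6 * b ^ 9) - 2172 * (m ^ 7 * b ^ 9) + 151 * (m ^ 8 * b ^ 9) + 84 * (m ^ 9 * b ^ 9) - 4 * (m ^ 10 * b ^ 9) + 2112 * (m ^ 0 * b ^ 10) - 33296 * (m ^ 1 * b ^ 10) - 72743 * (m ^ 2 * b ^ 10) + 12491 * (m ^ 3 * b ^ 10) + 7850 * (m ^ 4 * b ^ 10) - 3440 * (m ^ 5 * b ^ 10) - 1097 * (m ^ 6 * b ^ 10) - 343 * (m ^ 7 * b ^ 10) + 462 * (m ^ 8 * b ^ 10) - 20 * (m ^ 9 * b ^ 10) - 8 * (m ^ 10 * b ^ 10) + 6336 * (m ^ 1 * b ^ 11) - 4848 * (m ^ 2 * b ^ 11) - 42789 * (m ^ 3 * b ^ 11) - 17926 * (m ^ 4 * b ^ 11) - 3752 * (m ^ 5 * b ^ 11) + 2482 * (m ^ 6 * b ^ 11) + 697 * (m ^ 7 * b ^ 11) + 260 * (m ^ 8 * b ^ 11) - 76 * (m ^ 9 * b ^ 11) + 6336 * (m ^ 2 * b ^ 12) + 14160 * (m ^ 3 * b ^ 12) + 2859 * (m ^ 4 * b ^ 12) - 25 * (m ^ 5 * b ^ 12) + 291 * (m ^ 6 * b ^ 12) - 251 * (m ^ 7 * b ^ 12) - 14 * (m ^ 8 * b ^ 12)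 - 36 * (m ^ 9 * b ^ 12) + 8 * (m ^ 10 * b ^ 12) + 2112 * (m ^ 3 * b ^ 13) + 4720 * (m ^ 4 * b ^ 13) + 1129 * (m ^ 5 * b ^ 13) + 143 * (m ^ 6 * b ^ 13) - 281 * (m ^ 7 * b ^ 13) - 43 * (m ^ 8 * b ^ 13) - 8 * (m ^ 9 * b ^ 13) + 4 * (m ^ 10 * b ^ 13)"
  by algebra

lemma var_poly_bound:
  fixes m b :: real
  assumes "12 \<le> m" "0 < b" "b \<le> (26/100000)" "m * b \<le> (31/10000)"
  shows "\<bar>1024 * ((1 - 7 * b + 3 * b\<^sup>2) * (1 - b) * (2 - b - m * b - m * b\<^sup>2)\<^sup>2 - 2 * (1 - 3 * b + b\<^sup>2) * (2 - b - m * b - m * b\<^sup>2) * ((2 - b) * (1 - 2 * b) - m * b * (1 + b) * (3 - b) * (1 - b)) + (1 - 3 * b + b\<^sup>2)\<^sup>2 * ((2 - b) * (3 - b) - 2 * m * b * (1 + b) * (2 - b) - m\<^sup>2 * b * (1 + b) * (1 + 2 * b) * (1 - b))) - (256 + 16 * (- (m - 1)\<^sup>2 + 9 * (m - 1) - 14) * (b * (8 - b * (8 + 4 * m) + b\<^sup>2 * (8 + 4 * m + m * (m - 1)))) + (- 4 * (m - 1) ^ 3 + 20 * (m - 1)\<^sup>2 + 3 * (m - 1) - 54) * (b * (8 - b * (8 + 4 * m) + b\<^sup>2 * (8 + 4 * m + m * (m - 1))))\<^sup>2) * (1 - b) * (2 - b - m * b - m * b\<^sup>2) ^ 3 - (1024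 * (- 27/8 * m ^ 4 + 18 * m ^ 3 + 111/8 * m\<^sup>2 - 110 * m - 19/2)) * b ^ 3\<bar> \<le> 768/25 * (m ^ 4 * b ^ 3)"
proof -
  define M where "M = m ^ 4 * b ^ 3"
  note F = monomial_le[OF assms, where k = 3, folded M_def]
  have f0: "0 \<le> m ^ 0 * b ^ 4 \<and> m ^ 0 * b ^ 4 \<le> 63/5000000000 * M" by (rule F[of _ 4 0 _ 1]) (simp_all add: power_divide)
  have f1: "0 \<le> m ^ 1 * b ^ 4 \<and> m ^ 1 * b ^ 4 \<le> 151/1000000000 * M" by (rule F[of _ 3 0 _ 1]) (simp_all add: power_divide)
  have f2: "0 \<le> m ^ 2 * b ^ 4 \<and> m ^ 2 * b ^ 4 \<le> 181/100000000 * M" by (rule F[of _ 2 0 _ 1]) (simp_all add: power_divide)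
  have f3: "0 \<le> m ^ 3 * b ^ 4 \<and> m ^ 3 * b ^ 4 \<le> 217/10000000 * M" by (rule F[of _ 1 0 _ 1]) (simp_all add: power_divide)
  have f4: "0 \<le> m ^ 4 * b ^ 4 \<and> m ^ 4 * b ^ 4 \<le> 13/50000 * M" by (rule F[of _ 0 0 _ 1]) (simp_all add: power_divide)
  have f5: "0 \<le> m ^ 5 * b ^ 4 \<and> m ^ 5 * b ^ 4 \<le> 31/10000 * M" by (rule F[of _ 0 1 _ 0]) (simp_all add: power_divide)
  have f6: "0 \<le> m ^ 0 * b ^ 5 \<and> m ^ 0 * b ^ 5 \<le> 327/100000000000000 * M" by (rule F[of _ 4 0 _ 2]) (simp_all add: power_divide)
  have f7: "0 \<le> m ^ 1 * b ^ 5 \<and> m ^ 1 * b ^ 5 \<le> 49/1250000000000 * M" by (rule F[of _ 3 0 _ 2]) (simp_all add: power_divide)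
  have f8: "0 \<le> m ^ 2 * b ^ 5 \<and> m ^ 2 * b ^ 5 \<le> 47/100000000000 * M" by (rule F[of _ 2 0 _ 2]) (simp_all add: power_divide)
  have f9: "0 \<le> m ^ 3 * b ^ 5 \<and> m ^ 3 * b ^ 5 \<le> 141/25000000000 * M" by (rule F[of _ 1 0 _ 2]) (simp_all add: power_divide)
  have f10: "0 \<le> m ^ 4 * b ^ 5 \<and> m ^ 4 * b ^ 5 \<le> 169/2500000000 * M" by (rule F[of _ 0 0 _ 2]) (simp_all add: power_divide)
  have f11: "0 \<le> m ^ 5 * b ^ 5 \<and> m ^ 5 * b ^ 5 \<le> 403/500000000 * M" by (rule F[of _ 0 1 _ 1]) (simp_all add: power_divide)
  have f12: "0 \<le> m ^ 6 * b ^ 5 \<and> m ^ 6 * b ^ 5 \<le> 961/100000000 * M" by (rule F[of _ 0 2 _ 0]) (simp_all add: power_divide)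
  have f13: "0 \<le> m ^ 0 * b ^ 6 \<and> m ^ 0 * b ^ 6 \<le> 53/62500000000000000 * M" by (rule F[of _ 4 0 _ 3]) (simp_all add: power_divide)
  have f14: "0 \<le> m ^ 1 * b ^ 6 \<and> m ^ 1 * b ^ 6 \<le> 51/5000000000000000 * M" by (rule F[of _ 3 0 _ 3]) (simp_all add: power_divide)
  have f15: "0 \<le> m ^ 2 * b ^ 6 \<and> m ^ 2 * b ^ 6 \<le> 123/1000000000000000 * M" by (rule F[of _ 2 0 _ 3]) (simp_all add: power_divide)
  have f16: "0 \<le> m ^ 3 * b ^ 6 \<and> m ^ 3 * b ^ 6 \<le> 147/100000000000000 * M" by (rule F[of _ 1 0 _ 3]) (simp_all add: power_divide)
  have f17: "0 \<le> m ^ 4 * b ^ 6 \<and> m ^ 4 * b ^ 6 \<le> 11/625000000000 * M" by (rule F[of _ 0 0 _ 3]) (simp_all add: power_divide)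
  have f18: "0 \<le> m ^ 5 * b ^ 6 \<and> m ^ 5 * b ^ 6 \<le> 21/100000000000 * M" by (rule F[of _ 0 1 _ 2]) (simp_all add: power_divide)
  have f19: "0 \<le> m ^ 6 * b ^ 6 \<and> m ^ 6 * b ^ 6 \<le> 1/400000000 * M" by (rule F[of _ 0 2 _ 1]) (simp_all add: power_divide)
  have f20: "0 \<le> m ^ 7 * b ^ 6 \<and> m ^ 7 * b ^ 6 \<le> 149/5000000000 * M" by (rule F[of _ 0 3 _ 0]) (simp_all add: power_divide)
  have f21: "0 \<le> m ^ 0 * b ^ 7 \<and> m ^ 0 * b ^ 7 \<le> 221/1000000000000000000000 * M" by (rule F[of _ 4 0 _ 4]) (simp_all add: power_divide)
  have f22: "0 \<le> m ^ 1 * b ^ 7 \<and> m ^ 1 * b ^ 7 \<le> 53/20000000000000000000 * M" by (rule F[of _ 3 0 _ 4]) (simp_all add: power_divide)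
  have f23: "0 \<le> m ^ 2 * b ^ 7 \<and> m ^ 2 * b ^ 7 \<le> 159/5000000000000000000 * M" by (rule F[of _ 2 0 _ 4]) (simp_all add: power_divide)
  have f24: "0 \<le> m ^ 3 * b ^ 7 \<and> m ^ 3 * b ^ 7 \<le> 381/1000000000000000000 * M" by (rule F[of _ 1 0 _ 4]) (simp_all add: power_divide)
  have f25: "0 \<le> m ^ 4 * b ^ 7 \<and> m ^ 4 * b ^ 7 \<le> 457/100000000000000000 * M" by (rule F[of _ 0 0 _ 4]) (simp_all add: power_divide)
  have f26: "0 \<le> m ^ 5 * b ^ 7 \<and> m ^ 5 * b ^ 7 \<le> 109/2000000000000000 * M" by (rule F[of _ 0 1 _ 3]) (simp_all add: power_divide)
  have f27: "0 \<le> m ^ 6 * b ^ 7 \<and> m ^ 6 * b ^ 7 \<le> 13/20000000000000 * M" by (rule F[of _ 0 2 _ 2]) (simp_all add: power_divide)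
  have f28: "0 \<le> m ^ 7 * b ^ 7 \<and> m ^ 7 * b ^ 7 \<le> 31/4000000000000 * M" by (rule F[of _ 0 3 _ 1]) (simp_all add: power_divide)
  have f29: "0 \<le> m ^ 8 * b ^ 7 \<and> m ^ 8 * b ^ 7 \<le> 231/2500000000000 * M" by (rule F[of _ 0 4 _ 0]) (simp_all add: power_divide)
  have f30: "0 \<le> m ^ 0 * b ^ 8 \<and> m ^ 0 * b ^ 8 \<le> 573/10000000000000000000000000 * M" by (rule F[of _ 4 0 _ 5]) (simp_all add: power_divide)
  have f31: "0 \<le> m ^ 1 * b ^ 8 \<and> m ^ 1 * b ^ 8 \<le> 43/62500000000000000000000 * M" by (rule F[of _ 3 0 _ 5]) (simp_all add: power_divide)
  have f32: "0 \<le> m ^ 2 * b ^ 8 \<and> m ^ 2 * b ^ 8 \<le> 413/50000000000000000000000 * M" by (rule F[of _ 2 0 _ 5]) (simp_all add: power_divide)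
  have f33: "0 \<le> m ^ 3 * b ^ 8 \<and> m ^ 3 * b ^ 8 \<le> 991/10000000000000000000000 * M" by (rule F[of _ 1 0 _ 5]) (simp_all add: power_divide)
  have f34: "0 \<le> m ^ 4 * b ^ 8 \<and> m ^ 4 * b ^ 8 \<le> 119/100000000000000000000 * M" by (rule F[of _ 0 0 _ 5]) (simp_all add: power_divide)
  have f35: "0 \<le> m ^ 5 * b ^ 8 \<and> m ^ 5 * b ^ 8 \<le> 71/5000000000000000000 * M" by (rule F[of _ 0 1 _ 4]) (simp_all add: power_divide)
  have f36: "0 \<le> m ^ 6 * b ^ 8 \<and> m ^ 6 * b ^ 8 \<le> 169/1000000000000000000 * M" by (rule F[of _ 0 2 _ 3]) (simp_all add: power_divide)
  have f37: "0 \<le> m ^ 7 * b ^ 8 \<and> m ^ 7 * b ^ 8 \<le> 101/50000000000000000 * M" by (rule F[of _ 0 3 _ 2]) (simp_all add: power_divide)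
  have f38: "0 \<le> m ^ 8 * b ^ 8 \<and> m ^ 8 * b ^ 8 \<le> 241/10000000000000000 * M" by (rule F[of _ 0 4 _ 1]) (simp_all add: power_divide)
  have f39: "0 \<le> m ^ 9 * b ^ 8 \<and> m ^ 9 * b ^ 8 \<le> 287/1000000000000000 * M" by (rule F[of _ 0 5 _ 0]) (simp_all add: power_divide)
  have f40: "0 \<le> m ^ 0 * b ^ 9 \<and> m ^ 0 * b ^ 9 \<le> 149/10000000000000000000000000000 * M" by (rule F[of _ 4 0 _ 6]) (simp_all add: power_divide)
  have f41: "0 \<le> m ^ 1 * b ^ 9 \<and> m ^ 1 * b ^ 9 \<le> 179/1000000000000000000000000000 * M" by (rule F[of _ 3 0 _ 6]) (simp_all add: power_divide)
  have f42: "0 \<le> m ^ 2 * b ^ 9 \<and> m ^ 2 * b ^ 9 \<le> 43/20000000000000000000000000 * M" by (rule F[of _ 2 0 _ 6]) (simp_all add: power_divide)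
  have f43: "0 \<le> m ^ 3 * b ^ 9 \<and> m ^ 3 * b ^ 9 \<le> 129/5000000000000000000000000 * M" by (rule F[of _ 1 0 _ 6]) (simp_all add: power_divide)
  have f44: "0 \<le> m ^ 4 * b ^ 9 \<and> m ^ 4 * b ^ 9 \<le> 309/1000000000000000000000000 * M" by (rule F[of _ 0 0 _ 6]) (simp_all add: power_divide)
  have f45: "0 \<le> m ^ 5 * b ^ 9 \<and> m ^ 5 * b ^ 9 \<le> 369/100000000000000000000000 * M" by (rule F[of _ 0 1 _ 5]) (simp_all add: power_divide)
  have f46: "0 \<le> m ^ 6 * b ^ 9 \<and> m ^ 6 * b ^ 9 \<le> 11/250000000000000000000 * M" by (rule F[of _ 0 2 _ 4]) (simp_all add: power_divide)
  have f47: "0 \<le> m ^ 7 * b ^ 9 \<and> m ^ 7 * b ^ 9 \<le> 131/250000000000000000000 * M" by (rule F[of _ 0 3 _ 3]) (simp_all add: power_divide)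
  have f48: "0 \<le> m ^ 8 * b ^ 9 \<and> m ^ 8 * b ^ 9 \<le> 1/160000000000000000 * M" by (rule F[of _ 0 4 _ 2]) (simp_all add: power_divide)
  have f49: "0 \<le> m ^ 9 * b ^ 9 \<and> m ^ 9 * b ^ 9 \<le> 149/2000000000000000000 * M" by (rule F[of _ 0 5 _ 1]) (simp_all add: power_divide)
  have f50: "0 \<le> m ^ 10 * b ^ 9 \<and> m ^ 10 * b ^ 9 \<le> 111/125000000000000000 * M" by (rule F[of _ 0 6 _ 0]) (simp_all add: power_divide)
  have f51: "0 \<le> m ^ 0 * b ^ 10 \<and> m ^ 0 * b ^ 10 \<le> 97/25000000000000000000000000000000 * M" by (rule F[of _ 4 0 _ 7]) (simp_all add: power_divide)
  have f52: "0 \<le> m ^ 1 * b ^ 10 \<and> m ^ 1 * b ^ 10 \<le> 93/2000000000000000000000000000000 * M" by (rule F[of _ 3 0 _ 7]) (simp_all add: power_divide)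
  have f53: "0 \<le> m ^ 2 * b ^ 10 \<and> m ^ 2 * b ^ 10 \<le> 279/500000000000000000000000000000 * M" by (rule F[of _ 2 0 _ 7]) (simp_all add: power_divide)
  have f54: "0 \<le> m ^ 3 * b ^ 10 \<and> m ^ 3 * b ^ 10 \<le> 67/10000000000000000000000000000 * M" by (rule F[of _ 1 0 _ 7]) (simp_all add: power_divide)
  have f55: "0 \<le> m ^ 4 * b ^ 10 \<and> m ^ 4 * b ^ 10 \<le> 201/2500000000000000000000000000 * M" by (rule F[of _ 0 0 _ 7]) (simp_all add: power_divide)
  have f56: "0 \<le> m ^ 5 * b ^ 10 \<and> m ^ 5 * b ^ 10 \<le> 479/500000000000000000000000000 * M" by (rule F[of _ 0 1 _ 6]) (simp_all add: power_divide)
  have f57: "0 \<le> m ^ 6 * b ^ 10 \<and> m ^ 6 * b ^ 10 \<le> 23/2000000000000000000000000 * M" by (rule F[of _ 0 2 _ 5]) (simp_all add: power_divide)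
  have f58: "0 \<le> m ^ 7 * b ^ 10 \<and> m ^ 7 * b ^ 10 \<le> 137/1000000000000000000000000 * M" by (rule F[of _ 0 3 _ 4]) (simp_all add: power_divide)
  have f59: "0 \<le> m ^ 8 * b ^ 10 \<and> m ^ 8 * b ^ 10 \<le> 163/100000000000000000000000 * M" by (rule F[of _ 0 4 _ 3]) (simp_all add: power_divide)
  have f60: "0 \<le> m ^ 9 * b ^ 10 \<and> m ^ 9 * b ^ 10 \<le> 97/5000000000000000000000 * M" by (rule F[of _ 0 5 _ 2]) (simp_all add: power_divide)
  have f61: "0 \<le> m ^ 10 * b ^ 10 \<and> m ^ 10 * b ^ 10 \<le> 231/1000000000000000000000 * M" by (rule F[of _ 0 6 _ 1]) (simp_all add: power_divide)
  have f62: "0 \<le> m ^ 1 * b ^ 11 \<and> m ^ 1 * b ^ 11 \<le> 121/10000000000000000000000000000000000 * M" by (rule F[of _ 3 0 _ 8]) (simp_all add: power_divide)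
  have f63: "0 \<le> m ^ 2 * b ^ 11 \<and> m ^ 2 * b ^ 11 \<le> 73/500000000000000000000000000000000 * M" by (rule F[of _ 2 0 _ 8]) (simp_all add: power_divide)
  have f64: "0 \<le> m ^ 3 * b ^ 11 \<and> m ^ 3 * b ^ 11 \<le> 7/4000000000000000000000000000000 * M" by (rule F[of _ 1 0 _ 8]) (simp_all add: power_divide)
  have f65: "0 \<le> m ^ 4 * b ^ 11 \<and> m ^ 4 * b ^ 11 \<le> 209/10000000000000000000000000000000 * M" by (rule F[of _ 0 0 _ 8]) (simp_all add: power_divide)
  have f66: "0 \<le> m ^ 5 * b ^ 11 \<and> m ^ 5 * b ^ 11 \<le> 249/1000000000000000000000000000000 * M" by (rule F[of _ 0 1 _ 7]) (simp_all add: power_divide)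
  have f67: "0 \<le> m ^ 6 * b ^ 11 \<and> m ^ 6 * b ^ 11 \<le> 297/100000000000000000000000000000 * M" by (rule F[of _ 0 2 _ 6]) (simp_all add: power_divide)
  have f68: "0 \<le> m ^ 7 * b ^ 11 \<and> m ^ 7 * b ^ 11 \<le> 177/5000000000000000000000000000 * M" by (rule F[of _ 0 3 _ 5]) (simp_all add: power_divide)
  have f69: "0 \<le> m ^ 8 * b ^ 11 \<and> m ^ 8 * b ^ 11 \<le> 423/1000000000000000000000000000 * M" by (rule F[of _ 0 4 _ 4]) (simp_all add: power_divide)
  have f70: "0 \<le> m ^ 9 * b ^ 11 \<and> m ^ 9 * b ^ 11 \<le> 63/12500000000000000000000000 * M" by (rule F[of _ 0 5 _ 3]) (simp_all add: power_divide)
  have f71: "0 \<le> m ^ 2 * b ^ 12 \<and> m ^ 2 * b ^ 12 \<le> 189/5000000000000000000000000000000000000 * M" by (rule F[of _ 2 0 _ 9]) (simp_all add: power_divide)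
  have f72: "0 \<le> m ^ 3 * b ^ 12 \<and> m ^ 3 * b ^ 12 \<le> 453/1000000000000000000000000000000000000 * M" by (rule F[of _ 1 0 _ 9]) (simp_all add: power_divide)
  have f73: "0 \<le> m ^ 4 * b ^ 12 \<and> m ^ 4 * b ^ 12 \<le> 543/100000000000000000000000000000000000 * M" by (rule F[of _ 0 0 _ 9]) (simp_all add: power_divide)
  have f74: "0 \<le> m ^ 5 * b ^ 12 \<and> m ^ 5 * b ^ 12 \<le> 81/1250000000000000000000000000000000 * M" by (rule F[of _ 0 1 _ 8]) (simp_all add: power_divide)
  have f75: "0 \<le> m ^ 6 * b ^ 12 \<and> m ^ 6 * b ^ 12 \<le> 193/250000000000000000000000000000000 * M" by (rule F[of _ 0 2 _ 7]) (simp_all add: power_divide)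
  have f76: "0 \<le> m ^ 7 * b ^ 12 \<and> m ^ 7 * b ^ 12 \<le> 921/100000000000000000000000000000000 * M" by (rule F[of _ 0 3 _ 6]) (simp_all add: power_divide)
  have f77: "0 \<le> m ^ 8 * b ^ 12 \<and> m ^ 8 * b ^ 12 \<le> 11/100000000000000000000000000000 * M" by (rule F[of _ 0 4 _ 5]) (simp_all add: power_divide)
  have f78: "0 \<le> m ^ 9 * b ^ 12 \<and> m ^ 9 * b ^ 12 \<le> 131/100000000000000000000000000000 * M" by (rule F[of _ 0 5 _ 4]) (simp_all add: power_divide)
  have f79: "0 \<le> m ^ 10 * b ^ 12 \<and> m ^ 10 * b ^ 12 \<le> 39/2500000000000000000000000000 * M" by (rule F[of _ 0 6 _ 3]) (simp_all add: power_divide)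
  have f80: "0 \<le> m ^ 3 * b ^ 13 \<and> m ^ 3 * b ^ 13 \<le> 59/500000000000000000000000000000000000000 * M" by (rule F[of _ 1 0 _ 10]) (simp_all add: power_divide)
  have f81: "0 \<le> m ^ 4 * b ^ 13 \<and> m ^ 4 * b ^ 13 \<le> 71/50000000000000000000000000000000000000 * M" by (rule F[of _ 0 0 _ 10]) (simp_all add: power_divide)
  have f82: "0 \<le> m ^ 5 * b ^ 13 \<and> m ^ 5 * b ^ 13 \<le> 169/10000000000000000000000000000000000000 * M" by (rule F[of _ 0 1 _ 9]) (simp_all add: power_divide)
  have f83: "0 \<le> m ^ 6 * b ^ 13 \<and> m ^ 6 * b ^ 13 \<le> 201/1000000000000000000000000000000000000 * M" by (rule F[of _ 0 2 _ 8]) (simp_all add: power_divide)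
  have f84: "0 \<le> m ^ 7 * b ^ 13 \<and> m ^ 7 * b ^ 13 \<le> 3/1250000000000000000000000000000000 * M" by (rule F[of _ 0 3 _ 7]) (simp_all add: power_divide)
  have f85: "0 \<le> m ^ 8 * b ^ 13 \<and> m ^ 8 * b ^ 13 \<le> 143/5000000000000000000000000000000000 * M" by (rule F[of _ 0 4 _ 6]) (simp_all add: power_divide)
  have f86: "0 \<le> m ^ 9 * b ^ 13 \<and> m ^ 9 * b ^ 13 \<le> 341/1000000000000000000000000000000000 * M" by (rule F[of _ 0 5 _ 5]) (simp_all add: power_divide)
  have f87: "0 \<le> m ^ 10 * b ^ 13 \<and> m ^ 10 * b ^ 13 \<le> 203/50000000000000000000000000000000 * M" by (rule F[of _ 0 6 _ 4]) (simp_all add: power_divide)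
  have L: "(1024 * (- 27/8 * m ^ 4 + 18 * m ^ 3 + 111/8 * m\<^sup>2 - 110 * m - 19/2)) * b ^ 3 = - (3456 * M) + 18432 * (m ^ 3 * b ^ 3) + 14208 * (m\<^sup>2 * b ^ 3) - 112640 * (m ^ 1 * b ^ 3) - 9728 * (m ^ 0 * b ^ 3)"
    unfolding M_def by (simp add: algebra_simps)
  show ?thesis unfolding var_poly_expand L abs_le_iff M_def[symmetric]
    using f0 f1 f2 f3 f4 f5 f6 f7 f8 f9 f10 f11 f12 f13 f14 f15 f16 f17 f18 f19 f20 f21 f22 f23 f24 f25 f26 f27 f28 f29 f30 f31 f32 f33 f34 f35 f36 f37 f38 f39 f40 f41 f42 f43 f44 f45 f46 f47 f48 f49 f50 f51 f52 f53 f54 f55 f56 f57 f58 f59 f60 f61 f62 f63 f64 f65 f66 f67 f68 f69 f70 f71 f72 f73 f74 f75 f76 f77 f78 f79 f80 f81 f82 f83 f84 f85 f86 f87 by linarith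
qed

text \<open>Second order Bonferroni bounds.\<close>
lemma power_one_minus_bounds:
  fixes s :: real assumes "0 \<le> s" "s \<le> 1"
  shows "(1 - s) ^ n \<le> 1 - n * s + n * (n - 1) / 2 * s\<^sup>2 \<and> 1 - n * s + n * (n - 1) / 2 * s\<^sup>2 - n ^ 3 / 6 * s ^ 3 \<le> (1 - s) ^ n"
proof (induction n)
  case (Suc n)
  define U where "U = (\<lambda>x::real. 1 - x * s + x * (x - 1) / 2 * s\<^sup>2)"
  have x: "real (Suc n) = real n + 1" by simp
  have n: "real n * (real n - 1) \<ge> 0" by (cases n) auto
  have s3: "s ^ 3 \<ge> 0" "s ^ 4 \<ge> 0" using assms by auto
  have e: "(1 - s) * U (real n) = U (real n + 1) - real n * (real n - 1) / 2 * s ^ 3"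
    by (simp add: U_def field_simps eval_nat_numeral)
  have nn: "0 \<le> real n * (real n - 1) / 2 * s ^ 3" using n s3 by simp
  have "(1 - s) ^ Suc n \<le> (1 - s) * U (real n)" using Suc assms by (simp add: U_def mult_left_mono)
  hence up: "(1 - s) ^ Suc n \<le> U (real n + 1)" using e nn by linarith
  have "(1 - s) * (U (real n) - real n ^ 3 / 6 * s ^ 3) \<le> (1 - s) ^ Suc n" using Suc assms by (simp add: U_def mult_left_mono)
  moreover have "(1 - s) * (U (real n) - real n ^ 3 / 6 * s ^ 3) = U (real n + 1) - real n * (real n - 1) / 2 * s ^ 3 - real n ^ 3 / 6 * s ^ 3 + real n ^ 3 / 6 * s ^ 4"
    unfolding right_diff_distrib e by (simp add: field_simps eval_nat_numeral)
  moreover have "U (real n + 1) - (real n + 1) ^ 3 / 6 * s ^ 3 \<le> U (real n + 1) - real n * (real n - 1) / 2 * s ^ 3 - real n ^ 3 / 6 * s ^ 3 + real n ^ 3 / 6 * s ^ 4"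
  proof -
    have "(real n * (real n - 1) / 2 + real n ^ 3 / 6) * s ^ 3 \<le> (real n + 1) ^ 3 / 6 * s ^ 3"
      using s3 by (intro mult_right_mono) (auto simp: field_simps eval_nat_numeral)
    moreover have "0 \<le> real n ^ 3 / 6 * s ^ 4" using s3 by simp
    ultimately show ?thesis unfolding distrib_right by linarith
  qed
  ultimately have "U (real n + 1) - (real n + 1) ^ 3 / 6 * s ^ 3 \<le> (1 - s) ^ Suc n" by linarith
  thus ?case using up unfolding x by (simp add: U_def)
qed simp

lemma power_near_one:
  fixes \<kappa> \<epsilon> :: real assumes "\<bar>\<kappa>\<bar> \<le> \<epsilon>" "real n * \<epsilon> \<le> 1" "\<epsilon> \<le> 1"
  shows "\<bar>(1 + \<kappa>) ^ n - 1\<bar> \<le> 2 * real n * \<epsilon>"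
proof -
  have e: "\<epsilon> \<ge> 0" using assms by linarith
  have "1 + real n * \<kappa> \<le> (1 + \<kappa>) ^ n" using assms by (intro Bernoulli_inequality) auto
  moreover have "real n * (- \<epsilon>) \<le> real n * \<kappa>" using assms by (intro mult_left_mono) auto
  moreover have "(1 + \<kappa>) ^ n \<le> 1 + 2 * (real n * \<epsilon>)"
  proof -
    have "1 + \<kappa> \<le> exp \<epsilon>" using assms exp_ge_add_one_self[of \<epsilon>] by linarith
    hence "(1 + \<kappa>) ^ n \<le> (exp \<epsilon>) ^ n" using assms by (intro power_mono) auto
    also have "\<dots> = exp (real n * \<epsilon>)" by (simp add: exp_of_nat_mult)
    also have "\<dots> \<le> 1 + real n * \<epsilon> + (real n * \<epsilon>)\<^sup>2" using assms e by (intro exp_bound) auto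
    also have "(real n * \<epsilon>)\<^sup>2 \<le> real n * \<epsilon>"
      unfolding power2_eq_square using assms e mult_right_mono[of "real n * \<epsilon>" 1 "real n * \<epsilon>"] by simp
    finally show ?thesis by (simp add: mult.commute)
  qed
  moreover have "0 \<le> real n * \<epsilon>" using e by simp
  ultimately show ?thesis by (simp add: abs_le_iff)
qed

text \<open>The bounds on \<open>b\<close> and \<open>m * b\<close> hold for \<open>b = l\<^sub>1\<close> at the dominant root as soon as \<open>m \<ge> 12\<close>.\<close>
locale large_arity =
  fixes m b :: real
  assumes m: "12 \<le> m" and b: "0 < b" "b \<le> (26/100000)" and mb: "m * b \<le> (31/10000)"
begin

text \<open>The expansion of \<open>2 ^ (- t)\<close> in powers of \<open>b\<close>.\<close>
definition \<zeta> where "\<zeta> = b * (8 - b * (8 + 4 * m) + b\<^sup>2 * (8 + 4 * m + m * (m - 1))) / 4"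
text \<open>With \<open>l\<^sub>0 * (1 - b) = 1\<close>, the drift is \<open>Nn / Dn\<close> and the dispersion is \<open>Numer / ((1 - b) * Dn ^ 3)\<close>. The names \<open>Bus\<close> and \<open>Bss\<close>
refer to the mixed and pure second derivatives of the kernel.\<close>
definition Dn where "Dn = 2 - b - m * b - m * b\<^sup>2"
definition Nn where "Nn = 1 - 3 * b + b\<^sup>2"
definition Bus where "Bus = (2 - b) * (1 - 2 * b) - m * b * (1 + b) * (3 - b) * (1 - b)"
definition Bss where "Bss = (2 - b) * (3 - b) - 2 * m * b * (1 + b) * (2 - b) - m\<^sup>2 * b * (1 + b) * (1 + 2 * b) * (1 - b)"
definition Numer where "Numer = (1 - 7 * b + 3 * b\<^sup>2) * (1 - b) * Dn\<^sup>2 - 2 * Nn * Dn * Bus + Nn\<^sup>2 * Bss"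
definition mu_poly :: "real \<Rightarrow> real" where "mu_poly z = 1 / 2 + z * (m - 5) / 8 + z\<^sup>2 * (2 * (m - 1)\<^sup>2 - (m - 1) - 14) / 32
   + z ^ 3 * (9 * (m - 1) ^ 3 + 27 * (m - 1)\<^sup>2 - 76 * (m - 1) - 144) / 256"
definition sigma_poly :: "real \<Rightarrow> real" where "sigma_poly z = 1 / 4 + z * (- (m - 1)\<^sup>2 + 9 * (m - 1) - 14) / 16
   + z\<^sup>2 * (- 4 * (m - 1) ^ 3 + 20 * (m - 1)\<^sup>2 + 3 * (m - 1) - 54) / 64"

lemma small: "m * b\<^sup>2 \<le> (81/100000000)" "0 \<le> m * b\<^sup>2" "b\<^sup>2 \<le> (68/1000000000)" "0 \<le> b\<^sup>2" "(m * b)\<^sup>2 \<le> (961/100000000)" "0 \<le> m * b"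
proof -
  show "0 \<le> m * b" using m b by simp
  have "(m * b) * b \<le> (31/10000) * (26/100000)" using m b mb by (intro mult_mono) auto
  thus "m * b\<^sup>2 \<le> (81/100000000)" by (simp add: power2_eq_square)
  have "b * b \<le> (26/100000) * (26/100000)" using b by (intro mult_mono) auto
  thus "b\<^sup>2 \<le> (68/1000000000)" by (simp add: power2_eq_square)
  have "(m * b) * (m * b) \<le> (31/10000) * (31/10000)" using m b mb by (intro mult_mono) auto
  thus "(m * b)\<^sup>2 \<le> (961/100000000)" by (simp add: power2_eq_square)
qed (use m b in auto)

lemma Dn_bounds: "(1996/1000) \<le> Dn" "Dn \<le> 2" unfolding Dn_def using small mb b m by linarith+

lemma zeta_bounds: "(1996/1000) * b \<le> \<zeta>" "\<zeta> \<le> 2 * b"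
proof -
  have e: "\<zeta> = b * (2 - 2 * b - m * b + (2 * b\<^sup>2 + m * b\<^sup>2 + (m * b)\<^sup>2 / 4 - m * b\<^sup>2 / 4))"
    by (simp add: \<zeta>_def field_simps power2_eq_square)
  have "(1996/1000) \<le> 2 - 2 * b - m * b + (2 * b\<^sup>2 + m * b\<^sup>2 + (m * b)\<^sup>2 / 4 - m * b\<^sup>2 / 4)"
    using small b mb zero_le_power2[of "m * b"] by linarith
  thus "(1996/1000) * b \<le> \<zeta>" unfolding e using b by (simp add: mult.commute mult_left_mono)
  have "m * b\<^sup>2 \<le> (26/100000) * (m * b)" using m b by (simp add: power2_eq_square mult_right_mono mult.commute mult.left_commute)
  moreover have "(m * b)\<^sup>2 \<le> (31/10000) * (m * b)" unfolding power2_eq_square using mb small by (intro mult_right_mono) auto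
  moreover have "b\<^sup>2 \<le> (26/100000) * b" unfolding power2_eq_square using b by (intro mult_right_mono) auto
  ultimately have "2 - 2 * b - m * b + (2 * b\<^sup>2 + m * b\<^sup>2 + (m * b)\<^sup>2 / 4 - m * b\<^sup>2 / 4) \<le> 2"
    using small b by linarith
  thus "\<zeta> \<le> 2 * b" unfolding e using b by (simp add: mult.commute mult_left_mono)
qed

context
  fixes z :: real
  assumes z: "\<bar>z - \<zeta>\<bar> \<le> (8/100) * (m ^ 3 * b ^ 4)"
begin

lemma z_bounds: "(1995/1000) * b \<le> z" "z \<le> (2001/1000) * b"
proof -
  have "(m * b) ^ 3 * b \<le> (31/10000) ^ 3 * b" using small b mb by (intro mult_right_mono power_mono) auto
  hence "m ^ 3 * b ^ 4 \<le> (1/1000) * b" using b by (simp add: power_mult_distrib eval_nat_numeral mult_ac)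
  thus "(1995/1000) * b \<le> z" "z \<le> (2001/1000) * b" using z zeta_bounds by linarith+
qed

lemma t_bounds: 
  "\<bar>2 * (m - 1)\<^sup>2 - (m - 1) - 14\<bar> \<le> 2 * m\<^sup>2" "\<bar>9 * (m - 1) ^ 3 + 27 * (m - 1)\<^sup>2 - 76 * (m - 1) - 144\<bar> \<le> 18 * m ^ 3"
  "\<bar>- (m - 1)\<^sup>2 + 9 * (m - 1) - 14\<bar> \<le> m\<^sup>2" "\<bar>- 4 * (m - 1) ^ 3 + 20 * (m - 1)\<^sup>2 + 3 * (m - 1) - 54\<bar> \<le> 4 * m ^ 3"
proof -
  have m2: "m\<^sup>2 \<ge> 12 * m" using m by (simp add: power2_eq_square)
  have m3: "m ^ 3 \<ge> 12 * m\<^sup>2" using m by (simp add: power3_eq_cube power2_eq_square)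
  have p: "(m - 1)\<^sup>2 = m\<^sup>2 - 2 * m + 1" "(m - 1) ^ 3 = m ^ 3 - 3 * m\<^sup>2 + 3 * m - 1" by (simp_all add: power2_eq_square power3_eq_cube algebra_simps)
  show "\<bar>2 * (m - 1)\<^sup>2 - (m - 1) - 14\<bar> \<le> 2 * m\<^sup>2"
    unfolding p abs_le_iff right_diff_distrib distrib_left using m m2 m3 by auto
  show "\<bar>9 * (m - 1) ^ 3 + 27 * (m - 1)\<^sup>2 - 76 * (m - 1) - 144\<bar> \<le> 18 * m ^ 3"
    unfolding p abs_le_iff right_diff_distrib distrib_left using m m2 m3 by auto
  show "\<bar>- (m - 1)\<^sup>2 + 9 * (m - 1) - 14\<bar> \<le> m\<^sup>2"
    unfolding p abs_le_iff right_diff_distrib distrib_left using m m2 m3 by auto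
  show "\<bar>- 4 * (m - 1) ^ 3 + 20 * (m - 1)\<^sup>2 + 3 * (m - 1) - 54\<bar> \<le> 4 * m ^ 3"
    unfolding p abs_le_iff right_diff_distrib distrib_left using m m2 m3 by auto
qed

text \<open>The residual polynomial contributes at most \<open>0.95 * M\<close>, replacing \<open>\<zeta>\<close> by \<open>z\<close> at most \<open>0.021 * M\<close>, and the asserted error term is at
least \<open>0.98 * M\<close> after multiplication by the denominator.\<close>
lemma mean_final:
  assumes \<mu>: "\<bar>Nn - \<mu> * Dn\<bar> \<le> b ^ 4"
  shows "\<bar>\<mu> - mu_poly z\<bar> \<le> (6/100) * (m - 1) ^ 4 * z ^ 4"
proof -
  define M where "M = m ^ 4 * b ^ 4"
  have b4: "b ^ 4 \<le> (1/10000) * M"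
  proof -
    have "12 ^ 4 * b ^ 4 \<le> m ^ 4 * b ^ 4" using m by (intro mult_right_mono power_mono) auto
    moreover have "12 ^ 4 * b ^ 4 = 20736 * b ^ 4" by simp
    moreover have "0 \<le> b ^ 4" by simp
    ultimately show ?thesis unfolding M_def by linarith
  qed
  have 1: "\<bar>Nn - mu_poly \<zeta> * Dn\<bar> \<le> (95/100) * M"
  proof -
    have "16384 * (Nn - mu_poly \<zeta> * Dn) = 16384 * (1 - 3 * b + b\<^sup>2) - (8192 + 512 * (m - 5) * (4 * \<zeta>) + 32 * (2 * (m - 1)\<^sup>2 - (m - 1) - 14) * (4 * \<zeta>)\<^sup>2 + (9 * (m - 1) ^ 3 + 27 * (m - 1)\<^sup>2 - 76 * (m - 1) - 144) * (4 * \<zeta>) ^ 3) * (2 - b - m * b - m * b\<^sup>2)"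
      unfolding Dn_def[symmetric] Nn_def[symmetric] mu_poly_def by (simp add: field_simps power2_eq_square power3_eq_cube)
    moreover have "4 * \<zeta> = b * (8 - b * (8 + 4 * m) + b\<^sup>2 * (8 + 4 * m + m * (m - 1)))" by (simp add: \<zeta>_def)
    ultimately have "\<bar>16384 * (Nn - mu_poly \<zeta> * Dn)\<bar> \<le> 77824/5 * M"
      using mean_poly_bound[OF m b mb] unfolding M_def by (simp only:)
    thus ?thesis unfolding abs_mult by simp
  qed
  define Br where "Br = (m - 5) / 8 + (z + \<zeta>) * (2 * (m - 1)\<^sup>2 - (m - 1) - 14) / 32 + (z\<^sup>2 + z * \<zeta> + \<zeta>\<^sup>2) * (9 * (m - 1) ^ 3 + 27 * (m - 1)\<^sup>2 - 76 * (m - 1) - 144) / 256"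
  have dif: "mu_poly z - mu_poly \<zeta> = (z - \<zeta>) * Br"
    unfolding mu_poly_def Br_def by (simp add: field_simps power2_eq_square power3_eq_cube)
  have "\<bar>Br\<bar> \<le> (13/100) * m"
  proof -
    have 0: "0 \<le> z" "0 \<le> \<zeta>" using z_bounds zeta_bounds b by linarith+
    have A: "\<bar>(m - 5) / 8\<bar> \<le> m / 8" using m by simp
    have "\<bar>(z + \<zeta>) * (2 * (m - 1)\<^sup>2 - (m - 1) - 14)\<bar> \<le> ((4001/1000) * b) * (2 * m\<^sup>2)"
      unfolding abs_mult using z_bounds zeta_bounds 0 b by (intro mult_mono t_bounds) auto
    also have "\<dots> = (8002/1000) * (m * b) * m" by (simp add: power2_eq_square)
    also have "\<dots> \<le> (8002/1000) * (31/10000) * m" using mb m by (intro mult_right_mono mult_left_mono) auto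
    finally have B: "\<bar>(z + \<zeta>) * (2 * (m - 1)\<^sup>2 - (m - 1) - 14)\<bar> \<le> (25/1000) * m" using m by simp
    have "z\<^sup>2 + z * \<zeta> + \<zeta>\<^sup>2 \<le> ((2001/1000) * b)\<^sup>2 + ((2001/1000) * b) * (2 * b) + (2 * b)\<^sup>2"
      using z_bounds zeta_bounds 0 b by (intro add_mono power_mono mult_mono) auto
    also have "\<dots> \<le> (121/10) * b\<^sup>2" by (simp add: power2_eq_square)
    finally have q: "z\<^sup>2 + z * \<zeta> + \<zeta>\<^sup>2 \<le> (121/10) * b\<^sup>2" .
    have "\<bar>(z\<^sup>2 + z * \<zeta> + \<zeta>\<^sup>2) * (9 * (m - 1) ^ 3 + 27 * (m - 1)\<^sup>2 - 76 * (m - 1) - 144)\<bar> \<le> ((121/10) * b\<^sup>2) * (18 * m ^ 3)"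
      unfolding abs_mult using q 0 by (intro mult_mono t_bounds) auto
    also have "\<dots> = (2178/10) * (m * b)\<^sup>2 * m" by (simp add: power2_eq_square power3_eq_cube)
    also have "\<dots> \<le> (2178/10) * (961/100000000) * m" using small m by (intro mult_right_mono mult_left_mono) auto
    finally have "\<bar>(z\<^sup>2 + z * \<zeta> + \<zeta>\<^sup>2) * (9 * (m - 1) ^ 3 + 27 * (m - 1)\<^sup>2 - 76 * (m - 1) - 144)\<bar> \<le> (25/10000) * m" using m by simp
    thus ?thesis unfolding Br_def using A B m by linarith
  qed
  hence "\<bar>z - \<zeta>\<bar> * \<bar>Br\<bar> \<le> (8/100) * (m ^ 3 * b ^ 4) * ((13/100) * m)" using z b m by (intro mult_mono) auto
  hence "\<bar>mu_poly z - mu_poly \<zeta>\<bar> \<le> (104/10000) * M" unfolding dif abs_mult by (simp add: M_def eval_nat_numeral mult_ac)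
  hence "\<bar>mu_poly z - mu_poly \<zeta>\<bar> * Dn \<le> (104/10000) * M * 2" using Dn_bounds b m by (intro mult_mono) (auto simp: M_def)
  hence 2: "\<bar>mu_poly z * Dn - mu_poly \<zeta> * Dn\<bar> \<le> (208/10000) * M" using Dn_bounds by (simp add: left_diff_distrib[symmetric] abs_mult)
  have M0: "M \<ge> 0" by (simp add: M_def)
  have 3: "\<bar>\<mu> * Dn - mu_poly z * Dn\<bar> \<le> (98/100) * M"
    using 1 2 b4 \<mu> M0 by linarith
  have 4: "(98/100) * M \<le> ((6/100) * (m - 1) ^ 4 * z ^ 4) * Dn"
  proof -
    have "(11 / 12 * m) ^ 4 \<le> (m - 1) ^ 4" using m by (intro power_mono) auto
    moreover have "((1995/1000) * b) ^ 4 \<le> z ^ 4" using z_bounds b by (intro power_mono) auto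
    ultimately have "((6/100) * (11 / 12 * m) ^ 4 * ((1995/1000) * b) ^ 4) * (1996/1000) \<le> ((6/100) * (m - 1) ^ 4 * z ^ 4) * Dn"
      using Dn_bounds b m by (intro mult_mono mult_left_mono) auto
    moreover have "((6/100) * (11 / 12 * m) ^ 4 * ((1995/1000) * b) ^ 4) * (1996/1000) = ((6/100) * (11/12)^4 * (1995/1000)^4 * (1996/1000)) * M"
      by (simp add: M_def power_mult_distrib power_divide)
    moreover have "(98/100) * M \<le> ((6/100) * (11/12)^4 * (1995/1000)^4 * (1996/1000)) * M" using M0 by (intro mult_right_mono) (simp_all add: power_divide)
    ultimately show ?thesis by linarith
  qed
  have D: "\<bar>\<mu> * Dn - mu_poly z * Dn\<bar> = \<bar>\<mu> - mu_poly z\<bar> * Dn"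
    using Dn_bounds by (simp add: left_diff_distrib[symmetric] abs_mult)
  from 3 4 have "\<bar>\<mu> - mu_poly z\<bar> * Dn \<le> ((6/100) * (m - 1) ^ 4 * z ^ 4) * Dn"
    using D by linarith
  thus ?thesis by (rule mult_right_le_imp_le) (use Dn_bounds in linarith)
qed

text \<open>The coefficient \<open>c3\<close> of \<open>b ^ 3\<close> has leading term \<open>- 27 / 8 * m ^ 4\<close>, which nearly exhausts the asserted error term; the
corrections of order \<open>m ^ 3\<close> on both sides have to be kept.\<close>
lemma variance_final:
  assumes \<sigma>: "\<bar>Numer - \<sigma> * (1 - b) * Dn ^ 3\<bar> \<le> b ^ 4"
  shows "\<bar>\<sigma> - sigma_poly z\<bar> \<le> (56/1000) * (m - 1) ^ 4 * z ^ 3"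
proof -
  define M where "M = m ^ 4 * b ^ 3"
  define c3 where "c3 = - 27/8 * m ^ 4 + 18 * m ^ 3 + 111/8 * m\<^sup>2 - 110 * m - 19/2"
  define v where "v = (1 - b) * Dn ^ 3"
  have M0: "M \<ge> 0" using b by (simp add: M_def)
  have b4: "b ^ 4 \<le> (1/10000) * M"
  proof -
    have "12 ^ 4 * b ^ 3 \<le> m ^ 4 * b ^ 3" using m b by (intro mult_right_mono power_mono) auto
    hence "12 ^ 4 * b ^ 3 * b \<le> M * 1" using b by (intro mult_mono) (auto simp: M_def)
    moreover have "12 ^ 4 * b ^ 3 * b = 20736 * b ^ 4" by (simp add: eval_nat_numeral)
    moreover have "0 \<le> b ^ 4" by simp
    ultimately show ?thesis by linarith
  qed
  have D3: "(1996/1000) ^ 3 \<le> Dn ^ 3" "Dn ^ 3 \<le> 2 ^ 3" by (rule power_mono; use Dn_bounds in linarith)+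
  have v: "(7949/1000) \<le> v" "v \<le> 8"
  proof -
    have "(99974/100000) * (1996/1000) ^ 3 \<le> v" unfolding v_def using b D3 by (intro mult_mono) auto
    thus "(7949/1000) \<le> v" by (simp add: power3_eq_cube)
    have "v \<le> 1 * 2 ^ 3" unfolding v_def using b D3 Dn_bounds by (intro mult_mono) auto
    thus "v \<le> 8" by simp
  qed
  have 1: "\<bar>Numer - sigma_poly \<zeta> * v - c3 * b ^ 3\<bar> \<le> (3/100) * M"
  proof -
    have "1024 * Numer - 1024 * (sigma_poly \<zeta> * v) = 1024 * ((1 - 7 * b + 3 * b\<^sup>2) * (1 - b) * Dn\<^sup>2 - 2 * Nn * Dn * Bus + Nn\<^sup>2 * Bss) - (256 + 16 * (- (m - 1)\<^sup>2 + 9 * (m - 1) - 14) * (4 * \<zeta>) + (- 4 * (m - 1) ^ 3 + 20 * (m - 1)\<^sup>2 + 3 * (m - 1) - 54) * (4 * \<zeta>)\<^sup>2) * (1 - b) * Dn ^ 3"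
      unfolding Numer_def v_def sigma_poly_def by (simp add: field_simps power2_eq_square)
    moreover have "4 * \<zeta> = b * (8 - b * (8 + 4 * m) + b\<^sup>2 * (8 + 4 * m + m * (m - 1)))" by (simp add: \<zeta>_def)
    ultimately have "\<bar>1024 * Numer - 1024 * (sigma_poly \<zeta> * v) - (1024 * c3) * b ^ 3\<bar> \<le> 768/25 * M"
      using var_poly_bound[OF m b mb] unfolding M_def c3_def Dn_def Nn_def Bus_def Bss_def by (simp only:)
    thus ?thesis unfolding abs_le_iff by simp
  qed
  define Br where "Br = (- (m - 1)\<^sup>2 + 9 * (m - 1) - 14) / 16 + (z + \<zeta>) * (- 4 * (m - 1) ^ 3 + 20 * (m - 1)\<^sup>2 + 3 * (m - 1) - 54) / 64"
  have dif: "sigma_poly z - sigma_poly \<zeta> = (z - \<zeta>) * Br"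
    unfolding sigma_poly_def Br_def by (simp add: field_simps power2_eq_square)
  have "\<bar>Br\<bar> \<le> (7/100) * m\<^sup>2"
  proof -
    have "\<bar>(z + \<zeta>) * (- 4 * (m - 1) ^ 3 + 20 * (m - 1)\<^sup>2 + 3 * (m - 1) - 54)\<bar> \<le> ((4001/1000) * b) * (4 * m ^ 3)"
      unfolding abs_mult using z_bounds zeta_bounds b by (intro mult_mono t_bounds) auto
    also have "\<dots> = (16004/1000) * (m * b) * m\<^sup>2" by (simp add: power2_eq_square power3_eq_cube)
    also have "\<dots> \<le> (16004/1000) * (31/10000) * m\<^sup>2" using mb m by (intro mult_right_mono mult_left_mono) auto
    finally have "\<bar>(z + \<zeta>) * (- 4 * (m - 1) ^ 3 + 20 * (m - 1)\<^sup>2 + 3 * (m - 1) - 54)\<bar> \<le> (5/100) * m\<^sup>2" using m by simp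
    moreover have "\<bar>Q / 16 + P / 64\<bar> \<le> (7/100) * x" if "\<bar>P\<bar> \<le> (5/100) * x" "\<bar>Q\<bar> \<le> x" for P Q x :: real
      using that by linarith
    ultimately show ?thesis unfolding Br_def using t_bounds(3) by blast
  qed
  hence "\<bar>z - \<zeta>\<bar> * \<bar>Br\<bar> \<le> (8/100) * (m ^ 3 * b ^ 4) * ((7/100) * m\<^sup>2)" using z b m by (intro mult_mono) auto
  also have "\<dots> = (56/10000) * (m * b) * M" by (simp add: M_def eval_nat_numeral mult_ac)
  also have "\<dots> \<le> (56/10000) * (31/10000) * M" using mb M0 by (intro mult_right_mono mult_left_mono) auto
  finally have "\<bar>sigma_poly z - sigma_poly \<zeta>\<bar> \<le> (1/10000) * M" unfolding dif abs_mult using M0 by simp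
  hence "\<bar>sigma_poly z - sigma_poly \<zeta>\<bar> * v \<le> (1/10000) * M * 8" using v M0 by (intro mult_mono) auto
  hence 2: "\<bar>sigma_poly z * v - sigma_poly \<zeta> * v\<bar> \<le> (8/10000) * M" using v by (simp add: left_diff_distrib[symmetric] abs_mult)
  have c3: "\<bar>c3 * b ^ 3\<bar> \<le> (3375/1000) * M - 17 * (m ^ 3 * b ^ 3)"
  proof -
    have m2: "m\<^sup>2 \<ge> 12 * m" using m by (simp add: power2_eq_square)
    have m3: "m ^ 3 \<ge> 12 * m\<^sup>2" using m by (simp add: power3_eq_cube power2_eq_square)
    have m4: "m ^ 4 \<ge> 12 * m ^ 3" using m by (simp add: eval_nat_numeral)
    have "\<bar>c3\<bar> \<le> (3375/1000) * m ^ 4 - 17 * m ^ 3" unfolding c3_def abs_le_iff using m m2 m3 m4 by linarith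
    hence "\<bar>c3\<bar> * b ^ 3 \<le> ((3375/1000) * m ^ 4 - 17 * m ^ 3) * b ^ 3" using b by (intro mult_right_mono) auto
    thus ?thesis using b by (simp add: M_def abs_mult algebra_simps)
  qed
  have sv: "\<bar>Numer - \<sigma> * v\<bar> \<le> b ^ 4" using \<sigma> by (simp add: v_def mult.assoc)
  have 3: "\<bar>\<sigma> * v - sigma_poly z * v\<bar> \<le> (341/100) * M - 17 * (m ^ 3 * b ^ 3)"
    using 1 2 c3 b4 sv M0 by linarith
  have 4: "(341/100) * M - 17 * (m ^ 3 * b ^ 3) \<le> ((56/1000) * (m - 1) ^ 4 * z ^ 3) * v"
  proof -
    have z0: "0 \<le> z" using z_bounds b by linarith
    have z3: "((1995/1000) * b) ^ 3 \<le> z ^ 3" using z_bounds b by (intro power_mono) auto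
    have "m ^ 4 - 4 * m ^ 3 \<le> (m - 1) ^ 4"
    proof -
      have "(m - 1) ^ 4 = m ^ 4 - 4 * m ^ 3 + 6 * m\<^sup>2 - 4 * m + 1" by (simp add: eval_nat_numeral algebra_simps)
      moreover have "m\<^sup>2 \<ge> 12 * m" using m by (simp add: power2_eq_square)
      ultimately show ?thesis using m by linarith
    qed
    moreover have "m ^ 4 - 4 * m ^ 3 \<ge> 0" 
    proof -
      have "m ^ 4 - 4 * m ^ 3 = m ^ 3 * (m - 4)" by (simp add: eval_nat_numeral algebra_simps)
      thus ?thesis using m by simp
    qed
    ultimately have "((56/1000) * (m ^ 4 - 4 * m ^ 3) * ((1995/1000) * b) ^ 3) * (7949/1000) \<le> ((56/1000) * (m - 1) ^ 4 * z ^ 3) * v"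
      using z3 v b z0 by (intro mult_mono mult_left_mono mult_nonneg_nonneg) auto
    moreover have "((56/1000) * (m ^ 4 - 4 * m ^ 3) * ((1995/1000) * b) ^ 3) * (7949/1000) = ((56/1000) * (1995/1000) ^ 3 * (7949/1000)) * M - ((56/1000) * (1995/1000) ^ 3 * (7949/1000) * 4) * (m ^ 3 * b ^ 3)"
      by (simp only: M_def power_mult_distrib) algebra
    moreover have "(341/100) * M \<le> ((56/1000) * (1995/1000) ^ 3 * (7949/1000)) * M" using M0 by (intro mult_right_mono) (simp_all add: power3_eq_cube)
    moreover have "((56/1000) * (1995/1000) ^ 3 * (7949/1000) * 4) * (m ^ 3 * b ^ 3) \<le> 17 * (m ^ 3 * b ^ 3)" using m b by (intro mult_right_mono) (simp_all add: power3_eq_cube)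
    ultimately show ?thesis by linarith
  qed
  have D: "\<bar>\<sigma> * v - sigma_poly z * v\<bar> = \<bar>\<sigma> - sigma_poly z\<bar> * v"
    using v by (simp add: left_diff_distrib[symmetric] abs_mult)
  from 3 4 have "\<bar>\<sigma> - sigma_poly z\<bar> * v \<le> ((56/1000) * (m - 1) ^ 4 * z ^ 3) * v"
    using D by linarith
  thus ?thesis by (rule mult_right_le_imp_le) (use v in linarith)
qed

end
end

lemma curve_jets_two:
  fixes a b m \<mu> :: real
  assumes "a = lo t \<rho> 0" "b = lo t \<rho> 1" "m = real t + 1"
  shows "fst (kjet t \<rho> 1 0 2) = (C0, C1, C2) \<Longrightarrow> C1 = a * (1 + a) * (1 - b) - m * a * b * (1 + b)"
    and "fst (kjet t \<rho> (-\<mu>) 1 2) = (B0, B1, B2) \<Longrightarrow>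
      B0 = a * (1 - b) \<and> B1 = (a - b - 2 * a * b) - \<mu> * (a * (1 + a) * (1 - b) - m * a * b * (1 + b)) \<and>
      B2 = (a - 3 * b - 4 * a * b) - 2 * \<mu> * (a * (1 + a) * (1 - 2 * b) - m * b * (1 + b) * (1 + 2 * a))
         + \<mu>\<^sup>2 * (a * (1 + a) * (1 + 2 * a) * (1 - b) - 2 * m * b * (1 + b) * a * (1 + a) - m\<^sup>2 * a * b * (1 + b) * (1 + 2 * b))"
  using assms
  by (auto simp: numeral_2_eq_2 Let_def jexp_def jodds_def, (simp add: algebra_simps power2_eq_square)+)

lemma nat_times_power_small: "12 \<le> n \<Longrightarrow> real n * (501/1000) ^ n \<le> (301/100000)"
proof (induction n rule: dec_induct)
  case (step n)
  have "real (Suc n) * (501/1000) ^ Suc n = (real (Suc n) * (501/1000)) * (501/1000) ^ n" by simp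
  also have "\<dots> \<le> real n * (501/1000) ^ n" using step(1) by (intro mult_right_mono) auto
  finally show ?case using step(3) by linarith
qed (simp add: power_divide)

lemma tail_bound_two:
  assumes "t \<ge> 11" shows "tail_bound t 2 \<le> (312/1000) * (1 / 2 ^ t) ^ 8" "0 \<le> tail_bound t 2"
proof -
  have x: "((605/1000)::real) ^ (t + 1) \<le> (605/1000) ^ 12" using assms by (intro power_decreasing) auto
  also have p: "((605/1000)::real) ^ 12 \<le> 1 / 256" by (simp add: power_divide)
  finally have x1: "((605/1000)::real) ^ (t + 1) \<le> 1 / 256" .
  have e: "cbar t 0 \<le> (156/100)" "0 \<le> cbar t 0" by (simp_all add: cbar_def)
  have g1: "ge t 1 = t + 1" and g2: "ge t 2 - 1 = (t + 1) * t" by (simp_all add: numeral_2_eq_2 algebra_simps)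
  have cb: "cbar t 1 = (82 / 10000 + (605 / 1000) ^ (t + 1)) / (1 - (605 / 1000) ^ (t + 1))"
    unfolding cbar_def g1 by simp
  have x0: "0 \<le> (605 / 1000 :: real) ^ (t + 1)" by simp
  have "cbar t 1 \<le> ((82/10000) + 1 / 256) / (1 - 1 / 256)"
    unfolding cb by (rule frac_le; use x0 x1 in linarith)
  moreover have "0 \<le> cbar t 1"
    unfolding cb by (rule divide_nonneg_nonneg; use x0 x1 in linarith)
  ultimately have c1: "cbar t 1 \<le> ((82/10000) + 1 / 256) / (1 - 1 / 256)" "0 \<le> cbar t 1" .
  hence c1': "cbar t 1 \<le> (2/100)" by simp
  have "((605/1000)::real) ^ (ge t 2 - 1) = ((605/1000) ^ (t + 1)) ^ t" unfolding g2 by (rule power_mult)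
  also have "\<dots> \<le> (1 / 256) ^ t" using x1 by (intro power_mono) auto
  also have "(1 / 256 :: real) = (1 / 2) ^ 8" by (simp add: power_divide)
  also have "((1 / 2 :: real) ^ 8) ^ t = (1 / 2 ^ t) ^ 8" by (simp only: power_one_over power_mult[symmetric] mult.commute)
  finally have pw: "((605/1000)::real) ^ (ge t 2 - 1) \<le> (1 / 2 ^ t) ^ 8" .
  have tb: "tail_bound t 2 = 10 * (605/1000) ^ (ge t 2 - 1) * (cbar t 0 * cbar t 1)"
    by (simp add: tail_bound_def numeral_2_eq_2 del: ge.simps)
  have "tail_bound t 2 \<le> 10 * (1 / 2 ^ t) ^ 8 * ((156/100) * (2/100))" unfolding tb
    using pw e c1 c1' by (intro mult_mono) auto
  thus "tail_bound t 2 \<le> (312/1000) * (1 / 2 ^ t) ^ 8" by simp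
  show "0 \<le> tail_bound t 2" unfolding tb using e c1 by simp
qed

text \<open>The equation for the root reads \<open>x * (2 - b) ^ m * (1 + \<kappa>) ^ m = 1\<close> with \<open>x = b / (1 + b)\<close> and a relative perturbation
\<open>\<kappa>\<close> no larger than the remainder, which relates \<open>z\<close> to \<open>b\<close>. The remainder is of order \<open>z ^ 8\<close>, hence below \<open>b ^ 4\<close>
even after multiplication by large constants.\<close>
theorem constants_large:
  assumes t: "t \<ge> 11" and \<rho>: "\<rho> \<in> {1/2..0.6}" and ren: "renewal (block_count t) Rmax Vmax \<rho>"
  defines "m \<equiv> real t + 1" and "z \<equiv> 1 / 2 ^ t"
  shows "\<bar>renewal.mu (block_count t) \<rho> - (1 / 2 + z * (m - 5) / 8 + z\<^sup>2 * (2 * (m - 1)\<^sup>2 - (m - 1) - 14) / 32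
      + z ^ 3 * (9 * (m - 1) ^ 3 + 27 * (m - 1)\<^sup>2 - 76 * (m - 1) - 144) / 256)\<bar> \<le> (6/100) * (m - 1) ^ 4 * z ^ 4"
    and "\<bar>renewal.sigma2 (block_count t) \<rho> - (1 / 4 + z * (- (m - 1)\<^sup>2 + 9 * (m - 1) - 14) / 16
      + z\<^sup>2 * (- 4 * (m - 1) ^ 3 + 20 * (m - 1)\<^sup>2 + 3 * (m - 1) - 54) / 64)\<bar> \<le> (56/1000) * (m - 1) ^ 4 * z ^ 3"
proof -
  define \<mu> where "\<mu> = renewal.mu (block_count t) \<rho>"
  define \<sigma> where "\<sigma> = renewal.sigma2 (block_count t) \<rho>"
  define \<epsilon> where "\<epsilon> = tail_bound t 2"
  define a where "a = lo t \<rho> 0"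
  define b where "b = lo t \<rho> 1"
  define v where "v = 1 - b"
  define A where "A = a * (1 - b)"
  obtain B0 B1 B2 where B: "fst (kjet t \<rho> (-\<mu>) 1 2) = (B0, B1, B2)" by (cases "fst (kjet t \<rho> (-\<mu>) 1 2)")
  obtain C0 C1 C2 where C: "fst (kjet t \<rho> 1 0 2) = (C0, C1, C2)" by (cases "fst (kjet t \<rho> 1 0 2)")
  have t2: "t \<ge> 2" using t by simp
  note E = curve_equations[OF t2 \<rho> ren B[unfolded \<mu>_def] C, folded \<mu>_def \<sigma>_def \<epsilon>_def]
  note K1 = curve_jets_two(1)[OF a_def b_def m_def[THEN meta_eq_to_obj_eq] C]
  note K2 = curve_jets_two(2)[OF a_def b_def m_def[THEN meta_eq_to_obj_eq] B]
  have m12: "12 \<le> m" using t by (simp add: m_def)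
  have z: "0 < z" "z \<le> 1 / 2048" "m * z \<le> 1"
  proof -
    show "0 < z" by (simp add: z_def)
    have "(2::real) ^ 11 \<le> 2 ^ t" using t by (intro power_increasing) auto
    thus "z \<le> 1 / 2048" by (simp add: z_def field_simps)
    have "Suc t \<le> 2 ^ t" using less_exp[of t] by (simp add: Suc_le_eq)
    hence "real (Suc t) \<le> real (2 ^ t)" by (simp only: of_nat_le_iff)
    thus "m * z \<le> 1" by (simp add: z_def m_def field_simps)
  qed
  have \<epsilon>z: "\<epsilon> \<le> (312/1000) * z ^ 8" "0 \<le> \<epsilon>" using tail_bound_two[OF t] by (simp_all add: \<epsilon>_def z_def)
  have m\<epsilon>: "m * \<epsilon> \<le> (1/100000)"
  proof -
    have "m * \<epsilon> \<le> m * ((312/1000) * z ^ 8)" using \<epsilon>z m12 by (intro mult_left_mono) auto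
    also have "\<dots> = (312/1000) * (m * z) * z ^ 7" by (simp add: eval_nat_numeral)
    also have "\<dots> \<le> (312/1000) * 1 * (1 / 2048) ^ 7" using z m12 by (intro mult_mono power_mono) auto
    finally show ?thesis by (simp add: power_divide)
  qed
  have \<epsilon>s: "\<epsilon> \<le> (1/1000000)" 
  proof -
    have "12 * \<epsilon> \<le> m * \<epsilon>" using m12 \<epsilon>z by (intro mult_right_mono) auto
    thus ?thesis using m\<epsilon> by linarith
  qed
  define x where "x = \<rho> ^ (t + 1)"
  have a_rho: "a = \<rho> / (1 - \<rho>)" by (simp add: a_def lo_def)
  have b_x: "b = x / (1 - x)" by (simp add: b_def lo_def x_def)
  have A1: "\<bar>A - 1\<bar> \<le> \<epsilon>" using E(3) K2 by (simp add: A_def)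
  have rp: "0 < \<rho>" "\<rho> \<le> (6/10)" using \<rho> by auto
  have x0: "0 < x" "x \<le> (6/10) ^ 12"
  proof -
    show "0 < x" using rp by (simp add: x_def)
    have "x \<le> (6/10) ^ (t + 1)" unfolding x_def using rp by (intro power_mono) auto
    also have "((6/10)::real) ^ (t + 1) \<le> (6/10) ^ 12" using t by (intro power_decreasing) auto
    finally show "x \<le> (6/10) ^ 12" .
  qed
  hence x1: "x \<le> (22/10000)" by (simp add: power_divide)
  have b0: "0 < b" "b \<le> (23/10000)" using x0 x1 by (auto simp: b_x field_simps)
  have \<rho>_A: "\<rho> * (A + v) = A"
    unfolding A_def v_def a_rho using rp by (simp add: field_simps)
  have "\<rho> \<le> (501/1000)"
  proof (rule ccontr)
    assume "\<not> \<rho> \<le> (501/1000)"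
    hence "(501/1000) * (A + v) < \<rho> * (A + v)" using A1 b0 \<epsilon>s by (intro mult_strict_right_mono) (auto simp: v_def abs_le_iff)
    thus False using \<rho>_A A1 b0 \<epsilon>s by (simp add: v_def abs_le_iff)
  qed
  hence x2: "x \<le> (501/1000) ^ (t + 1)" unfolding x_def using rp by (intro power_mono) auto
  have mx: "m * x \<le> (301/100000)"
  proof -
    have "m * x \<le> real (t + 1) * (501/1000) ^ (t + 1)" unfolding m_def of_nat_add of_nat_1 using x2 by (intro mult_left_mono) auto
    thus ?thesis using nat_times_power_small[of "t + 1"] t by simp
  qed
  have "12 * x \<le> m * x" using m12 x0 by (intro mult_right_mono) auto
  hence x3: "x \<le> (251/1000000)" using mx by linarith
  have b1: "b \<le> (26/100000)" using x0 x3 by (simp add: b_x field_simps)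
  have "b \<le> (1001/1000) * x" 
  proof -
    have "1 \<le> (1001/1000) * (1 - x)" using x3 by simp
    hence "x * 1 \<le> x * ((1001/1000) * (1 - x))" using x0 by (intro mult_left_mono) auto
    thus ?thesis using x3 by (simp add: b_x pos_divide_le_eq mult_ac)
  qed
  hence "m * b \<le> m * ((1001/1000) * x)" using m12 by (intro mult_left_mono) auto
  hence mb: "m * b \<le> (31/10000)" using mx by simp
  interpret large_arity m b by unfold_locales (use m12 b0 b1 mb in auto)
  \<comment> \<open>the equation for the root, solved for \<open>z\<close>\<close>
  define \<kappa> where "\<kappa> = (2 - b + (A - 1)) / (A * (2 - b)) - 1"
  have Ap: "A > 0" "A \<ge> (9999/10000)" "A \<le> (10001/10000)" using A1 \<epsilon>s by auto
  have \<kappa>: "\<bar>\<kappa>\<bar> \<le> \<epsilon>"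
  proof -
    define q where "q = (1 - b) / (A * (2 - b))"
    have e: "\<kappa> = (1 - A) * q" unfolding \<kappa>_def q_def using Ap b1 by (simp add: field_simps)
    have "0 \<le> q" using Ap b1 by (simp add: q_def)
    moreover have "q \<le> 1"
    proof -
      have "(9999/10000) * (2 - b) \<le> A * (2 - b)" using Ap b1 by (intro mult_right_mono) auto
      moreover have "(9999/10000) * (2 - b) = 19998/10000 - 9999/10000 * b" by simp
      ultimately have "1 - b \<le> A * (2 - b)" using b1 b0 by linarith
      thus ?thesis using Ap b1 by (simp add: q_def)
    qed
    ultimately have "\<bar>\<kappa>\<bar> \<le> \<bar>1 - A\<bar> * 1" unfolding e abs_mult by (intro mult_left_mono) auto
    hence "\<bar>\<kappa>\<bar> \<le> \<bar>A - 1\<bar>" by (simp add: abs_minus_commute)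
    thus ?thesis using A1 by (rule order_trans)
  qed
  have "\<rho> * ((2 - b) * (1 + \<kappa>)) = 1"
  proof -
    have "(2 - b) * (1 + \<kappa>) = (A + v) / A" unfolding \<kappa>_def v_def using Ap b1 by (simp add: field_simps)
    thus ?thesis using \<rho>_A Ap by simp
  qed
  hence "(\<rho> * ((2 - b) * (1 + \<kappa>))) ^ (t + 1) = 1" by simp
  hence z1: "x * ((2 - b) ^ (t + 1) * (1 + \<kappa>) ^ (t + 1)) = 1" by (simp only: power_mult_distrib x_def)
  define w where "w = (1 - b / 2) ^ (t + 1)"
  have w2: "(2 - b) ^ (t + 1) = 2 / z * w"
  proof -
    have "2 - b = 2 * (1 - b / 2)" by simp
    hence "(2 - b) ^ (t + 1) = 2 ^ (t + 1) * w" by (simp only: power_mult_distrib w_def)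
    thus ?thesis by (simp add: z_def)
  qed
  have xb: "x = b * (1 / (1 + b))" using x3 x0 by (simp add: b_x field_simps)
  define y where "y = 1 / (1 + b)"
  have z2: "z = 2 * b * (y * w) * (1 + \<kappa>) ^ (t + 1)"
    using z1 z unfolding w2 xb y_def[symmetric] by (simp add: field_simps)
  define \<theta> where "\<theta> = y * w - (1 - b * (1 + m / 2) + b\<^sup>2 * (1 + m / 2 + m * (m - 1) / 8))"
  have w01: "0 \<le> w" "w \<le> 1" unfolding w_def by (rule zero_le_power power_le_one; use b0 b1 in linarith)+
  have y01: "0 \<le> y" "y \<le> 1" using b0 by (auto simp: y_def)
  have \<theta>: "\<bar>\<theta>\<bar> \<le> (354/10000) * (m ^ 3 * b ^ 3)"
  proof -
    define U where "U = 1 - m * (b / 2) + m * (m - 1) / 2 * (b / 2)\<^sup>2"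
    have W: "w \<le> U" "U - m ^ 3 / 6 * (b / 2) ^ 3 \<le> w"
      using power_one_minus_bounds[of "b / 2" "t + 1"] b0 b1 by (simp_all add: w_def U_def m_def add.commute)
    have Y: "y \<le> 1 - b + b\<^sup>2" "1 - b + b\<^sup>2 - b ^ 3 \<le> y"
    proof -
      have "(1 - b + b\<^sup>2) * (1 + b) = 1 + b ^ 3" by (simp add: power2_eq_square power3_eq_cube algebra_simps)
      thus "y \<le> 1 - b + b\<^sup>2" using b0 by (simp add: y_def pos_divide_le_eq)
      have "(1 - b + b\<^sup>2 - b ^ 3) * (1 + b) = 1 - b ^ 4" by (simp add: eval_nat_numeral algebra_simps)
      thus "1 - b + b\<^sup>2 - b ^ 3 \<le> y" using b0 by (simp add: y_def pos_le_divide_eq)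
    qed
    have split: "\<theta> = (y - (1 - b + b\<^sup>2)) * w + (1 - b + b\<^sup>2) * (w - U) + (- (b ^ 3 * (m / 2 + m * (m - 1) / 8)) + b ^ 4 * (m * (m - 1) / 8))"
      unfolding \<theta>_def U_def by (simp add: field_simps eval_nat_numeral)
    have P1: "\<bar>(y - (1 - b + b\<^sup>2)) * w\<bar> \<le> b ^ 3 * 1" unfolding abs_mult using Y w01 b0 by (intro mult_mono) auto
    have P2: "\<bar>(1 - b + b\<^sup>2) * (w - U)\<bar> \<le> 1 * (m ^ 3 / 6 * (b / 2) ^ 3)" unfolding abs_mult
    proof (intro mult_mono)
      have "b\<^sup>2 \<le> b" using b0 b1 by (simp add: power2_eq_square mult_left_le)
      thus "\<bar>1 - b + b\<^sup>2\<bar> \<le> 1" using b1 b0 by (simp add: abs_le_iff)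
    qed (use W in auto)
    have P3: "\<bar>- (b ^ 3 * (m / 2 + m * (m - 1) / 8)) + b ^ 4 * (m * (m - 1) / 8)\<bar> \<le> b ^ 3 * (m / 2 + m\<^sup>2 / 8)"
    proof -
      have M: "0 \<le> m * (m - 1) / 8" "m * (m - 1) / 8 \<le> m\<^sup>2 / 8" using m12 by (auto simp: power2_eq_square)
      have "b ^ 4 * (m * (m - 1) / 8) \<le> b ^ 3 * (m * (m - 1) / 8)" using M b0 b1 by (intro mult_right_mono power_decreasing) auto
      moreover have "0 \<le> b ^ 4 * (m * (m - 1) / 8)" using M by simp
      moreover have "b ^ 3 * (m / 2 + m * (m - 1) / 8) \<le> b ^ 3 * (m / 2 + m\<^sup>2 / 8)" using M b0 by (intro mult_left_mono) auto
      moreover have "0 \<le> b ^ 3 * (m / 2)" using b0 m12 by simp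
      ultimately show ?thesis unfolding abs_le_iff distrib_left by linarith
    qed
    have "\<bar>\<theta>\<bar> \<le> b ^ 3 * 1 + 1 * (m ^ 3 / 6 * (b / 2) ^ 3) + b ^ 3 * (m / 2 + m\<^sup>2 / 8)"
      unfolding split by (intro order_trans[OF abs_triangle_ineq] add_mono P1 P2 P3)
    also have "\<dots> = b ^ 3 * (1 + m ^ 3 / 48 + m / 2 + m\<^sup>2 / 8)" by (simp add: power_divide algebra_simps)
    also have "\<dots> \<le> b ^ 3 * ((354/10000) * m ^ 3)"
    proof (intro mult_left_mono)
      have m2: "m\<^sup>2 \<ge> 12 * m" using m12 by (simp add: power2_eq_square)
      have m3: "m ^ 3 \<ge> 12 * m\<^sup>2" using m12 by (simp add: power3_eq_cube power2_eq_square)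
      show "1 + m ^ 3 / 48 + m / 2 + m\<^sup>2 / 8 \<le> (354/10000) * m ^ 3" using m12 m2 m3 by linarith
    qed (use b0 in auto)
    finally show ?thesis by (simp add: mult_ac)
  qed
  define \<eta> where "\<eta> = (1 + \<kappa>) ^ (t + 1) - 1"
  have mt: "real (t + 1) = m" by (simp add: m_def)
  have "\<bar>(1 + \<kappa>) ^ (t + 1) - 1\<bar> \<le> 2 * real (t + 1) * \<epsilon>"
    by (rule power_near_one[OF \<kappa>]; (unfold mt)?; use m\<epsilon> \<epsilon>s in linarith)
  hence \<eta>: "\<bar>\<eta>\<bar> \<le> 2 * (m * \<epsilon>)" by (simp only: mt \<eta>_def mult.assoc)
  have yw: "0 \<le> y * w" "y * w \<le> 1" using y01 w01 by (auto intro: mult_le_one)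
  have z3: "z = 2 * b * (y * w) * (1 + \<eta>)" using z2 by (simp add: \<eta>_def)
  have zb: "z \<le> (21/10) * b"
  proof -
    have "2 * b * (y * w) * (1 + \<eta>) \<le> 2 * b * 1 * (105/100)" using b0 yw \<eta> m\<epsilon> by (intro mult_mono) auto
    thus ?thesis using z3 by simp
  qed
  have m\<epsilon>b: "13000 * (m * \<epsilon>) \<le> b ^ 4"
  proof -
    have "m * \<epsilon> \<le> m * ((312/1000) * z ^ 8)" using \<epsilon>z m12 by (intro mult_left_mono) auto
    also have "\<dots> \<le> m * ((312/1000) * ((21/10) * b) ^ 8)" using zb z m12 by (intro mult_left_mono power_mono) auto
    also have "\<dots> = (312/1000) * (21/10) ^ 8 * (m * b) * b ^ 3 * b ^ 4" by (simp add: eval_nat_numeral)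
    also have "\<dots> \<le> (312/1000) * (21/10) ^ 8 * (31/10000) * (26/100000) ^ 3 * b ^ 4"
      using mb b0 b1 m12 by (intro mult_mono power_mono) auto
    finally have "13000 * (m * \<epsilon>) \<le> 13000 * ((312/1000) * (21/10) ^ 8 * (31/10000) * (26/100000) ^ 3) * b ^ 4" by (simp only: mult_ac) 
    also have "\<dots> \<le> 1 * b ^ 4" by (intro mult_right_mono) (simp_all add: power_divide)
    finally show ?thesis by simp
  qed
  have z\<zeta>: "\<bar>z - \<zeta>\<bar> \<le> (8/100) * (m ^ 3 * b ^ 4)"
  proof -
    have "\<zeta> = 2 * b * (y * w - \<theta>)" by (simp add: \<zeta>_def \<theta>_def field_simps power2_eq_square)
    hence e: "z - \<zeta> = 2 * b * \<theta> + 2 * b * (y * w) * \<eta>" unfolding z3 by (simp add: algebra_simps)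
    have "\<bar>2 * b * \<theta>\<bar> \<le> 2 * b * ((354/10000) * (m ^ 3 * b ^ 3))" unfolding abs_mult using \<theta> b0 by (intro mult_mono) auto
    moreover have "\<bar>2 * b * (y * w) * \<eta>\<bar> \<le> 2 * b * 1 * (2 * (m * \<epsilon>))" unfolding abs_mult using \<eta> b0 yw by (intro mult_mono) auto
    moreover have "2 * b * 1 * (2 * (m * \<epsilon>)) \<le> (9/1000) * (m ^ 3 * b ^ 4)"
    proof -
      have "b * (13000 * (m * \<epsilon>)) \<le> 1 * b ^ 4" using m\<epsilon>b b0 b1 m12 \<epsilon>z by (intro mult_mono) auto
      moreover have "12 ^ 3 * b ^ 4 \<le> m ^ 3 * b ^ 4" using m12 by (intro mult_right_mono power_mono) auto
      moreover have "2 * b * 1 * (2 * (m * \<epsilon>)) = 4 / 13000 * (b * (13000 * (m * \<epsilon>)))" by simp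
      moreover have "(12::real) ^ 3 * b ^ 4 = 1728 * b ^ 4" by simp
      moreover have "0 \<le> b ^ 4" by simp
      ultimately show ?thesis by linarith
    qed
    moreover have "2 * b * ((354/10000) * (m ^ 3 * b ^ 3)) = (708/10000) * (m ^ 3 * b ^ 4)" by (simp add: eval_nat_numeral)
    moreover have "0 \<le> m ^ 3 * b ^ 4" using m12 by simp
    ultimately show ?thesis unfolding e using abs_triangle_ineq[of "2 * b * \<theta>" "2 * b * (y * w) * \<eta>"]
      by linarith
  qed
  have \<mu>01: "0 \<le> \<mu>" "\<mu> \<le> 1" using E(1,2) .
  have v01: "(999/1000) \<le> v" "v \<le> 1" using b0 b1 by (simp_all add: v_def)
  define k where "k = m * b * (1 + b)"
  have k: "0 \<le> k" "k \<le> (32/10000)"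
  proof -
    show "0 \<le> k" using m12 b0 by (simp add: k_def)
    have "m * b * (1 + b) \<le> (31/10000) * (100026/100000)" using mb b0 b1 m12 by (intro mult_mono) auto
    thus "k \<le> (32/10000)" by (simp add: k_def)
  qed
  define l where "l = m * k * (1 + 2 * b)"
  have l: "0 \<le> l" "l \<le> (33/10000) * m"
  proof -
    show "0 \<le> l" using m12 b0 k by (simp add: l_def)
    have "m * k * (1 + 2 * b) \<le> (m * (32/10000)) * (100052/100000)" using k b0 b1 m12 by (intro mult_mono) auto
    moreover have "(m * (32/10000)) * (100052/100000) \<le> (33/10000) * m" using m12 by simp
    ultimately show "l \<le> (33/10000) * m" unfolding l_def by linarith
  qed
  have D: "C1 * v = A * (A + v) - k * A" unfolding K1 A_def v_def k_def by algebra
  have D1: "\<bar>C1 * v - Dn\<bar> \<le> 4 * \<epsilon>"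
  proof -
    have "C1 * v - Dn = (A - 1) * (A + 1 + v - k)" unfolding D unfolding Dn_def v_def k_def by algebra
    also have "\<bar>\<dots>\<bar> \<le> \<epsilon> * 4" unfolding abs_mult using A1 Ap v01 k by (intro mult_mono) auto
    finally show ?thesis by simp
  qed
  have N1: "\<bar>Nn - \<mu> * Dn\<bar> \<le> 130 * \<epsilon>"
  proof -
    have "Nn - \<mu> * Dn = B1 * v - (A - 1) * (1 - 2 * b) + \<mu> * (C1 * v - Dn)"
      unfolding conjunct1[OF conjunct2[OF K2]] K1 A_def Nn_def Dn_def v_def by algebra
    moreover have "\<bar>B1 * v\<bar> \<le> 125 * \<epsilon> * 1" unfolding abs_mult using E(4) v01 \<epsilon>z by (intro mult_mono) auto
    moreover have "\<bar>(A - 1) * (1 - 2 * b)\<bar> \<le> \<epsilon> * 1" unfolding abs_mult using A1 b0 b1 \<epsilon>z by (intro mult_mono) auto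
    moreover have "\<bar>\<mu> * (C1 * v - Dn)\<bar> \<le> 1 * (4 * \<epsilon>)" unfolding abs_mult using D1 \<mu>01 by (intro mult_mono) auto
    ultimately show ?thesis by linarith
  qed
  have "130 * \<epsilon> \<le> 13000 * (m * \<epsilon>)" 
  proof -
    have "1 * \<epsilon> \<le> m * \<epsilon>" using m12 \<epsilon>z by (intro mult_right_mono) auto
    thus ?thesis using \<epsilon>z by linarith
  qed
  hence "\<bar>Nn - \<mu> * Dn\<bar> \<le> b ^ 4" using N1 m\<epsilon>b by linarith
  from mean_final[OF z\<zeta> this] show "\<bar>renewal.mu (block_count t) \<rho> - (1 / 2 + z * (m - 5) / 8 + z\<^sup>2 * (2 * (m - 1)\<^sup>2 - (m - 1) - 14) / 32
      + z ^ 3 * (9 * (m - 1) ^ 3 + 27 * (m - 1)\<^sup>2 - 76 * (m - 1) - 144) / 256)\<bar> \<le> (6/100) * (m - 1) ^ 4 * z ^ 4"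
    by (simp only: mu_poly_def \<mu>_def)
  define G where "G = (1 - 7 * b + 3 * b\<^sup>2) * (1 - b) - 2 * \<mu> * Bus + \<mu>\<^sup>2 * Bss"
  have bsq: "b\<^sup>2 \<le> b" using b0 b1 by (simp add: power2_eq_square mult_left_le)
  have \<mu>2: "0 \<le> \<mu>\<^sup>2" "\<mu>\<^sup>2 \<le> 1" using \<mu>01 by (auto intro: power_le_one)
  have bb: "0 \<le> b\<^sup>2" "b\<^sup>2 \<le> (1/1000)" using small by auto
  have Bus: "\<bar>Bus\<bar> \<le> (202/100)"
  proof -
    have "Bus = 2 - 5 * b + 2 * b\<^sup>2 - k * ((3 - b) * (1 - b))" unfolding Bus_def k_def by algebra
    moreover have "0 \<le> (3 - b) * (1 - b)" using b1 by simp
    moreover have "(3 - b) * (1 - b) \<le> 3 * 1" using b0 b1 by (intro mult_mono) auto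
    ultimately have "k * ((3 - b) * (1 - b)) \<le> (32/10000) * (3 * 1)" "0 \<le> k * ((3 - b) * (1 - b))"
      using k b0 b1 by (intro mult_mono mult_nonneg_nonneg; auto)+
    thus ?thesis using \<open>Bus = _\<close> b0 b1 bb by linarith
  qed
  have Bss: "\<bar>Bss\<bar> \<le> (52/100) * m" "Bss \<le> 6"
  proof -
    have e: "Bss = 6 - 5 * b + b\<^sup>2 - 2 * (k * (2 - b)) - l * v" unfolding Bss_def k_def l_def v_def by algebra
    have q: "0 \<le> k * (2 - b)" "k * (2 - b) \<le> (32/10000) * 2" using k b0 b1 by (intro mult_mono mult_nonneg_nonneg; auto)+
    have "0 \<le> l * v" "l * v \<le> ((33/10000) * m) * 1" using l v01 m12 by (intro mult_mono mult_nonneg_nonneg; auto)+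
    hence q': "0 \<le> l * v" "l * v \<le> (33/10000) * m" by simp_all
    have bsq: "b\<^sup>2 \<le> b" using b0 b1 by (simp add: power2_eq_square mult_left_le)
    define x where "x = k * (2 - b)"
    define y where "y = l * v"
    note q = q[folded x_def] q'[folded y_def]
    have e: "Bss = 6 - 5 * b + b\<^sup>2 - 2 * x - y" using e by (simp only: x_def y_def)
    have "Bss \<le> 52/100 * m" "- Bss \<le> 52/100 * m" unfolding e using q bsq bb b0 b1 m12 by linarith+
    thus "\<bar>Bss\<bar> \<le> (52/100) * m" by (simp only: abs_le_iff)
    show "Bss \<le> 6" unfolding e using q bsq bb b0 b1 by linarith
  qed
  have B2: "\<bar>B2 * v\<^sup>2 - G\<bar> \<le> 25 * (m * \<epsilon>)"
  proof -
    define g1 where "g1 = (1 - 4 * b) * v - 2 * \<mu> * (v * (1 - 2 * b) - 2 * (k * v)) + \<mu>\<^sup>2 * (v\<^sup>2 - 2 * (k * v) - l * v)"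
    define g2 where "g2 = - 2 * \<mu> * (1 - 2 * b) + \<mu>\<^sup>2 * (3 * v - 2 * k)"
    have e: "B2 * v\<^sup>2 - G = (A - 1) * (g1 + g2 * (A + 1) + 2 * \<mu>\<^sup>2 * (A\<^sup>2 + A + 1))"
      unfolding conjunct2[OF conjunct2[OF K2]] A_def G_def Bus_def Bss_def g1_def g2_def k_def l_def v_def by algebra
    have "0 \<le> k * v" "k * v \<le> (32/10000) * 1" "0 \<le> l * v" "l * v \<le> ((33/10000) * m) * 1"
      using k l v01 m12 by (intro mult_mono mult_nonneg_nonneg; auto)+
    hence kv: "0 \<le> k * v" "k * v \<le> 32/10000" "0 \<le> l * v" "l * v \<le> (33/10000) * m" by simp_all
    have p: "\<bar>(1 - 4 * b) * v\<bar> \<le> 1 * 1" "\<bar>2 * \<mu> * (v * (1 - 2 * b) - 2 * (k * v))\<bar> \<le> 2 * (11/10)" 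
        "\<bar>\<mu>\<^sup>2 * (v\<^sup>2 - 2 * (k * v) - l * v)\<bar> \<le> (11/10) + (33/10000) * m"
        "\<bar>- 2 * \<mu> * (1 - 2 * b)\<bar> \<le> 2 * 1" "\<bar>\<mu>\<^sup>2 * (3 * v - 2 * k)\<bar> \<le> 1 * 3"
        "\<bar>2 * \<mu>\<^sup>2 * (A\<^sup>2 + A + 1)\<bar> \<le> 2 * (31/10)"
    proof -
      have "0 \<le> v * (1 - 2 * b)" "v * (1 - 2 * b) \<le> 1 * 1" using v01 b0 b1 by (intro mult_mono mult_nonneg_nonneg; auto)+
      hence "\<bar>v * (1 - 2 * b) - 2 * (k * v)\<bar> \<le> (11/10)" using kv by linarith
      thus "\<bar>2 * \<mu> * (v * (1 - 2 * b) - 2 * (k * v))\<bar> \<le> 2 * (11/10)" unfolding abs_mult using \<mu>01 by (intro mult_mono) auto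
      have "0 \<le> v\<^sup>2" "v\<^sup>2 \<le> 1" using v01 by (auto intro: power_le_one)
      hence "\<bar>v\<^sup>2 - 2 * (k * v) - l * v\<bar> \<le> (11/10) + (33/10000) * m" using kv m12 by linarith
      hence "\<bar>\<mu>\<^sup>2 * (v\<^sup>2 - 2 * (k * v) - l * v)\<bar> \<le> 1 * ((11/10) + (33/10000) * m)" unfolding abs_mult using \<mu>2 by (intro mult_mono) auto
      thus "\<bar>\<mu>\<^sup>2 * (v\<^sup>2 - 2 * (k * v) - l * v)\<bar> \<le> (11/10) + (33/10000) * m" by simp
      have "A\<^sup>2 \<le> (10001/10000)\<^sup>2" using Ap by (intro power_mono) auto
      hence "A\<^sup>2 \<le> 10003/10000" by (simp add: power2_eq_square)
      hence "\<bar>A\<^sup>2 + A + 1\<bar> \<le> (31/10)" using Ap zero_le_power2[of A] by linarith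
      thus "\<bar>2 * \<mu>\<^sup>2 * (A\<^sup>2 + A + 1)\<bar> \<le> 2 * (31/10)" unfolding abs_mult using \<mu>2 by (intro mult_mono) auto
      show "\<bar>(1 - 4 * b) * v\<bar> \<le> 1 * 1" unfolding abs_mult using v01 b0 b1 by (intro mult_mono) auto
      show "\<bar>- 2 * \<mu> * (1 - 2 * b)\<bar> \<le> 2 * 1" unfolding abs_mult using \<mu>01 b0 b1 by (intro mult_mono) auto
      show "\<bar>\<mu>\<^sup>2 * (3 * v - 2 * k)\<bar> \<le> 1 * 3" unfolding abs_mult using \<mu>2 k v01 by (intro mult_mono) auto
    qed
    have "\<bar>g2\<bar> \<le> 5" unfolding g2_def using p(4,5) by linarith
    hence "\<bar>g2 * (A + 1)\<bar> \<le> 5 * (21/10)" unfolding abs_mult using Ap by (intro mult_mono) auto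
    moreover have "\<bar>g1\<bar> \<le> 5 + m" unfolding g1_def using p(1,2,3) m12 by linarith
    ultimately have "\<bar>g1 + g2 * (A + 1) + 2 * \<mu>\<^sup>2 * (A\<^sup>2 + A + 1)\<bar> \<le> 25 * m" using p(6) m12 by linarith
    hence "\<bar>B2 * v\<^sup>2 - G\<bar> \<le> \<epsilon> * (25 * m)" unfolding e abs_mult using A1 \<epsilon>z by (intro mult_mono) auto
    thus ?thesis by (simp add: mult_ac)
  qed
  have vDn: "0 \<le> v * Dn" using v01 Dn_bounds by simp
  obtain d where d: "\<bar>d\<bar> \<le> 125 * \<epsilon>" "\<bar>B2 - \<sigma> * (C1 + d)\<bar> \<le> 31250 * \<epsilon>" using E(5) by blast
  have v2: "(99/100) \<le> v\<^sup>2" "v\<^sup>2 \<le> 1"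
  proof -
    have "(999/1000)\<^sup>2 \<le> v\<^sup>2" using v01 by (intro power_mono) auto
    thus "(99/100) \<le> v\<^sup>2" by (simp add: power2_eq_square)
  qed (use v01 in \<open>auto intro: power_le_one\<close>)
  define r where "r = (B2 - \<sigma> * (C1 + d)) * v\<^sup>2"
  have r: "\<bar>r\<bar> \<le> 31250 * \<epsilon> * 1" unfolding r_def abs_mult using d(2) v2 \<epsilon>z by (intro mult_mono) auto
  define f where "f = C1 * v - Dn + d * v"
  have f: "\<bar>f\<bar> \<le> 129 * \<epsilon>"
  proof -
    have "\<bar>d * v\<bar> \<le> 125 * \<epsilon> * 1" unfolding abs_mult using d(1) v01 \<epsilon>z by (intro mult_mono) auto
    thus ?thesis unfolding f_def using D1 by linarith
  qed
  have S: "B2 * v\<^sup>2 = \<sigma> * v * (Dn + f) + r" unfolding r_def f_def by (simp add: algebra_simps power2_eq_square)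
  have \<sigma>: "0 \<le> \<sigma>" "\<sigma> \<le> 20"
  proof -
    show \<sigma>0: "0 \<le> \<sigma>" using renewal.sigma2_pos[OF ren] by (simp add: \<sigma>_def)
    have "G \<le> 12"
    proof -
      have "(1 - 7 * b + 3 * b\<^sup>2) * (1 - b) \<le> 1 * 1" by (rule mult_mono; use bsq b0 b1 in linarith)
      moreover have "\<bar>2 * \<mu> * Bus\<bar> \<le> 2 * (202/100)" unfolding abs_mult using Bus \<mu>01 by (intro mult_mono) auto
      moreover have "\<mu>\<^sup>2 * Bss \<le> 6"
      proof (cases "Bss \<le> 0")
        case True thus ?thesis using \<mu>2 mult_nonneg_nonpos[of "\<mu>\<^sup>2" Bss] by linarith
      next
        case False
        hence "\<mu>\<^sup>2 * Bss \<le> 1 * 6" using \<mu>2 Bss by (intro mult_mono) auto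
        thus ?thesis by simp
      qed
      ultimately show ?thesis unfolding G_def by linarith
    qed
    hence "B2 * v\<^sup>2 \<le> 13" using B2 m\<epsilon> by linarith
    moreover have "B2 * v\<^sup>2 = \<sigma> * (v * (Dn + f)) + r" using S by (simp only: mult.assoc)
    ultimately have "\<sigma> * (v * (Dn + f)) \<le> 14" using r \<epsilon>s by linarith
    moreover have "(99/100) * (19/10) \<le> v * (Dn + f)" using v01 Dn_bounds f \<epsilon>s by (intro mult_mono) auto
    hence "18/10 \<le> v * (Dn + f)" by simp
    hence "\<sigma> * (18/10) \<le> \<sigma> * (v * (Dn + f))" using \<sigma>0 by (intro mult_left_mono)
    ultimately show "\<sigma> \<le> 20" by linarith
  qed
  have GS: "\<bar>G - \<sigma> * v * Dn\<bar> \<le> 2900 * (m * \<epsilon>)"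
  proof -
    have "\<bar>\<sigma> * v * f\<bar> \<le> 20 * 1 * (129 * \<epsilon>)" unfolding abs_mult using \<sigma> v01 f by (intro mult_mono) auto
    moreover have "12 * \<epsilon> \<le> m * \<epsilon>" using m12 \<epsilon>z by (intro mult_right_mono) auto
    moreover have "B2 * v\<^sup>2 = \<sigma> * v * Dn + \<sigma> * v * f + r" by (simp only: S distrib_left)
    ultimately show ?thesis using B2 r \<epsilon>z by linarith
  qed
  have "Numer - \<sigma> * (1 - b) * Dn ^ 3 = Dn\<^sup>2 * (G - \<sigma> * v * Dn) + (Nn - \<mu> * Dn) * (Bss * (Nn + \<mu> * Dn) - 2 * Dn * Bus)"
    unfolding Numer_def G_def v_def by algebra
  also have "\<bar>\<dots>\<bar> \<le> 13000 * (m * \<epsilon>)"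
  proof -
    have "Dn\<^sup>2 \<le> 2\<^sup>2" by (rule power_mono; use Dn_bounds in linarith)
    hence "Dn\<^sup>2 \<le> 4" by simp
    hence "\<bar>Dn\<^sup>2 * (G - \<sigma> * v * Dn)\<bar> \<le> 4 * (2900 * (m * \<epsilon>))" unfolding abs_mult using GS by (intro mult_mono) auto
    moreover have "\<bar>(Nn - \<mu> * Dn) * (Bss * (Nn + \<mu> * Dn) - 2 * Dn * Bus)\<bar> \<le> (130 * \<epsilon>) * (4 * m)"
    proof -
      have "0 \<le> Nn" "Nn \<le> 1" unfolding Nn_def using b0 b1 bb bsq by linarith+
      moreover have "0 \<le> \<mu> * Dn" "\<mu> * Dn \<le> 1 * 2" using \<mu>01 Dn_bounds by (intro mult_mono mult_nonneg_nonneg; auto)+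
      ultimately have "\<bar>Bss * (Nn + \<mu> * Dn)\<bar> \<le> ((52/100) * m) * 3" unfolding abs_mult using Bss by (intro mult_mono) auto
      moreover have "\<bar>2 * Dn * Bus\<bar> \<le> (2 * 2) * (202/100)" unfolding abs_mult using Dn_bounds Bus by (intro mult_mono) auto
      ultimately have "\<bar>Bss * (Nn + \<mu> * Dn) - 2 * Dn * Bus\<bar> \<le> 4 * m" using m12 by linarith
      thus ?thesis unfolding abs_mult using N1 \<epsilon>z by (intro mult_mono) auto
    qed
    moreover have "0 \<le> m * \<epsilon>" using m12 \<epsilon>z by simp
    moreover have "(130 * \<epsilon>) * (4 * m) = 520 * (m * \<epsilon>)" by simp
    ultimately show ?thesis
      using abs_triangle_ineq[of "Dn\<^sup>2 * (G - \<sigma> * v * Dn)" "(Nn - \<mu> * Dn) * (Bss * (Nn + \<mu> * Dn) - 2 * Dn * Bus)"]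
      by linarith
  qed
  finally have "\<bar>Numer - \<sigma> * (1 - b) * Dn ^ 3\<bar> \<le> b ^ 4" using m\<epsilon>b by linarith
  from variance_final[OF z\<zeta> this]
  show "\<bar>renewal.sigma2 (block_count t) \<rho> - (1 / 4 + z * (- (m - 1)\<^sup>2 + 9 * (m - 1) - 14) / 16
      + z\<^sup>2 * (- 4 * (m - 1) ^ 3 + 20 * (m - 1)\<^sup>2 + 3 * (m - 1) - 54) / 64)\<bar> \<le> (56/1000) * (m - 1) ^ 4 * z ^ 3"
    by (simp only: sigma_poly_def \<sigma>_def)
qed

section \<open>The limit laws for canonical trees\<close>

text \<open>For the single tree without internal vertices the weight differs from the renewal sequence, which
starts with 1; this affects neither the limit in \<open>n\<close> nor the bounds away from 1, which are only
required for \<open>n \<ge> 1\<close>.\<close>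
lemma limit_laws:
  assumes t: "t \<ge> 2" and \<rho>: "\<rho> \<in> {1/2..0.6}" and root: "block_gf t \<rho> 1 (1::real) = 1"
  shows "weak_conv_m (\<lambda>n. distr (measure_pmf (random_tree t n)) borel
           (\<lambda>T. (real (num_leaf_depths T) - mean_d t n) / sqrt (var_d t n))) std_normal_distribution"
    and "(\<lambda>n. SUP x::real. \<bar>sqrt (var_d t n) * measure_pmf.prob (random_tree t n)
             {T. int (num_leaf_depths T) = \<lfloor>mean_d t n + x * sqrt (var_d t n)\<rfloor>}
           - 1 / sqrt (2 * pi) * exp (- x\<^sup>2 / 2)\<bar>) \<longlonglongrightarrow> 0"
    and "(\<lambda>n. mean_d t n - renewal.mu (block_count t) \<rho> * real n) \<in> O(\<lambda>n. 1)"
    and "(\<lambda>n. var_d t n - renewal.sigma2 (block_count t) \<rho> * real n) \<in> O(\<lambda>n. 1)"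
proof -
  interpret R: renewal "block_count t" Rmax Vmax \<rho> by (rule blocks_renewal[OF t \<rho> root])
  obtain e s F where Q: "e > 0" "s holomorphic_on ball 0 e" "s 0 = of_real (ln \<rho>)" "deriv s 0 = - of_real R.mu"
      "(deriv ^^ 2) s 0 = - of_real R.sigma2" "F holomorphic_on ball 0 e" "F 0 \<noteq> 0"
      "uniform_limit (ball 0 e) (\<lambda>n z. R.p n (exp z) * exp (of_nat n * s z)) F sequentially"
    using R.quasi_power by blast
  have fin: "finite (canonical_trees t n)" and ne: "canonical_trees t n \<noteq> {}" for n
    using finite_canonical_trees canonical_trees_nonempty t by auto
  have p_path: "path_poly t n v = R.p n v" for n v
  proof (rule R.p_rec[of "\<lambda>n. path_poly t n v"])
    fix n :: nat assume "n \<ge> 1"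
    thus "path_poly t n v = (\<Sum>k=1..n. R.cn k v * path_poly t (n - k) v)"
      using path_poly_rec[OF t] by (simp add: block_poly_counts R.cn_def)
  qed (simp add: path_poly_0)
  define N where "N n = real (card (canonical_trees t n))" for n
  define Mg where "Mg = (\<lambda>n z. \<Sum>T\<in>set_pmf (random_tree t n). of_real (pmf (random_tree t n) T) * exp (z * of_nat (num_leaf_depths T)) :: complex)"
  have Np: "N n > 0" for n using fin ne by (simp add: N_def card_gt_0_iff)
  have set: "set_pmf (random_tree t n) = canonical_trees t n" for n
    using fin ne by (simp add: random_tree_def)
  have NM: "of_real (N n) * Mg n z = R.p n (exp z)" if "n \<ge> 1" for n z
  proof -
    have "of_real (N n) * Mg n z = (\<Sum>T\<in>canonical_trees t n. exp z ^ num_leaf_depths T)"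
      unfolding Mg_def set sum_distrib_left
    proof (rule sum.cong[OF refl])
      fix T assume T: "T \<in> canonical_trees t n"
      have "pmf (random_tree t n) T = 1 / N n" unfolding random_tree_def N_def using T fin ne by simp
      thus "of_real (N n) * (of_real (pmf (random_tree t n) T) * exp (z * of_nat (num_leaf_depths T))) = exp z ^ num_leaf_depths T"
        using Np[of n] by (simp add: exp_of_nat2_mult)
    qed
    thus ?thesis using tree_poly[of t n "exp z"] t that by (simp add: p_path)
  qed
  have ul: "uniform_limit (ball 0 e) (\<lambda>n z. of_real (N n) * Mg n z * exp (of_nat n * s z)) F sequentially"
  proof (rule uniform_limit_cong[THEN iffD1, OF _ _ Q(8)])
    show "\<forall>\<^sub>F n in sequentially. \<forall>z\<in>ball 0 e. R.p n (exp z) * exp (of_nat n * s z) = of_real (N n) * Mg n z * exp (of_nat n * s z)"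
      using eventually_ge_at_top[of 1] by eventually_elim (simp add: NM)
  qed simp
  have arcs: "\<exists>M r. r > \<rho> \<and> (\<forall>\<theta>. \<forall>n\<ge>1. norm (exp (\<i> * of_real \<theta>) - 1) \<ge> \<delta> \<longrightarrow>
       norm (of_real (N n) * Mg n (\<i> * of_real \<theta>)) \<le> M / r ^ n)" if \<delta>: "\<delta> > 0" for \<delta>
  proof -
    obtain M r where "r > \<rho>" "\<forall>v n. norm v = 1 \<longrightarrow> norm (v - 1) \<ge> \<delta> \<longrightarrow> norm (R.p n v) \<le> M / r ^ n"
      using R.p_unit_circle_bound[OF \<delta>] by blast
    thus ?thesis by (intro exI[of _ M] exI[of _ r]) (simp add: NM)
  qed
  have fins: "finite (set_pmf (random_tree t n))" for n using fin by (simp add: set)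
  interpret Q: quasi_powers "random_tree t" num_leaf_depths N s F e \<rho> R.mu R.sigma2 Mg
  proof (unfold_locales; (fact Q Np R.rho0 R.sigma2_pos fins ul[unfolded Mg_def] | (rule arcs[unfolded Mg_def], assumption))?)
    show "Mg \<equiv> (\<lambda>n z. \<Sum>T\<in>set_pmf (random_tree t n). of_real (pmf (random_tree t n) T) * exp (z * of_nat (num_leaf_depths T)))"
      unfolding Mg_def .
  qed
  have m: "Q.mean = mean_d t" and v: "Q.var = var_d t"
    unfolding Q.mean_def[abs_def] Q.var_def[abs_def] mean_d_def[abs_def] var_d_def[abs_def] by simp_all
  show "weak_conv_m (\<lambda>n. distr (measure_pmf (random_tree t n)) borel
           (\<lambda>T. (real (num_leaf_depths T) - mean_d t n) / sqrt (var_d t n))) std_normal_distribution"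
    using Q.central_limit unfolding m v .
  show "(\<lambda>n. SUP x::real. \<bar>sqrt (var_d t n) * measure_pmf.prob (random_tree t n)
             {T. int (num_leaf_depths T) = \<lfloor>mean_d t n + x * sqrt (var_d t n)\<rfloor>}
           - 1 / sqrt (2 * pi) * exp (- x\<^sup>2 / 2)\<bar>) \<longlonglongrightarrow> 0"
    using Q.local_limit unfolding m v .
  show "(\<lambda>n. mean_d t n - R.mu * real n) \<in> O(\<lambda>n. 1)" using Q.mean_bigo unfolding m .
  show "(\<lambda>n. var_d t n - R.sigma2 * real n) \<in> O(\<lambda>n. 1)" using Q.var_bigo unfolding v .
qed

definition mean_approx :: "nat \<Rightarrow> real" where
  "mean_approx t = 1 / 2 + (real t - 4) / 2 ^ (t + 3)
             + (2 * real t ^ 2 - real t - 14) / 2 ^ (2 * t + 5)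
             + (9 * real t ^ 3 + 27 * real t ^ 2 - 76 * real t - 144) / 2 ^ (3 * t + 8)"

definition variance_approx :: "nat \<Rightarrow> real" where
  "variance_approx t = 1 / 4 + (- (real t ^ 2) + 9 * real t - 14) / 2 ^ (t + 4)
              + (- 4 * real t ^ 3 + 20 * real t ^ 2 + 3 * real t - 54) / 2 ^ (2 * t + 6)"

text \<open>The cases up to 10 are decided by the enclosures, the others by the expansions.\<close>
theorem constants_approximation:
  assumes t: "t \<ge> 2" and \<rho>: "\<rho> \<in> {1/2..0.6}" and ren: "renewal (block_count t) Rmax Vmax \<rho>"
  shows "\<bar>renewal.mu (block_count t) \<rho> - mean_approx t\<bar> \<le> 0.06 * real t ^ 4 / 2 ^ (4 * t)"
    and "\<bar>renewal.sigma2 (block_count t) \<rho> - variance_approx t\<bar> \<le> 0.056 * real t ^ 4 / 2 ^ (3 * t)"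
proof -
  have "\<bar>renewal.mu (block_count t) \<rho> - mean_approx t\<bar> \<le> 0.06 * real t ^ 4 / 2 ^ (4 * t) \<and>
      \<bar>renewal.sigma2 (block_count t) \<rho> - variance_approx t\<bar> \<le> 0.056 * real t ^ 4 / 2 ^ (3 * t)"
  proof (cases "t \<le> 10")
    case True
    note enclosed = constants_enclosed[OF t \<rho> ren]
    note defs = mem_def ulp_def mean_approx_def variance_approx_def abs_le_iff
    from True t consider "t = 2" | "t = 3" | "t = 4" | "t = 5" | "t = 6" | "t = 7" | "t = 8" | "t = 9" | "t = 10" by linarith
    thus ?thesis
    proof cases
      case 1 thus ?thesis unfolding abs_le_iff using enclosed[unfolded 1, OF constants_iv_2] by (simp add: defs)
    next
      case 2 thus ?thesis unfolding abs_le_iff using enclosed[unfolded 2, OF constants_iv_3] by (simp add: defs)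
    next
      case 3 thus ?thesis unfolding abs_le_iff using enclosed[unfolded 3, OF constants_iv_4] by (simp add: defs)
    next
      case 4 thus ?thesis unfolding abs_le_iff using enclosed[unfolded 4, OF constants_iv_5] by (simp add: defs)
    next
      case 5 thus ?thesis unfolding abs_le_iff using enclosed[unfolded 5, OF constants_iv_6] by (simp add: defs)
    next
      case 6 thus ?thesis unfolding abs_le_iff using enclosed[unfolded 6, OF constants_iv_7] by (simp add: defs)
    next
      case 7 thus ?thesis unfolding abs_le_iff using enclosed[unfolded 7, OF constants_iv_8] by (simp add: defs)
    next
      case 8 thus ?thesis unfolding abs_le_iff using enclosed[unfolded 8, OF constants_iv_9] by (simp add: defs)
    next
      case 9 thus ?thesis unfolding abs_le_iff using enclosed[unfolded 9, OF constants_iv_10] by (simp add: defs)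
    qed
  next
    case False
    define z where "z = (1 / 2 ^ t :: real)"
    have z0: "1 / 2 ^ (t + k) = z / 2 ^ k" "1 / 2 ^ (2 * t + k) = z\<^sup>2 / 2 ^ k" "1 / 2 ^ (3 * t + k) = z ^ 3 / 2 ^ k" 
        "1 / 2 ^ (3 * t) = z ^ 3" "1 / 2 ^ (4 * t) = z ^ 4" for k
      unfolding z_def by (simp_all add: power_add power_divide power_mult[symmetric] mult.commute)
    have div: "x / y = x * (1 / y)" for x y :: real by simp
    have z: "x / 2 ^ (t + k) = x * (z / 2 ^ k)" "x / 2 ^ (2 * t + k) = x * (z\<^sup>2 / 2 ^ k)" "x / 2 ^ (3 * t + k) = x * (z ^ 3 / 2 ^ k)"
        "x / 2 ^ (3 * t) = x * z ^ 3" "x / 2 ^ (4 * t) = x * z ^ 4" for x k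
      by (rule trans[OF div], simp only: z0)+
    have m: "mean_approx t = 1 / 2 + z * (real t + 1 - 5) / 8 + z\<^sup>2 * (2 * (real t + 1 - 1)\<^sup>2 - (real t + 1 - 1) - 14) / 32
        + z ^ 3 * (9 * (real t + 1 - 1) ^ 3 + 27 * (real t + 1 - 1)\<^sup>2 - 76 * (real t + 1 - 1) - 144) / 256"
      unfolding mean_approx_def z by (simp add: field_simps)
    have v: "variance_approx t = 1 / 4 + z * (- (real t + 1 - 1)\<^sup>2 + 9 * (real t + 1 - 1) - 14) / 16
        + z\<^sup>2 * (- 4 * (real t + 1 - 1) ^ 3 + 20 * (real t + 1 - 1)\<^sup>2 + 3 * (real t + 1 - 1) - 54) / 64"
      unfolding variance_approx_def z by (simp add: field_simps)
    have "t \<ge> 11" using False by simp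
    note L = constants_large[OF this \<rho> ren, folded z_def, folded m v]
    have "\<bar>renewal.mu (block_count t) \<rho> - mean_approx t\<bar> \<le> 0.06 * real t ^ 4 / 2 ^ (4 * t)"
      using L(1) unfolding z by simp
    moreover have "\<bar>renewal.sigma2 (block_count t) \<rho> - variance_approx t\<bar> \<le> 0.056 * real t ^ 4 / 2 ^ (3 * t)"
      using L(2) unfolding z by simp
    ultimately show ?thesis ..
  qed
  thus "\<bar>renewal.mu (block_count t) \<rho> - mean_approx t\<bar> \<le> 0.06 * real t ^ 4 / 2 ^ (4 * t)"
    and "\<bar>renewal.sigma2 (block_count t) \<rho> - variance_approx t\<bar> \<le> 0.056 * real t ^ 4 / 2 ^ (3 * t)" by auto
qed

theorem theorem4:
  shows "\<exists>(\<mu> :: nat \<Rightarrow> real) (\<sigma>2 :: nat \<Rightarrow> real) (\<epsilon> :: nat \<Rightarrow> real) (\<epsilon>' :: nat \<Rightarrow> real).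
    \<forall>t\<ge>2.
      weak_conv_m
        (\<lambda>n. distr (measure_pmf (random_tree t n)) borel
               (\<lambda>T. (real (num_leaf_depths T) - mean_d t n) / sqrt (var_d t n)))
        std_normal_distribution
    \<and> (\<lambda>n. SUP x::real.
          \<bar>sqrt (var_d t n)
             * measure_pmf.prob (random_tree t n)
                 {T. int (num_leaf_depths T) = \<lfloor>mean_d t n + x * sqrt (var_d t n)\<rfloor>}
           - 1 / sqrt (2 * pi) * exp (- x\<^sup>2 / 2)\<bar>) \<longlonglongrightarrow> 0
    \<and> (\<lambda>n. mean_d t n - \<mu> t * real n) \<in> O(\<lambda>n. 1)
    \<and> (\<lambda>n. var_d t n - \<sigma>2 t * real n) \<in> O(\<lambda>n. 1)
    \<and> \<mu> t = 1 / 2 + (real t - 4) / 2 ^ (t + 3)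
             + (2 * real t ^ 2 - real t - 14) / 2 ^ (2 * t + 5)
             + (9 * real t ^ 3 + 27 * real t ^ 2 - 76 * real t - 144) / 2 ^ (3 * t + 8)
             + 0.06 * real t ^ 4 / 2 ^ (4 * t) * \<epsilon> t
    \<and> \<sigma>2 t = 1 / 4 + (- (real t ^ 2) + 9 * real t - 14) / 2 ^ (t + 4)
              + (- 4 * real t ^ 3 + 20 * real t ^ 2 + 3 * real t - 54) / 2 ^ (2 * t + 6)
              + 0.056 * real t ^ 4 / 2 ^ (3 * t) * \<epsilon>' t
    \<and> \<bar>\<epsilon> t\<bar> \<le> 1 \<and> \<bar>\<epsilon>' t\<bar> \<le> 1"
proof -
  define root where "root t = (SOME \<rho>::real. \<rho> \<in> {1/2..0.6} \<and> block_gf t \<rho> 1 1 = 1)" for t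
  have root: "root t \<in> {1/2..0.6}" "block_gf t (root t) 1 1 = 1" if "t \<ge> 2" for t
  proof -
    have "\<exists>\<rho>::real. \<rho> \<in> {1/2..0.6} \<and> block_gf t \<rho> 1 1 = 1" using dominant_root[OF that] by blast
    from someI_ex[OF this] show "root t \<in> {1/2..0.6}" "block_gf t (root t) 1 1 = 1" by (simp_all add: root_def)
  qed
  define \<mu> where "\<mu> t = renewal.mu (block_count t) (root t)" for t
  define \<sigma>2 where "\<sigma>2 t = renewal.sigma2 (block_count t) (root t)" for t
  define \<epsilon> where "\<epsilon> t = (\<mu> t - mean_approx t) / (0.06 * real t ^ 4 / 2 ^ (4 * t))" for t
  define \<epsilon>' where "\<epsilon>' t = (\<sigma>2 t - variance_approx t) / (0.056 * real t ^ 4 / 2 ^ (3 * t))" for t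
  have quot: "x = y + c * ((x - y) / c) \<and> \<bar>(x - y) / c\<bar> \<le> 1" if "\<bar>x - y\<bar> \<le> c" "c > 0" for x y c :: real
    using that by (simp add: abs_le_iff field_simps)
  show ?thesis
  proof (rule exI[of _ \<mu>], rule exI[of _ \<sigma>2], rule exI[of _ \<epsilon>], rule exI[of _ \<epsilon>'], intro allI impI conjI)
    fix t :: nat assume t: "t \<ge> 2"
    note approx = constants_approximation[OF t root(1)[OF t] blocks_renewal[OF t root[OF t]], folded \<mu>_def \<sigma>2_def]
    have pos: "0 < 0.06 * real t ^ 4 / 2 ^ (4 * t)" "0 < 0.056 * real t ^ 4 / 2 ^ (3 * t)" using t by simp_all
    note \<epsilon> = quot[OF approx(1) pos(1), folded \<epsilon>_def] quot[OF approx(2) pos(2), folded \<epsilon>'_def]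
    show "\<mu> t = 1 / 2 + (real t - 4) / 2 ^ (t + 3)
             + (2 * real t ^ 2 - real t - 14) / 2 ^ (2 * t + 5)
             + (9 * real t ^ 3 + 27 * real t ^ 2 - 76 * real t - 144) / 2 ^ (3 * t + 8)
             + 0.06 * real t ^ 4 / 2 ^ (4 * t) * \<epsilon> t"
      using \<epsilon>(1) unfolding mean_approx_def by (rule conjunct1)
    show "\<sigma>2 t = 1 / 4 + (- (real t ^ 2) + 9 * real t - 14) / 2 ^ (t + 4)
              + (- 4 * real t ^ 3 + 20 * real t ^ 2 + 3 * real t - 54) / 2 ^ (2 * t + 6)
              + 0.056 * real t ^ 4 / 2 ^ (3 * t) * \<epsilon>' t"
      using \<epsilon>(2) unfolding variance_approx_def by (rule conjunct1)
    show "\<bar>\<epsilon> t\<bar> \<le> 1" "\<bar>\<epsilon>' t\<bar> \<le> 1" using \<epsilon> by auto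
  qed (rule limit_laws[OF _ root(1) root(2), folded \<mu>_def \<sigma>2_def]; assumption)+
qed

end
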